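(* Let $\Omega\subset\mathbb R^3$ be a bounded convex domain with $C^3$ boundary. There is $C>0$ depending only on $\Omega$ such that for every small $\epsilon>0$, every $S\in L^2(\Omega\times\mathbb S^2)$ and every $g\in L^2(\Gamma^-)$, the problem $$\epsilon\vec w\cdot\nabla_xu+u-\bar u=S\ \text{in }\Omega\times\mathbb S^2,\qquad u(\vec x_0,\vec w)=g(\vec x_0,\vec w)\ \text{for }\vec x_0\in\partial\Omega,\ \vec w\cdot\vec\nu<0$$ has a unique solution $u$ satisfying $$\epsilon^{-\frac12}\|u\|_{L^2(\Gamma^+)}+\|u\|_{L^2(\Omega\times\mathbb S^2)}\le C\Big(\epsilon^{-2}\|S\|_{L^2(\Omega\times\mathbb S^2)}+\epsilon^{-\frac12}\|g\|_{L^2(\Gamma^-)}\Big).$$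
   Context: $\bar u(\vec x)=\frac1{4\pi}\int_{\mathbb S^2}u(\vec x,\vec w)\,\mathrm d\vec w$; $\vec\nu$ is the outward unit normal; $\Gamma^\pm=\{(\vec x,\vec w):\vec x\in\partial\Omega,\ \pm\vec w\cdot\vec\nu>0\}$. Boundary norms: $\|f\|_{L^p(\Gamma^\pm)}=\big(\int\int_{\Gamma^\pm}|f|^p|\vec w\cdot\vec\nu|\,\mathrm d\vec w\,\mathrm d\vec x\big)^{1/p}$ with surface measure $\mathrm d\vec x$ on $\partial\Omega$. *)

theory Defs
  imports "HOL-Analysis.Analysis"
begin

definition pderiv3 :: "3 \<Rightarrow> (real^3 \<Rightarrow> real) \<Rightarrow> real^3 \<Rightarrow> real" where
  "pderiv3 i f x = frechet_derivative f (at x) (axis i 1)"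

definition grad3 :: "(real^3 \<Rightarrow> real) \<Rightarrow> real^3 \<Rightarrow> real^3" where
  "grad3 f x = (\<chi> i. pderiv3 i f x)"

fun Ck3 :: "nat \<Rightarrow> (real^3 \<Rightarrow> real) \<Rightarrow> bool" where
  "Ck3 0 f = continuous_on UNIV f"
| "Ck3 (Suc k) f = (continuous_on UNIV f \<and> (\<forall>x. f differentiable (at x))
                     \<and> (\<forall>i. Ck3 k (pderiv3 i f)))"

definition local_defining_fun :: "(real^3) set \<Rightarrow> (real^3) set \<Rightarrow> (real^3 \<Rightarrow> real) \<Rightarrow> bool" where
  "local_defining_fun \<Omega> U \<rho> \<longleftrightarrow> open U \<and> Ck3 3 \<rho> \<and>
     \<Omega> \<inter> U = {x \<in> U. \<rho> x < 0} \<and> (\<forall>x\<in>U. grad3 \<rho> x \<noteq> 0)"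

definition C3_boundary :: "(real^3) set \<Rightarrow> bool" where
  "C3_boundary \<Omega> \<longleftrightarrow> (\<forall>x0\<in>frontier \<Omega>. \<exists>U \<rho>. x0 \<in> U \<and> local_defining_fun \<Omega> U \<rho>)"

text \<open>Outward unit normal (independent of the chosen defining function).\<close>
definition outward_normal :: "(real^3) set \<Rightarrow> real^3 \<Rightarrow> real^3" where
  "outward_normal \<Omega> x = (SOME n. \<exists>U \<rho>. x \<in> U \<and> local_defining_fun \<Omega> U \<rho> \<and>
        n = (1 / norm (grad3 \<rho> x)) *\<^sub>R grad3 \<rho> x)"

definition hausdorff2_pre :: "real \<Rightarrow> (real^3) set \<Rightarrow> ennreal" where
  "hausdorff2_pre \<delta> A = (INF C \<in> {C :: nat \<Rightarrow> (real^3) set. A \<subseteq> (\<Union>i. C i) \<and>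
        (\<forall>i. bounded (C i) \<and> diameter (C i) \<le> \<delta>)}.
        (\<Sum>i. ennreal (pi / 4 * (diameter (C i))\<^sup>2)))"

definition hausdorff2 :: "(real^3) set \<Rightarrow> ennreal" where
  "hausdorff2 A = (SUP \<delta> \<in> {0<..}. hausdorff2_pre \<delta> A)"

definition surface_measure :: "(real^3) set \<Rightarrow> (real^3) measure" where
  "surface_measure X = measure_of X (sets (restrict_space borel X)) hausdorff2"

definition sphere_measure :: "(real^3) measure" where
  "sphere_measure = surface_measure (sphere 0 1)"

definition vol_measure :: "(real^3) set \<Rightarrow> ((real^3) \<times> (real^3)) measure" where
  "vol_measure \<Omega> = restrict_space lborel \<Omega> \<Otimes>\<^sub>M sphere_measure"

definition bdry_measure :: "(real^3) set \<Rightarrow> ((real^3) \<times> (real^3)) measure" where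
  "bdry_measure \<Omega> = surface_measure (frontier \<Omega>) \<Otimes>\<^sub>M sphere_measure"

definition Gamma_plus :: "(real^3) set \<Rightarrow> ((real^3) \<times> (real^3)) set" where
  "Gamma_plus \<Omega> = {(x, w). x \<in> frontier \<Omega> \<and> w \<in> sphere 0 1 \<and> w \<bullet> outward_normal \<Omega> x > 0}"

definition Gamma_minus :: "(real^3) set \<Rightarrow> ((real^3) \<times> (real^3)) set" where
  "Gamma_minus \<Omega> = {(x, w). x \<in> frontier \<Omega> \<and> w \<in> sphere 0 1 \<and> w \<bullet> outward_normal \<Omega> x < 0}"

definition L2sq_vol :: "(real^3) set \<Rightarrow> (real^3 \<Rightarrow> real^3 \<Rightarrow> real) \<Rightarrow> ennreal" where
  "L2sq_vol \<Omega> f = (\<integral>\<^sup>+ p. ennreal ((f (fst p) (snd p))\<^sup>2) \<partial>vol_measure \<Omega>)"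

definition L2sq_bdry :: "(real^3) set \<Rightarrow> ((real^3) \<times> (real^3)) set \<Rightarrow> (real^3 \<Rightarrow> real^3 \<Rightarrow> real) \<Rightarrow> ennreal" where
  "L2sq_bdry \<Omega> G f = (\<integral>\<^sup>+ p. indicator G p *
       ennreal ((f (fst p) (snd p))\<^sup>2 * \<bar>snd p \<bullet> outward_normal \<Omega> (fst p)\<bar>) \<partial>bdry_measure \<Omega>)"

definition L2_vol :: "(real^3) set \<Rightarrow> (real^3 \<Rightarrow> real^3 \<Rightarrow> real) \<Rightarrow> real" where
  "L2_vol \<Omega> f = sqrt (enn2real (L2sq_vol \<Omega> f))"

definition L2_bdry :: "(real^3) set \<Rightarrow> ((real^3) \<times> (real^3)) set \<Rightarrow> (real^3 \<Rightarrow> real^3 \<Rightarrow> real) \<Rightarrow> real" where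
  "L2_bdry \<Omega> G f = sqrt (enn2real (L2sq_bdry \<Omega> G f))"

definition in_L2_vol :: "(real^3) set \<Rightarrow> (real^3 \<Rightarrow> real^3 \<Rightarrow> real) \<Rightarrow> bool" where
  "in_L2_vol \<Omega> f \<longleftrightarrow> (\<lambda>p. f (fst p) (snd p)) \<in> borel_measurable (vol_measure \<Omega>) \<and> L2sq_vol \<Omega> f < \<infinity>"

definition in_L2_bdry :: "(real^3) set \<Rightarrow> ((real^3) \<times> (real^3)) set \<Rightarrow> (real^3 \<Rightarrow> real^3 \<Rightarrow> real) \<Rightarrow> bool" where
  "in_L2_bdry \<Omega> G f \<longleftrightarrow> (\<lambda>p. f (fst p) (snd p)) \<in> borel_measurable (bdry_measure \<Omega>) \<and> L2sq_bdry \<Omega> G f < \<infinity>"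

definition ang_avg :: "(real^3 \<Rightarrow> real^3 \<Rightarrow> real) \<Rightarrow> real^3 \<Rightarrow> real" where
  "ang_avg u x = 1 / (4 * pi) * (\<integral>w. u x w \<partial>sphere_measure)"

text \<open>u is defined on R^3 x R^3; its values on \<Omega> x S^2 are the solution and its values on
  Gamma_plus are its outgoing trace.  The weak formulation (Green's formula) is tested against
  all functions phi that are continuous and continuously differentiable in x (Dphi x w is the
  x-derivative of phi at (x,w), so Dphi x w w = w . grad_x phi).\<close>
definition weak_solution ::
  "(real^3) set \<Rightarrow> real \<Rightarrow> (real^3 \<Rightarrow> real^3 \<Rightarrow> real) \<Rightarrow> (real^3 \<Rightarrow> real^3 \<Rightarrow> real)
     \<Rightarrow> (real^3 \<Rightarrow> real^3 \<Rightarrow> real) \<Rightarrow> bool" where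
  "weak_solution \<Omega> \<epsilon> S g u \<longleftrightarrow>
     in_L2_vol \<Omega> u \<and> in_L2_bdry \<Omega> (Gamma_plus \<Omega>) u \<and>
     (\<forall>\<phi> D\<phi>. continuous_on UNIV (\<lambda>p. \<phi> (fst p) (snd p)) \<and>
               (\<forall>x w. ((\<lambda>y. \<phi> y w) has_derivative D\<phi> x w) (at x)) \<and>
               continuous_on UNIV (\<lambda>p. D\<phi> (fst p) (snd p) (snd p)) \<longrightarrow>
        (\<integral>p. u (fst p) (snd p) * (\<phi> (fst p) (snd p) - \<epsilon> * D\<phi> (fst p) (snd p) (snd p))
              - ang_avg u (fst p) * \<phi> (fst p) (snd p) \<partial>vol_measure \<Omega>)
        + \<epsilon> * (\<integral>p. indicator (Gamma_plus \<Omega>) p * u (fst p) (snd p) * \<phi> (fst p) (snd p)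
                    * \<bar>snd p \<bullet> outward_normal \<Omega> (fst p)\<bar> \<partial>bdry_measure \<Omega>)
        - \<epsilon> * (\<integral>p. indicator (Gamma_minus \<Omega>) p * g (fst p) (snd p) * \<phi> (fst p) (snd p)
                    * \<bar>snd p \<bullet> outward_normal \<Omega> (fst p)\<bar> \<partial>bdry_measure \<Omega>)
        = (\<integral>p. S (fst p) (snd p) * \<phi> (fst p) (snd p) \<partial>vol_measure \<Omega>))"

end

theory Submission
  imports Defs
begin

text \<open>
  Multiply the equation by \<open>u (a + \<epsilon> w \<bullet> \<nabla>a)\<close> with \<open>a x = const - \<bar>x\<bar>\<^sup>2 / 2\<close> and integrate. The boundary term
  has the right sign up to \<open>g\<close>, Jensen's inequality absorbs the angular average, the odd moments of the
  average vanish, and the concavity of \<open>a\<close> leaves \<open>\<epsilon>\<^sup>2 / 2\<close> times the norm of \<open>u\<close> squared. The factor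
  \<open>\<epsilon>\<^sup>2\<close> in this coercivity is the source of \<open>\<epsilon>\<^sup>-\<^sup>2\<close> in the estimate. For nonnegative data the monotone iteration
  \<open>\<epsilon> w \<bullet> \<nabla>u' + u' = S + avg u\<close> along characteristics is bounded by the same inequality, so it
  converges; general data are split into positive and negative parts. A weak solution coincides
  with the solution by characteristics of the transport equation with source \<open>S + avg u\<close>, because the
  adjoint equation has enough \<open>C\<^sup>1\<close> solutions; hence the energy inequality also yields uniqueness.

  Everything is disintegrated along characteristics starting on \<open>\<Gamma>\<^sup>-\<close>, which needs the area formula
  for \<open>hausdorff2\<close> on a \<open>C\<^sup>3\<close> surface. By translation invariance \<open>hausdorff2\<close> on planes is \<open>planar_const\<close> times
  Lebesgue measure with \<open>0 < planar_const \<le> 1\<close>. The value 1 (the isodiametric inequality) is not needed: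
  the constant appears in the flux as a factor of \<open>g\<close>, and the sphere has mass \<open>4 pi planar_const \<le> 4 pi\<close>,
  which is all that Jensen's inequality uses.
\<close>

text \<open>The multiplier \<open>u\<close> alone controls only \<open>u - avg u\<close>, since
  functions of \<open>x\<close> alone are in the kernel of the collision term. The weight repairs
  this pointwise: the derivative of \<open>psi\<close> along a characteristic is
  \<open>- (x \<bullet> w) - \<epsilon>\<close>. Its first summand turns \<open>psi\<close> back
  into the weight \<open>aw\<close>, its second one leaves \<open>- \<epsilon>\<^sup>2\<close> in
  front of \<open>u\<^sup>2\<close>, of which half is spent on \<open>S\<close>. Volume integrals
  use Lebesgue measure and boundary integrals use \<open>hausdorff2\<close>, so Green's formula
  reads \<open>planar_const\<close> times volume integral equals outflow minus inflow. A weak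
  solution therefore starts from \<open>planar_const * g\<close> on its characteristics, and its
  outgoing trace is the end value divided by \<open>planar_const\<close>. Convexity makes every
  characteristic a single chord. The normal, defined by choice from defining functions, is
  identified with the unique supporting direction; uniqueness makes it continuous, and continuity
  together with the support inequality gives the local flatness that replaces charts in the area
  formula.\<close>

type_synonym phase = "(real^3) \<times> (real^3)"

subsection \<open>Hausdorff measure of dimension 2\<close>

definition delta_cover :: "real \<Rightarrow> (real^3) set \<Rightarrow> (nat \<Rightarrow> (real^3) set) \<Rightarrow> bool" where
  "delta_cover \<delta> A C \<longleftrightarrow> A \<subseteq> (\<Union>i. C i) \<and> (\<forall>i. bounded (C i) \<and> diameter (C i) \<le> \<delta>)"

abbreviation cover_cost :: "(nat \<Rightarrow> (real^3) set) \<Rightarrow> ennreal" where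
  "cover_cost C \<equiv> (\<Sum>i. ennreal (pi / 4 * (diameter (C i))\<^sup>2))"

lemma hausdorff2_pre_alt: "hausdorff2_pre \<delta> A = (INF C \<in> {C. delta_cover \<delta> A C}. cover_cost C)"
  by (simp add: hausdorff2_pre_def delta_cover_def)

lemma hausdorff2_pre_le: "delta_cover \<delta> A C \<Longrightarrow> hausdorff2_pre \<delta> A \<le> cover_cost C"
  unfolding hausdorff2_pre_alt by (rule INF_lower) simp

lemma hausdorff2_pre_greatest:
  "(\<And>C. delta_cover \<delta> A C \<Longrightarrow> z \<le> cover_cost C) \<Longrightarrow> z \<le> hausdorff2_pre \<delta> A"
  unfolding hausdorff2_pre_alt by (rule INF_greatest) simp

lemma hausdorff2_pre_less:
  "hausdorff2_pre \<delta> A < z \<Longrightarrow> \<exists>C. delta_cover \<delta> A C \<and> cover_cost C < z"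
  unfolding hausdorff2_pre_alt by (auto simp: INF_less_iff)

lemma hausdorff2_pre_antimono: "\<delta> \<le> \<delta>' \<Longrightarrow> hausdorff2_pre \<delta>' A \<le> hausdorff2_pre \<delta> A"
  unfolding hausdorff2_pre_alt
  by (rule INF_superset_mono, unfold delta_cover_def, blast intro: order_trans, rule order_refl)

lemma hausdorff2_pre_mono: "A \<subseteq> B \<Longrightarrow> hausdorff2_pre \<delta> A \<le> hausdorff2_pre \<delta> B"
  unfolding hausdorff2_pre_alt
  by (rule INF_superset_mono) (simp_all add: delta_cover_def subset_iff)

lemma hausdorff2_pre_empty: "0 < \<delta> \<Longrightarrow> hausdorff2_pre \<delta> {} = 0"
  using hausdorff2_pre_le[of \<delta> "{}" "\<lambda>_. {}"] by (simp add: delta_cover_def)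

lemma hausdorff2_upper: "0 < \<delta> \<Longrightarrow> hausdorff2_pre \<delta> A \<le> hausdorff2 A"
  unfolding hausdorff2_def by (rule SUP_upper) simp

lemma hausdorff2_least: "(\<And>\<delta>. 0 < \<delta> \<Longrightarrow> hausdorff2_pre \<delta> A \<le> z) \<Longrightarrow> hausdorff2 A \<le> z"
  unfolding hausdorff2_def by (rule SUP_least) simp

lemma hausdorff2_mono: "A \<subseteq> B \<Longrightarrow> hausdorff2 A \<le> hausdorff2 B"
  by (meson hausdorff2_least hausdorff2_pre_mono hausdorff2_upper order_trans)

lemma hausdorff2_empty: "hausdorff2 {} = 0"
  using hausdorff2_least[of "{}" 0] hausdorff2_pre_empty by simp

text \<open>Covers that are optimal up to \<open>e * (1/2)^Suc n\<close> exist because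
  \<open>ennreal_le_epsilon\<close> lets the sum, hence every summand, be assumed finite; the errors
  add up to \<open>e\<close>.\<close>

lemma hausdorff2_pre_UN:
  fixes A :: "nat \<Rightarrow> (real^3) set"
  shows "hausdorff2_pre \<delta> (\<Union>i. A i) \<le> (\<Sum>i. hausdorff2_pre \<delta> (A i))"
proof (rule ennreal_le_epsilon)
  fix e :: real assume fin: "(\<Sum>i. hausdorff2_pre \<delta> (A i)) < top" and "0 < e"
  have "\<exists>C. delta_cover \<delta> (A n) C \<and> cover_cost C \<le> hausdorff2_pre \<delta> (A n) + ennreal (e * (1/2)^Suc n)" for n
  proof -
    have "hausdorff2_pre \<delta> (A n) < top"
      using fin by (metis ennreal_suminf_lessD)
    then have "hausdorff2_pre \<delta> (A n) < hausdorff2_pre \<delta> (A n) + ennreal (e * (1/2)^Suc n)"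
      using \<open>0 < e\<close> by (auto intro!: ennreal_between simp: ennreal_add_left_cancel_less less_top)
    from hausdorff2_pre_less[OF this] show ?thesis by (auto intro: less_imp_le)
  qed
  then obtain C where C: "\<And>n. delta_cover \<delta> (A n) (C n)"
    "\<And>n. cover_cost (C n) \<le> hausdorff2_pre \<delta> (A n) + ennreal (e * (1/2)^Suc n)" by metis
  \<comment> \<open>The double family of cover sets is enumerated along one index by the pairing
    function.\<close>
  define D where "D k = (case prod_decode k of (i, j) \<Rightarrow> C i j)" for k
  have D: "delta_cover \<delta> (\<Union>i. A i) D"
    unfolding delta_cover_def
  proof safe
    fix x i assume "x \<in> A i"
    then obtain j where "x \<in> C i j" using C(1)[of i] by (auto simp: delta_cover_def)
    then have "x \<in> D (prod_encode (i,j))" by (simp add: D_def)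
    then show "x \<in> (\<Union>i. D i)" by blast
  next
    fix k show "bounded (D k)" "diameter (D k) \<le> \<delta>"
      using C(1) by (auto simp: D_def delta_cover_def split: prod.split)
  qed
  define f where "f p = ennreal (pi / 4 * (diameter (C (fst p) (snd p)))\<^sup>2)" for p
  have "cover_cost D = (\<Sum>k. f (prod_decode k))"
    by (simp add: f_def D_def case_prod_unfold)
  also have "\<dots> = (\<Sum>i. cover_cost (C i))"
    by (rule suminf_ennreal_2dimen) (simp add: f_def)
  also have "\<dots> \<le> (\<Sum>n. hausdorff2_pre \<delta> (A n) + ennreal (e * (1/2)^Suc n))"
    by (intro suminf_le C summableI)
  also have "\<dots> = (\<Sum>n. hausdorff2_pre \<delta> (A n)) + (\<Sum>n. ennreal (e * (1/2)^Suc n))"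
    by (rule suminf_add[symmetric]) auto
  also have "(\<Sum>n. ennreal (e * (1/2)^Suc n)) = ennreal e"
    using \<open>0 < e\<close> sums_mult[OF power_half_series, of e]
    by (intro suminf_ennreal_eq) (auto simp: field_simps)
  finally show "hausdorff2_pre \<delta> (\<Union>i. A i) \<le> (\<Sum>n. hausdorff2_pre \<delta> (A n)) + ennreal e"
    using hausdorff2_pre_le[OF D] by (rule order_trans[rotated])
qed

lemma hausdorff2_UN:
  fixes A :: "nat \<Rightarrow> (real^3) set"
  shows "hausdorff2 (\<Union>i. A i) \<le> (\<Sum>i. hausdorff2 (A i))"
proof (rule hausdorff2_least)
  fix \<delta> :: real assume "0 < \<delta>"
  then show "hausdorff2_pre \<delta> (\<Union>i. A i) \<le> (\<Sum>i. hausdorff2 (A i))"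
    by (intro order_trans[OF hausdorff2_pre_UN] suminf_le hausdorff2_upper summableI)
qed

lemma hausdorff2_outer: "outer_measure_space (Pow UNIV) hausdorff2"
  unfolding outer_measure_space_def
  by (auto simp: positive_def increasing_def countably_subadditive_def hausdorff2_empty
      intro: hausdorff2_mono hausdorff2_UN)

lemma hausdorff2_Un: "hausdorff2 (A \<union> B) \<le> hausdorff2 A + hausdorff2 B"
proof -
  have "subadditive (Pow UNIV) hausdorff2"
    using hausdorff2_outer unfolding outer_measure_space_def
    by (intro ring_of_sets.countably_subadditive_subadditive[of UNIV]) (use ring_of_sets_Pow[of UNIV] in auto)
  then have "hausdorff2 (A \<union> (B - A)) \<le> hausdorff2 A + hausdorff2 (B - A)"
    by (rule subadditiveD) auto
  also have "\<dots> \<le> hausdorff2 A + hausdorff2 B" by (intro add_left_mono hausdorff2_mono) auto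
  finally show ?thesis by simp
qed

text \<open>A set of diameter at most \<open>\<delta> < r\<close> cannot meet both \<open>A\<close>
  and \<open>B\<close>, so a common cover splits into two covers that use disjoint sets of indices
  and share its cost.\<close>

lemma hausdorff2_pre_separated:
  assumes r: "0 < r" "\<And>x y. x \<in> A \<Longrightarrow> y \<in> B \<Longrightarrow> r \<le> dist x y" and d: "0 < \<delta>" "\<delta> < r"
  shows "hausdorff2_pre \<delta> A + hausdorff2_pre \<delta> B \<le> hausdorff2_pre \<delta> (A \<union> B)"
proof (rule hausdorff2_pre_greatest)
  fix C assume C: "delta_cover \<delta> (A \<union> B) C"
  define C1 where "C1 i = (if C i \<inter> A = {} then {} else C i)" for i
  define C2 where "C2 i = (if C i \<inter> A = {} then C i else {})" for i
  have 1: "delta_cover \<delta> A C1"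
    using C \<open>0 < \<delta>\<close> by (fastforce simp: delta_cover_def C1_def)
  have disj: "C i \<inter> A = {}" if "y \<in> C i" "y \<in> B" for i y
  proof (rule ccontr)
    assume "C i \<inter> A \<noteq> {}"
    then obtain x where "x \<in> C i" "x \<in> A" by auto
    then have "dist x y \<le> \<delta>"
      using C that diameter_bounded_bound[of "C i" x y] \<open>x \<in> C i\<close> unfolding delta_cover_def
      by (meson order_trans)
    with r(2)[OF \<open>x \<in> A\<close> \<open>y \<in> B\<close>] d show False by linarith
  qed
  have 2: "delta_cover \<delta> B C2"
    unfolding delta_cover_def
  proof (intro conjI allI subsetI)
    fix y assume "y \<in> B"
    then obtain i where "y \<in> C i" using C by (auto simp: delta_cover_def)
    with \<open>y \<in> B\<close> have "y \<in> C2 i" using disj by (auto simp: C2_def)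
    then show "y \<in> (\<Union>i. C2 i)" by blast
  qed (use C \<open>0 < \<delta>\<close> in \<open>auto simp: delta_cover_def C2_def\<close>)
  have "hausdorff2_pre \<delta> A + hausdorff2_pre \<delta> B \<le> cover_cost C1 + cover_cost C2"
    by (intro add_mono hausdorff2_pre_le 1 2)
  also have "\<dots> = (\<Sum>i. ennreal (pi / 4 * (diameter (C1 i))\<^sup>2) + ennreal (pi / 4 * (diameter (C2 i))\<^sup>2))"
    by (rule suminf_add) auto
  also have "\<dots> = cover_cost C"
    by (intro suminf_cong) (simp add: C1_def C2_def)
  finally show "hausdorff2_pre \<delta> A + hausdorff2_pre \<delta> B \<le> cover_cost C" .
qed

lemma hausdorff2_separated:
  assumes r: "0 < r" "\<And>x y. x \<in> A \<Longrightarrow> y \<in> B \<Longrightarrow> r \<le> dist x y"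
  shows "hausdorff2 (A \<union> B) = hausdorff2 A + hausdorff2 B"
proof (rule antisym[OF hausdorff2_Un])
  have *: "hausdorff2_pre \<delta> A + hausdorff2_pre \<delta>' B \<le> hausdorff2 (A \<union> B)"
    if "0 < \<delta>" "0 < \<delta>'" for \<delta> \<delta>'
  proof -
    define d where "d = min (min \<delta> \<delta>') (r/2)"
    have d: "0 < d" "d < r" "d \<le> \<delta>" "d \<le> \<delta>'" using that r by (auto simp: d_def)
    have "hausdorff2_pre \<delta> A + hausdorff2_pre \<delta>' B \<le> hausdorff2_pre d A + hausdorff2_pre d B"
      using d by (intro add_mono hausdorff2_pre_antimono)
    also have "\<dots> \<le> hausdorff2_pre d (A \<union> B)"
      using hausdorff2_pre_separated[OF r d(1,2)] .
    also have "\<dots> \<le> hausdorff2 (A \<union> B)" by (rule hausdorff2_upper[OF d(1)])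
    finally show ?thesis .
  qed
  show "hausdorff2 A + hausdorff2 B \<le> hausdorff2 (A \<union> B)"
    unfolding hausdorff2_def[of A] hausdorff2_def[of B]
    by (subst ennreal_SUP_add_left[symmetric], force, rule SUP_least,
      subst ennreal_SUP_add_right, force, rule SUP_least, rule *, auto)
qed

text \<open>Caratheodory's criterion for a metric outer measure. The part \<open>E k\<close> of
  \<open>A - F\<close> at distance at least \<open>1 / Suc k\<close> from \<open>F\<close> is
  separated from \<open>A \<inter> F\<close>, so the inequality holds with \<open>E k\<close> in
  place of \<open>A - F\<close>. The error made by this replacement is bounded by the tail of the
  measures of the shells \<open>R k\<close>, which are shown to be summable.\<close>

lemma hausdorff2_closed_split:
  assumes F: "closed F"
  shows "hausdorff2 (A \<inter> F) + hausdorff2 (A - F) \<le> hausdorff2 A"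
proof (cases "F = {} \<or> hausdorff2 A = top")
  case True
  then show ?thesis by (auto simp: hausdorff2_empty)
next
  case False
  then have F0: "F \<noteq> {}" and fin: "hausdorff2 A < top" by (auto simp: less_top)
  define E where "E k = {x \<in> A. infdist x F \<ge> 1 / real (Suc k)}" for k
  define R where "R k = E (Suc k) - E k" for k
  have E_mono: "E m \<subseteq> E n" if "m \<le> n" for m n
    using that by (auto simp: E_def frac_le intro: order_trans[rotated])
  have EF: "A - F = (\<Union>k. E k)"
  proof safe
    fix x assume "x \<in> A" "x \<notin> F"
    then have "infdist x F > 0"
      using F F0 by (meson infdist_pos_not_in_closed)
    then obtain k where "1 / real (Suc k) < infdist x F"
      using nat_approx_posE by blast
    then show "x \<in> (\<Union>k. E k)" using \<open>x \<in> A\<close> unfolding E_def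
      by (intro UN_I[of k]) auto
  next
    fix x k assume "x \<in> E k" then show "x \<in> A" by (simp add: E_def)
  next
    fix x k assume "x \<in> E k" "x \<in> F"
    moreover have "0 < 1 / real (Suc k)" by simp
    ultimately show False by (simp add: E_def del: of_nat_Suc)
  qed
  \<comment> \<open>Neighbouring shells may touch; skipping one shell opens a gap of the size of the
    difference of the two distances to \<open>F\<close>.\<close>
  have sepR: "\<exists>r>0. \<forall>x\<in>E k. \<forall>y\<in>R (Suc k). r \<le> dist x y" for k
  proof (intro exI[of _ "1 / real (Suc k) - 1 / real (Suc (Suc k))"] conjI ballI)
    show "0 < 1 / real (Suc k) - 1 / real (Suc (Suc k))"
      by (simp add: frac_less2)
    fix x y assume "x \<in> E k" "y \<in> R (Suc k)"
    then have "infdist x F \<ge> 1 / real (Suc k)" "infdist y F < 1 / real (Suc (Suc k))"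
      by (auto simp: E_def R_def)
    then show "1 / real (Suc k) - 1 / real (Suc (Suc k)) \<le> dist x y"
      using infdist_triangle[of x F y] by linarith
  qed
  \<comment> \<open>Shells whose indices have the same parity are separated, so their measures add
    up inside \<open>A\<close>. The parameter \<open>j\<close> will be 0 or 1.\<close>
  have odd_even: "(\<Sum>i<n. hausdorff2 (R (Suc (j + 2*i)))) \<le> hausdorff2 (E (j + 2 * n))" for n j
  proof (induction n)
    case (Suc n)
    obtain r where r: "r > 0" "\<And>x y. x\<in>E (j + 2*n) \<Longrightarrow> y\<in>R (Suc (j+2*n)) \<Longrightarrow> r \<le> dist x y"
      using sepR[of "j + 2*n"] by blast
    have "(\<Sum>i<Suc n. hausdorff2 (R (Suc (j+2*i)))) \<le> hausdorff2 (E (j+2*n)) + hausdorff2 (R (Suc (j+2*n)))"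
      using Suc by (simp add: add_right_mono)
    also have "\<dots> = hausdorff2 (E (j+2*n) \<union> R (Suc (j+2*n)))"
      using hausdorff2_separated[OF r] by simp
    also have "\<dots> \<le> hausdorff2 (E (j+2*Suc n))"
      using E_mono[of "j+2*n" "j+2*Suc n"] by (intro hausdorff2_mono) (auto simp: R_def)
    finally show ?case .
  qed simp
  have fin_j: "(\<Sum>i. hausdorff2 (R (Suc (j+2*i)))) \<le> hausdorff2 A" for j
    unfolding suminf_eq_SUP
    by (intro SUP_least order_trans[OF odd_even] hausdorff2_mono) (auto simp: E_def)
  define h where "h i = hausdorff2 (R i)" for i
  have hsum: "(\<Sum>i. h (Suc i)) < top"
  proof -
    have "(\<Sum>i<n. h (Suc i)) \<le> hausdorff2 A + hausdorff2 A" for n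
    proof -
      have "(\<Sum>i<n. h (Suc i)) \<le> (\<Sum>i\<in>(\<lambda>i. 2*i) ` {..<n} \<union> (\<lambda>i. 1+2*i) ` {..<n}. h (Suc i))"
      proof (rule sum_mono2)
        show "{..<n} \<subseteq> (\<lambda>i. 2*i) ` {..<n} \<union> (\<lambda>i. 1+2*i) ` {..<n}"
        proof
          fix i assume "i \<in> {..<n}"
          then show "i \<in> (\<lambda>i. 2*i) ` {..<n} \<union> (\<lambda>i. 1+2*i) ` {..<n}"
            by (cases "even i") (auto elim!: evenE oddE)
        qed
      qed auto
      also have "\<dots> = (\<Sum>i\<in>(\<lambda>i. 2*i) ` {..<n}. h (Suc i)) + (\<Sum>i\<in>(\<lambda>i. 1+2*i) ` {..<n}. h (Suc i))"
        by (rule sum.union_disjoint) (auto, presburger)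
      also have "\<dots> = (\<Sum>i<n. hausdorff2 (R (Suc (0+2*i)))) + (\<Sum>i<n. hausdorff2 (R (Suc (1+2*i))))"
        by (subst (1 2) sum.reindex) (auto simp: inj_on_def h_def)
      also have "\<dots> \<le> hausdorff2 A + hausdorff2 A"
        by (intro add_mono order_trans[OF odd_even] hausdorff2_mono) (auto simp: E_def)
      finally show ?thesis .
    qed
    then have "(\<Sum>i. h (Suc i)) \<le> hausdorff2 A + hausdorff2 A"
      unfolding suminf_eq_SUP by (intro SUP_least)
    also have "\<dots> < top" using fin by simp
    finally show ?thesis .
  qed
  have AF: "hausdorff2 (A \<inter> F) + hausdorff2 (E n) \<le> hausdorff2 A" for n
  proof -
    have "1 / real (Suc n) \<le> dist x y" if "x \<in> A \<inter> F" "y \<in> E n" for x y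
    proof -
      have "infdist y F \<le> dist y x" using that by (intro infdist_le) auto
      then show ?thesis using that by (auto simp: E_def dist_commute)
    qed
    then have "hausdorff2 (A \<inter> F) + hausdorff2 (E n) = hausdorff2 (A \<inter> F \<union> E n)"
      by (intro hausdorff2_separated[symmetric, of "1 / real (Suc n)"]) auto
    also have "\<dots> \<le> hausdorff2 A" by (intro hausdorff2_mono) (auto simp: E_def)
    finally show ?thesis .
  qed
  have tail: "hausdorff2 (A - F) \<le> hausdorff2 (E n) + (\<Sum>i. h (i + n))" for n
  proof -
    have "A - F \<subseteq> E n \<union> (\<Union>i. R (i + n))"
    proof
      fix x assume "x \<in> A - F"
      then have ex: "\<exists>k. x \<in> E k" using EF by auto
      define k where "k = (LEAST k. x \<in> E k)"
      have k: "x \<in> E k" unfolding k_def using ex by (rule LeastI_ex)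
      show "x \<in> E n \<union> (\<Union>i. R (i + n))"
      proof (cases "k \<le> n")
        case True then show ?thesis using E_mono k by blast
      next
        case False
        then have "x \<notin> E (k - 1)" unfolding k_def
          by (intro not_less_Least) (simp add: k_def[symmetric])
        then have "x \<in> R ((k - 1 - n) + n)" using k False by (simp add: R_def)
        then show ?thesis by blast
      qed
    qed
    then have "hausdorff2 (A - F) \<le> hausdorff2 (E n \<union> (\<Union>i. R (i + n)))" by (rule hausdorff2_mono)
    also have "\<dots> \<le> hausdorff2 (E n) + hausdorff2 (\<Union>i. R (i + n))" by (rule hausdorff2_Un)
    also have "\<dots> \<le> hausdorff2 (E n) + (\<Sum>i. h (i + n))"
      unfolding h_def by (intro add_left_mono hausdorff2_UN)
    finally show ?thesis .
  qed
  \<comment> \<open>The summability \<open>hsum\<close> starts with the shell of index 1, hence the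
    shift to \<open>Suc n\<close>.\<close>
  have lim: "(\<lambda>n. \<Sum>i. h (i + Suc n)) \<longlonglongrightarrow> 0"
  proof -
    have "h (Suc i) < top" for i using hsum by (rule ennreal_suminf_lessD)
    then have eq: "h (Suc i) = ennreal (enn2real (h (Suc i)))" for i by simp
    define r where "r i = enn2real (h (Suc i))" for i
    have hr: "h (Suc i) = ennreal (r i)" "0 \<le> r i" for i using eq by (auto simp: r_def)
    have "summable r"
      using hsum by (intro summable_suminf_not_top) (auto simp: hr(1)[symmetric] hr(2))
    then have "(\<lambda>n. \<Sum>i. r (i + n)) \<longlonglongrightarrow> 0" by (rule suminf_exist_split2)
    then have "(\<lambda>n. ennreal (\<Sum>i. r (i + n))) \<longlonglongrightarrow> ennreal 0" by (rule tendsto_ennrealI)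
    moreover have "ennreal (\<Sum>i. r (i + n)) = (\<Sum>i. h (i + Suc n))" for n
      using \<open>summable r\<close> hr by (subst suminf_ennreal2[symmetric]) (auto simp: summable_iff_shift)
    ultimately show ?thesis by simp
  qed
  have "hausdorff2 (A \<inter> F) + hausdorff2 (A - F) \<le> hausdorff2 A + (\<Sum>i. h (i + Suc n))" for n
  proof -
    have "hausdorff2 (A \<inter> F) + hausdorff2 (A - F)
      \<le> hausdorff2 (A \<inter> F) + (hausdorff2 (E (Suc n)) + (\<Sum>i. h (i + Suc n)))"
      by (intro add_left_mono tail)
    also have "\<dots> \<le> hausdorff2 A + (\<Sum>i. h (i + Suc n))"
      using AF[of "Suc n"] by (metis add.assoc add_right_mono)
    finally show ?thesis .
  qed
  moreover have "(\<lambda>n. hausdorff2 A + (\<Sum>i. h (i + Suc n))) \<longlonglongrightarrow> hausdorff2 A + 0"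
    by (intro tendsto_add lim tendsto_const)
  ultimately show ?thesis
    by (intro LIMSEQ_le_const[of _ "hausdorff2 A"]) auto
qed

text \<open>Closed sets are Caratheodory measurable by the splitting above, and they generate the
  Borel sets.\<close>

lemma measure_space_hausdorff2: "measure_space UNIV (sets borel) hausdorff2"
proof -
  let ?L = "lambda_system UNIV (Pow UNIV) hausdorff2"
  have L: "measure_space UNIV ?L hausdorff2"
    using sigma_algebra.caratheodory_lemma[OF sigma_algebra_Pow hausdorff2_outer] by simp
  have cl: "F \<in> ?L" if "closed F" for F
    unfolding lambda_system_def
  proof safe
    fix x :: "(real^3) set"
    have "hausdorff2 x \<le> hausdorff2 (x \<inter> F) + hausdorff2 (x - F)"
      using hausdorff2_Un[of "x \<inter> F" "x - F"] by (simp add: Int_Diff_Un)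
    then show "hausdorff2 (F \<inter> x) + hausdorff2 ((UNIV - F) \<inter> x) = hausdorff2 x"
      using hausdorff2_closed_split[OF that, of x]
      by (metis Diff_eq Int_UNIV_left Int_commute antisym Compl_eq_Diff_UNIV)
  qed auto
  have "sigma_sets UNIV (Collect closed) \<subseteq> ?L"
    using L cl by (intro sigma_algebra.sigma_sets_subset) (auto simp: measure_space_def)
  then have "sets (borel :: (real^3) measure) \<subseteq> ?L"
    by (simp add: borel_eq_closed)
  from measure_down[OF L _ this] show ?thesis
    using sets.sigma_algebra_axioms[of "borel :: (real^3) measure"] by simp
qed

definition hausdorff_measure :: "(real^3) measure" where
  "hausdorff_measure = measure_of UNIV (sets borel) hausdorff2"

lemma sets_hausdorff_measure [simp, measurable_cong]: "sets hausdorff_measure = sets borel"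
  unfolding hausdorff_measure_def using sets.sets_measure_of_eq[of "borel :: (real^3) measure"] by simp

lemma emeasure_hausdorff_measure: "A \<in> sets borel \<Longrightarrow> emeasure hausdorff_measure A = hausdorff2 A"
  using measure_space_hausdorff2 unfolding hausdorff_measure_def
  by (subst emeasure_measure_of_sigma) (auto simp: measure_space_def)

text \<open>\<open>measure_of\<close> falls back to the zero measure unless its set function is a
  measure on the given algebra. This lemma rules that out and so gives \<open>sphere_measure\<close>
  and \<open>bdry_measure\<close> their content, as restrictions of one measure on the whole
  space.\<close>

lemma surface_measure_eq: "X \<in> sets borel \<Longrightarrow> surface_measure X = restrict_space hausdorff_measure X"
proof (rule measure_eqI)
  assume X: "X \<in> sets borel"
  have sp: "sets (restrict_space borel X) \<subseteq> Pow X" by (auto simp: sets_restrict_space)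
  have sg: "sigma_algebra X (sets (restrict_space borel X))"
    using sets.sigma_algebra_axioms[of "restrict_space borel X"] by (simp add: space_restrict_space)
  show s: "sets (surface_measure X) = sets (restrict_space hausdorff_measure X)"
    unfolding surface_measure_def using sg sp
    by (simp add: sets_restrict_space sigma_algebra.sigma_sets_eq)
  have ms: "measure_space X (sets (restrict_space borel X)) hausdorff2"
    unfolding measure_space_def
  proof (intro conjI sg)
    have b: "sets (restrict_space borel X) \<subseteq> sets borel"
      using X by (auto simp: sets_restrict_space)
    show "positive (sets (restrict_space borel X)) hausdorff2"
      by (simp add: positive_def hausdorff2_empty)
    show "countably_additive (sets (restrict_space borel X)) hausdorff2"
      using measure_space_hausdorff2 b unfolding measure_space_def countably_additive_def
      by (meson order_trans subsetD)
  qed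
  fix A assume "A \<in> sets (surface_measure X)"
  then have A: "A \<in> sets (restrict_space borel X)" "A \<in> sets borel" "A \<subseteq> X"
    unfolding s using X by (auto simp: sets_restrict_space)
  have "emeasure (surface_measure X) A = hausdorff2 A"
    unfolding surface_measure_def using ms A
    by (subst emeasure_measure_of_sigma) (auto simp: measure_space_def)
  then show "emeasure (surface_measure X) A = emeasure (restrict_space hausdorff_measure X) A"
    using A X by (subst emeasure_restrict_space) (auto simp: emeasure_hausdorff_measure)
qed

text \<open>A cover at scale \<open>\<delta> / L\<close> is mapped to a cover at scale
  \<open>\<delta>\<close>, and each cost grows at most by the square of \<open>L\<close>. Since
  \<open>f\<close> is controlled on \<open>A\<close> alone, the cover sets are cut down to
  \<open>A\<close> before they are mapped.\<close>

lemma hausdorff2_lipschitz_image: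
  assumes L: "0 < L" "\<And>x y. x \<in> A \<Longrightarrow> y \<in> A \<Longrightarrow> dist (f x) (f y) \<le> L * dist x y"
  shows "hausdorff2 (f ` A) \<le> ennreal (L\<^sup>2) * hausdorff2 A"
proof (rule hausdorff2_least)
  fix \<delta> :: real assume d: "0 < \<delta>"
  have "hausdorff2_pre \<delta> (f ` A) \<le> ennreal (L\<^sup>2) * cover_cost C" if C: "delta_cover (\<delta>/L) A C" for C
  proof -
    define D where "D i = f ` (C i \<inter> A)" for i
    have bd: "bounded (D i) \<and> diameter (D i) \<le> L * diameter (C i)" for i
    proof -
      have "dist x y \<le> L * diameter (C i)" if xy: "x \<in> D i" "y \<in> D i" for x y
      proof -
        from xy obtain a b where ab: "a \<in> C i" "a \<in> A" "b \<in> C i" "b \<in> A" "x = f a" "y = f b" by (auto simp: D_def)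
        have "dist a b \<le> diameter (C i)" using C ab by (intro diameter_bounded_bound) (auto simp: delta_cover_def)
        then show ?thesis using L(2)[OF ab(2,4)] ab L(1) by (smt (verit, best) mult_left_mono)
      qed
      moreover have "0 \<le> diameter (C i)" using C by (simp add: diameter_ge_0 delta_cover_def)
      ultimately show ?thesis
        using L(1) by (auto simp: bounded_two_points dist_norm intro!: diameter_le)
    qed
    have "delta_cover \<delta> (f ` A) D"
      unfolding delta_cover_def
    proof (intro conjI allI)
      show "f ` A \<subseteq> (\<Union>i. D i)" using C by (fastforce simp: delta_cover_def D_def)
      fix i show "bounded (D i)" using bd by blast
      have "diameter (C i) \<le> \<delta> / L" using C by (simp add: delta_cover_def)
      then have "L * diameter (C i) \<le> \<delta>" using L(1) by (simp add: field_simps)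
      then show "diameter (D i) \<le> \<delta>" using bd[of i] by simp
    qed
    then have "hausdorff2_pre \<delta> (f ` A) \<le> cover_cost D" by (rule hausdorff2_pre_le)
    also have "\<dots> \<le> (\<Sum>i. ennreal (L\<^sup>2) * ennreal (pi / 4 * (diameter (C i))\<^sup>2))"
    proof (intro suminf_le summableI)
      fix i
      have "0 \<le> diameter (D i)" using bd by (simp add: diameter_ge_0)
      then have "(diameter (D i))\<^sup>2 \<le> (L * diameter (C i))\<^sup>2" using bd by (intro power_mono) auto
      then have "pi / 4 * (diameter (D i))\<^sup>2 \<le> L\<^sup>2 * (pi / 4 * (diameter (C i))\<^sup>2)"
        by (simp add: power_mult_distrib field_simps)
      then show "ennreal (pi / 4 * (diameter (D i))\<^sup>2) \<le> ennreal (L\<^sup>2) * ennreal (pi / 4 * (diameter (C i))\<^sup>2)"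
        by (simp add: ennreal_mult'[symmetric] ennreal_leI)
    qed
    also have "\<dots> = ennreal (L\<^sup>2) * cover_cost C" by simp
    finally show ?thesis .
  qed
  \<comment> \<open>Dividing by the constant brings the bound into the form in which the infimum
    over all covers can be taken.\<close>
  then have "hausdorff2_pre \<delta> (f ` A) / ennreal (L\<^sup>2) \<le> hausdorff2_pre (\<delta>/L) A"
    using L(1) by (intro hausdorff2_pre_greatest divide_le_posI_ennreal) (auto simp: mult.commute)
  also have "\<dots> \<le> hausdorff2 A" using d L(1) by (intro hausdorff2_upper) auto
  finally have "ennreal (L\<^sup>2) * (hausdorff2_pre \<delta> (f ` A) / ennreal (L\<^sup>2)) \<le> ennreal (L\<^sup>2) * hausdorff2 A"
    by (rule mult_left_mono) simp
  then show "hausdorff2_pre \<delta> (f ` A) \<le> ennreal (L\<^sup>2) * hausdorff2 A"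
    using L(1) by (simp add: ennreal_times_divide ennreal_mult_divide_eq mult.commute)
qed

text \<open>The Lipschitz bound with constant 1, for the map and for its inverse on the
  image.\<close>

lemma hausdorff2_isometry:
  assumes "\<And>x y. x \<in> A \<Longrightarrow> y \<in> A \<Longrightarrow> dist (f x) (f y) = dist x y"
  shows "hausdorff2 (f ` A) = hausdorff2 A"
proof (rule antisym)
  show "hausdorff2 (f ` A) \<le> hausdorff2 A"
    using hausdorff2_lipschitz_image[of 1 A f] assms by simp
  have inj: "inj_on f A" using assms by (metis dist_eq_0_iff inj_onI)
  have "hausdorff2 (inv_into A f ` (f ` A)) \<le> ennreal (1\<^sup>2) * hausdorff2 (f ` A)"
    using assms inj by (intro hausdorff2_lipschitz_image) auto
  then show "hausdorff2 A \<le> hausdorff2 (f ` A)"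
    using inj by simp
qed

subsection \<open>Hausdorff measure on planes\<close>

text \<open>The double integral of \<open>indicator A (y + x) * indicator B y\<close>, with
  \<open>B\<close> the unit ball, is evaluated in both orders. Invariance of \<open>M\<close> in
  \<open>x\<close> gives the left side; invariance of \<open>lborel\<close> in \<open>y\<close> and
  the symmetry of the ball give the right side.\<close>

lemma translation_invariant_measure_unique:
  fixes M :: "'a::euclidean_space measure"
  assumes sets: "sets M = sets borel"
    and inv: "\<And>v. distr M borel ((+) v) = M"
    and fin: "emeasure M (ball 0 1) < top"
    and A: "A \<in> sets borel"
  shows "emeasure M A * emeasure lborel (ball (0::'a) 1) = emeasure lborel A * emeasure M (ball 0 1)"
proof -
  note [measurable_cong] = sets
  have sp: "space M = UNIV" using sets_eq_imp_space_eq[OF sets] by simp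
  have bv: "emeasure M (ball v 1) = emeasure M (ball 0 1)" for v
  proof -
    have "emeasure M (ball v 1) = emeasure (distr M borel ((+) v)) (ball v 1)" by (simp add: inv)
    also have "\<dots> = emeasure M ((+) v -` ball v 1 \<inter> space M)"
      by (rule emeasure_distr) auto
    also have "(+) v -` ball v 1 \<inter> space M = ball 0 1"
      by (auto simp: dist_norm sp)
    finally show ?thesis .
  qed
  have bvf: "emeasure M (ball v 1) < top" for v
    using fin bv[of v] by simp
  obtain D :: "'a set" where D: "countable D" "\<And>X. open X \<Longrightarrow> X \<noteq> {} \<Longrightarrow> \<exists>d\<in>D. d \<in> X"
    using countable_dense_exists by metis
  \<comment> \<open>Fubini's theorem asks for this. Unit balls around a countable dense set cover
    the space, and by invariance all have the finite mass of the one around 0.\<close>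
  interpret M: sigma_finite_measure M
  proof
    show "\<exists>\<A>. countable \<A> \<and> \<A> \<subseteq> sets M \<and> \<Union>\<A> = space M \<and> (\<forall>a\<in>\<A>. emeasure M a \<noteq> \<infinity>)"
    proof (intro exI[of _ "(\<lambda>d. ball d 1) ` D"] conjI)
      show "\<Union>((\<lambda>d. ball d 1) ` D) = space M"
      proof -
        have "x \<in> \<Union>((\<lambda>d. ball d 1) ` D)" for x
          using D(2)[of "ball x 1"] by (auto simp: dist_commute)
        then show ?thesis using sp by auto
      qed
    qed (use D bvf sets in \<open>auto simp: less_top\<close>)
  qed
  interpret P: pair_sigma_finite M lborel ..
  define B where "B = ball (0::'a) 1"
  have [measurable]: "B \<in> sets borel" by (simp add: B_def)
  note [measurable] = A
  have trM: "(\<integral>\<^sup>+x. f (v + x) \<partial>M) = (\<integral>\<^sup>+x. f x \<partial>M)" if [measurable]: "f \<in> borel_measurable borel" for f :: "'a \<Rightarrow> ennreal" and v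
    by (subst (2) inv[of v, symmetric], subst nn_integral_distr) auto
  have trL: "(\<integral>\<^sup>+x. f (v + x) \<partial>lborel) = (\<integral>\<^sup>+x. f x \<partial>lborel)" if [measurable]: "f \<in> borel_measurable borel" for f :: "'a \<Rightarrow> ennreal" and v
    by (subst (2) lborel_distr_plus[of v, symmetric], subst nn_integral_distr) auto
  have "emeasure M A * emeasure lborel B = (\<integral>\<^sup>+y. (\<integral>\<^sup>+x. indicator A x * indicator B y \<partial>M) \<partial>lborel)"
    by (simp add: nn_integral_multc nn_integral_cmult_indicator)
  also have "\<dots> = (\<integral>\<^sup>+y. (\<integral>\<^sup>+x. indicator A (y + x) * indicator B y \<partial>M) \<partial>lborel)"
    by (subst trM) simp_all
  also have "\<dots> = (\<integral>\<^sup>+x. (\<integral>\<^sup>+y. indicator A (y + x) * indicator B y \<partial>lborel) \<partial>M)"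
    by (rule P.Fubini') measurable
  also have "\<dots> = (\<integral>\<^sup>+x. (\<integral>\<^sup>+y. indicator A y * indicator B (y - x) \<partial>lborel) \<partial>M)"
  proof (rule nn_integral_cong)
    fix x
    show "(\<integral>\<^sup>+y. indicator A (y + x) * indicator B y \<partial>lborel) = (\<integral>\<^sup>+y. indicator A y * indicator B (y - x) \<partial>lborel)"
      using trL[of "\<lambda>y. indicator A y * indicator B (y - x)" x] by (simp add: add.commute)
  qed
  also have "\<dots> = (\<integral>\<^sup>+y. (\<integral>\<^sup>+x. indicator A y * indicator B (y - x) \<partial>M) \<partial>lborel)"
    by (rule P.Fubini'[symmetric]) measurable
  also have "\<dots> = (\<integral>\<^sup>+y. indicator A y * emeasure M B \<partial>lborel)"
  proof (rule nn_integral_cong)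
    fix y
    have [measurable]: "ball y 1 \<in> sets M" by (simp add: sets)
    have "(\<integral>\<^sup>+x. indicator A y * indicator B (y - x) \<partial>M) = indicator A y * (\<integral>\<^sup>+x. indicator (ball y 1) x \<partial>M)"
      by (subst nn_integral_cmult[symmetric]) (auto intro!: nn_integral_cong simp: indicator_def dist_norm B_def norm_minus_commute)
    then show "(\<integral>\<^sup>+x. indicator A y * indicator B (y - x) \<partial>M) = indicator A y * emeasure M B"
      by (simp add: bv[of y] B_def)
  qed
  also have "\<dots> = emeasure lborel A * emeasure M B"
    by (simp add: nn_integral_multc)
  finally show ?thesis unfolding B_def .
qed

section \<open>Orthonormal frames and coordinates on planes\<close>

definition frame3 :: "real^3 \<Rightarrow> real^3 \<Rightarrow> real^3 \<Rightarrow> bool" where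
  "frame3 a b n \<longleftrightarrow> norm a = 1 \<and> norm b = 1 \<and> a \<bullet> b = 0 \<and> cross3 a b = n"

lemma frame3_props:
  assumes "frame3 a b n"
  shows "a \<bullet> a = 1" "b \<bullet> b = 1" "a \<bullet> b = 0" "b \<bullet> a = 0" "n \<bullet> n = 1"
    "a \<bullet> n = 0" "b \<bullet> n = 0" "n \<bullet> a = 0" "n \<bullet> b = 0" "norm n = 1" "norm a = 1" "norm b = 1" "cross3 a b = n"
proof -
  have *: "norm a = 1" "norm b = 1" "a \<bullet> b = 0" "n = cross3 a b" using assms by (auto simp: frame3_def)
  show "norm n = 1"
    using norm_cross_dot[of a b] * by (simp add: power2_eq_1_iff) (smt (verit) norm_ge_zero)
  then show "a \<bullet> a = 1" "b \<bullet> b = 1" "n \<bullet> n = 1" using * by (auto simp: dot_square_norm)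
  show "a \<bullet> b = 0" "b \<bullet> a = 0" "norm a = 1" "norm b = 1" "cross3 a b = n" using * by (auto simp: inner_commute)
  show "a \<bullet> n = 0" "b \<bullet> n = 0" "n \<bullet> a = 0" "n \<bullet> b = 0"
    using dot_cross_self(1)[of a b] dot_cross_self(2)[of b a] dot_cross_self(3,4)
    unfolding *(4) by (simp_all only: inner_commute[of "cross3 a b"])
qed

lemma frame3_exists:
  assumes "norm n = 1"
  shows "\<exists>a b. frame3 a b n"
proof -
  obtain y where y: "y \<noteq> 0" "orthogonal n y" using orthogonal_to_vector_exists[of n] by auto
  define a where "a = (1 / norm y) *\<^sub>R y"
  have a: "norm a = 1" "n \<bullet> a = 0" using y by (auto simp: a_def orthogonal_def)
  have "norm (cross3 n a) = 1"
    using norm_cross_dot[of n a] a assms by (simp add: power2_eq_1_iff) (smt (verit) norm_ge_zero)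
  moreover have "cross3 a (cross3 n a) = (a \<bullet> a) *\<^sub>R n - (a \<bullet> n) *\<^sub>R a"
    by (rule Lagrange)
  ultimately have "frame3 a (cross3 n a) n"
    using a dot_cross_self(2)[of a n] by (simp add: frame3_def dot_square_norm inner_commute[of a n])
  then show ?thesis by blast
qed

text \<open>The remainder \<open>d\<close> is orthogonal to all three vectors. Lagrange's identity
  makes \<open>cross3 d n\<close> vanish as well, and \<open>norm_cross_dot\<close> then forces
  \<open>d = 0\<close>.\<close>

lemma frame3_expand:
  assumes "frame3 a b n"
  shows "x = (x \<bullet> a) *\<^sub>R a + (x \<bullet> b) *\<^sub>R b + (x \<bullet> n) *\<^sub>R n"
proof -
  note f = frame3_props[OF assms]
  define d where "d = x - ((x \<bullet> a) *\<^sub>R a + (x \<bullet> b) *\<^sub>R b + (x \<bullet> n) *\<^sub>R n)"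
  have d: "d \<bullet> a = 0" "d \<bullet> b = 0" "d \<bullet> n = 0"
    using f by (auto simp: d_def inner_diff_left inner_add_left)
  have "cross3 d n = (d \<bullet> b) *\<^sub>R a - (d \<bullet> a) *\<^sub>R b"
    using Lagrange[of d a b] f by simp
  then have "cross3 d n = 0" using d by simp
  then have "d = 0" using norm_cross_dot[of d n] d f by simp
  then show ?thesis by (simp add: d_def)
qed

definition emb :: "real^3 \<Rightarrow> real^3 \<Rightarrow> real^2 \<Rightarrow> real^3" where
  "emb a b z = (z$1) *\<^sub>R a + (z$2) *\<^sub>R b"

definition prj :: "real^3 \<Rightarrow> real^3 \<Rightarrow> real^3 \<Rightarrow> real^2" where
  "prj a b x = vector [x \<bullet> a, x \<bullet> b]"

lemma prj_nth [simp]: "prj a b x $ 1 = x \<bullet> a" "prj a b x $ 2 = x \<bullet> b"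
  by (auto simp: prj_def vector_2)

lemma vec2_eq_iff: "x = y \<longleftrightarrow> x$1 = y$1 \<and> x$2 = y$2" for x y :: "real^2"
  by (simp add: vec_eq_iff forall_2)

lemma linear_emb: "linear (emb a b)"
  by (rule linearI) (auto simp: emb_def algebra_simps)

lemma linear_prj: "linear (prj a b)"
  by (rule linearI) (auto simp: vec2_eq_iff inner_add_left)

lemma continuous_emb [continuous_intros]: "continuous_on S (emb a b)"
  using linear_continuous_on linear_conv_bounded_linear linear_emb by blast

lemma continuous_prj [continuous_intros]: "continuous_on S (prj a b)"
  using linear_continuous_on linear_conv_bounded_linear linear_prj by blast

lemma measurable_emb [measurable]: "emb a b \<in> borel_measurable borel"
  by (rule borel_measurable_continuous_onI[OF continuous_emb])

lemma measurable_prj [measurable]: "prj a b \<in> borel_measurable borel"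
  by (rule borel_measurable_continuous_onI[OF continuous_prj])

lemma norm_vec2: "(norm z)\<^sup>2 = (z$1)\<^sup>2 + (z$2)\<^sup>2" for z :: "real^2"
  unfolding power2_norm_eq_inner by (simp add: inner_vec_def sum_2 power2_eq_square)

context
  fixes a b n :: "real^3"
  assumes fr: "frame3 a b n"
begin

lemma prj_emb: "prj a b (emb a b z) = z"
  using frame3_props[OF fr] by (simp add: vec2_eq_iff emb_def inner_add_left)

lemma emb_inner: "emb a b z \<bullet> n = 0"
  using frame3_props[OF fr] by (simp add: emb_def inner_add_left)

lemma emb_prj: "emb a b (prj a b x) = x - (x \<bullet> n) *\<^sub>R n"
  using frame3_expand[OF fr, of x] by (simp add: emb_def algebra_simps)

lemma norm_emb_add: "(norm (emb a b z + s *\<^sub>R n))\<^sup>2 = (norm z)\<^sup>2 + s\<^sup>2"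
  unfolding norm_vec2 power2_norm_eq_inner using frame3_props[OF fr]
  by (simp add: emb_def inner_add_left inner_add_right power2_eq_square)

lemma norm_emb: "norm (emb a b z) = norm z"
  using norm_emb_add[of z 0] by simp

lemma dist_emb: "dist (emb a b x) (emb a b y) = dist x y"
  using norm_emb[of "x - y"] linear_diff[OF linear_emb, of a b x y] by (simp add: dist_norm)

lemma range_emb: "range (emb a b) = {x. x \<bullet> n = 0}"
proof safe
  fix x assume "x \<bullet> n = 0"
  then have "x = emb a b (prj a b x)" by (simp add: emb_prj)
  then show "x \<in> range (emb a b)" by blast
qed (simp add: emb_inner)

lemma range_emb_borel [measurable]: "range (emb a b) \<in> sets borel"
  unfolding range_emb using closed_hyperplane[of n 0] by (simp add: inner_commute borel_closed)

lemma norm_prj_le: "norm (prj a b x) \<le> norm x"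
proof -
  have "(norm (prj a b x))\<^sup>2 \<le> (norm x)\<^sup>2"
    using norm_emb_add[of "prj a b x" "x \<bullet> n"] by (simp add: emb_prj)
  then show ?thesis by simp
qed

lemma dist_prj_le: "dist (prj a b x) (prj a b y) \<le> dist x y"
  using norm_prj_le[of "x - y"] linear_diff[OF linear_prj, of a b x y] by (simp add: dist_norm)

lemma emb_image_borel: "A \<in> sets borel \<Longrightarrow> emb a b ` A \<in> sets borel"
proof -
  assume [measurable]: "A \<in> sets borel"
  have "emb a b ` A = prj a b -` A \<inter> range (emb a b)" by (auto simp: prj_emb)
  moreover have "prj a b -` A \<inter> range (emb a b) \<in> sets borel" by measurable
  ultimately show ?thesis by simp
qed

text \<open>Fubini's theorem in rotated coordinates. The image of Lebesgue measure under the linear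
  isometry \<open>T\<close> is translation invariant and gives the unit ball its usual volume, so it
  is Lebesgue measure by the uniqueness result.\<close>

lemma nn_integral_frame:
  assumes [measurable]: "F \<in> borel_measurable borel"
  shows "(\<integral>\<^sup>+x. F x \<partial>lborel) = (\<integral>\<^sup>+z. (\<integral>\<^sup>+s. F (emb a b z + s *\<^sub>R n) \<partial>lborel) \<partial>lborel)"
proof -
  define T :: "(real^2) \<times> real \<Rightarrow> real^3" where "T p = emb a b (fst p) + snd p *\<^sub>R n" for p
  have Tc: "continuous_on UNIV T"
    unfolding T_def by (intro continuous_intros continuous_on_compose2[OF continuous_emb[of UNIV]]) auto
  have [measurable]: "T \<in> borel_measurable borel" by (rule borel_measurable_continuous_onI[OF Tc])
  have linT: "linear T"
    using linear_emb[of a b] by (intro linearI) (auto simp: T_def linear_add linear_cmul algebra_simps)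
  have normT: "norm (T p) = norm p" for p
  proof -
    have "(norm (T p))\<^sup>2 = (norm p)\<^sup>2"
      unfolding T_def norm_emb_add by (cases p) (simp add: norm_Pair)
    then show ?thesis by simp
  qed
  have surjT: "\<exists>u. T u = v" for v
    by (rule exI[of _ "(prj a b v, v \<bullet> n)"]) (simp add: T_def emb_prj)
  define M where "M = distr lborel borel T"
  have preb: "T -` ball 0 1 = ball 0 1" by (auto simp: normT)
  have bM: "emeasure M (ball 0 1) = emeasure lborel (ball (0::real^3) 1)"
    unfolding M_def by (subst emeasure_distr) (auto simp: preb emeasure_ball)
  have tr: "distr M borel ((+) v) = M" for v
  proof -
    obtain u where u: "T u = v" using surjT by blast
    have "distr M borel ((+) v) = distr lborel borel (\<lambda>p. v + T p)"
      unfolding M_def by (subst distr_distr) (auto simp: comp_def)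
    also have "(\<lambda>p. v + T p) = (\<lambda>p. T (u + p))" using u linT by (simp add: linear_add)
    also have "distr lborel borel (\<lambda>p. T (u + p)) = distr (distr lborel borel ((+) u)) borel T"
      by (subst distr_distr) (auto simp: comp_def)
    also have "\<dots> = M" by (simp add: lborel_distr_plus M_def)
    finally show ?thesis .
  qed
  have b0: "emeasure lborel (ball (0::real^3) 1) = ennreal (unit_ball_vol 3)" by (simp add: emeasure_ball)
  have "M = lborel"
  proof (rule measure_eqI)
    fix A assume "A \<in> sets M"
    then have A: "A \<in> sets borel" by (simp add: M_def)
    have "emeasure M A * emeasure lborel (ball (0::real^3) 1) = emeasure lborel A * emeasure M (ball 0 1)"
      by (rule translation_invariant_measure_unique[OF _ tr _ A]) (simp_all only: bM, auto simp: M_def b0)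
    then show "emeasure M A = emeasure lborel A"
      unfolding bM b0 using pi_gt_zero by (auto simp: mult_right_ennreal_cancel unit_ball_vol_3)
  qed (simp add: M_def)
  then have "(\<integral>\<^sup>+x. F x \<partial>lborel) = (\<integral>\<^sup>+x. F x \<partial>M)" by simp
  also have "\<dots> = (\<integral>\<^sup>+p. F (T p) \<partial>(lborel \<Otimes>\<^sub>M lborel))"
    unfolding M_def lborel_prod by (rule nn_integral_distr) auto
  also have "\<dots> = (\<integral>\<^sup>+z. (\<integral>\<^sup>+s. F (emb a b z + s *\<^sub>R n) \<partial>lborel) \<partial>lborel)"
  proof -
    have "(\<lambda>p. F (T p)) \<in> borel_measurable (lborel \<Otimes>\<^sub>M lborel)"
      using measurable_compose[OF \<open>T \<in> borel_measurable borel\<close> assms]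
      unfolding lborel_prod by simp
    from lborel.nn_integral_fst[OF this] show ?thesis by (simp only: T_def fst_conv snd_conv)
  qed
  finally show ?thesis .
qed

end

text \<open>Hausdorff measure on the plane, read in the coordinates of \<open>real^2\<close>: there
  all translations act, as the uniqueness result requires.\<close>

definition planar :: "real^3 \<Rightarrow> real^3 \<Rightarrow> (real^2) measure" where
  "planar a b = distr (restrict_space hausdorff_measure (range (emb a b))) borel (prj a b)"

lemma sets_planar [simp, measurable_cong]: "sets (planar a b) = sets borel"
  by (simp add: planar_def)

lemma emeasure_planar:
  assumes fr: "frame3 a b n" and A: "A \<in> sets borel"
  shows "emeasure (planar a b) A = hausdorff2 (emb a b ` A)"
proof -
  note [measurable] = A range_emb_borel[OF fr]
  have m: "prj a b \<in> measurable (restrict_space hausdorff_measure (range (emb a b))) borel"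
    by (rule measurable_restrict_space1) measurable
  have eq: "prj a b -` A \<inter> space (restrict_space hausdorff_measure (range (emb a b))) = emb a b ` A"
    by (auto simp: space_restrict_space prj_emb[OF fr])
  show ?thesis
    unfolding planar_def
    apply (subst emeasure_distr[OF m A])
    apply (subst eq)
    apply (subst emeasure_restrict_space)
    using emb_image_borel[OF fr A] by (auto simp: emeasure_hausdorff_measure)
qed

lemma planar_translate:
  assumes fr: "frame3 a b n"
  shows "distr (planar a b) borel ((+) v) = planar a b"
proof (rule measure_eqI)
  fix A assume "A \<in> sets (distr (planar a b) borel ((+) v))"
  then have [measurable]: "A \<in> sets borel" by simp
  let ?B = "(+) v -` A"
  have B: "?B \<in> sets borel"
    using measurable_sets[of "(+) v" borel borel A] by simp
  have "emeasure (distr (planar a b) borel ((+) v)) A = emeasure (planar a b) ?B"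
    by (subst emeasure_distr) (auto simp: planar_def)
  also have "\<dots> = hausdorff2 (emb a b ` ?B)" using B by (rule emeasure_planar[OF fr])
  also have "\<dots> = hausdorff2 ((+) (emb a b v) ` (emb a b ` ?B))"
    by (rule hausdorff2_isometry[symmetric]) auto
  also have "(+) (emb a b v) ` (emb a b ` ?B) = emb a b ` A"
  proof -
    have "(+) (emb a b v) ` (emb a b ` ?B) = emb a b ` ((+) v ` ?B)"
      by (simp only: image_image linear_add[OF linear_emb])
    also have "(+) v ` ?B = A" by (auto intro!: image_eqI[of _ _ "_ - v"])
    finally show ?thesis .
  qed
  also have "hausdorff2 \<dots> = emeasure (planar a b) A" by (simp add: emeasure_planar[OF fr])
  finally show "emeasure (distr (planar a b) borel ((+) v)) A = emeasure (planar a b) A" .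
qed simp

lemma hausdorff2_pre_single:
  assumes "bounded E" "diameter E \<le> \<delta>" "0 \<le> \<delta>"
  shows "hausdorff2_pre \<delta> E \<le> ennreal (pi / 4 * (diameter E)\<^sup>2)"
proof -
  have "hausdorff2_pre \<delta> E \<le> (\<Sum>i::nat. ennreal (pi / 4 * (diameter (if i = 0 then E else {}))\<^sup>2))"
    using assms by (intro hausdorff2_pre_le) (auto simp: delta_cover_def split: if_splits)
  also have "\<dots> = (\<Sum>i\<in>{0::nat}. ennreal (pi / 4 * (diameter (if i = 0 then E else {}))\<^sup>2))"
    by (rule suminf_finite) auto
  finally show ?thesis by simp
qed

text \<open>A crude bound that makes the uniqueness result applicable: the square around the disc is
  cut into \<open>N * N\<close> cells of side \<open>h = 2 / N\<close>, each with diameter at most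
  \<open>sqrt 2 * h\<close>, at a total cost of at most \<open>2 * pi\<close>.\<close>

lemma planar_ball_finite:
  assumes fr: "frame3 a b n"
  shows "hausdorff2 (emb a b ` ball 0 1) \<le> ennreal (2 * pi)"
proof (rule hausdorff2_least)
  fix \<delta> :: real assume d: "0 < \<delta>"
  obtain N :: nat where N: "N > 0" "2 * sqrt 2 / real N \<le> \<delta>"
  proof -
    obtain N :: nat where "2 * sqrt 2 / \<delta> < real N" using reals_Archimedean2 by blast
    moreover have "0 < 2 * sqrt 2 / \<delta>" using d by simp
    ultimately have N: "0 < real N" by linarith
    then have "2 * sqrt 2 < real N * \<delta>"
      using \<open>2 * sqrt 2 / \<delta> < real N\<close> d by (simp add: pos_divide_less_eq)
    then have "2 * sqrt 2 / real N \<le> \<delta>" using N by (simp add: pos_divide_le_eq mult.commute)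
    moreover have "N > 0" using N by simp
    ultimately have "N > 0" "2 * sqrt 2 / real N \<le> \<delta>" by auto
    then show ?thesis using that by blast
  qed
  define h where "h = 2 / real N"
  have h: "h > 0" "real N * h = 2" using N by (auto simp: h_def)
  \<comment> \<open>Cells are numbered by one index \<open>k\<close>: the quotient by
    \<open>N\<close> is the column, the remainder is the row.\<close>
  define Q where "Q k = {z::real^2. (\<bar>z$1 - (-1 + h * real (k div N))\<bar> \<le> h \<and> -1 + h * real (k div N) \<le> z$1)
     \<and> (\<bar>z$2 - (-1 + h * real (k mod N))\<bar> \<le> h \<and> -1 + h * real (k mod N) \<le> z$2)}" for k
  have Qd: "dist x y \<le> sqrt 2 * h" if "x \<in> Q k" "y \<in> Q k" for x y k
  proof -
    have "\<bar>x$1 - y$1\<bar> \<le> h" "\<bar>x$2 - y$2\<bar> \<le> h" using that by (auto simp: Q_def)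
    then have "\<bar>x$1 - y$1\<bar>\<^sup>2 \<le> h\<^sup>2" "\<bar>x$2 - y$2\<bar>\<^sup>2 \<le> h\<^sup>2" by (intro power_mono; simp)+
    then have "(norm (x - y))\<^sup>2 \<le> 2 * h\<^sup>2" by (simp add: norm_vec2)
    then have "norm (x - y) \<le> sqrt (2 * h\<^sup>2)" by (rule real_le_rsqrt)
    then show ?thesis using h by (simp add: real_sqrt_mult dist_norm)
  qed
  define C where "C k = (if k < N * N then emb a b ` Q k else {})" for k
  have Cd: "bounded (C k) \<and> diameter (C k) \<le> sqrt 2 * h" for k
  proof -
    have "dist x y \<le> sqrt 2 * h" if "x \<in> C k" "y \<in> C k" for x y
      using that Qd by (auto simp: C_def dist_emb[OF fr] split: if_splits)
    then show ?thesis using h by (auto simp: bounded_two_points dist_norm intro!: diameter_le)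
  qed
  have idx: "\<exists>i<N. \<bar>t - (-1 + h * real i)\<bar> \<le> h \<and> -1 + h * real i \<le> t" if "\<bar>t\<bar> < 1" for t
  proof -
    define i where "i = nat \<lfloor>(t + 1) / h\<rfloor>"
    have p: "0 \<le> (t+1)/h" using that h by auto
    have i1: "real i \<le> (t + 1) / h" "(t + 1) / h < real i + 1"
      using p by (auto simp: i_def)
    have "real i * h \<le> t + 1" "t + 1 < (real i + 1) * h"
      using i1 h(1) by (auto simp: field_simps)
    moreover have "i < N"
    proof -
      have "real i * h < real N * h" using \<open>real i * h \<le> t + 1\<close> h(2) that by linarith
      then show ?thesis using h(1) by simp
    qed
    ultimately show ?thesis by (intro exI[of _ i]) (auto simp: algebra_simps)
  qed
  have "delta_cover \<delta> (emb a b ` ball 0 1) C"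
    unfolding delta_cover_def
  proof (intro conjI allI subsetI)
    fix x assume "x \<in> emb a b ` ball 0 1"
    then obtain z where z: "norm z < 1" "x = emb a b z" by auto
    have "\<bar>z$1\<bar> < 1" "\<bar>z$2\<bar> < 1"
      using z(1) component_le_norm_cart[of z 1] component_le_norm_cart[of z 2] by auto
    then obtain i j where ij: "i < N" "\<bar>z$1 - (-1 + h * real i)\<bar> \<le> h" "-1 + h * real i \<le> z$1"
       "j < N" "\<bar>z$2 - (-1 + h * real j)\<bar> \<le> h" "-1 + h * real j \<le> z$2"
      using idx by metis
    define k where "k = i * N + j"
    have k: "k div N = i" "k mod N = j" using ij by (auto simp: k_def)
    have "k < N * N"
      using ij(1,4) k(1) N(1) by (metis div_less_iff_less_mult mult.commute)
    then have "x \<in> C k" using ij z k by (auto simp: C_def Q_def)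
    then show "x \<in> (\<Union>k. C k)" by blast
  next
    fix k show "bounded (C k)" using Cd by blast
    show "diameter (C k) \<le> \<delta>" using Cd[of k] N(2) by (simp add: h_def mult.commute)
  qed
  then have "hausdorff2_pre \<delta> (emb a b ` ball 0 1) \<le> cover_cost C" by (rule hausdorff2_pre_le)
  also have "\<dots> = (\<Sum>k<N*N. ennreal (pi / 4 * (diameter (C k))\<^sup>2))"
    by (rule suminf_finite) (auto simp: C_def)
  also have "\<dots> \<le> (\<Sum>k<N*N. ennreal (pi / 4 * (2 * h\<^sup>2)))"
  proof (intro sum_mono ennreal_leI mult_left_mono)
    fix k
    have "0 \<le> diameter (C k)" using Cd by (simp add: diameter_ge_0)
    then have "(diameter (C k))\<^sup>2 \<le> (sqrt 2 * h)\<^sup>2" using Cd by (intro power_mono) auto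
    then show "(diameter (C k))\<^sup>2 \<le> 2 * h\<^sup>2" by (simp add: power_mult_distrib)
  qed simp
  also have "\<dots> = ennreal (real (N * N) * (pi / 4 * (2 * h\<^sup>2)))"
    by (subst ennreal_mult') (auto simp: ennreal_of_nat_eq_real_of_nat)
  also have "real (N * N) * (pi / 4 * (2 * h\<^sup>2)) = 2 * pi"
    using N by (simp add: h_def power2_eq_square)
  finally show "hausdorff2_pre \<delta> (emb a b ` ball 0 1) \<le> ennreal (2 * pi)" .
qed

lemma emeasure_lborel_ball2: "0 \<le> r \<Longrightarrow> emeasure lborel (ball (x::real^2) r) = ennreal (pi * r\<^sup>2)"
  by (simp add: emeasure_ball unit_ball_vol_2)

lemma emeasure_lborel_cball2: "0 \<le> r \<Longrightarrow> emeasure lborel (cball (x::real^2) r) = ennreal (pi * r\<^sup>2)"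
  by (simp add: emeasure_cball unit_ball_vol_2)

lemma planar_unique:
  assumes fr: "frame3 a b n" and A: "A \<in> sets borel"
  shows "hausdorff2 (emb a b ` A) * ennreal pi = emeasure lborel A * hausdorff2 (emb a b ` ball 0 1)"
proof -
  have "emeasure (planar a b) (ball 0 1) < top"
    using planar_ball_finite[OF fr] by (subst emeasure_planar[OF fr]) (auto simp: less_top[symmetric] top_unique)
  from translation_invariant_measure_unique[OF sets_planar planar_translate[OF fr] this A]
  show ?thesis using A by (simp add: emeasure_planar[OF fr] emeasure_lborel_ball2)
qed

text \<open>A cover set of diameter \<open>r\<close> projects into a disc of radius \<open>r\<close>
  around any of its points. Taking radius \<open>r\<close> where the isodiametric inequality would
  give the area of radius \<open>r / 2\<close> costs the factor 4; the purpose is positivity of the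
  constant.\<close>

lemma planar_ball_lower:
  assumes fr: "frame3 a b n"
  shows "ennreal pi \<le> 4 * hausdorff2 (emb a b ` ball 0 1)"
proof -
  have "ennreal pi \<le> 4 * cover_cost C" if C: "delta_cover 1 (emb a b ` ball 0 1) C" for C
  proof -
    define r where "r i = diameter (C i)" for i
    have r0: "0 \<le> r i" for i using C by (simp add: r_def diameter_ge_0 delta_cover_def)
    define B where "B i = (if C i = {} then {} else cball (prj a b (SOME x. x \<in> C i)) (r i))" for i
    have sub: "ball 0 1 \<subseteq> (\<Union>i. B i)"
    proof
      fix z :: "real^2" assume "z \<in> ball 0 1"
      then have "emb a b z \<in> (\<Union>i. C i)" using C unfolding delta_cover_def by blast
      then obtain i where i: "emb a b z \<in> C i" by blast
      then have s: "(SOME x. x \<in> C i) \<in> C i" by (rule someI)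
      have "dist (prj a b (SOME x. x \<in> C i)) (prj a b (emb a b z)) \<le> dist (SOME x. x \<in> C i) (emb a b z)"
        by (rule dist_prj_le[OF fr])
      also have "\<dots> \<le> r i"
        unfolding r_def using C s i by (intro diameter_bounded_bound) (auto simp: delta_cover_def)
      finally have "z \<in> B i" using i by (auto simp: B_def prj_emb[OF fr])
      then show "z \<in> (\<Union>i. B i)" by blast
    qed
    have B: "B i \<in> sets lborel" for i by (simp add: B_def)
    have "ennreal pi = emeasure lborel (ball (0::real^2) 1)" by (simp add: emeasure_lborel_ball2)
    also have "\<dots> \<le> emeasure lborel (\<Union>i. B i)"
      using sub B by (intro emeasure_mono) auto
    also have "\<dots> \<le> (\<Sum>i. emeasure lborel (B i))"
      using B by (intro emeasure_subadditive_countably) auto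
    also have "\<dots> \<le> (\<Sum>i. 4 * ennreal (pi / 4 * (r i)\<^sup>2))"
    proof (intro suminf_le summableI)
      fix i
      have "emeasure lborel (B i) \<le> ennreal (pi * (r i)\<^sup>2)"
        using r0 by (simp add: B_def emeasure_lborel_cball2)
      also have "\<dots> = ennreal (4 * (pi / 4 * (r i)\<^sup>2))" by simp
      also have "\<dots> = 4 * ennreal (pi / 4 * (r i)\<^sup>2)" by (subst ennreal_mult') auto
      finally show "emeasure lborel (B i) \<le> 4 * ennreal (pi / 4 * (r i)\<^sup>2)" .
    qed
    also have "\<dots> = 4 * cover_cost C" by (simp add: r_def)
    finally show ?thesis .
  qed
  then have "ennreal pi / 4 \<le> hausdorff2_pre 1 (emb a b ` ball 0 1)"
    by (intro hausdorff2_pre_greatest divide_le_posI_ennreal) (auto simp: mult.commute)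
  also have "\<dots> \<le> hausdorff2 (emb a b ` ball 0 1)" by (rule hausdorff2_upper) simp
  finally have "4 * (ennreal pi / 4) \<le> 4 * hausdorff2 (emb a b ` ball 0 1)"
    by (rule mult_left_mono) simp
  then show ?thesis by (simp add: ennreal_times_divide ennreal_mult_divide_eq mult.commute)
qed

text \<open>The uniqueness result with a finite constant already settles Borel null sets, and a
  negligible set lies in one. This disposes of the part that a Vitali covering leaves
  uncovered.\<close>

lemma planar_null:
  assumes fr: "frame3 a b n" and N: "negligible N"
  shows "hausdorff2 (emb a b ` N) = 0"
proof -
  have "N \<in> null_sets lebesgue" using N by (simp add: negligible_iff_null_sets)
  then obtain N' where N': "N' \<in> null_sets lborel" "N \<subseteq> N'"
    by (meson null_sets_completionI null_sets_completion_iff2)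
  have "hausdorff2 (emb a b ` N') * ennreal pi = 0"
    using planar_unique[OF fr, of N'] N' by (auto simp: null_sets_def)
  then have "hausdorff2 (emb a b ` N') = 0" using pi_gt_zero by (auto simp: ennreal_eq_0_iff)
  then show ?thesis using hausdorff2_mono[OF image_mono[OF N'(2)]] by (metis le_zero_eq)
qed

text \<open>Vitali's theorem exhausts the unit disc, up to a null set, by disjoint discs of diameter
  at most \<open>\<delta>\<close>. Each of them covers itself at a cost of at most its area, and the
  areas add up to at most \<open>pi\<close>.\<close>

lemma planar_ball_upper:
  assumes fr: "frame3 a b n"
  shows "hausdorff2 (emb a b ` ball 0 1) \<le> ennreal pi"
proof (rule hausdorff2_least)
  fix \<delta> :: real assume d: "0 < \<delta>"
  let ?S = "ball (0::real^2) 1"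
  define K where "K = {p::(real^2) \<times> real. ball (fst p) (snd p) \<subseteq> ?S \<and> 0 < snd p \<and> snd p \<le> \<delta> / 2}"
  obtain \<C> where \<C>: "countable \<C>" "\<C> \<subseteq> K"
    "pairwise (\<lambda>i j. disjnt (ball (fst i) (snd i)) (ball (fst j) (snd j))) \<C>"
    "negligible (?S - (\<Union>i\<in>\<C>. ball (fst i) (snd i)))"
  proof (rule Vitali_covering_theorem_balls[of ?S K fst snd])
    fix x :: "real^2" and e :: real assume x: "x \<in> ?S" and e: "0 < e"
    obtain k where k: "k > 0" "ball x k \<subseteq> ?S" using x open_ball openE by blast
    define r where "r = min (min (e/2) k) (\<delta>/2)"
    have "r > 0" "r < e" "r \<le> \<delta> / 2" "r \<le> k" using e k d by (auto simp: r_def)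
    moreover from this have "ball x r \<subseteq> ?S" using k(2) subset_ball[of r k x] by blast
    ultimately show "\<exists>i. i \<in> K \<and> x \<in> ball (fst i) (snd i) \<and> snd i < e"
      by (intro exI[of _ "(x,r)"]) (auto simp: K_def)
  qed auto
  define B where "B i = (\<Union>p\<in>{p\<in>\<C>. to_nat_on \<C> p = i}. ball (fst p) (snd p))" for i
  have single: "B i = {} \<or> (\<exists>p\<in>\<C>. to_nat_on \<C> p = i \<and> B i = ball (fst p) (snd p))" for i
  proof (cases "\<exists>p\<in>\<C>. to_nat_on \<C> p = i")
    case True
    then obtain p where p: "p \<in> \<C>" "to_nat_on \<C> p = i" by blast
    then have "{p\<in>\<C>. to_nat_on \<C> p = i} = {p}"
      using inj_on_to_nat_on[OF \<C>(1)] by (auto dest: inj_onD)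
    then show ?thesis using p by (auto simp: B_def)
  qed (auto simp: B_def)
  have UB: "(\<Union>i. B i) = (\<Union>p\<in>\<C>. ball (fst p) (snd p))" by (auto simp: B_def)
  have disj: "disjoint_family B"
    unfolding disjoint_family_on_def
  proof (intro ballI impI)
    fix i j :: nat assume "i \<noteq> j"
    show "B i \<inter> B j = {}"
    proof (rule ccontr)
      assume "B i \<inter> B j \<noteq> {}"
      then obtain x p q where "p \<in> \<C>" "q \<in> \<C>" "to_nat_on \<C> p = i" "to_nat_on \<C> q = j"
        "x \<in> ball (fst p) (snd p)" "x \<in> ball (fst q) (snd q)" unfolding B_def by blast
      moreover from this \<open>i \<noteq> j\<close> have "p \<noteq> q" by auto
      ultimately show False using \<C>(3) unfolding pairwise_def disjnt_def by blast
    qed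
  qed
  have Bb: "B i \<in> sets lborel" for i using single[of i] by auto
  have HB: "hausdorff2_pre \<delta> (emb a b ` B i) \<le> emeasure lborel (B i)" for i
  proof (cases "B i = {}")
    case True then show ?thesis using d by (simp add: hausdorff2_pre_empty)
  next
    case False
    then obtain p where p: "p \<in> \<C>" "B i = ball (fst p) (snd p)" using single by blast
    have r: "0 < snd p" "2 * snd p \<le> \<delta>" using p(1) \<C>(2) by (auto simp: K_def)
    have dm: "bounded (emb a b ` B i) \<and> diameter (emb a b ` B i) \<le> 2 * snd p"
    proof -
      have "dist x y \<le> 2 * snd p" if "x \<in> emb a b ` B i" "y \<in> emb a b ` B i" for x y
      proof -
        obtain u v where uv: "u \<in> B i" "v \<in> B i" "x = emb a b u" "y = emb a b v" using \<open>x \<in> _\<close> \<open>y \<in> _\<close> by blast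
        have "dist u v \<le> dist (fst p) u + dist (fst p) v" by (rule dist_triangle3)
        then show ?thesis using uv p by (simp add: dist_emb[OF fr])
      qed
      then show ?thesis using r by (auto simp: bounded_two_points dist_norm intro!: diameter_le)
    qed
    have "hausdorff2_pre \<delta> (emb a b ` B i) \<le> ennreal (pi / 4 * (diameter (emb a b ` B i))\<^sup>2)"
      using dm r d by (intro hausdorff2_pre_single) auto
    also have "\<dots> \<le> ennreal (pi / 4 * (2 * snd p)\<^sup>2)"
      using dm by (intro ennreal_leI mult_left_mono power_mono) (auto simp: diameter_ge_0)
    also have "\<dots> = emeasure lborel (B i)"
      using r p by (simp add: emeasure_lborel_ball2 power_mult_distrib)
    finally show ?thesis .
  qed
  \<comment> \<open>Index 0 holds the uncovered null set.\<close>
  define A where "A i = (case i of 0 \<Rightarrow> emb a b ` (?S - (\<Union>i. B i)) | Suc k \<Rightarrow> emb a b ` B k)" for i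
  have "emb a b ` ?S \<subseteq> (\<Union>i. A i)"
  proof
    fix x assume "x \<in> emb a b ` ?S"
    then obtain z where z: "z \<in> ?S" "x = emb a b z" by auto
    show "x \<in> (\<Union>i. A i)"
    proof (cases "z \<in> (\<Union>i. B i)")
      case True
      then obtain k where "z \<in> B k" by auto
      then have "x \<in> A (Suc k)" using z by (auto simp: A_def)
      then show ?thesis by blast
    next
      case False
      then have "x \<in> A 0" using z by (auto simp: A_def)
      then show ?thesis by blast
    qed
  qed
  then have "hausdorff2_pre \<delta> (emb a b ` ?S) \<le> hausdorff2_pre \<delta> (\<Union>i. A i)" by (rule hausdorff2_pre_mono)
  also have "\<dots> \<le> (\<Sum>i. hausdorff2_pre \<delta> (A i))" by (rule hausdorff2_pre_UN)
  also have "\<dots> = (\<Sum>i. hausdorff2_pre \<delta> (A (i + 1))) + (\<Sum>i<1. hausdorff2_pre \<delta> (A i))"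
    by (rule suminf_offset) simp
  also have "(\<Sum>i<1. hausdorff2_pre \<delta> (A i)) = hausdorff2_pre \<delta> (emb a b ` (?S - (\<Union>i. B i)))"
    by (simp add: A_def)
  also have "\<dots> = 0"
    using hausdorff2_upper[OF d, of "emb a b ` (?S - (\<Union>i. B i))"] planar_null[OF fr \<C>(4)]
    by (simp add: UB)
  also have "(\<Sum>i. hausdorff2_pre \<delta> (A (i + 1))) \<le> (\<Sum>i. emeasure lborel (B i))"
    by (intro suminf_le summableI) (simp add: A_def HB)
  also have "(\<Sum>i. emeasure lborel (B i)) = emeasure lborel (\<Union>i. B i)"
    using Bb disj by (intro suminf_emeasure) auto
  also have "\<dots> \<le> emeasure lborel ?S"
    using \<C>(2) by (intro emeasure_mono) (auto simp: UB K_def)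
  also have "\<dots> = ennreal pi" by (simp add: emeasure_lborel_ball2)
  finally show "hausdorff2_pre \<delta> (emb a b ` ?S) \<le> ennreal pi" by simp
qed

definition planar_const :: real where
  "planar_const = enn2real (hausdorff2 (emb (axis 1 1) (axis 2 1) ` ball 0 1)) / pi"

lemma frame3_std: "frame3 (axis 1 1) (axis 2 1) (axis 3 1)"
  by (simp add: frame3_def cross_basis inner_axis_axis)

lemma hausdorff2_frame_indep:
  assumes fr: "frame3 a b n" "frame3 a' b' n'"
  shows "hausdorff2 (emb a b ` A) = hausdorff2 (emb a' b' ` A)"
proof -
  have "emb a' b' ` A = (\<lambda>x. emb a' b' (prj a b x)) ` (emb a b ` A)"
    by (simp add: image_image prj_emb[OF fr(1)])
  also have "hausdorff2 \<dots> = hausdorff2 (emb a b ` A)"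
    by (rule hausdorff2_isometry) (auto simp: prj_emb[OF fr(1)] dist_emb[OF fr(1)] dist_emb[OF fr(2)])
  finally show ?thesis ..
qed

text \<open>The Vitali covering gives the upper bound 1, the projection of covers gives positivity.
  Independence of the frame lets one constant, computed in the coordinate plane, serve all
  planes.\<close>

lemma planar_const: "0 < planar_const" "planar_const \<le> 1"
  and hausdorff2_planar: "frame3 a b n \<Longrightarrow> A \<in> sets borel \<Longrightarrow>
    hausdorff2 (emb a b ` A) = ennreal planar_const * emeasure lborel A"
proof -
  let ?H = "hausdorff2 (emb (axis 1 1) (axis 2 1) ` ball 0 1)"
  have up: "?H \<le> ennreal pi" by (rule planar_ball_upper[OF frame3_std])
  have lo: "ennreal pi \<le> 4 * ?H" by (rule planar_ball_lower[OF frame3_std])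
  obtain h where h: "?H = ennreal h" "0 \<le> h" using up by (cases ?H) (auto simp: top_unique)
  have "h \<le> pi" using up h by simp
  moreover have "h > 0"
  proof (rule ccontr)
    assume "\<not> h > 0" then have "h = 0" using h by simp
    then show False using lo h by simp
  qed
  ultimately show c: "0 < planar_const" "planar_const \<le> 1" using h by (auto simp: planar_const_def)
  have H: "?H = ennreal planar_const * ennreal pi"
    using h by (simp add: planar_const_def ennreal_mult'[symmetric])
  show "hausdorff2 (emb a b ` A) = ennreal planar_const * emeasure lborel A"
    if fr: "frame3 a b n" and A: "A \<in> sets borel" for a b n A
  proof -
    have "hausdorff2 (emb a b ` A) * ennreal pi = emeasure lborel A * ?H"
      using planar_unique[OF fr A] hausdorff2_frame_indep[OF fr frame3_std] by simp
    also have "\<dots> = (ennreal planar_const * emeasure lborel A) * ennreal pi"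
      unfolding H by (simp add: mult_ac)
    finally show ?thesis using pi_gt_zero by (auto simp: mult_right_ennreal_cancel)
  qed
qed

subsection \<open>Exit times in convex domains\<close>

text \<open>The element 0 gives the supremum a value when the ray misses the domain. The condition
  on \<open>norm w\<close> sits inside the set so that every other direction has time 0: the
  supremum is then over a bounded set for all arguments, and the function is Borel on the whole
  phase space.\<close>

definition exit_time :: "(real^3) set \<Rightarrow> real^3 \<Rightarrow> real^3 \<Rightarrow> real" where
  "exit_time \<Omega> x w = Sup (insert 0 {s. 0 < s \<and> norm w = 1 \<and> x + s *\<^sub>R w \<in> \<Omega>})"

text \<open>The smooth boundary is represented by a field of supporting directions together with its
  uniqueness \<open>nu_uniq\<close>. In this form the unit ball is an instance too, which later
  yields the mass of the sphere.\<close>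

locale convex_dom =
  fixes \<Omega> :: "(real^3) set" and \<nu> :: "real^3 \<Rightarrow> real^3"
  assumes open_dom: "open \<Omega>" and bounded_dom: "bounded \<Omega>" and convex_dom: "convex \<Omega>"
    and nonempty_dom: "\<Omega> \<noteq> {}"
    and nu_norm: "x \<in> frontier \<Omega> \<Longrightarrow> norm (\<nu> x) = 1"
    and nu_supp: "x \<in> frontier \<Omega> \<Longrightarrow> y \<in> \<Omega> \<Longrightarrow> (y - x) \<bullet> \<nu> x < 0"
    and nu_uniq: "x \<in> frontier \<Omega> \<Longrightarrow> norm n = 1 \<Longrightarrow> (\<And>y. y \<in> \<Omega> \<Longrightarrow> (y - x) \<bullet> n \<le> 0) \<Longrightarrow> n = \<nu> x"
begin

lemma frontier_eq: "frontier \<Omega> = closure \<Omega> - \<Omega>"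
  using open_dom by (simp add: frontier_def interior_open)

lemma nu_supp_closure: "x \<in> frontier \<Omega> \<Longrightarrow> y \<in> closure \<Omega> \<Longrightarrow> (y - x) \<bullet> \<nu> x \<le> 0"
proof -
  assume x: "x \<in> frontier \<Omega>" and y: "y \<in> closure \<Omega>"
  have "closed {y. (y - x) \<bullet> \<nu> x \<le> 0}"
    by (intro closed_Collect_le continuous_intros)
  moreover have "\<Omega> \<subseteq> {y. (y - x) \<bullet> \<nu> x \<le> 0}" using nu_supp[OF x] by (auto intro: less_imp_le)
  ultimately show ?thesis using y closure_minimal by blast
qed

lemma compact_frontier: "compact (frontier \<Omega>)"
  using bounded_dom compact_frontier_bounded by blast

lemma frontier_borel [measurable]: "frontier \<Omega> \<in> sets borel"
  using compact_frontier by (simp add: borel_compact)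

lemma dom_borel [measurable]: "\<Omega> \<in> sets borel"
  using open_dom by simp

text \<open>A limit of supporting directions is a supporting direction, hence equal to
  \<open>\<nu>\<close> at the limit point by uniqueness. The graph is thus closed, and the values
  lie in the compact sphere.\<close>

lemma continuous_nu: "continuous_on (frontier \<Omega>) \<nu>"
proof (rule continuous_from_closed_graph[of "sphere 0 1"])
  show "\<nu> \<in> frontier \<Omega> \<rightarrow> sphere 0 1" using nu_norm by auto
  show "closed ((\<lambda>x. (x, \<nu> x)) ` frontier \<Omega>)"
    unfolding closed_sequential_limits
  proof (intro allI impI, elim conjE)
    fix f :: "nat \<Rightarrow> phase" and l
    assume f: "\<forall>n. f n \<in> (\<lambda>x. (x, \<nu> x)) ` frontier \<Omega>" and lim: "f \<longlonglongrightarrow> l"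
    define X where "X n = fst (f n)" for n
    have X: "X n \<in> frontier \<Omega>" "f n = (X n, \<nu> (X n))" for n
    proof -
      obtain x where "x \<in> frontier \<Omega>" "f n = (x, \<nu> x)" using f by blast
      then show "X n \<in> frontier \<Omega>" "f n = (X n, \<nu> (X n))" by (auto simp: X_def)
    qed
    have l1: "X \<longlonglongrightarrow> fst l" using tendsto_fst[OF lim] by (simp add: X_def[abs_def])
    have l2: "(\<lambda>n. \<nu> (X n)) \<longlonglongrightarrow> snd l" using tendsto_snd[OF lim] by (subst (asm) X(2)) simp
    have fr: "fst l \<in> frontier \<Omega>"
      using closed_sequentially[OF frontier_closed _ l1] X by blast
    have "(\<lambda>n. norm (\<nu> (X n))) \<longlonglongrightarrow> norm (snd l)" by (intro tendsto_norm l2)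
    then have "norm (snd l) = 1" using nu_norm X(1) by (simp add: LIMSEQ_const_iff)
    moreover have "(y - fst l) \<bullet> snd l \<le> 0" if "y \<in> \<Omega>" for y
    proof (rule LIMSEQ_le_const2)
      show "(\<lambda>n. (y - X n) \<bullet> \<nu> (X n)) \<longlonglongrightarrow> (y - fst l) \<bullet> snd l"
        by (intro tendsto_intros l1 l2)
      show "\<exists>N. \<forall>n\<ge>N. (y - X n) \<bullet> \<nu> (X n) \<le> 0"
        using nu_supp[OF X(1) that] by (auto intro: less_imp_le)
    qed
    ultimately have "snd l = \<nu> (fst l)" by (intro nu_uniq fr)
    then have "l = (fst l, \<nu> (fst l))" by (simp add: prod_eq_iff)
    then show "l \<in> (\<lambda>x. (x, \<nu> x)) ` frontier \<Omega>" using fr by blast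
  qed
qed auto

text \<open>The direction field is only controlled on the frontier; \<open>nub\<close> is a Borel version.\<close>
definition nub :: "real^3 \<Rightarrow> real^3" where
  "nub x = (if x \<in> frontier \<Omega> then \<nu> x else 0)"

lemma nub_eq [simp]: "x \<in> frontier \<Omega> \<Longrightarrow> nub x = \<nu> x"
  by (simp add: nub_def)

lemma nub_measurable [measurable]: "nub \<in> borel_measurable borel"
proof -
  have "(\<lambda>x. indicator (frontier \<Omega>) x *\<^sub>R \<nu> x) \<in> borel_measurable borel"
    by (intro borel_measurable_continuous_on_indicator continuous_nu) auto
  moreover have "(\<lambda>x. indicator (frontier \<Omega>) x *\<^sub>R \<nu> x) = nub" by (auto simp: nub_def)
  ultimately show ?thesis by simp
qed

text \<open>The support inequality at \<open>y\<close> bounds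
  \<open>(x - y) \<bullet> \<nu> y\<close> above by 0, and continuity lets \<open>\<nu> x0\<close>
  replace \<open>\<nu> y\<close> at the price of \<open>e\<close>. Exchanging \<open>x\<close> and
  \<open>y\<close> gives the absolute value.\<close>

lemma flat_nhd:
  assumes x0: "x0 \<in> frontier \<Omega>" and e: "0 < e"
  obtains r where "0 < r" "\<And>x. x \<in> frontier \<Omega> \<inter> ball x0 r \<Longrightarrow> norm (\<nu> x - \<nu> x0) \<le> e"
    "\<And>x y. x \<in> frontier \<Omega> \<inter> ball x0 r \<Longrightarrow> y \<in> frontier \<Omega> \<inter> ball x0 r \<Longrightarrow>
       \<bar>(x - y) \<bullet> \<nu> x0\<bar> \<le> e * norm (x - y)"
proof -
  obtain r where r: "0 < r" "\<And>x. x \<in> frontier \<Omega> \<Longrightarrow> dist x x0 < r \<Longrightarrow> dist (\<nu> x) (\<nu> x0) < e"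
    using continuous_nu x0 e unfolding continuous_on_iff by metis
  have nd: "norm (\<nu> x - \<nu> x0) \<le> e" if "x \<in> frontier \<Omega> \<inter> ball x0 r" for x
    using r(2)[of x] that by (auto simp: dist_norm norm_minus_commute intro: less_imp_le)
  have half: "(x - y) \<bullet> \<nu> x0 \<le> e * norm (x - y)"
    if "x \<in> frontier \<Omega> \<inter> ball x0 r" "y \<in> frontier \<Omega> \<inter> ball x0 r" for x y
  proof -
    have "(x - y) \<bullet> \<nu> y \<le> 0" using that by (intro nu_supp_closure) (auto simp: frontier_eq)
    moreover have "(x - y) \<bullet> (\<nu> x0 - \<nu> y) \<le> norm (x - y) * norm (\<nu> x0 - \<nu> y)"
      by (rule norm_cauchy_schwarz)
    moreover have "norm (x - y) * norm (\<nu> x0 - \<nu> y) \<le> norm (x - y) * e"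
      using nd[OF that(2)] by (intro mult_left_mono) (auto simp: norm_minus_commute)
    ultimately show ?thesis by (simp add: inner_diff_right mult.commute)
  qed
  show ?thesis
  proof (rule that[OF r(1) nd])
    fix x y assume xy: "x \<in> frontier \<Omega> \<inter> ball x0 r" "y \<in> frontier \<Omega> \<inter> ball x0 r"
    have "(y - x) \<bullet> \<nu> x0 = - ((x - y) \<bullet> \<nu> x0)" by (simp add: inner_diff_left)
    then show "\<bar>(x - y) \<bullet> \<nu> x0\<bar> \<le> e * norm (x - y)"
      using half[OF xy] half[OF xy(2,1)] by (simp add: norm_minus_commute)
  qed
qed

abbreviation \<tau> :: "real^3 \<Rightarrow> real^3 \<Rightarrow> real" where
  "\<tau> \<equiv> exit_time \<Omega>"

definition rad :: real where
  "rad = (SOME R. 0 < R \<and> (\<forall>x\<in>closure \<Omega>. norm x \<le> R))"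

lemma rad: "0 < rad" "x \<in> closure \<Omega> \<Longrightarrow> norm x \<le> rad"
proof -
  have "\<exists>R. 0 < R \<and> (\<forall>x\<in>closure \<Omega>. norm x \<le> R)"
    using bounded_closure[OF bounded_dom] unfolding bounded_pos .
  from someI_ex[OF this] show "0 < rad" "x \<in> closure \<Omega> \<Longrightarrow> norm x \<le> rad"
    by (auto simp: rad_def)
qed

lemma rad_dom: "x \<in> \<Omega> \<Longrightarrow> norm x \<le> rad"
  using rad(2) closure_subset by blast

lemma exit_set_bound: "norm w = 1 \<Longrightarrow> x + s *\<^sub>R w \<in> \<Omega> \<Longrightarrow> s \<le> norm x + rad"
proof -
  assume w: "norm w = 1" and xs: "x + s *\<^sub>R w \<in> \<Omega>"
  have "\<bar>s\<bar> = norm (s *\<^sub>R w)" using w by simp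
  also have "\<dots> \<le> norm (x + s *\<^sub>R w) + norm x"
    using norm_triangle_ineq4[of "x + s *\<^sub>R w" x] by simp
  finally show ?thesis using rad_dom[OF xs] by simp
qed

lemma exit_bdd: "bdd_above (insert 0 {s. 0 < s \<and> norm w = 1 \<and> x + s *\<^sub>R w \<in> \<Omega>})"
  using exit_set_bound rad(1) by (intro bdd_aboveI[of _ "norm x + rad"]) auto

lemma exit_time_nonneg: "0 \<le> \<tau> x w"
  unfolding exit_time_def by (intro cSup_upper exit_bdd) auto

lemma exit_time_le: "\<tau> x w \<le> norm x + rad"
  unfolding exit_time_def using exit_set_bound rad(1) by (intro cSup_least) auto

lemma exit_time_gr_iff: "0 \<le> s \<Longrightarrow> s < \<tau> x w \<longleftrightarrow> (\<exists>q>s. norm w = 1 \<and> x + q *\<^sub>R w \<in> \<Omega>)"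
  unfolding exit_time_def
  by (subst less_cSup_iff[OF _ exit_bdd]) (auto intro: le_less_trans)

text \<open>For \<open>s \<ge> 0\<close> the set where the time exceeds \<open>s\<close> is the
  closed set of unit directions intersected with a union of open sets, one for each later time
  \<open>q\<close>.\<close>

lemma exit_time_measurable [measurable]: "(\<lambda>p. \<tau> (fst p) (snd p)) \<in> borel_measurable borel"
proof (rule borel_measurableI_greater)
  fix s :: real
  show "{p \<in> space borel. s < \<tau> (fst p) (snd p)} \<in> sets borel"
  proof (cases "s < 0")
    case True
    then have "{p \<in> space borel. s < \<tau> (fst p) (snd p)} = UNIV"
      using less_le_trans[OF True exit_time_nonneg] by auto
    then show ?thesis by simp
  next
    case False
    have "{p \<in> space borel. s < \<tau> (fst p) (snd p)}
       = {p. norm (snd p) = 1} \<inter> (\<Union>q\<in>{s<..}. (\<lambda>p. fst p + q *\<^sub>R snd p) -` \<Omega>)"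
      using False by (auto simp: exit_time_gr_iff)
    moreover have "open (\<Union>q\<in>{s<..}. (\<lambda>p. fst p + q *\<^sub>R snd p) -` \<Omega>)"
      by (intro open_UN ballI open_vimage open_dom continuous_intros)
    moreover have "closed {p::phase. norm (snd p) = 1}"
      by (intro closed_Collect_eq continuous_intros)
    ultimately show ?thesis by auto
  qed
qed

lemma exit_time_measurable' [measurable (raw)]:
  "f \<in> borel_measurable M \<Longrightarrow> g \<in> borel_measurable M \<Longrightarrow> (\<lambda>x. \<tau> (f x) (g x)) \<in> borel_measurable M"
  using measurable_compose[OF borel_measurable_Pair exit_time_measurable, of f M g] by simp

context
  fixes w :: "real^3"
  assumes w: "norm w = 1"
begin

lemma segment_in_dom:
  assumes x: "x \<in> closure \<Omega>" and "0 < r" "r \<le> s" "x + s *\<^sub>R w \<in> \<Omega>"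
  shows "x + r *\<^sub>R w \<in> \<Omega>"
proof (cases "r = s")
  case False
  then have "r < s" using assms by simp
  have "open_segment (x + s *\<^sub>R w) x \<subseteq> \<Omega>"
    using in_interior_closure_convex_segment[OF convex_dom _ x] assms open_dom by (simp add: interior_open)
  moreover have "x + r *\<^sub>R w \<in> open_segment (x + s *\<^sub>R w) x"
    unfolding in_segment
  proof (intro conjI exI[of _ "1 - r/s"])
    show "x + s *\<^sub>R w \<noteq> x" using w \<open>0 < r\<close> \<open>r < s\<close> by auto
    show "0 < 1 - r / s" "1 - r / s < 1" using \<open>0 < r\<close> \<open>r < s\<close> by auto
    have "(1 - (1 - r / s)) *\<^sub>R (x + s *\<^sub>R w) + (1 - r / s) *\<^sub>R x = x + (r / s * s) *\<^sub>R w"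
      by (simp add: algebra_simps)
    then show "x + r *\<^sub>R w = (1 - (1 - r / s)) *\<^sub>R (x + s *\<^sub>R w) + (1 - r / s) *\<^sub>R x"
      using \<open>0 < r\<close> \<open>r < s\<close> by simp
  qed
  ultimately show ?thesis by blast
qed (use assms in auto)

lemma open_forward:
  assumes "x + s *\<^sub>R w \<in> \<Omega>"
  obtains d where "0 < d" "x + (s + d) *\<^sub>R w \<in> \<Omega>" "x + (s - d) *\<^sub>R w \<in> \<Omega>"
proof -
  obtain e where e: "0 < e" "ball (x + s *\<^sub>R w) e \<subseteq> \<Omega>" using open_dom assms open_contains_ball by blast
  have "x + (s + e/2) *\<^sub>R w \<in> ball (x + s *\<^sub>R w) e" "x + (s - e/2) *\<^sub>R w \<in> ball (x + s *\<^sub>R w) e"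
    using e w by (auto simp: dist_norm algebra_simps)
  then show ?thesis using e by (intro that[of "e/2"]) auto
qed

lemma in_dom_iff:
  assumes x: "x \<in> closure \<Omega>" and s: "0 < s"
  shows "x + s *\<^sub>R w \<in> \<Omega> \<longleftrightarrow> s < \<tau> x w"
proof
  assume "x + s *\<^sub>R w \<in> \<Omega>"
  then obtain d where "0 < d" "x + (s + d) *\<^sub>R w \<in> \<Omega>" by (rule open_forward)
  then show "s < \<tau> x w" using s w by (subst exit_time_gr_iff) (auto intro!: exI[of _ "s + d"])
next
  assume "s < \<tau> x w"
  then obtain q where "q > s" "x + q *\<^sub>R w \<in> \<Omega>" using s by (subst (asm) exit_time_gr_iff) auto
  then show "x + s *\<^sub>R w \<in> \<Omega>" using segment_in_dom[OF x s, of q] by simp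
qed

lemma exit_time_pos_dom: "x \<in> \<Omega> \<Longrightarrow> 0 < \<tau> x w"
  using open_forward[of x 0] w by (subst exit_time_gr_iff) auto

text \<open>If the ray missed the domain, a hyperplane would separate the two convex sets. It passes
  through \<open>x\<close>, so its normal is \<open>\<nu> x\<close> by uniqueness, and the ray lies
  on its outer side, against \<open>w \<bullet> \<nu> x < 0\<close>.\<close>

lemma exit_time_pos_entry:
  assumes x: "x \<in> frontier \<Omega>" and wn: "w \<bullet> \<nu> x < 0"
  shows "0 < \<tau> x w"
proof (rule ccontr)
  assume "\<not> 0 < \<tau> x w"
  then have no: "x + q *\<^sub>R w \<notin> \<Omega>" if "q > 0" for q
    using that w by (subst (asm) exit_time_gr_iff) auto
  define R where "R = (\<lambda>q. x + q *\<^sub>R w) ` {0..}"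
  have "\<Omega> \<inter> R = {}"
    using no x frontier_eq by (fastforce simp: R_def order_le_less)
  moreover have "convex R"
  proof -
    have "R = (+) x ` ((\<lambda>q. q *\<^sub>R w) ` {0..})" by (auto simp: R_def image_image)
    moreover have "convex ((\<lambda>q. q *\<^sub>R w) ` {0::real..})"
      by (intro convex_linear_image linearI) (auto simp: algebra_simps)
    ultimately show ?thesis by (simp add: convex_translation)
  qed
  ultimately obtain n b where n: "n \<noteq> 0" "\<forall>x\<in>\<Omega>. n \<bullet> x \<le> b" "\<forall>x\<in>R. n \<bullet> x \<ge> b"
    using separating_hyperplane_sets[OF convex_dom _ nonempty_dom, of R] by (auto simp: R_def)
  have "\<Omega> \<subseteq> {x. n \<bullet> x \<le> b}" using n by auto
  then have "x \<in> {x. n \<bullet> x \<le> b}"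
    using closure_minimal[of \<Omega> "{x. n \<bullet> x \<le> b}"] closed_halfspace_le[of n b] x frontier_eq by blast
  moreover have "x \<in> R" by (auto simp: R_def intro!: image_eqI[of _ _ 0])
  ultimately have nb: "n \<bullet> x = b" using n(3) by force
  have "(1 / norm n) *\<^sub>R n = \<nu> x"
  proof (rule nu_uniq[OF x])
    show "norm ((1 / norm n) *\<^sub>R n) = 1" using n by simp
    fix y assume "y \<in> \<Omega>"
    then have "(y - x) \<bullet> n \<le> 0" using n(2) nb by (simp add: inner_diff_left inner_commute[of n])
    then show "(y - x) \<bullet> ((1 / norm n) *\<^sub>R n) \<le> 0" by (simp add: divide_le_0_iff)
  qed
  moreover have "x + 1 *\<^sub>R w \<in> R" by (auto simp: R_def intro!: image_eqI[of _ _ 1])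
  then have "n \<bullet> w \<ge> 0" using n(3) nb by (force simp: inner_add_right)
  ultimately have "w \<bullet> \<nu> x \<ge> 0" by (metis inner_commute inner_scaleR_right divide_nonneg_nonneg mult_nonneg_nonneg norm_ge_zero zero_le_one)
  then show False using wn by simp
qed

lemma exit_point:
  assumes x: "x \<in> closure \<Omega>" and pos: "0 < \<tau> x w"
  shows "x + \<tau> x w *\<^sub>R w \<in> frontier \<Omega>" "0 < w \<bullet> \<nu> (x + \<tau> x w *\<^sub>R w)"
proof -
  let ?z = "x + \<tau> x w *\<^sub>R w"
  have "?z \<notin> \<Omega>" using in_dom_iff[OF x pos] by simp
  moreover have "?z \<in> closure \<Omega>"
  proof -
    have "(\<lambda>n. 1 / real (Suc n)) \<longlonglongrightarrow> 0"
      using LIMSEQ_inverse_real_of_nat by (simp add: inverse_eq_divide)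
    from LIMSEQ_Suc[OF this] have l0: "(\<lambda>n. 1 / real (Suc (Suc n))) \<longlonglongrightarrow> 0" .
    have l: "(\<lambda>n. x + (\<tau> x w * (1 - 1 / real (Suc (Suc n)))) *\<^sub>R w) \<longlonglongrightarrow> x + (\<tau> x w * (1 - 0)) *\<^sub>R w"
      by (intro tendsto_intros l0)
    have "x + (\<tau> x w * (1 - 1 / real (Suc (Suc n)))) *\<^sub>R w \<in> \<Omega>" for n
    proof -
      define q where "q = 1 / real (Suc (Suc n))"
      have "q < 1" "0 < q" by (simp_all add: q_def)
      then have "0 < \<tau> x w * (1 - q)" "\<tau> x w * (1 - q) < \<tau> x w"
        using pos by (auto simp: algebra_simps)
      then show ?thesis unfolding q_def using in_dom_iff[OF x] by blast
    qed
    then show ?thesis using l unfolding closure_sequential by (auto intro!: exI)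
  qed
  ultimately show fr: "?z \<in> frontier \<Omega>" using frontier_eq by blast
  have "x + (\<tau> x w / 2) *\<^sub>R w \<in> \<Omega>" using in_dom_iff[OF x, of "\<tau> x w / 2"] pos by simp
  \<comment> \<open>The midpoint of the segment is an interior point that is seen from the exit
    point in direction \<open>- w\<close>.\<close>
  from nu_supp[OF fr this] have "(- (\<tau> x w / 2)) * (w \<bullet> \<nu> ?z) < 0"
    by (simp add: algebra_simps inner_diff_left)
  then show "0 < w \<bullet> \<nu> ?z" using pos by (simp add: zero_less_mult_iff)
qed

text \<open>Looking back from a point of the chord, the domain is met exactly until the entry point
  \<open>y\<close>: behind \<open>y\<close> the support inequality excludes further points. The
  bound \<open>s \<le> \<tau> y w\<close> includes the exit point, where the outgoing trace is read
  off.\<close>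

lemma back_time:
  assumes y: "y \<in> frontier \<Omega>" and wn: "w \<bullet> \<nu> y < 0" and s: "0 < s" "s \<le> \<tau> y w"
  shows "\<tau> (y + s *\<^sub>R w) (- w) = s"
proof -
  have yc: "y \<in> closure \<Omega>" "y \<notin> \<Omega>" using y frontier_eq by auto
  have "{r. 0 < r \<and> norm (- w) = 1 \<and> y + s *\<^sub>R w + r *\<^sub>R (- w) \<in> \<Omega>} = {0<..<s}"
  proof (intro set_eqI iffI)
    fix r assume "r \<in> {0<..<s}"
    then have "y + (s - r) *\<^sub>R w \<in> \<Omega>" using in_dom_iff[OF yc(1), of "s - r"] s by auto
    then show "r \<in> {r. 0 < r \<and> norm (- w) = 1 \<and> y + s *\<^sub>R w + r *\<^sub>R (- w) \<in> \<Omega>}"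
      using \<open>r \<in> _\<close> w by (simp add: algebra_simps)
  next
    fix r assume "r \<in> {r. 0 < r \<and> norm (- w) = 1 \<and> y + s *\<^sub>R w + r *\<^sub>R (- w) \<in> \<Omega>}"
    then have r: "0 < r" "y + (s - r) *\<^sub>R w \<in> \<Omega>" by (auto simp: algebra_simps)
    have "((s - r) *\<^sub>R w) \<bullet> \<nu> y < 0" using nu_supp[OF y r(2)] by simp
    then have "0 < s - r" using wn by (simp add: mult_less_0_iff)
    then show "r \<in> {0<..<s}" using r by simp
  qed
  moreover have "insert 0 {0<..<s} = {0..<s}" using s by auto
  ultimately show ?thesis using s by (simp add: exit_time_def)
qed

lemma exit_time_shift:
  assumes y: "y \<in> closure \<Omega>" and s: "0 < s" "s < \<tau> y w"
  shows "\<tau> (y + s *\<^sub>R w) w = \<tau> y w - s"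
proof -
  have ys: "y + s *\<^sub>R w \<in> \<Omega>" using in_dom_iff[OF y] s by simp
  have "{r. 0 < r \<and> norm w = 1 \<and> y + s *\<^sub>R w + r *\<^sub>R w \<in> \<Omega>} = {0<..<\<tau> y w - s}"
    using in_dom_iff[OF y, of "s + _"] s w by (auto simp: algebra_simps)
  moreover have "insert 0 {0<..<\<tau> y w - s} = {0..<\<tau> y w - s}" using s by auto
  ultimately show ?thesis using s by (simp add: exit_time_def)
qed

end

end

section \<open>Instances: the unit ball and convex domains with \<open>C3_boundary\<close>\<close>

lemma convex_dom_ball: "convex_dom (ball 0 1) (\<lambda>x. x)"
proof
  fix x y :: "real^3" assume x: "x \<in> frontier (ball 0 1)"
  then have nx: "norm x = 1" by (simp add: frontier_ball)
  then show "norm x = 1" .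
  { assume y: "y \<in> ball 0 1"
    have "y \<bullet> x \<le> norm y * norm x" by (rule norm_cauchy_schwarz)
    then show "(y - x) \<bullet> x < 0"
      using y nx by (simp add: inner_diff_left dot_square_norm) }
  { fix n :: "real^3" assume n: "norm n = 1" and le: "\<And>y. y \<in> ball 0 1 \<Longrightarrow> (y - x) \<bullet> n \<le> 0"
    have "t \<le> x \<bullet> n" if "t < 1" "0 < t" for t
    proof -
      have "(t *\<^sub>R n - x) \<bullet> n \<le> 0" using that n by (intro le) auto
      then show ?thesis using n by (simp add: inner_diff_left dot_square_norm)
    qed
    then have "1 \<le> x \<bullet> n"
      using dense_le_bounded[of 0 1 "x \<bullet> n"] by auto
    moreover have "(norm (x - n))\<^sup>2 = 2 * (1 - x \<bullet> n)"
      using nx n by (simp add: dot_norm_neg field_simps)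
    ultimately have "(norm (x - n))\<^sup>2 \<le> 0" by simp
    then show "n = x" by simp }
qed auto

lemma ck3_has_derivative: "Ck3 3 \<rho> \<Longrightarrow> (\<rho> has_derivative (\<lambda>h. grad3 \<rho> x \<bullet> h)) (at x)"
proof -
  assume "Ck3 3 \<rho>"
  then have "\<rho> differentiable (at x)" by (simp add: numeral_3_eq_3)
  then have d: "(\<rho> has_derivative frechet_derivative \<rho> (at x)) (at x)"
    by (simp add: frechet_derivative_works)
  then have lin: "linear (frechet_derivative \<rho> (at x))" by (rule has_derivative_linear)
  have "frechet_derivative \<rho> (at x) h = grad3 \<rho> x \<bullet> h" for h
  proof -
    have "h = (\<Sum>i\<in>UNIV. h $ i *\<^sub>R axis i 1)"
      using basis_expansion[of h] by (simp add: scalar_mult_eq_scaleR)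
    then have "frechet_derivative \<rho> (at x) h = (\<Sum>i\<in>UNIV. h $ i *\<^sub>R frechet_derivative \<rho> (at x) (axis i 1))"
      by (metis (no_types, lifting) linear_sum[OF lin] linear_cmul[OF lin] sum.cong)
    then show ?thesis by (simp add: grad3_def pderiv3_def inner_vec_def mult.commute)
  qed
  then show ?thesis using d by (metis (no_types, lifting) ext)
qed

text \<open>The defining function vanishes at \<open>x\<close>, so every direction \<open>v\<close>
  along which it decreases enters the domain and satisfies \<open>v \<bullet> n < 0\<close>. Two
  distinct unit vectors cannot be related in this way.\<close>

lemma local_defining_normal:
  assumes om: "open \<Omega>" and x: "x \<in> frontier \<Omega>" and U: "x \<in> U" "local_defining_fun \<Omega> U \<rho>"
    and n: "norm n = 1" "\<And>y. y \<in> \<Omega> \<Longrightarrow> (y - x) \<bullet> n < 0"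
  shows "(1 / norm (grad3 \<rho> x)) *\<^sub>R grad3 \<rho> x = n"
proof -
  let ?g = "grad3 \<rho> x"
  have u: "open U" "Ck3 3 \<rho>" "\<Omega> \<inter> U = {x \<in> U. \<rho> x < 0}" "?g \<noteq> 0"
    using U unfolding local_defining_fun_def by blast+
  have inU: "\<rho> y < 0" if "y \<in> U" "y \<in> \<Omega>" for y using that u(3) by blast
  have inO: "y \<in> \<Omega>" if "y \<in> U" "\<rho> y < 0" for y using that u(3) by blast
  have der: "(\<rho> has_derivative (\<lambda>h. ?g \<bullet> h)) (at x)"
    by (rule ck3_has_derivative[OF u(2)])
  have cont: "continuous_on UNIV \<rho>" using u(2) by (simp add: numeral_3_eq_3)
  have xn: "x \<notin> \<Omega>" "x \<in> closure \<Omega>" using x om by (auto simp: frontier_def interior_open)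
  have "0 \<le> \<rho> x" using xn(1) inO[OF U(1)] by linarith
  have "\<rho> x \<le> 0"
  proof (rule ccontr)
    assume "\<not> \<rho> x \<le> 0"
    then have "open (U \<inter> {y. 0 < \<rho> y})" "x \<in> U \<inter> {y. 0 < \<rho> y}"
      using u(1) cont U(1) by (auto intro!: open_Int open_Collect_less)
    then have "(U \<inter> {y. 0 < \<rho> y}) \<inter> \<Omega> \<noteq> {}"
      using xn(2) open_Int_closure_eq_empty[of "U \<inter> {y. 0 < \<rho> y}" \<Omega>] by blast
    then obtain y where "y \<in> U" "0 < \<rho> y" "y \<in> \<Omega>" by blast
    then show False using inU[of y] by linarith
  qed
  then have r0: "\<rho> x = 0" using \<open>0 \<le> \<rho> x\<close> by simp
  have key: "v \<bullet> n < 0" if v: "?g \<bullet> v < 0" for v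
  proof -
    have h: "((\<lambda>t. \<rho> (x + t *\<^sub>R v)) has_derivative (\<lambda>t. ?g \<bullet> (t *\<^sub>R v))) (at 0)"
    proof -
      have 1: "((\<lambda>t. x + t *\<^sub>R v) has_derivative (\<lambda>t. t *\<^sub>R v)) (at 0)"
        by (auto intro!: derivative_eq_intros)
      have 2: "(\<rho> has_derivative (\<lambda>h. ?g \<bullet> h)) (at (x + 0 *\<^sub>R v))"
        using der by simp
      show ?thesis using has_derivative_compose[OF 1 2] .
    qed
    then have "((\<lambda>t. \<rho> (x + t *\<^sub>R v)) has_real_derivative (?g \<bullet> v)) (at 0)"
      by (simp add: has_field_derivative_def mult_commute_abs)
    from DERIV_neg_dec_right[OF this v]
    obtain d where d: "d > 0" "\<And>h. 0 < h \<Longrightarrow> h < d \<Longrightarrow> \<rho> (x + h *\<^sub>R v) < \<rho> (x + 0 *\<^sub>R v)"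
      by auto
    have "isCont (\<lambda>t. x + t *\<^sub>R v) 0" by (intro continuous_intros)
    then have "\<forall>\<^sub>F t in at 0. x + t *\<^sub>R v \<in> U"
      using u(1) U(1) by (intro topological_tendstoD[where l = x]) (auto simp: isCont_def)
    then obtain e where e: "e > 0" "\<And>t. t \<noteq> 0 \<Longrightarrow> \<bar>t\<bar> < e \<Longrightarrow> x + t *\<^sub>R v \<in> U"
      by (auto simp: eventually_at)
    define t where "t = min d e / 2"
    have t: "0 < t" "t < d" "t < e" using d e by (auto simp: t_def)
    then have "x + t *\<^sub>R v \<in> \<Omega>" using d(2)[of t] e(2)[of t] r0 by (intro inO) auto
    from n(2)[OF this] t show ?thesis by (simp add: mult_less_0_iff)
  qed
  define m where "m = (1 / norm ?g) *\<^sub>R ?g"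
  have m: "norm m = 1" "?g = norm ?g *\<^sub>R m" using u(4) by (auto simp: m_def)
  have "n = m"
  proof (rule ccontr)
    assume "n \<noteq> m"
    then have "0 < (norm (n - m))\<^sup>2" by simp
    also have "(norm (n - m))\<^sup>2 = 2 * (1 - m \<bullet> n)"
      using m(1) n(1) by (simp add: dot_norm_neg norm_minus_commute[of n m] field_simps)
    finally have mn: "m \<bullet> n < 1" by simp
    \<comment> \<open>The direction \<open>n - m\<close> points inwards as seen from
      \<open>m\<close>, but outwards as seen from \<open>n\<close>.\<close>
    have "m \<bullet> (n - m) < 0" using mn m(1) by (simp add: inner_diff_right dot_square_norm)
    then have "?g \<bullet> (n - m) < 0"
      using u(4) by (subst m(2)) (simp add: mult_less_0_iff)
    from key[OF this] show False using mn n(1) by (simp add: inner_diff_left dot_square_norm)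
  qed
  then show ?thesis by (simp add: m_def)
qed

text \<open>Whatever defining function the choice operator picks, its normalised gradient is the
  supporting direction. The same argument, applied to any competing direction, gives
  uniqueness.\<close>

lemma convex_dom_outward_normal:
  assumes "open \<Omega>" "\<Omega> \<noteq> {}" "bounded \<Omega>" "convex \<Omega>" "C3_boundary \<Omega>"
  shows "convex_dom \<Omega> (outward_normal \<Omega>)"
proof -
  have supp: "\<exists>n. norm n = 1 \<and> (\<forall>y\<in>\<Omega>. (y - x) \<bullet> n < 0)" if x: "x \<in> frontier \<Omega>" for x
  proof -
    have "x \<notin> \<Omega>" using x assms(1) by (simp add: frontier_def interior_open)
    then obtain a b where a: "a \<noteq> 0" "\<forall>y\<in>\<Omega>. a \<bullet> y \<le> b" "\<forall>y\<in>{x}. b \<le> a \<bullet> y"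
      using separating_hyperplane_sets[OF assms(4), of "{x}"] assms(2) by auto
    have le: "(y - x) \<bullet> a \<le> 0" if "y \<in> \<Omega>" for y
      using a(3) bspec[OF a(2) that] by (simp add: inner_diff_left inner_commute[of a])
    have lt: "(y - x) \<bullet> a < 0" if y: "y \<in> \<Omega>" for y
    proof -
      obtain e where e: "0 < e" "ball y e \<subseteq> \<Omega>" using assms(1) y open_contains_ball by blast
      \<comment> \<open>An open set has room to move \<open>y\<close> towards \<open>a\<close>; this
        makes the separating inequality strict.\<close>
      define y' where "y' = y + (e / (2 * norm a)) *\<^sub>R a"
      have "y' \<in> ball y e" using e a by (auto simp: y'_def dist_norm)
      then have "(y' - x) \<bullet> a \<le> 0" using le e by blast
      then have "(y - x) \<bullet> a + (e / (2 * norm a)) * (a \<bullet> a) \<le> 0"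
        by (simp add: y'_def inner_add_left inner_diff_left algebra_simps)
      moreover have "0 < (e / (2 * norm a)) * (a \<bullet> a)" using e a by simp
      ultimately show ?thesis by linarith
    qed
    show ?thesis
      using a lt by (intro exI[of _ "(1 / norm a) *\<^sub>R a"]) (auto simp: divide_less_0_iff)
  qed
  have normal: "outward_normal \<Omega> x = n"
    if x: "x \<in> frontier \<Omega>" and n: "norm n = 1" "\<And>y. y \<in> \<Omega> \<Longrightarrow> (y - x) \<bullet> n < 0" for x n
  proof -
    let ?P = "\<lambda>n. \<exists>U \<rho>. x \<in> U \<and> local_defining_fun \<Omega> U \<rho> \<and> n = (1 / norm (grad3 \<rho> x)) *\<^sub>R grad3 \<rho> x"
    have "\<exists>n. ?P n" using assms(5) x unfolding C3_boundary_def by blast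
    then have "?P (outward_normal \<Omega> x)" unfolding outward_normal_def by (rule someI_ex)
    then show ?thesis using local_defining_normal[OF assms(1) x _ _ n] by metis
  qed
  show ?thesis
  proof
    fix x y n assume x: "x \<in> frontier \<Omega>"
    obtain m where m: "norm m = 1" "\<And>y. y \<in> \<Omega> \<Longrightarrow> (y - x) \<bullet> m < 0" using supp[OF x] by blast
    have eq: "outward_normal \<Omega> x = m" using normal[OF x] m by blast
    show "norm (outward_normal \<Omega> x) = 1" using m eq by simp
    show "y \<in> \<Omega> \<Longrightarrow> (y - x) \<bullet> outward_normal \<Omega> x < 0" using m eq by simp
    assume n: "norm n = 1" and le: "\<And>y. y \<in> \<Omega> \<Longrightarrow> (y - x) \<bullet> n \<le> 0"
    have "(y - x) \<bullet> n < 0" if y: "y \<in> \<Omega>" for y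
    proof -
      obtain e where e: "0 < e" "ball y e \<subseteq> \<Omega>" using assms(1) y open_contains_ball by blast
      have "y + (e/2) *\<^sub>R n \<in> ball y e" using e n by (auto simp: dist_norm)
      then have "(y + (e/2) *\<^sub>R n - x) \<bullet> n \<le> 0" using le e by blast
      then have "(y - x) \<bullet> n + (e/2) * (n \<bullet> n) \<le> 0"
        by (simp add: inner_add_left inner_diff_left algebra_simps)
      then show ?thesis using e n by (simp add: dot_square_norm)
    qed
    then show "n = outward_normal \<Omega> x" using normal[OF x n] by simp
  qed (use assms in auto)
qed

subsection \<open>The area formula on the boundary\<close>

lemma emeasure_linear_image2:
  fixes L :: "real^2 \<Rightarrow> real^2"
  assumes L: "linear L" and B: "B \<in> sets borel" "bounded B" and LB: "L ` B \<in> sets borel"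
  shows "emeasure lborel (L ` B) = ennreal \<bar>det (matrix L)\<bar> * emeasure lborel B"
proof -
  have Bm: "B \<in> lmeasurable"
    using B by (intro bounded_set_imp_lmeasurable) (auto intro: sets_completionI_sets)
  have "emeasure lborel (L ` B) = emeasure lebesgue (L ` B)" using LB by simp
  also have "\<dots> = ennreal (measure lebesgue (L ` B))"
    using measurable_linear_image[OF L Bm] by (simp add: emeasure_eq_measure2)
  also have "\<dots> = ennreal (\<bar>det (matrix L)\<bar> * measure lebesgue B)"
    using measure_linear_image[OF L Bm] by simp
  also have "\<dots> = ennreal \<bar>det (matrix L)\<bar> * ennreal (measure lebesgue B)"
    by (rule ennreal_mult) auto
  also have "ennreal (measure lebesgue B) = emeasure lebesgue B"
    using Bm by (simp add: emeasure_eq_measure2)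
  also have "\<dots> = emeasure lborel B" using B by simp
  finally show ?thesis .
qed

lemma cross_dot_cross: "cross3 a' b' \<bullet> cross3 a b = (a' \<bullet> a) * (b' \<bullet> b) - (b' \<bullet> a) * (a' \<bullet> b)"
  by (simp add: cross3_simps)

text \<open>Binet-Cauchy: the determinant is the inner product of the two cross products, that is,
  the cosine of the angle between the planes. It is the Jacobian of the area formula.\<close>

lemma det_prj_emb:
  assumes "frame3 a b n" "frame3 a' b' n'"
  shows "det (matrix (\<lambda>z. prj a b (emb a' b' z))) = n' \<bullet> n"
proof -
  have e: "emb a' b' (axis 1 1) = a'" "emb a' b' (axis 2 1) = b'"
    by (auto simp: emb_def axis_def)
  have "det (matrix (\<lambda>z. prj a b (emb a' b' z))) = (a' \<bullet> a) * (b' \<bullet> b) - (b' \<bullet> a) * (a' \<bullet> b)"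
    by (simp add: det_2 matrix_def e)
  then show ?thesis
    using cross_dot_cross[of a' b' a b] frame3_props(13)[OF assms(1)] frame3_props(13)[OF assms(2)] by simp
qed

context convex_dom
begin

definition inflow :: "real^3 \<Rightarrow> (real^3) set" where
  "inflow w = {y \<in> frontier \<Omega>. w \<bullet> \<nu> y < 0}"

lemma inflow_alt: "inflow w = frontier \<Omega> \<inter> {y. w \<bullet> nub y < 0}"
  by (auto simp: inflow_def)

lemma inflow_borel [measurable]: "inflow w \<in> sets borel"
proof -
  have "{y. w \<bullet> nub y < 0} \<in> sets borel" by measurable
  then show ?thesis unfolding inflow_alt by (intro sets.Int frontier_borel)
qed

lemma inflow_frontier: "y \<in> inflow w \<Longrightarrow> y \<in> frontier \<Omega>" "y \<in> inflow w \<Longrightarrow> y \<in> closure \<Omega>"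
  by (auto simp: inflow_def frontier_eq)

lemma exit_time_pos_inflow: "norm w = 1 \<Longrightarrow> y \<in> inflow w \<Longrightarrow> 0 < \<tau> y w"
  using exit_time_pos_entry by (auto simp: inflow_def)

definition shadow :: "real^3 \<Rightarrow> real^3 \<Rightarrow> (real^2) set" where
  "shadow a b = prj a b ` \<Omega>"

text \<open>Over the shadow this is the parameter at which the line above \<open>z\<close> enters
  the domain. The value 0 elsewhere is a default that keeps the function Borel.\<close>

definition height :: "real^3 \<Rightarrow> real^3 \<Rightarrow> real^3 \<Rightarrow> real^2 \<Rightarrow> real" where
  "height a b w z = (if z \<in> shadow a b then Inf {s. emb a b z + s *\<^sub>R w \<in> \<Omega>} else 0)"

definition entry :: "real^3 \<Rightarrow> real^3 \<Rightarrow> real^3 \<Rightarrow> real^2 \<Rightarrow> real^3" where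
  "entry a b w z = emb a b z + height a b w z *\<^sub>R w"

context
  fixes a b w :: "real^3"
  assumes fr: "frame3 a b w"
begin

lemma frame_unit: "norm w = 1"
  using frame3_props(10)[OF fr] .

lemma prj_add_dir: "prj a b (x + s *\<^sub>R w) = prj a b x"
  using frame3_props[OF fr] by (simp add: vec2_eq_iff inner_add_left)

lemma shadow_iff: "z \<in> shadow a b \<longleftrightarrow> (\<exists>s. emb a b z + s *\<^sub>R w \<in> \<Omega>)"
proof
  assume "z \<in> shadow a b"
  then obtain x where "x \<in> \<Omega>" "z = prj a b x" by (auto simp: shadow_def)
  then show "\<exists>s. emb a b z + s *\<^sub>R w \<in> \<Omega>"
    by (intro exI[of _ "x \<bullet> w"]) (simp add: emb_prj[OF fr])
next
  assume "\<exists>s. emb a b z + s *\<^sub>R w \<in> \<Omega>"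
  then obtain s where "emb a b z + s *\<^sub>R w \<in> \<Omega>" by blast
  then have "prj a b (emb a b z + s *\<^sub>R w) \<in> shadow a b" by (auto simp: shadow_def)
  then show "z \<in> shadow a b" by (simp add: prj_add_dir prj_emb[OF fr])
qed

lemma open_lines: "open {z. emb a b z + s *\<^sub>R w \<in> \<Omega>}"
proof -
  have "open ((\<lambda>z. emb a b z + s *\<^sub>R w) -` \<Omega>)"
    by (intro open_vimage open_dom continuous_intros)
  then show ?thesis by (simp add: vimage_def)
qed

lemma shadow_borel [measurable]: "shadow a b \<in> sets borel"
proof -
  have "shadow a b = (\<Union>s. {z. emb a b z + s *\<^sub>R w \<in> \<Omega>})" using shadow_iff by auto
  moreover have "open (\<Union>s. {z. emb a b z + s *\<^sub>R w \<in> \<Omega>})" using open_lines by blast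
  ultimately show ?thesis by simp
qed

lemma shadow_finite: "emeasure lborel (shadow a b) < top"
proof -
  have "shadow a b \<subseteq> cball 0 rad"
    using norm_prj_le[OF fr] rad_dom by (force simp: shadow_def intro: order_trans)
  then have "emeasure lborel (shadow a b) \<le> emeasure lborel (cball (0::real^2) rad)"
    by (intro emeasure_mono) auto
  also have "\<dots> < top" using rad(1) by (simp add: emeasure_lborel_cball2)
  finally show ?thesis .
qed

text \<open>An inflow point is the first point of its chord, because the support inequality excludes
  domain points behind it. The shift by \<open>y \<bullet> w\<close> appears because lines are
  parametrised from the plane through 0.\<close>

lemma line_set_inflow:
  assumes y: "y \<in> inflow w"
  shows "{s. emb a b (prj a b y) + s *\<^sub>R w \<in> \<Omega>} = {y \<bullet> w <..< y \<bullet> w + \<tau> y w}"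
proof (intro set_eqI)
  fix s
  have e: "emb a b (prj a b y) + s *\<^sub>R w = y + (s - y \<bullet> w) *\<^sub>R w"
    by (simp add: emb_prj[OF fr] algebra_simps)
  have "y + (s - y \<bullet> w) *\<^sub>R w \<in> \<Omega> \<longleftrightarrow> 0 < s - y \<bullet> w \<and> s - y \<bullet> w < \<tau> y w"
  proof (cases "0 < s - y \<bullet> w")
    case True
    then show ?thesis using in_dom_iff[OF frame_unit inflow_frontier(2)[OF y]] by blast
  next
    case False
    have "y + (s - y \<bullet> w) *\<^sub>R w \<notin> \<Omega>"
    proof
      assume "y + (s - y \<bullet> w) *\<^sub>R w \<in> \<Omega>"
      from nu_supp[OF inflow_frontier(1)[OF y] this]
      have "(s - y \<bullet> w) * (w \<bullet> \<nu> y) < 0" by simp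
      then show False using False y by (simp add: inflow_def mult_less_0_iff)
    qed
    then show ?thesis using False by blast
  qed
  then show "s \<in> {s. emb a b (prj a b y) + s *\<^sub>R w \<in> \<Omega>} \<longleftrightarrow> s \<in> {y \<bullet> w <..< y \<bullet> w + \<tau> y w}"
    unfolding mem_Collect_eq e by auto
qed

lemma prj_inflow_shadow: "y \<in> inflow w \<Longrightarrow> prj a b y \<in> shadow a b"
proof -
  assume y: "y \<in> inflow w"
  have "y \<bullet> w + \<tau> y w / 2 \<in> {s. emb a b (prj a b y) + s *\<^sub>R w \<in> \<Omega>}"
    unfolding line_set_inflow[OF y] using exit_time_pos_inflow[OF frame_unit y] by simp
  then show ?thesis unfolding shadow_iff by blast
qed

lemma entry_prj: "y \<in> inflow w \<Longrightarrow> entry a b w (prj a b y) = y"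
proof -
  assume y: "y \<in> inflow w"
  have "height a b w (prj a b y) = y \<bullet> w"
    using prj_inflow_shadow[OF y] exit_time_pos_inflow[OF frame_unit y]
    by (simp add: height_def line_set_inflow[OF y])
  then show ?thesis by (simp add: entry_def emb_prj[OF fr])
qed

lemma prj_entry: "prj a b (entry a b w z) = z"
  by (simp add: entry_def prj_add_dir prj_emb[OF fr])

lemma entry_inflow: "z \<in> shadow a b \<Longrightarrow> entry a b w z \<in> inflow w"
proof -
  assume "z \<in> shadow a b"
  then obtain x where x: "x \<in> \<Omega>" "z = prj a b x" by (auto simp: shadow_def)
  have xc: "x \<in> closure \<Omega>" using x closure_subset by blast
  have nw: "norm (- w) = 1" using frame_unit by simp
  define y where "y = x + \<tau> x (-w) *\<^sub>R (- w)"
  have "y \<in> frontier \<Omega>" "0 < (- w) \<bullet> \<nu> y"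
    using exit_point[OF nw xc exit_time_pos_dom[OF nw x(1)]] by (auto simp: y_def)
  then have y: "y \<in> inflow w" by (simp add: inflow_def)
  have "prj a b y = z" using prj_add_dir[of x "- \<tau> x (-w)"] x by (simp add: y_def)
  then show ?thesis using entry_prj[OF y] y by simp
qed

lemma height_measurable [measurable]: "height a b w \<in> borel_measurable borel"
proof (rule borel_measurableI_less)
  fix r
  have bdd: "bdd_below {s. emb a b z + s *\<^sub>R w \<in> \<Omega>}" and ne: "{s. emb a b z + s *\<^sub>R w \<in> \<Omega>} \<noteq> {}"
    if z: "z \<in> shadow a b" for z
    using line_set_inflow[OF entry_inflow[OF z]] exit_time_pos_inflow[OF frame_unit entry_inflow[OF z]]
    by (auto simp: prj_entry)
  have "{z \<in> space borel. height a b w z < r}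
     = (\<Union>s\<in>{..<r}. {z. emb a b z + s *\<^sub>R w \<in> \<Omega>}) \<union> (- shadow a b \<inter> {z. 0 < r})"
  proof (intro set_eqI)
    fix z
    show "z \<in> {z \<in> space borel. height a b w z < r} \<longleftrightarrow>
      z \<in> (\<Union>s\<in>{..<r}. {z. emb a b z + s *\<^sub>R w \<in> \<Omega>}) \<union> (- shadow a b \<inter> {z. 0 < r})"
    proof (cases "z \<in> shadow a b")
      case True
      then show ?thesis using cInf_less_iff[OF ne[OF True] bdd[OF True], of r] by (auto simp: height_def)
    next
      case False
      then show ?thesis using shadow_iff by (auto simp: height_def)
    qed
  qed
  moreover have "open (\<Union>s\<in>{..<r}. {z. emb a b z + s *\<^sub>R w \<in> \<Omega>})" using open_lines by blast
  ultimately show "{z \<in> space borel. height a b w z < r} \<in> sets borel" by simp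
qed

lemma entry_measurable [measurable]: "entry a b w \<in> borel_measurable borel"
  unfolding entry_def[abs_def] by measurable

lemma prj_image_eq:
  assumes A: "A \<subseteq> inflow w"
  shows "prj a b ` A = shadow a b \<inter> entry a b w -` A"
proof (intro set_eqI iffI)
  fix z assume "z \<in> prj a b ` A"
  then obtain y where y: "y \<in> A" "z = prj a b y" by blast
  then have "y \<in> inflow w" using A by blast
  then show "z \<in> shadow a b \<inter> entry a b w -` A"
    using prj_inflow_shadow entry_prj y by simp
next
  fix z assume "z \<in> shadow a b \<inter> entry a b w -` A"
  then show "z \<in> prj a b ` A"
    by (intro image_eqI[of z _ "entry a b w z"]) (simp_all add: prj_entry)
qed

lemma prj_image_borel: "A \<in> sets borel \<Longrightarrow> A \<subseteq> inflow w \<Longrightarrow> prj a b ` A \<in> sets borel"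
proof -
  assume [measurable]: "A \<in> sets borel" and "A \<subseteq> inflow w"
  have "entry a b w -` A \<inter> space borel \<in> sets borel"
    using measurable_sets[OF entry_measurable \<open>A \<in> sets borel\<close>] by simp
  then show ?thesis unfolding prj_image_eq[OF \<open>A \<subseteq> _\<close>] by simp
qed

text \<open>Near \<open>y0\<close> the boundary is nearly flat, so sliding it along \<open>w\<close>
  onto the tangent plane changes distances by factors between \<open>1 - t\<close> and
  \<open>1 + t\<close>, and \<open>hausdorff2\<close> by their squares. From the tangent plane to
  the shadow the map is affine with determinant of modulus \<open>\<alpha>\<close>, and the density
  \<open>- (w \<bullet> \<nu>)\<close> differs from \<open>\<alpha>\<close> by at most
  \<open>t * \<alpha>\<close>. These factors combine to the two constants.\<close>

lemma area_local:
  assumes y0: "y0 \<in> inflow w" and t: "0 < t" "t < 1"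
  shows "\<exists>U. open U \<and> y0 \<in> U \<and> (\<forall>A\<in>sets borel. A \<subseteq> inflow w \<inter> U \<longrightarrow>
     (\<integral>\<^sup>+y. indicator A y * ennreal (- (w \<bullet> nub y)) \<partial>hausdorff_measure)
       \<le> ennreal ((1 + t) / (1 - t)\<^sup>2) * (ennreal planar_const * emeasure lborel (prj a b ` A)) \<and>
     ennreal ((1 - t) / (1 + t)\<^sup>2) * (ennreal planar_const * emeasure lborel (prj a b ` A))
       \<le> (\<integral>\<^sup>+y. indicator A y * ennreal (- (w \<bullet> nub y)) \<partial>hausdorff_measure))"
proof -
  define n where "n = \<nu> y0"
  define \<alpha> where "\<alpha> = - (w \<bullet> n)"
  have y0f: "y0 \<in> frontier \<Omega>" and \<alpha>: "0 < \<alpha>" using y0 by (auto simp: inflow_def \<alpha>_def n_def)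
  have nn: "norm n = 1" using nu_norm[OF y0f] by (simp add: n_def)
  obtain a' b' where fr': "frame3 a' b' n" using frame3_exists[OF nn] by blast
  \<comment> \<open>The tolerance \<open>t * \<alpha>\<close> absorbs the division by
    \<open>\<alpha>\<close> in \<open>P\<close>, which is large when \<open>w\<close> is nearly
    tangent.\<close>
  obtain r where r: "0 < r" "\<And>x. x \<in> frontier \<Omega> \<inter> ball y0 r \<Longrightarrow> norm (\<nu> x - n) \<le> t * \<alpha>"
    "\<And>x y. x \<in> frontier \<Omega> \<inter> ball y0 r \<Longrightarrow> y \<in> frontier \<Omega> \<inter> ball y0 r \<Longrightarrow>
       \<bar>(x - y) \<bullet> n\<bar> \<le> (t * \<alpha>) * norm (x - y)"
    by (rule flat_nhd[OF y0f mult_pos_pos[OF t(1) \<alpha>], folded n_def], rule that, assumption+)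
  \<comment> \<open>The oblique projection along \<open>w\<close> onto the tangent plane at
    \<open>y0\<close>.\<close>
  define P where "P v = v + ((v \<bullet> n) / \<alpha>) *\<^sub>R w" for v
  have Pn: "P v \<bullet> n = 0" for v
  proof -
    have wn: "w \<bullet> n = - \<alpha>" by (simp add: \<alpha>_def)
    show ?thesis unfolding P_def inner_add_left inner_scaleR_left wn using \<alpha> by simp
  qed
  have Pd: "P (x - y) = P x - P y" for x y
    by (simp add: P_def inner_diff_left diff_divide_distrib algebra_simps)
  define Q where "Q x = prj a' b' (P (x - y0))" for x
  have embQ: "emb a' b' (Q x) = P (x - y0)" for x
    by (simp add: Q_def emb_prj[OF fr'] Pn)
  have dQ: "dist (emb a' b' (Q x)) (emb a' b' (Q y)) = norm (P (x - y))" for x y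
    unfolding embQ dist_norm Pd[symmetric] by simp
  have P_bounds: "norm (P (x - y)) \<le> (1 + t) * norm (x - y)" "(1 - t) * norm (x - y) \<le> norm (P (x - y))"
    if "x \<in> frontier \<Omega> \<inter> ball y0 r" "y \<in> frontier \<Omega> \<inter> ball y0 r" for x y
  proof -
    have "norm ((((x - y) \<bullet> n) / \<alpha>) *\<^sub>R w) = \<bar>(x - y) \<bullet> n\<bar> / \<alpha>"
      using \<alpha> frame_unit by simp
    also have "\<dots> \<le> t * norm (x - y)"
      using r(3)[OF that] \<alpha> by (simp add: pos_divide_le_eq mult_ac)
    finally have *: "norm ((((x - y) \<bullet> n) / \<alpha>) *\<^sub>R w) \<le> t * norm (x - y)" .
    show "norm (P (x - y)) \<le> (1 + t) * norm (x - y)"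
      using * norm_triangle_ineq[of "x - y" "(((x - y) \<bullet> n) / \<alpha>) *\<^sub>R w"]
      by (simp add: P_def algebra_simps)
    show "(1 - t) * norm (x - y) \<le> norm (P (x - y))"
      using * norm_triangle_ineq2[of "x - y" "- ((((x - y) \<bullet> n) / \<alpha>) *\<^sub>R w)"]
      by (simp add: P_def algebra_simps)
  qed
  define L where "L z = prj a b (emb a' b' z)" for z
  have linL: "linear L"
    using linear_compose[OF linear_emb linear_prj] by (simp add: L_def[abs_def] comp_def)
  have detL: "\<bar>det (matrix L)\<bar> = \<alpha>"
    using det_prj_emb[OF fr fr'] \<alpha> by (simp add: L_def[abs_def] \<alpha>_def inner_commute)
  have "det (matrix L) \<noteq> 0" using detL \<alpha> by auto
  then have injL: "inj L" using det_nz_iff_inj[OF linL] by simp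
  \<comment> \<open>Sliding along \<open>w\<close> does not change the projection along
    \<open>w\<close>, so in the tangent coordinates \<open>Q\<close> the projection to the shadow is
    affine.\<close>
  have prjQ: "prj a b x = prj a b y0 + L (Q x)" for x
  proof -
    have "L (Q x) = prj a b ((x - y0) + (((x - y0) \<bullet> n) / \<alpha>) *\<^sub>R w)"
      unfolding L_def embQ P_def ..
    also have "\<dots> = prj a b (x - y0)" by (rule prj_add_dir)
    also have "\<dots> = prj a b x - prj a b y0" by (rule linear_diff[OF linear_prj])
    finally show ?thesis by simp
  qed
  have contL: "continuous_on UNIV L"
    using linL linear_continuous_on linear_conv_bounded_linear by blast
  show ?thesis
  proof (intro exI[of _ "ball y0 r"] conjI ballI impI)
    fix A assume A: "A \<in> sets borel" and sub: "A \<subseteq> inflow w \<inter> ball y0 r"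
    then have AF: "x \<in> frontier \<Omega> \<inter> ball y0 r" if "x \<in> A" for x
      using that inflow_frontier by blast
    define B where "B = Q ` A"
    have pA: "prj a b ` A \<in> sets borel" using prj_image_borel[OF A] sub by blast
    have pAB: "prj a b ` A = (+) (prj a b y0) ` (L ` B)"
      unfolding B_def image_image by (rule image_cong[OF refl prjQ])
    have Bset: "B = (\<lambda>z. prj a b y0 + L z) -` (prj a b ` A)"
    proof (intro set_eqI iffI)
      fix z assume "z \<in> B"
      then show "z \<in> (\<lambda>z. prj a b y0 + L z) -` (prj a b ` A)" unfolding pAB by blast
    next
      fix z assume "z \<in> (\<lambda>z. prj a b y0 + L z) -` (prj a b ` A)"
      then obtain z' where z': "z' \<in> B" "prj a b y0 + L z = prj a b y0 + L z'" unfolding pAB by blast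
      then have "L z = L z'" by simp
      then show "z \<in> B" using injL z'(1) by (auto dest: injD)
    qed
    have "(\<lambda>z. prj a b y0 + L z) \<in> borel_measurable borel"
      by (intro borel_measurable_continuous_onI continuous_intros contL)
    from measurable_sets[OF this pA] have B: "B \<in> sets borel" using Bset by simp
    have LBset: "L ` B = (\<lambda>z. prj a b y0 + z) -` (prj a b ` A)"
      unfolding pAB by (rule inj_vimage_image_eq[symmetric]) (simp add: inj_on_def)
    have "(\<lambda>z::real^2. prj a b y0 + z) \<in> borel_measurable borel" by measurable
    from measurable_sets[OF this pA] have LB: "L ` B \<in> sets borel" using LBset by simp
    have "bounded B"
    proof -
      have "norm z \<le> (1 + t) * r" if zB: "z \<in> B" for z
      proof -
        obtain x where x: "x \<in> A" "z = Q x" using zB by (auto simp: B_def)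
        have "norm z = norm (P (x - y0))" using norm_emb[OF fr', of z] x embQ by simp
        also have "\<dots> \<le> (1 + t) * norm (x - y0)"
          using P_bounds(1)[of x y0] AF[OF x(1)] y0f r(1) by simp
        also have "\<dots> \<le> (1 + t) * r"
          using AF[OF x(1)] t by (intro mult_left_mono) (auto simp: dist_norm norm_minus_commute)
        finally show ?thesis .
      qed
      then show ?thesis unfolding bounded_iff by blast
    qed
    have area: "emeasure lborel (prj a b ` A) = ennreal \<alpha> * emeasure lborel B"
    proof -
      have "emeasure lborel (prj a b ` A) = emeasure lborel (L ` B)"
      proof -
        have "emeasure lborel (L ` B) = emeasure lborel ((+) (prj a b y0) -` (prj a b ` A) \<inter> space lborel)"
          using LBset by simp
        also have "\<dots> = emeasure (distr lborel borel ((+) (prj a b y0))) (prj a b ` A)"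
          using pA by (subst emeasure_distr) auto
        finally show ?thesis by (simp add: lborel_distr_plus)
      qed
      then show ?thesis using emeasure_linear_image2[OF linL B \<open>bounded B\<close> LB] detL by simp
    qed
    define H where "H = hausdorff2 A"
    define m where "m = ennreal planar_const * emeasure lborel B"
    have HB: "hausdorff2 (emb a' b' ` B) = m"
      unfolding m_def by (rule hausdorff2_planar[OF fr' B])
    have up: "m \<le> ennreal ((1 + t)\<^sup>2) * H"
    proof -
      have "m = hausdorff2 ((\<lambda>x. emb a' b' (Q x)) ` A)" unfolding HB[symmetric] B_def image_image ..
      also have "\<dots> \<le> ennreal ((1 + t)\<^sup>2) * H"
        unfolding H_def using t P_bounds(1) AF
        by (intro hausdorff2_lipschitz_image) (auto simp: dQ, simp add: dist_norm)
      finally show ?thesis .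
    qed
    have lo: "H \<le> ennreal ((1 / (1 - t))\<^sup>2) * m"
    proof -
      let ?f = "\<lambda>x. emb a' b' (Q x)"
      have low: "dist x y \<le> 1 / (1 - t) * dist (?f x) (?f y)" if "x \<in> A" "y \<in> A" for x y
        using P_bounds(2)[OF AF[OF that(1)] AF[OF that(2)]] t unfolding dQ
        by (simp add: dist_norm pos_le_divide_eq mult.commute)
      have "inj_on ?f A"
      proof (rule inj_onI)
        fix x y assume xy: "x \<in> A" "y \<in> A" "?f x = ?f y"
        have "dist x y \<le> 0" using low[OF xy(1,2)] unfolding xy(3) by simp
        then show "x = y" by simp
      qed
      then have inv: "inv_into A ?f (?f x) = x" if "x \<in> A" for x
        using inv_into_f_f[OF \<open>inj_on ?f A\<close> that] by simp
      have "inv_into A ?f ` (?f ` A) = A"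
        using inv by (force simp: image_image)
      then have "H = hausdorff2 (inv_into A ?f ` (?f ` A))"
        by (simp only: H_def)
      also have "\<dots> \<le> ennreal ((1 / (1 - t))\<^sup>2) * hausdorff2 (?f ` A)"
      proof (rule hausdorff2_lipschitz_image)
        fix u v assume "u \<in> ?f ` A" "v \<in> ?f ` A"
        then obtain x y where "x \<in> A" "y \<in> A" "u = ?f x" "v = ?f y" by blast
        then show "dist (inv_into A ?f u) (inv_into A ?f v) \<le> 1 / (1 - t) * dist u v"
          using low[of x y] inv by simp
      qed (use t in simp)
      also have "hausdorff2 (?f ` A) = m" unfolding HB[symmetric] B_def image_image ..
      finally show ?thesis .
    qed
    have wb: "\<alpha> * (1 - t) \<le> - (w \<bullet> nub y)" "- (w \<bullet> nub y) \<le> \<alpha> * (1 + t)" if "y \<in> A" for y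
    proof -
      have yf: "y \<in> frontier \<Omega>" using AF[OF that] by simp
      have "\<bar>w \<bullet> (\<nu> y - n)\<bar> \<le> norm w * norm (\<nu> y - n)" by (rule Cauchy_Schwarz_ineq2)
      also have "\<dots> \<le> t * \<alpha>" using r(2)[OF AF[OF that]] frame_unit by simp
      finally have "\<bar>w \<bullet> \<nu> y + \<alpha>\<bar> \<le> t * \<alpha>" by (simp add: inner_diff_right \<alpha>_def)
      then show "\<alpha> * (1 - t) \<le> - (w \<bullet> nub y)" "- (w \<bullet> nub y) \<le> \<alpha> * (1 + t)"
        using yf by (auto simp: algebra_simps)
    qed
    have IH: "(\<integral>\<^sup>+y. indicator A y * ennreal k \<partial>hausdorff_measure) = ennreal k * H" for k
      using A by (subst nn_integral_multc) (auto simp: emeasure_hausdorff_measure H_def mult.commute)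
    have I_up: "(\<integral>\<^sup>+y. indicator A y * ennreal (- (w \<bullet> nub y)) \<partial>hausdorff_measure) \<le> ennreal (\<alpha> * (1 + t)) * H"
      unfolding IH[symmetric] using wb by (intro nn_integral_mono) (auto simp: indicator_def intro!: ennreal_leI)
    have I_lo: "ennreal (\<alpha> * (1 - t)) * H \<le> (\<integral>\<^sup>+y. indicator A y * ennreal (- (w \<bullet> nub y)) \<partial>hausdorff_measure)"
      unfolding IH[symmetric] using wb by (intro nn_integral_mono) (auto simp: indicator_def intro!: ennreal_leI)
    have M: "ennreal planar_const * emeasure lborel (prj a b ` A) = ennreal \<alpha> * m"
      unfolding area m_def by (simp add: mult_ac)
    show "(\<integral>\<^sup>+y. indicator A y * ennreal (- (w \<bullet> nub y)) \<partial>hausdorff_measure)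
       \<le> ennreal ((1 + t) / (1 - t)\<^sup>2) * (ennreal planar_const * emeasure lborel (prj a b ` A))"
    proof -
      have "ennreal (\<alpha> * (1 + t)) * H \<le> ennreal (\<alpha> * (1 + t)) * (ennreal ((1 / (1 - t))\<^sup>2) * m)"
        by (intro mult_left_mono lo) simp
      also have "\<dots> = ennreal (\<alpha> * (1 + t) * (1 / (1 - t))\<^sup>2) * m"
        using \<alpha> t by (simp add: ennreal_mult mult.assoc)
      also have "\<alpha> * (1 + t) * (1 / (1 - t))\<^sup>2 = ((1 + t) / (1 - t)\<^sup>2) * \<alpha>"
        by (simp add: power_divide)
      also have "ennreal (((1 + t) / (1 - t)\<^sup>2) * \<alpha>) = ennreal ((1 + t) / (1 - t)\<^sup>2) * ennreal \<alpha>"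
        using \<alpha> t by (intro ennreal_mult) auto
      finally show ?thesis using I_up unfolding M by (simp add: mult.assoc)
    qed
    show "ennreal ((1 - t) / (1 + t)\<^sup>2) * (ennreal planar_const * emeasure lborel (prj a b ` A))
       \<le> (\<integral>\<^sup>+y. indicator A y * ennreal (- (w \<bullet> nub y)) \<partial>hausdorff_measure)"
    proof -
      have "ennreal ((1 - t) / (1 + t)\<^sup>2) * (ennreal \<alpha> * m)
          \<le> ennreal ((1 - t) / (1 + t)\<^sup>2) * (ennreal \<alpha> * (ennreal ((1 + t)\<^sup>2) * H))"
        by (intro mult_left_mono up) auto
      also have "\<dots> = (ennreal ((1 - t) / (1 + t)\<^sup>2) * ennreal \<alpha> * ennreal ((1 + t)\<^sup>2)) * H"
        by (simp only: mult.assoc)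
      also have "ennreal ((1 - t) / (1 + t)\<^sup>2) * ennreal \<alpha> * ennreal ((1 + t)\<^sup>2)
          = ennreal ((1 - t) / (1 + t)\<^sup>2 * \<alpha> * (1 + t)\<^sup>2)"
        using \<alpha> ennreal_mult''[of "(1 + t)\<^sup>2" "(1 - t) / (1 + t)\<^sup>2 * \<alpha>"]
          ennreal_mult''[of \<alpha> "(1 - t) / (1 + t)\<^sup>2"] by simp
      also have "(1 - t) / (1 + t)\<^sup>2 * \<alpha> * (1 + t)\<^sup>2 = \<alpha> * (1 - t)"
        using t by simp
      finally show ?thesis using I_lo unfolding M by simp
    qed
  qed (use r(1) in auto)
qed

text \<open>The area formula is stated as equality of two measures on the inflow boundary:
  \<open>area1\<close> carries the shadow to it, \<open>area2\<close> is the flux density on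
  it.\<close>

definition area1 :: "(real^3) measure" where
  "area1 = distr (density lborel (\<lambda>z. ennreal planar_const * indicator (shadow a b) z)) borel (entry a b w)"

definition area2 :: "(real^3) measure" where
  "area2 = density hausdorff_measure (\<lambda>y. indicator (inflow w) y * ennreal (- (w \<bullet> nub y)))"

lemma sets_area [simp, measurable_cong]: "sets area1 = sets borel" "sets area2 = sets borel"
  by (auto simp: area1_def area2_def)

lemma emeasure_area1:
  assumes A: "A \<in> sets borel"
  shows "emeasure area1 A = ennreal planar_const * emeasure lborel (prj a b ` (A \<inter> inflow w))"
proof -
  have eA: "entry a b w -` A \<in> sets borel"
    using measurable_sets[OF entry_measurable A] by simp
  have "emeasure area1 A = emeasure (density lborel (\<lambda>z. ennreal planar_const * indicator (shadow a b) z)) (entry a b w -` A)"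
    unfolding area1_def using A by (subst emeasure_distr) auto
  also have "\<dots> = (\<integral>\<^sup>+z. ennreal planar_const * indicator (shadow a b \<inter> entry a b w -` A) z \<partial>lborel)"
    using eA by (subst emeasure_density) (auto intro!: nn_integral_cong simp: indicator_def)
  also have "\<dots> = ennreal planar_const * emeasure lborel (shadow a b \<inter> entry a b w -` A)"
    using eA by (subst nn_integral_cmult_indicator) auto
  also have "shadow a b \<inter> entry a b w -` A = shadow a b \<inter> entry a b w -` (A \<inter> inflow w)"
    using entry_inflow by auto
  also have "\<dots> = prj a b ` (A \<inter> inflow w)" by (rule prj_image_eq[symmetric]) auto
  finally show ?thesis .
qed

lemma emeasure_area1_finite: "A \<in> sets borel \<Longrightarrow> emeasure area1 A < top"
proof -
  assume A: "A \<in> sets borel"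
  have "emeasure lborel (prj a b ` (A \<inter> inflow w)) \<le> emeasure lborel (shadow a b)"
    using prj_inflow_shadow by (intro emeasure_mono) auto
  then show ?thesis unfolding emeasure_area1[OF A]
    using shadow_finite by (simp add: ennreal_mult_less_top le_less_trans)
qed

lemma emeasure_area2:
  assumes A: "A \<in> sets borel"
  shows "emeasure area2 A = (\<integral>\<^sup>+y. indicator (A \<inter> inflow w) y * ennreal (- (w \<bullet> nub y)) \<partial>hausdorff_measure)"
  unfolding area2_def using A by (subst emeasure_density) (auto intro!: nn_integral_cong simp: indicator_def)

text \<open>Countably many of the local neighbourhoods cover the inflow boundary by Lindelof's
  theorem. Made disjoint, they reduce the inequalities to the local ones, whose constants depend on
  \<open>t\<close> alone.\<close>

lemma area_bounds:
  assumes t: "0 < t" "t < 1" and A: "A \<in> sets borel"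
  shows "emeasure area2 A \<le> ennreal ((1 + t) / (1 - t)\<^sup>2) * emeasure area1 A"
    "ennreal ((1 - t) / (1 + t)\<^sup>2) * emeasure area1 A \<le> emeasure area2 A"
proof -
  define ok where "ok y V \<longleftrightarrow> open V \<and> y \<in> V \<and> (\<forall>A\<in>sets borel. A \<subseteq> inflow w \<inter> V \<longrightarrow>
     (\<integral>\<^sup>+y. indicator A y * ennreal (- (w \<bullet> nub y)) \<partial>hausdorff_measure)
       \<le> ennreal ((1 + t) / (1 - t)\<^sup>2) * (ennreal planar_const * emeasure lborel (prj a b ` A)) \<and>
     ennreal ((1 - t) / (1 + t)\<^sup>2) * (ennreal planar_const * emeasure lborel (prj a b ` A))
       \<le> (\<integral>\<^sup>+y. indicator A y * ennreal (- (w \<bullet> nub y)) \<partial>hausdorff_measure))" for y V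
  have "\<exists>V. ok y V" if "y \<in> inflow w" for y
    unfolding ok_def by (rule area_local[OF that t])
  then obtain U where okU: "\<And>y. y \<in> inflow w \<Longrightarrow> ok y (U y)" by metis
  have Uo: "open (U y)" "y \<in> U y" if "y \<in> inflow w" for y
    using okU[OF that] by (auto simp: ok_def)
  obtain \<F> where \<F>: "\<F> \<subseteq> U ` inflow w" "countable \<F>" "\<Union>\<F> = \<Union>(U ` inflow w)"
    by (rule Lindelof[of "U ` inflow w"]) (use Uo in auto)
  define V where "V n = (if \<F> = {} then {} else from_nat_into \<F> n)" for n
  have V\<F>: "(\<Union>n. V n) = \<Union>\<F>"
    using range_from_nat_into[OF _ \<F>(2)] by (auto simp: V_def)
  have cov: "inflow w \<subseteq> (\<Union>n. V n)" unfolding V\<F> \<F>(3) using Uo by blast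
  have VU: "V n = {} \<or> (\<exists>y\<in>inflow w. V n = U y)" for n
  proof (cases "\<F> = {}")
    case False
    then have "from_nat_into \<F> n \<in> U ` inflow w" using \<F>(1) from_nat_into[OF False] by blast
    then show ?thesis using False by (auto simp: V_def)
  qed (simp add: V_def)
  have Vo: "open (V n)" for n using VU[of n] Uo(1) by auto
  define A' where "A' n = (A \<inter> inflow w) \<inter> disjointed V n" for n
  have A': "A' n \<in> sets borel" for n
    using A Vo by (auto simp: A'_def disjointed_def intro!: sets.Int sets.Diff sets.finite_UN)
  have disj: "disjoint_family A'"
    unfolding A'_def using disjoint_family_disjointed[of V] by (auto simp: disjoint_family_on_def)
  have un: "(\<Union>n. A' n) = A \<inter> inflow w"
    using cov UN_disjointed_eq[of V] by (auto simp: A'_def)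
  have loc: "emeasure area2 (A' n) \<le> ennreal ((1 + t) / (1 - t)\<^sup>2) * emeasure area1 (A' n)"
    "ennreal ((1 - t) / (1 + t)\<^sup>2) * emeasure area1 (A' n) \<le> emeasure area2 (A' n)" for n
  proof -
    have e: "A' n \<inter> inflow w = A' n" by (auto simp: A'_def)
    have "emeasure area2 (A' n) \<le> ennreal ((1 + t) / (1 - t)\<^sup>2) * emeasure area1 (A' n) \<and>
      ennreal ((1 - t) / (1 + t)\<^sup>2) * emeasure area1 (A' n) \<le> emeasure area2 (A' n)"
    proof (cases "V n = {}")
      case True then have "A' n = {}" using disjointed_subset[of V n] by (auto simp: A'_def)
      then show ?thesis by simp
    next
      case False
      then obtain y where y: "y \<in> inflow w" "V n = U y" using VU by blast
      have sub: "A' n \<subseteq> inflow w \<inter> U y" using disjointed_subset[of V n] y by (auto simp: A'_def)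
      show ?thesis
        using okU[OF y(1)] A'[of n] sub
        unfolding ok_def emeasure_area1[OF A'] emeasure_area2[OF A'] e by blast
    qed
    then show "emeasure area2 (A' n) \<le> ennreal ((1 + t) / (1 - t)\<^sup>2) * emeasure area1 (A' n)"
      "ennreal ((1 - t) / (1 + t)\<^sup>2) * emeasure area1 (A' n) \<le> emeasure area2 (A' n)" by auto
  qed
  have AI: "A \<inter> inflow w \<in> sets borel" using A by simp
  have s1: "emeasure area1 A = (\<Sum>n. emeasure area1 (A' n))"
  proof -
    have "emeasure area1 A = emeasure area1 (A \<inter> inflow w)"
      unfolding emeasure_area1[OF A] emeasure_area1[OF AI] by simp
    also have "\<dots> = (\<Sum>n. emeasure area1 (A' n))"
      unfolding un[symmetric] using A' disj by (intro suminf_emeasure[symmetric]) auto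
    finally show ?thesis .
  qed
  have s2: "emeasure area2 A = (\<Sum>n. emeasure area2 (A' n))"
  proof -
    have "emeasure area2 A = emeasure area2 (A \<inter> inflow w)"
      unfolding emeasure_area2[OF A] emeasure_area2[OF AI] by simp
    also have "\<dots> = (\<Sum>n. emeasure area2 (A' n))"
      unfolding un[symmetric] using A' disj by (intro suminf_emeasure[symmetric]) auto
    finally show ?thesis .
  qed
  show "emeasure area2 A \<le> ennreal ((1 + t) / (1 - t)\<^sup>2) * emeasure area1 A"
    unfolding s1 s2 ennreal_suminf_cmult[symmetric] by (intro suminf_le loc summableI)
  show "ennreal ((1 - t) / (1 + t)\<^sup>2) * emeasure area1 A \<le> emeasure area2 A"
    unfolding s1 s2 ennreal_suminf_cmult[symmetric] by (intro suminf_le loc summableI)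
qed

text \<open>The factors in \<open>area_bounds\<close> tend to 1 as \<open>t\<close> tends to 0. The
  shadow is bounded, so all masses are finite and the limit can be taken in the reals.\<close>

lemma area_eq: "area1 = area2"
proof (rule measure_eqI)
  fix A assume "A \<in> sets area1"
  then have A: "A \<in> sets borel" by simp
  obtain m where m: "emeasure area1 A = ennreal m" "0 \<le> m"
    using emeasure_area1_finite[OF A] by (cases "emeasure area1 A") auto
  have "emeasure area2 A \<le> ennreal ((1 + 1/2) / (1 - 1/2)\<^sup>2) * ennreal m"
    using area_bounds(1)[of "1/2" A] A m by simp
  also have "\<dots> < top" by (simp add: ennreal_mult_less_top)
  finally obtain m2 where m2: "emeasure area2 A = ennreal m2" "0 \<le> m2"
    by (cases "emeasure area2 A") auto
  define x where "x n = 1 / real (Suc (Suc n))" for n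
  have x: "0 < x n" "x n < 1" for n by (auto simp: x_def)
  have "(\<lambda>n. 1 / real (Suc n)) \<longlonglongrightarrow> 0"
    using LIMSEQ_inverse_real_of_nat by (simp add: inverse_eq_divide)
  from LIMSEQ_Suc[OF this] have x0: "x \<longlonglongrightarrow> 0" by (simp add: x_def[abs_def])
  have up: "m2 \<le> (1 + x n) / (1 - x n)\<^sup>2 * m" for n
    using area_bounds(1)[OF x A, of n] x[of n] m m2 by (simp add: ennreal_mult'[symmetric])
  have lo: "(1 - x n) / (1 + x n)\<^sup>2 * m \<le> m2" for n
    using area_bounds(2)[OF x A, of n] x[of n] m m2 by (simp add: ennreal_mult'[symmetric])
  have "(\<lambda>n. (1 + x n) / (1 - x n)\<^sup>2 * m) \<longlonglongrightarrow> (1 + 0) / (1 - 0)\<^sup>2 * m"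
    by (intro tendsto_intros x0) auto
  then have "m2 \<le> m" using LIMSEQ_le_const[of _ m m2] up by auto
  have "(\<lambda>n. (1 - x n) / (1 + x n)\<^sup>2 * m) \<longlonglongrightarrow> (1 - 0) / (1 + 0)\<^sup>2 * m"
    by (intro tendsto_intros x0) auto
  then have "m \<le> m2" using LIMSEQ_le_const2[of _ m m2] lo by auto
  with \<open>m2 \<le> m\<close> show "emeasure area1 A = emeasure area2 A" using m m2 by simp
qed simp

lemma area_integral:
  assumes [measurable]: "G \<in> borel_measurable borel"
  shows "ennreal planar_const * (\<integral>\<^sup>+z. indicator (shadow a b) z * G (entry a b w z) \<partial>lborel)
    = (\<integral>\<^sup>+y. indicator (inflow w) y * ennreal (- (w \<bullet> nub y)) * G y \<partial>hausdorff_measure)"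
proof -
  have "(\<integral>\<^sup>+y. G y \<partial>area1) = (\<integral>\<^sup>+z. G (entry a b w z) \<partial>density lborel (\<lambda>z. ennreal planar_const * indicator (shadow a b) z))"
    unfolding area1_def by (subst nn_integral_distr) auto
  also have "\<dots> = (\<integral>\<^sup>+z. ennreal planar_const * indicator (shadow a b) z * G (entry a b w z) \<partial>lborel)"
    by (subst nn_integral_density) auto
  also have "\<dots> = ennreal planar_const * (\<integral>\<^sup>+z. indicator (shadow a b) z * G (entry a b w z) \<partial>lborel)"
    by (subst nn_integral_cmult[symmetric]) (auto simp: mult.assoc)
  finally have 1: "(\<integral>\<^sup>+y. G y \<partial>area1) = \<dots>" .
  have "(\<integral>\<^sup>+y. G y \<partial>area2) = (\<integral>\<^sup>+y. indicator (inflow w) y * ennreal (- (w \<bullet> nub y)) * G y \<partial>hausdorff_measure)"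
    unfolding area2_def by (subst nn_integral_density) auto
  then show ?thesis using 1 area_eq by simp
qed

text \<open>Fubini's theorem over the lines in direction \<open>w\<close>, each parametrised from
  its entry point; the area formula then exchanges shadow points for entry points.\<close>

lemma lines_integral_frame:
  assumes [measurable]: "F \<in> borel_measurable borel"
  shows "ennreal planar_const * (\<integral>\<^sup>+x. indicator \<Omega> x * F x \<partial>lborel)
    = (\<integral>\<^sup>+y. indicator (inflow w) y * ennreal (- (w \<bullet> nub y)) *
         (\<integral>\<^sup>+s. indicator {0<..<\<tau> y w} s * F (y + s *\<^sub>R w) \<partial>lborel) \<partial>hausdorff_measure)"
proof -
  define G where "G y = (\<integral>\<^sup>+s. indicator {0<..<\<tau> y w} s * F (y + s *\<^sub>R w) \<partial>lborel)" for y
  have [measurable]: "(\<lambda>(y, s). indicator {0<..<\<tau> y w} s :: ennreal) \<in> borel_measurable (borel \<Otimes>\<^sub>M borel)"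
    unfolding indicator_def greaterThanLessThan_iff by measurable
  have Gm [measurable]: "G \<in> borel_measurable borel"
    unfolding G_def[abs_def] by measurable
  have "(\<integral>\<^sup>+x. indicator \<Omega> x * F x \<partial>lborel)
    = (\<integral>\<^sup>+z. (\<integral>\<^sup>+s. indicator \<Omega> (emb a b z + s *\<^sub>R w) * F (emb a b z + s *\<^sub>R w) \<partial>lborel) \<partial>lborel)"
    by (rule nn_integral_frame[OF fr]) measurable
  also have "\<dots> = (\<integral>\<^sup>+z. indicator (shadow a b) z * G (entry a b w z) \<partial>lborel)"
  proof (rule nn_integral_cong)
    fix z
    show "(\<integral>\<^sup>+s. indicator \<Omega> (emb a b z + s *\<^sub>R w) * F (emb a b z + s *\<^sub>R w) \<partial>lborel)
       = indicator (shadow a b) z * G (entry a b w z)"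
    proof (cases "z \<in> shadow a b")
      case False
      then show ?thesis using shadow_iff by (auto simp: indicator_def)
    next
      case True
      define y where "y = entry a b w z"
      define h where "h = height a b w z"
      have y: "y \<in> inflow w" using entry_inflow[OF True] by (simp add: y_def)
      have pz: "prj a b y = z" by (simp add: y_def prj_entry)
      have yw: "y \<bullet> w = h"
        using frame3_props[OF fr] emb_inner[OF fr] by (simp add: y_def entry_def h_def inner_add_left)
      have ye: "y + s *\<^sub>R w = emb a b z + (h + s) *\<^sub>R w" for s
        by (simp add: y_def entry_def h_def algebra_simps)
      have mem: "emb a b z + s *\<^sub>R w \<in> \<Omega> \<longleftrightarrow> s \<in> {h<..<h + \<tau> y w}" for s
        using line_set_inflow[OF y] unfolding pz yw by blast
      define f where "f s = indicator \<Omega> (emb a b z + s *\<^sub>R w) * F (emb a b z + s *\<^sub>R w)" for s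
      have [measurable]: "f \<in> borel_measurable borel" unfolding f_def[abs_def] by measurable
      have "(\<integral>\<^sup>+s. f s \<partial>distr lborel borel ((+) h)) = (\<integral>\<^sup>+s. f (h + s) \<partial>lborel)"
        by (rule nn_integral_distr) auto
      then have "(\<integral>\<^sup>+s. f s \<partial>lborel) = (\<integral>\<^sup>+s. f (h + s) \<partial>lborel)"
        by (simp add: lborel_distr_plus)
      also have "\<dots> = G y"
        unfolding G_def ye f_def by (intro nn_integral_cong) (auto simp: indicator_def mem)
      finally show ?thesis using True by (simp add: y_def f_def)
    qed
  qed
  finally show ?thesis
    using area_integral[OF Gm] by (simp add: G_def)
qed

end

lemma lines_integral:
  assumes w: "norm w = 1" and F: "F \<in> borel_measurable borel"
  shows "ennreal planar_const * (\<integral>\<^sup>+x. indicator \<Omega> x * F x \<partial>lborel)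
    = (\<integral>\<^sup>+y. indicator (inflow w) y * ennreal (- (w \<bullet> nub y)) *
         (\<integral>\<^sup>+s. indicator {0<..<\<tau> y w} s * F (y + s *\<^sub>R w) \<partial>lborel) \<partial>hausdorff_measure)"
proof -
  obtain a b where "frame3 a b w" using frame3_exists[OF w] by blast
  from lines_integral_frame[OF this F] show ?thesis .
qed

end

section \<open>Reflection, exit points and finiteness of the boundary measure\<close>

lemma hausdorff_measure_uminus: "distr hausdorff_measure borel uminus = hausdorff_measure"
proof (rule measure_eqI)
  fix A assume "A \<in> sets (distr hausdorff_measure borel uminus)"
  then have A: "A \<in> sets borel" by simp
  have e: "uminus -` A = uminus ` A" by (auto intro: image_eqI[of _ _ "- _"])
  have m: "(uminus :: real^3 \<Rightarrow> real^3) \<in> borel_measurable borel" by measurable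
  have "uminus -` A \<in> sets borel" using measurable_sets[OF m A] by simp
  then have "emeasure (distr hausdorff_measure borel uminus) A = hausdorff2 (uminus ` A)"
    using A e by (subst emeasure_distr) (auto simp: emeasure_hausdorff_measure)
  also have "\<dots> = hausdorff2 A" by (rule hausdorff2_isometry) (simp add: dist_minus)
  finally show "emeasure (distr hausdorff_measure borel uminus) A = emeasure hausdorff_measure A"
    using A by (simp add: emeasure_hausdorff_measure)
qed simp

context convex_dom
begin

text \<open>Both sides are \<open>planar_const\<close> times the volume integral of one function
  that is constant on chords, disintegrated from the entry points along \<open>w\<close> and from
  the exit points along \<open>- w\<close>.\<close>

lemma exit_integral:
  assumes w: "norm w = 1" and [measurable]: "G \<in> borel_measurable borel"
  shows "(\<integral>\<^sup>+y. indicator (inflow (- w)) y * ennreal (w \<bullet> nub y) * G y \<partial>hausdorff_measure)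
    = (\<integral>\<^sup>+y. indicator (inflow w) y * ennreal (- (w \<bullet> nub y)) * G (y + \<tau> y w *\<^sub>R w) \<partial>hausdorff_measure)"
proof -
  \<comment> \<open>The denominator is the length of the chord through \<open>x\<close>, so the
    integral of \<open>F\<close> over a chord is the value of \<open>G\<close> at its exit
    point.\<close>
  define F where "F x = G (x + \<tau> x w *\<^sub>R w) * ennreal (1 / (\<tau> x w + \<tau> x (- w)))" for x
  have Fm: "F \<in> borel_measurable borel" unfolding F_def[abs_def] by measurable
  have nw: "norm (- w) = 1" using w by simp
  have int: "(\<integral>\<^sup>+s. indicator {0<..<T} s * (C * ennreal (1 / T)) \<partial>lborel) = C" if "0 < T" for T C
  proof -
    have "(\<integral>\<^sup>+s. indicator {0<..<T} s * (C * ennreal (1 / T)) \<partial>lborel) = ennreal T * (C * ennreal (1 / T))"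
      using that by (subst nn_integral_multc) auto
    also have "\<dots> = C * (ennreal T * ennreal (1 / T))" by (simp add: mult_ac)
    also have "ennreal T * ennreal (1 / T) = 1" using that by (subst ennreal_mult'[symmetric]) auto
    finally show ?thesis by simp
  qed
  have "(\<integral>\<^sup>+y. indicator (inflow w) y * ennreal (- (w \<bullet> nub y)) * G (y + \<tau> y w *\<^sub>R w) \<partial>hausdorff_measure)
     = (\<integral>\<^sup>+y. indicator (inflow w) y * ennreal (- (w \<bullet> nub y)) *
         (\<integral>\<^sup>+s. indicator {0<..<\<tau> y w} s * F (y + s *\<^sub>R w) \<partial>lborel) \<partial>hausdorff_measure)"
  proof (rule nn_integral_cong)
    fix y
    show "indicator (inflow w) y * ennreal (- (w \<bullet> nub y)) * G (y + \<tau> y w *\<^sub>R w) =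
      indicator (inflow w) y * ennreal (- (w \<bullet> nub y)) * (\<integral>\<^sup>+s. indicator {0<..<\<tau> y w} s * F (y + s *\<^sub>R w) \<partial>lborel)"
    proof (cases "y \<in> inflow w")
      case True
      have pos: "0 < \<tau> y w" using exit_time_pos_inflow[OF w True] .
      have "F (y + s *\<^sub>R w) = G (y + \<tau> y w *\<^sub>R w) * ennreal (1 / \<tau> y w)" if s: "0 < s" "s < \<tau> y w" for s
      proof -
        have "\<tau> (y + s *\<^sub>R w) w = \<tau> y w - s"
          using exit_time_shift[OF w inflow_frontier(2)[OF True] s] .
        moreover have "\<tau> (y + s *\<^sub>R w) (- w) = s"
          using True s by (intro back_time[OF w]) (auto simp: inflow_def)
        moreover have "y + s *\<^sub>R w + (\<tau> y w - s) *\<^sub>R w = y + \<tau> y w *\<^sub>R w"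
          by (simp add: algebra_simps)
        ultimately show ?thesis unfolding F_def by (simp only:) simp
      qed
      then have "(\<integral>\<^sup>+s. indicator {0<..<\<tau> y w} s * F (y + s *\<^sub>R w) \<partial>lborel)
        = (\<integral>\<^sup>+s. indicator {0<..<\<tau> y w} s * (G (y + \<tau> y w *\<^sub>R w) * ennreal (1 / \<tau> y w)) \<partial>lborel)"
        by (intro nn_integral_cong) (auto simp: indicator_def)
      then show ?thesis using int[OF pos] by simp
    qed simp
  qed
  also have "\<dots> = ennreal planar_const * (\<integral>\<^sup>+x. indicator \<Omega> x * F x \<partial>lborel)"
    by (rule lines_integral[OF w Fm, symmetric])
  also have "\<dots> = (\<integral>\<^sup>+y. indicator (inflow (- w)) y * ennreal (- (- w \<bullet> nub y)) *
         (\<integral>\<^sup>+s. indicator {0<..<\<tau> y (- w)} s * F (y + s *\<^sub>R (- w)) \<partial>lborel) \<partial>hausdorff_measure)"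
    by (rule lines_integral[OF nw Fm])
  also have "\<dots> = (\<integral>\<^sup>+y. indicator (inflow (- w)) y * ennreal (w \<bullet> nub y) * G y \<partial>hausdorff_measure)"
  proof (rule nn_integral_cong)
    fix y
    show "indicator (inflow (- w)) y * ennreal (- (- w \<bullet> nub y)) *
         (\<integral>\<^sup>+s. indicator {0<..<\<tau> y (- w)} s * F (y + s *\<^sub>R (- w)) \<partial>lborel)
      = indicator (inflow (- w)) y * ennreal (w \<bullet> nub y) * G y"
    proof (cases "y \<in> inflow (- w)")
      case True
      have pos: "0 < \<tau> y (- w)" using exit_time_pos_inflow[OF nw True] .
      have "F (y + s *\<^sub>R (- w)) = G y * ennreal (1 / \<tau> y (- w))" if s: "0 < s" "s < \<tau> y (- w)" for s
      proof -
        have "\<tau> (y + s *\<^sub>R (- w)) (- w) = \<tau> y (- w) - s"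
          using exit_time_shift[OF nw inflow_frontier(2)[OF True] s] .
        moreover have "\<tau> (y + s *\<^sub>R (- w)) (- (- w)) = s"
          using True s by (intro back_time[OF nw]) (auto simp: inflow_def)
        ultimately show ?thesis by (simp add: F_def)
      qed
      then have "(\<integral>\<^sup>+s. indicator {0<..<\<tau> y (- w)} s * F (y + s *\<^sub>R (- w)) \<partial>lborel)
        = (\<integral>\<^sup>+s. indicator {0<..<\<tau> y (- w)} s * (G y * ennreal (1 / \<tau> y (- w))) \<partial>lborel)"
        by (intro nn_integral_cong) (auto simp: indicator_def)
      then show ?thesis using int[OF pos] by simp
    qed simp
  qed
  finally show ?thesis by simp
qed

text \<open>By the area formula the flux is \<open>planar_const\<close> times the area of the
  shadow, a bounded set.\<close>

lemma inflow_flux_finite: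
  assumes w: "norm w = 1"
  shows "(\<integral>\<^sup>+y. indicator (inflow w) y * ennreal (- (w \<bullet> nub y)) \<partial>hausdorff_measure) < top"
proof -
  obtain a b where fr: "frame3 a b w" using frame3_exists[OF w] by blast
  have "ennreal planar_const * (\<integral>\<^sup>+z. indicator (shadow a b) z * 1 \<partial>lborel)
    = (\<integral>\<^sup>+y. indicator (inflow w) y * ennreal (- (w \<bullet> nub y)) * 1 \<partial>hausdorff_measure)"
    by (rule area_integral[OF fr]) simp
  moreover have "(\<integral>\<^sup>+z. indicator (shadow a b) z * 1 \<partial>lborel) = emeasure lborel (shadow a b)"
    using shadow_borel[OF fr] by simp
  ultimately have eq: "(\<integral>\<^sup>+y. indicator (inflow w) y * ennreal (- (w \<bullet> nub y)) \<partial>hausdorff_measure)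
      = ennreal planar_const * emeasure lborel (shadow a b)" by simp
  show ?thesis unfolding eq using shadow_finite[OF fr] by (simp add: ennreal_mult_less_top)
qed

text \<open>Six coordinate directions suffice: every boundary point has a normal component of
  modulus above 1/2, and on each of the sets \<open>P w\<close> the measure is at most twice the
  flux in direction \<open>w\<close>.\<close>

lemma frontier_finite: "emeasure hausdorff_measure (frontier \<Omega>) < top"
proof -
  define k :: real where "k = 1/2"
  have k: "0 < k" by (simp add: k_def)
  define P where "P w = {y \<in> frontier \<Omega>. w \<bullet> nub y < - k}" for w
  have Pb: "P w \<in> sets borel" for w
  proof -
    have "{y. w \<bullet> nub y < - k} \<in> sets borel" by measurable
    moreover have "P w = frontier \<Omega> \<inter> {y. w \<bullet> nub y < - k}" by (auto simp: P_def)
    ultimately show ?thesis by (simp add: sets.Int)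
  qed
  have Pfin: "emeasure hausdorff_measure (P w) < top" if w: "norm w = 1" for w
  proof -
    have "ennreal k * emeasure hausdorff_measure (P w)
       = (\<integral>\<^sup>+y. ennreal k * indicator (P w) y \<partial>hausdorff_measure)"
      using Pb by (subst nn_integral_cmult_indicator) auto
    also have "\<dots> \<le> (\<integral>\<^sup>+y. indicator (inflow w) y * ennreal (- (w \<bullet> nub y)) \<partial>hausdorff_measure)"
      by (intro nn_integral_mono) (use k in \<open>auto simp: indicator_def P_def inflow_def intro!: ennreal_leI\<close>)
    also have "\<dots> < top" by (rule inflow_flux_finite[OF w])
    finally show ?thesis using k by (auto simp: ennreal_mult_less_top)
  qed
  define W where "W = (\<lambda>i. axis i 1 :: real^3) ` UNIV \<union> (\<lambda>i. - axis i 1 :: real^3) ` UNIV"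
  have Wf: "finite W" by (simp add: W_def)
  have W1: "norm w = 1" if "w \<in> W" for w using that by (auto simp: W_def)
  have "frontier \<Omega> \<subseteq> (\<Union>w\<in>W. P w)"
  proof
    fix y assume y: "y \<in> frontier \<Omega>"
    \<comment> \<open>Three components of modulus at most 1/2 would give a squared length of at most
      3/4.\<close>
    have "\<exists>i. 1/2 < \<bar>\<nu> y $ i\<bar>"
    proof (rule ccontr)
      assume "\<not> (\<exists>i. 1/2 < \<bar>\<nu> y $ i\<bar>)"
      then have "(\<bar>\<nu> y $ i\<bar>)\<^sup>2 \<le> (1/2)\<^sup>2" for i by (intro power_mono) (auto simp: not_less)
      then have "(\<nu> y $ i) * (\<nu> y $ i) \<le> 1/4" for i by (simp add: power2_eq_square)
      then have "(\<Sum>i\<in>UNIV. (\<nu> y $ i) * (\<nu> y $ i)) \<le> (\<Sum>i\<in>(UNIV::3 set). 1/4)" by (intro sum_mono)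
      moreover have "(\<Sum>i\<in>UNIV. (\<nu> y $ i) * (\<nu> y $ i)) = 1"
        using nu_norm[OF y] by (simp add: norm_eq_1 inner_vec_def)
      ultimately show False by simp
    qed
    then obtain i where i: "1/2 < \<bar>\<nu> y $ i\<bar>" by blast
    show "y \<in> (\<Union>w\<in>W. P w)"
    proof (cases "0 < \<nu> y $ i")
      case True
      then have "y \<in> P (- axis i 1)" using i y by (simp add: P_def inner_axis' k_def)
      then show ?thesis by (auto simp: W_def)
    next
      case False
      then have "y \<in> P (axis i 1)" using i y by (simp add: P_def inner_axis' k_def)
      then show ?thesis by (auto simp: W_def)
    qed
  qed
  then have "emeasure hausdorff_measure (frontier \<Omega>) \<le> emeasure hausdorff_measure (\<Union>w\<in>W. P w)"
    using Pb Wf by (intro emeasure_mono) (auto intro!: sets.finite_UN)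
  also have "\<dots> \<le> (\<Sum>w\<in>W. emeasure hausdorff_measure (P w))"
    using Pb Wf by (intro emeasure_subadditive_finite) auto
  also have "\<dots> < top" using Pfin W1 Wf by (auto simp: less_top ennreal_sum_less_top)
  finally show ?thesis .
qed

end

section \<open>Mass and symmetry of the sphere measure\<close>

lemma sphere_borel [measurable]: "sphere (0::real^3) 1 \<in> sets borel"
  by simp

interpretation uball: convex_dom "ball 0 1" "\<lambda>x. x" by (rule convex_dom_ball)

text \<open>The disintegration of the unit ball into chords of direction \<open>e\<close>, applied
  to the constant 1. The chord entering at \<open>y\<close> has length
  \<open>- 2 * (e \<bullet> y)\<close> and flux density \<open>- (e \<bullet> y)\<close>; the left
  side is their product, the right side is the volume of the ball.\<close>

lemma sphere_flux:
  assumes e: "norm e = 1"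
  shows "(\<integral>\<^sup>+y. indicator {y \<in> sphere 0 1. e \<bullet> y < 0} y * ennreal (2 * (e \<bullet> y)\<^sup>2) \<partial>hausdorff_measure)
     = ennreal (planar_const * (4 / 3 * pi))"
proof -
  have fs: "frontier (ball 0 1) = sphere (0::real^3) 1" by (simp add: frontier_ball)
  \<comment> \<open>The polynomial \<open>s * (s + 2 * (e \<bullet> y))\<close> is negative exactly
    between its two roots.\<close>
  have tm: "exit_time (ball 0 1) y e = - 2 * (e \<bullet> y)" if y: "norm y = 1" "e \<bullet> y < 0" for y
  proof -
    have "{s. 0 < s \<and> norm e = 1 \<and> y + s *\<^sub>R e \<in> ball 0 1} = {0<..<- 2 * (e \<bullet> y)}"
    proof (intro set_eqI)
      fix s
      have yy: "y \<bullet> y = 1" "e \<bullet> e = 1" using y(1) e by (simp_all add: norm_eq_1)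
      have "y + s *\<^sub>R e \<in> ball 0 1 \<longleftrightarrow> (norm (y + s *\<^sub>R e))\<^sup>2 < 1"
        by (simp add: abs_square_less_1)
      also have "(norm (y + s *\<^sub>R e))\<^sup>2 = 1 + 2 * s * (e \<bullet> y) + s * s"
        unfolding power2_norm_eq_inner using yy
        by (simp add: inner_add_left inner_add_right inner_commute[of y e] distrib_left)
      also have "1 + 2 * s * (e \<bullet> y) + s * s < 1 \<longleftrightarrow> s * (s + 2 * (e \<bullet> y)) < 0"
        by (simp add: algebra_simps)
      finally show "s \<in> {s. 0 < s \<and> norm e = 1 \<and> y + s *\<^sub>R e \<in> ball 0 1} \<longleftrightarrow> s \<in> {0<..<- 2 * (e \<bullet> y)}"
        using e by (auto simp: mult_less_0_iff)
    qed
    moreover have "insert 0 {0<..<- 2 * (e \<bullet> y)} = {0..<- 2 * (e \<bullet> y)}" using y by auto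
    ultimately show ?thesis using y by (simp add: exit_time_def)
  qed
  have "ennreal (planar_const * (4 / 3 * pi)) = ennreal planar_const * (\<integral>\<^sup>+x. indicator (ball 0 1) x * 1 \<partial>(lborel :: (real^3) measure))"
    using planar_const(1) by (subst ennreal_mult') (auto simp: emeasure_ball unit_ball_vol_3)
  also have "\<dots> = (\<integral>\<^sup>+y. indicator (uball.inflow e) y * ennreal (- (e \<bullet> uball.nub y)) *
      (\<integral>\<^sup>+s. indicator {0<..<exit_time (ball 0 1) y e} s * 1 \<partial>lborel) \<partial>hausdorff_measure)"
    by (rule uball.lines_integral[OF e]) simp
  also have "\<dots> = (\<integral>\<^sup>+y. indicator {y \<in> sphere 0 1. e \<bullet> y < 0} y * ennreal (2 * (e \<bullet> y)\<^sup>2) \<partial>hausdorff_measure)"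
  proof (rule nn_integral_cong)
    fix y
    have iff: "y \<in> uball.inflow e \<longleftrightarrow> y \<in> {y \<in> sphere 0 1. e \<bullet> y < 0}"
      by (simp add: uball.inflow_def fs)
    show "indicator (uball.inflow e) y * ennreal (- (e \<bullet> uball.nub y)) *
      (\<integral>\<^sup>+s. indicator {0<..<exit_time (ball 0 1) y e} s * 1 \<partial>lborel)
      = indicator {y \<in> sphere 0 1. e \<bullet> y < 0} y * ennreal (2 * (e \<bullet> y)\<^sup>2)"
    proof (cases "y \<in> uball.inflow e")
      case True
      then have y: "norm y = 1" "e \<bullet> y < 0" using iff by auto
      have nub: "uball.nub y = y" using y by (simp add: uball.nub_def fs)
      have "(\<integral>\<^sup>+s. indicator {0<..<exit_time (ball 0 1) y e} s * 1 \<partial>lborel) = ennreal (- 2 * (e \<bullet> y))"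
        unfolding tm[OF y] using y by simp
      moreover have "ennreal (- (e \<bullet> y)) * ennreal (- 2 * (e \<bullet> y)) = ennreal (2 * (e \<bullet> y)\<^sup>2)"
        using y by (subst ennreal_mult[symmetric]) (auto simp: power2_eq_square)
      ultimately show ?thesis using True iff nub by simp
    next
      case False
      then show ?thesis using iff by simp
    qed
  qed
  finally show ?thesis ..
qed

text \<open>The two open hemispheres of \<open>e\<close> and \<open>- e\<close> contribute equally,
  and on the equator the integrand vanishes.\<close>

lemma sphere_second_moment:
  assumes e: "norm e = 1"
  shows "(\<integral>\<^sup>+y. indicator (sphere 0 1) y * ennreal ((e \<bullet> y)\<^sup>2) \<partial>hausdorff_measure)
     = ennreal (planar_const * (4 / 3 * pi))"
proof -
  have [measurable]: "{y \<in> sphere 0 1. v \<bullet> y < 0} \<in> sets borel" for v :: "real^3"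
  proof -
    have "{y \<in> sphere 0 1. v \<bullet> y < 0} = sphere 0 1 \<inter> {y. v \<bullet> y < 0}" by auto
    moreover have "open {y. v \<bullet> y < 0}" by (simp add: open_halfspace_lt)
    ultimately show ?thesis by auto
  qed
  have ne: "norm (- e) = 1" using e by simp
  let ?I = "\<integral>\<^sup>+y. indicator (sphere 0 1) y * ennreal ((e \<bullet> y)\<^sup>2) \<partial>hausdorff_measure"
  have "2 * ?I = (\<integral>\<^sup>+y. 2 * (indicator (sphere 0 1) y * ennreal ((e \<bullet> y)\<^sup>2)) \<partial>hausdorff_measure)"
    by (rule nn_integral_cmult[symmetric]) simp
  also have "\<dots> = (\<integral>\<^sup>+y. indicator {y \<in> sphere 0 1. e \<bullet> y < 0} y * ennreal (2 * (e \<bullet> y)\<^sup>2)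
      + indicator {y \<in> sphere 0 1. - e \<bullet> y < 0} y * ennreal (2 * (- e \<bullet> y)\<^sup>2) \<partial>hausdorff_measure)"
    by (rule nn_integral_cong) (auto simp: indicator_def ennreal_mult')
  also have "\<dots> = ennreal (planar_const * (4 / 3 * pi)) + ennreal (planar_const * (4 / 3 * pi))"
    by (subst nn_integral_add) (simp_all only: sphere_flux[OF e] sphere_flux[OF ne], auto)
  also have "\<dots> = 2 * ennreal (planar_const * (4 / 3 * pi))" by (simp add: mult_2)
  finally show ?thesis by (subst (asm) ennreal_mult_cancel_left) auto
qed

text \<open>The squares of the three coordinates add up to 1 on the sphere, so its mass is the sum
  of three equal second moments.\<close>

lemma hausdorff_sphere: "emeasure hausdorff_measure (sphere 0 1) = ennreal (4 * pi * planar_const)"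
proof -
  have "emeasure hausdorff_measure (sphere 0 1) = (\<integral>\<^sup>+y. indicator (sphere 0 1) y \<partial>hausdorff_measure)"
    by simp
  also have "\<dots> = (\<integral>\<^sup>+y. (\<Sum>i\<in>UNIV. indicator (sphere 0 1) y * ennreal ((axis i 1 \<bullet> y)\<^sup>2)) \<partial>hausdorff_measure)"
  proof (rule nn_integral_cong)
    fix y :: "real^3"
    show "indicator (sphere 0 1) y = (\<Sum>i\<in>UNIV. indicator (sphere 0 1) y * ennreal ((axis i 1 \<bullet> y)\<^sup>2))"
    proof (cases "norm y = 1")
      case True
      have "(\<Sum>i\<in>UNIV. ennreal ((axis i 1 \<bullet> y)\<^sup>2)) = ennreal (\<Sum>i\<in>UNIV. (y $ i)\<^sup>2)"
        by (subst sum_ennreal) (auto simp: inner_axis')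
      also have "(\<Sum>i\<in>UNIV. (y $ i)\<^sup>2) = y \<bullet> y" by (simp add: inner_vec_def power2_eq_square)
      also have "\<dots> = 1" using True by (simp add: norm_eq_1)
      finally show ?thesis using True by simp
    qed simp
  qed
  also have "\<dots> = (\<Sum>i\<in>(UNIV::3 set). ennreal (planar_const * (4 / 3 * pi)))"
    by (subst nn_integral_sum) (auto simp: sphere_second_moment simp del: sum_constant)
  also have "\<dots> = ennreal (\<Sum>i\<in>(UNIV::3 set). planar_const * (4 / 3 * pi))"
    using planar_const(1) by (subst sum_ennreal) auto
  finally show ?thesis by (simp add: field_simps)
qed

lemma sphere_measure_eq: "sphere_measure = restrict_space hausdorff_measure (sphere 0 1)"
  unfolding sphere_measure_def by (rule surface_measure_eq) simp

lemma space_sphere_measure [simp]: "space sphere_measure = sphere 0 1"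
  by (simp add: sphere_measure_eq space_restrict_space)

lemma sphere_measure_mass: "emeasure sphere_measure (sphere 0 1) = ennreal (4 * pi * planar_const)"
  by (simp add: sphere_measure_eq emeasure_restrict_space hausdorff_sphere)

interpretation sphere: finite_measure sphere_measure
  by standard (simp add: sphere_measure_mass)

lemma measurable_sphere_id: "(\<lambda>w. w) \<in> measurable sphere_measure borel"
  unfolding sphere_measure_eq by (rule measurable_restrict_space1) simp

lemma measurable_sphereI: "f \<in> measurable borel N \<Longrightarrow> f \<in> measurable sphere_measure N"
  using measurable_compose[OF measurable_sphere_id] by blast

lemma nn_integral_sphere_uminus:
  assumes [measurable]: "f \<in> borel_measurable borel"
  shows "(\<integral>\<^sup>+w. f (- w) \<partial>sphere_measure) = (\<integral>\<^sup>+w. f w \<partial>sphere_measure)"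
proof -
  have "(\<integral>\<^sup>+w. f w \<partial>sphere_measure) = (\<integral>\<^sup>+w. f w * indicator (sphere 0 1) w \<partial>distr hausdorff_measure borel uminus)"
    unfolding sphere_measure_eq hausdorff_measure_uminus by (subst nn_integral_restrict_space) auto
  also have "\<dots> = (\<integral>\<^sup>+w. f (- w) * indicator (sphere 0 1) (- w) \<partial>hausdorff_measure)"
    by (subst nn_integral_distr) auto
  also have "\<dots> = (\<integral>\<^sup>+w. f (- w) * indicator (sphere 0 1) w \<partial>hausdorff_measure)"
    by (intro nn_integral_cong) (auto simp: indicator_def)
  also have "\<dots> = (\<integral>\<^sup>+w. f (- w) \<partial>sphere_measure)"
    unfolding sphere_measure_eq by (subst nn_integral_restrict_space) auto
  finally show ?thesis ..
qed

text \<open>The antipodal map preserves the measure and changes the sign of the integrand.\<close>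

lemma sphere_mean_zero: "(\<integral>w. v \<bullet> w \<partial>sphere_measure) = 0"
proof -
  have d: "distr sphere_measure borel uminus = distr sphere_measure borel (\<lambda>w. w)"
  proof (rule measure_eqI)
    fix A assume "A \<in> sets (distr sphere_measure borel uminus)"
    then have A: "A \<in> sets borel" by simp
    have "(\<integral>\<^sup>+w. indicator A (- w) \<partial>sphere_measure) = (\<integral>\<^sup>+w. indicator A w \<partial>sphere_measure)"
      using A by (intro nn_integral_sphere_uminus) auto
    then show "emeasure (distr sphere_measure borel uminus) A = emeasure (distr sphere_measure borel (\<lambda>w. w)) A"
      using A measurable_sphereI[of uminus borel] measurable_sphere_id
      by (subst (1 2) nn_integral_indicator[symmetric], simp, simp, subst (1 2) nn_integral_distr) auto
  qed simp
  have "(\<integral>w. v \<bullet> w \<partial>sphere_measure) = (\<integral>w. v \<bullet> w \<partial>distr sphere_measure borel (\<lambda>w. w))"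
    using measurable_sphere_id by (subst integral_distr) auto
  also have "\<dots> = (\<integral>w. v \<bullet> (- w) \<partial>sphere_measure)"
    unfolding d[symmetric] using measurable_sphereI[of uminus borel] by (subst integral_distr) auto
  finally show ?thesis by simp
qed

subsection \<open>Integration along characteristics\<close>

lemma measurable_pair_ident [measurable (raw)]:
  "(\<lambda>p. p) \<in> measurable (borel :: phase measure) (borel \<Otimes>\<^sub>M borel)"
  by (simp add: borel_prod)

lemma measurable_fst_snd_borel:
  fixes f :: "'a \<Rightarrow> phase"
  assumes f: "f \<in> borel_measurable M"
  shows "(\<lambda>x. fst (f x)) \<in> borel_measurable M" "(\<lambda>x. snd (f x)) \<in> borel_measurable M"
proof -
  have "f \<in> measurable M (borel \<Otimes>\<^sub>M borel)" using f by (simp add: borel_prod)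
  then show "(\<lambda>x. fst (f x)) \<in> borel_measurable M" "(\<lambda>x. snd (f x)) \<in> borel_measurable M"
    by measurable
qed

lemma integrable_product_lborel:
  fixes f g :: "real \<Rightarrow> real"
  assumes f: "integrable lborel f" and g: "integrable lborel g"
  shows "integrable (lborel \<Otimes>\<^sub>M lborel) (\<lambda>(x, y). f x * g y)"
proof -
  have [measurable]: "f \<in> borel_measurable borel" "g \<in> borel_measurable borel"
    using f g by (auto dest: borel_measurable_integrable)
  show ?thesis
  proof (rule lborel_pair.Fubini_integrable)
    have "(\<integral>y. norm (case (x, y) of (x, y) \<Rightarrow> f x * g y) \<partial>lborel) = \<bar>f x\<bar> * (\<integral>y. \<bar>g y\<bar> \<partial>lborel)" for x
      by (simp add: abs_mult)
    then show "integrable lborel (\<lambda>x. \<integral>y. norm (case (x, y) of (x, y) \<Rightarrow> f x * g y) \<partial>lborel)"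
      using f by (simp add: integrable_abs)
    show "AE x in lborel. integrable lborel (\<lambda>y. case (x, y) of (x, y) \<Rightarrow> f x * g y)"
      using g by simp
  qed measurable
qed

text \<open>The product rule for absolutely continuous functions, given as primitives. Inserting the
  primitives turns the two integrals on the right into integrals of \<open>f x * g y\<close> over
  the two triangles below and above the diagonal of a square; together they fill the square up to a
  null set.\<close>

lemma product_primitive:
  fixes f g F G :: "real \<Rightarrow> real"
  assumes f: "set_integrable lborel {0<..<T} f" and g: "set_integrable lborel {0<..<T} g"
    and F: "\<And>s. 0 < s \<Longrightarrow> s \<le> T \<Longrightarrow> F s = F0 + (LINT t:{0<..<s}|lborel. f t)"
    and G: "\<And>s. 0 < s \<Longrightarrow> s \<le> T \<Longrightarrow> G s = G0 + (LINT t:{0<..<s}|lborel. g t)"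
    and Fm [measurable]: "F \<in> borel_measurable borel" and Gm [measurable]: "G \<in> borel_measurable borel"
  shows "set_integrable lborel {0<..<T} (\<lambda>t. f t * G t + F t * g t)"
    "0 < s \<Longrightarrow> s \<le> T \<Longrightarrow> F s * G s = F0 * G0 + (LINT t:{0<..<s}|lborel. f t * G t + F t * g t)"
proof -
  \<comment> \<open>A primitive of an integrable function is bounded, which makes the products
    integrable.\<close>
  have bound: "\<exists>K. \<forall>s\<in>{0<..<T}. \<bar>F' s\<bar> \<le> K"
    if f: "set_integrable lborel {0<..<T} f'" and F: "\<And>s. 0 < s \<Longrightarrow> s \<le> T \<Longrightarrow> F' s = F0' + (LINT t:{0<..<s}|lborel. f' t)"
    for F' f' :: "real \<Rightarrow> real" and F0'
  proof (intro exI ballI)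
    fix s assume s: "s \<in> {0<..<T}"
    have fs: "set_integrable lborel {0<..<s} f'"
      by (rule set_integrable_subset[OF f]) (use s in auto)
    have "\<bar>LINT t:{0<..<s}|lborel. f' t\<bar> \<le> (LINT t:{0<..<s}|lborel. \<bar>f' t\<bar>)"
      using set_integral_norm_bound[OF fs] by simp
    also have "\<dots> \<le> (LINT t:{0<..<T}|lborel. \<bar>f' t\<bar>)"
      using s set_integrable_abs[OF f] set_integrable_abs[OF fs]
      unfolding set_lebesgue_integral_def set_integrable_def
      by (intro integral_mono) (auto simp: indicator_def)
    finally show "\<bar>F' s\<bar> \<le> \<bar>F0'\<bar> + (LINT t:{0<..<T}|lborel. \<bar>f' t\<bar>)"
      using F[of s] s by auto
  qed
  have prod_int: "set_integrable lborel {0<..<T} (\<lambda>t. f' t * G' t)"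
    if f: "set_integrable lborel {0<..<T} f'" and G: "\<exists>K. \<forall>s\<in>{0<..<T}. \<bar>G' s\<bar> \<le> K"
      and [measurable]: "G' \<in> borel_measurable borel" for f' G' :: "real \<Rightarrow> real"
  proof -
    obtain K where K: "\<And>s. s \<in> {0<..<T} \<Longrightarrow> \<bar>G' s\<bar> \<le> K" using G by blast
    have i: "integrable lborel (\<lambda>t. indicator {0<..<T} t *\<^sub>R f' t)" using f by (simp add: set_integrable_def)
    have "integrable lborel (\<lambda>t. (indicator {0<..<T} t *\<^sub>R f' t) * G' t)"
    proof (rule Bochner_Integration.integrable_bound[OF integrable_mult_right[OF integrable_abs[OF i], of "\<bar>K\<bar>"]])
      show "(\<lambda>t. (indicator {0<..<T} t *\<^sub>R f' t) * G' t) \<in> borel_measurable lborel"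
        using borel_measurable_integrable[OF i] by measurable
      show "AE t in lborel. norm ((indicator {0<..<T} t *\<^sub>R f' t) * G' t) \<le> norm (\<bar>K\<bar> * \<bar>indicator {0<..<T} t *\<^sub>R f' t\<bar>)"
      proof (intro AE_I2)
        fix t
        have "\<bar>f' t\<bar> * \<bar>G' t\<bar> \<le> \<bar>K\<bar> * \<bar>f' t\<bar>" if "t \<in> {0<..<T}"
          using mult_right_mono[OF order_trans[OF K[OF that] abs_ge_self], of "\<bar>f' t\<bar>"]
          by (simp add: mult.commute)
        then show "norm ((indicator {0<..<T} t *\<^sub>R f' t) * G' t) \<le> norm (\<bar>K\<bar> * \<bar>indicator {0<..<T} t *\<^sub>R f' t\<bar>)"
          by (auto simp: abs_mult indicator_def)
      qed
    qed
    then show ?thesis by (simp add: set_integrable_def mult.assoc)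
  qed
  have fG: "set_integrable lborel {0<..<T} (\<lambda>t. f t * G t)" by (rule prod_int[OF f bound[OF g G] Gm])
  have gF: "set_integrable lborel {0<..<T} (\<lambda>t. g t * F t)" by (rule prod_int[OF g bound[OF f F] Fm])
  then have Fg: "set_integrable lborel {0<..<T} (\<lambda>t. F t * g t)" by (simp add: mult.commute)
  show int: "set_integrable lborel {0<..<T} (\<lambda>t. f t * G t + F t * g t)"
    using set_integral_add(1)[OF fG Fg] .
  assume s: "0 < s" "s \<le> T"
  define f1 where "f1 t = indicator {0<..<s} t *\<^sub>R f t" for t
  define g1 where "g1 t = indicator {0<..<s} t *\<^sub>R g t" for t
  have sub: "{0<..<s} \<subseteq> {0<..<T}" using s by auto
  have f1: "integrable lborel f1"
    using set_integrable_subset[OF f _ sub] by (simp add: set_integrable_def f1_def[abs_def])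
  have g1: "integrable lborel g1"
    using set_integrable_subset[OF g _ sub] by (simp add: set_integrable_def g1_def[abs_def])
  have [measurable]: "f1 \<in> borel_measurable borel" "g1 \<in> borel_measurable borel"
    using f1 g1 by (auto dest: borel_measurable_integrable)
  have h: "integrable (lborel \<Otimes>\<^sub>M lborel) (\<lambda>(x, y). f1 x * g1 y)"
    by (rule integrable_product_lborel[OF f1 g1])
  have dm [measurable]: "{p::real\<times>real. snd p < fst p} \<in> sets (borel \<Otimes>\<^sub>M borel)"
    "{p::real\<times>real. fst p < snd p} \<in> sets (borel \<Otimes>\<^sub>M borel)"
    unfolding borel_prod by (auto intro!: borel_open open_Collect_less continuous_intros)
  have h1: "integrable (lborel \<Otimes>\<^sub>M lborel) (\<lambda>(x, y). f1 x * (indicator {..<x} y * g1 y))"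
  proof -
    have "integrable (lborel \<Otimes>\<^sub>M lborel) (\<lambda>p. indicator {p. snd p < fst p} p *\<^sub>R (case p of (x, y) \<Rightarrow> f1 x * g1 y))"
      using dm(1) by (intro integrable_mult_indicator h) simp
    then show ?thesis by (rule Bochner_Integration.integrable_cong[THEN iffD1, rotated -1]) (auto simp: indicator_def)
  qed
  have h2: "integrable (lborel \<Otimes>\<^sub>M lborel) (\<lambda>(x, y). (indicator {..<y} x * f1 x) * g1 y)"
  proof -
    have "integrable (lborel \<Otimes>\<^sub>M lborel) (\<lambda>p. indicator {p. fst p < snd p} p *\<^sub>R (case p of (x, y) \<Rightarrow> f1 x * g1 y))"
      using dm(2) by (intro integrable_mult_indicator h) simp
    then show ?thesis by (rule Bochner_Integration.integrable_cong[THEN iffD1, rotated -1]) (auto simp: indicator_def)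
  qed
  have G1: "G x = G0 + (\<integral>y. indicator {..<x} y * g1 y \<partial>lborel)" if "0 < x" "x < s" for x
    unfolding G[OF that(1) less_imp_le[OF less_le_trans[OF that(2) s(2)]]] set_lebesgue_integral_def g1_def
    using that by (intro arg_cong2[where f="(+)"] refl Bochner_Integration.integral_cong) (auto simp: indicator_def)
  have F1: "F y = F0 + (\<integral>x. indicator {..<y} x * f1 x \<partial>lborel)" if "0 < y" "y < s" for y
    unfolding F[OF that(1) less_imp_le[OF less_le_trans[OF that(2) s(2)]]] set_lebesgue_integral_def f1_def
    using that by (intro arg_cong2[where f="(+)"] refl Bochner_Integration.integral_cong) (auto simp: indicator_def)
  define If where "If = (\<integral>x. f1 x \<partial>lborel)"
  define Ig where "Ig = (\<integral>x. g1 x \<partial>lborel)"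
  define D1 where "D1 = (\<integral>x. (\<integral>y. f1 x * (indicator {..<x} y * g1 y) \<partial>lborel) \<partial>lborel)"
  define D2 where "D2 = (\<integral>y. (\<integral>x. (indicator {..<y} x * f1 x) * g1 y \<partial>lborel) \<partial>lborel)"
  have i1: "integrable lborel (\<lambda>x. \<integral>y. f1 x * (indicator {..<x} y * g1 y) \<partial>lborel)"
    using lborel_pair.integrable_fst[OF h1] .
  have i2: "integrable lborel (\<lambda>y. \<integral>x. (indicator {..<y} x * f1 x) * g1 y \<partial>lborel)"
    using lborel_pair.integrable_snd[OF h2] .
  have e1: "(LINT t:{0<..<s}|lborel. f t * G t) = G0 * If + D1"
  proof -
    have "(LINT t:{0<..<s}|lborel. f t * G t) = (\<integral>x. G0 * f1 x + (\<integral>y. f1 x * (indicator {..<x} y * g1 y) \<partial>lborel) \<partial>lborel)"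
      unfolding set_lebesgue_integral_def
    proof (rule Bochner_Integration.integral_cong[OF refl])
      fix x
      show "indicator {0<..<s} x *\<^sub>R (f x * G x) = G0 * f1 x + (\<integral>y. f1 x * (indicator {..<x} y * g1 y) \<partial>lborel)"
        by (cases "x \<in> {0<..<s}") (simp_all add: G1 f1_def algebra_simps)
    qed
    also have "\<dots> = G0 * If + D1"
      unfolding If_def D1_def using f1 i1 by (subst Bochner_Integration.integral_add) auto
    finally show ?thesis .
  qed
  have e2: "(LINT t:{0<..<s}|lborel. F t * g t) = F0 * Ig + D2"
  proof -
    have "(LINT t:{0<..<s}|lborel. F t * g t) = (\<integral>y. F0 * g1 y + (\<integral>x. (indicator {..<y} x * f1 x) * g1 y \<partial>lborel) \<partial>lborel)"
      unfolding set_lebesgue_integral_def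
    proof (rule Bochner_Integration.integral_cong[OF refl])
      fix y
      show "indicator {0<..<s} y *\<^sub>R (F y * g y) = F0 * g1 y + (\<integral>x. (indicator {..<y} x * f1 x) * g1 y \<partial>lborel)"
        by (cases "y \<in> {0<..<s}") (simp_all add: F1 g1_def distrib_right mult.assoc[symmetric])
    qed
    also have "\<dots> = F0 * Ig + D2"
      unfolding Ig_def D2_def using g1 i2 by (subst Bochner_Integration.integral_add) auto
    finally show ?thesis .
  qed
  \<comment> \<open>For fixed \<open>x\<close> the two triangles leave out only the diagonal point
    \<open>y = x\<close>.\<close>
  have D: "D1 + D2 = If * Ig"
  proof -
    have "D2 = (\<integral>x. (\<integral>y. (indicator {..<y} x * f1 x) * g1 y \<partial>lborel) \<partial>lborel)"
      unfolding D2_def by (rule lborel_pair.Fubini_integral[OF h2])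
    then have "D1 + D2 = (\<integral>x. (\<integral>y. f1 x * (indicator {..<x} y * g1 y) \<partial>lborel)
        + (\<integral>y. (indicator {..<y} x * f1 x) * g1 y \<partial>lborel) \<partial>lborel)"
      unfolding D1_def using i1 lborel_pair.integrable_fst[OF h2]
      by (subst Bochner_Integration.integral_add) auto
    also have "\<dots> = (\<integral>x. f1 x * Ig \<partial>lborel)"
    proof (rule Bochner_Integration.integral_cong[OF refl])
      fix x
      have ia: "integrable lborel (\<lambda>y. indicator {..<x} y * g1 y)"
        using integrable_mult_indicator[OF _ g1, of "{..<x}"] by simp
      have ib: "integrable lborel (\<lambda>y. indicator {x<..} y * g1 y)"
        using integrable_mult_indicator[OF _ g1, of "{x<..}"] by simp
      have "(\<integral>y. f1 x * (indicator {..<x} y * g1 y) \<partial>lborel) + (\<integral>y. (indicator {..<y} x * f1 x) * g1 y \<partial>lborel)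
         = (\<integral>y. f1 x * (indicator {..<x} y * g1 y) \<partial>lborel) + (\<integral>y. f1 x * (indicator {x<..} y * g1 y) \<partial>lborel)"
        by (intro arg_cong2[where f="(+)"] refl Bochner_Integration.integral_cong) (auto simp: indicator_def)
      also have "\<dots> = f1 x * ((\<integral>y. indicator {..<x} y * g1 y \<partial>lborel) + (\<integral>y. indicator {x<..} y * g1 y \<partial>lborel))"
        by (simp add: distrib_left)
      also have "(\<integral>y. indicator {..<x} y * g1 y \<partial>lborel) + (\<integral>y. indicator {x<..} y * g1 y \<partial>lborel)
         = (\<integral>y. indicator {..<x} y * g1 y + indicator {x<..} y * g1 y \<partial>lborel)"
        by (rule Bochner_Integration.integral_add[OF ia ib, symmetric])
      also have "\<dots> = Ig"
        unfolding Ig_def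
        by (rule integral_cong_AE) (auto intro: AE_mp[OF AE_lborel_singleton[of x]] simp: indicator_def)
      finally show "(\<integral>y. f1 x * (indicator {..<x} y * g1 y) \<partial>lborel) + (\<integral>y. (indicator {..<y} x * f1 x) * g1 y \<partial>lborel) = f1 x * Ig" .
    qed
    also have "\<dots> = If * Ig" by (simp add: If_def)
    finally show ?thesis .
  qed
  have Fs: "F s = F0 + If" using F[OF s] by (simp add: If_def f1_def set_lebesgue_integral_def)
  have Gs: "G s = G0 + Ig" using G[OF s] by (simp add: Ig_def g1_def set_lebesgue_integral_def)
  have "(LINT t:{0<..<s}|lborel. f t * G t + F t * g t)
      = (LINT t:{0<..<s}|lborel. f t * G t) + (LINT t:{0<..<s}|lborel. F t * g t)"
    using set_integrable_subset[OF fG _ sub] set_integrable_subset[OF Fg _ sub] by (intro set_integral_add(2)) auto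
  also have "\<dots> = G0 * If + F0 * Ig + If * Ig" using e1 e2 D by simp
  finally show "F s * G s = F0 * G0 + (LINT t:{0<..<s}|lborel. f t * G t + F t * g t)"
    unfolding Fs Gs by (simp add: algebra_simps)
qed

lemma primitive_of_C1:
  fixes F f :: "real \<Rightarrow> real"
  assumes der: "\<And>s. (F has_real_derivative f s) (at s)" and cont: "continuous_on UNIV f" and s: "0 < s"
  shows "set_integrable lborel {0<..<s} f" "F s = F 0 + (LINT t:{0<..<s}|lborel. f t)"
proof -
  have bi: "has_bochner_integral lborel (\<lambda>x. f x * indicator {0..s} x) (F s - F 0)"
    using s der cont by (intro has_bochner_integral_FTC_Icc_real) (auto simp: continuous_on_eq_continuous_at)
  have [measurable]: "f \<in> borel_measurable borel" by (rule borel_measurable_continuous_onI[OF cont])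
  have ae: "AE x in lborel. f x * indicator {0..s} x = indicator {0<..<s} x *\<^sub>R f x"
    using AE_lborel_singleton[of 0] AE_lborel_singleton[of s]
    by eventually_elim (auto simp: indicator_def)
  have bi2: "has_bochner_integral lborel (\<lambda>x. indicator {0<..<s} x *\<^sub>R f x) (F s - F 0)"
    using bi by (subst (asm) has_bochner_integral_cong_AE[OF _ _ ae]) auto
  show "set_integrable lborel {0<..<s} f"
    using bi2 by (auto simp: set_integrable_def has_bochner_integral_iff)
  show "F s = F 0 + (LINT t:{0<..<s}|lborel. f t)"
    using bi2 by (auto simp: set_lebesgue_integral_def has_bochner_integral_iff)
qed

section \<open>Phase space, flux measures and their chords\<close>

locale c3_dom =
  fixes \<Omega> :: "(real^3) set"
  assumes c3: "open \<Omega>" "\<Omega> \<noteq> {}" "bounded \<Omega>" "convex \<Omega>" "C3_boundary \<Omega>"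

sublocale c3_dom \<subseteq> convex_dom \<Omega> "outward_normal \<Omega>"
  by (rule convex_dom_outward_normal[OF c3])

context c3_dom
begin

abbreviation V :: "phase measure" where "V \<equiv> vol_measure \<Omega>"
abbreviation B :: "phase measure" where "B \<equiv> bdry_measure \<Omega>"

lemma surface_frontier: "surface_measure (frontier \<Omega>) = restrict_space hausdorff_measure (frontier \<Omega>)"
  by (rule surface_measure_eq) simp

lemma space_V: "space V = \<Omega> \<times> sphere 0 1"
  by (simp add: vol_measure_def space_pair_measure space_restrict_space)

lemma space_B: "space B = frontier \<Omega> \<times> sphere 0 1"
  by (simp add: bdry_measure_def surface_frontier space_pair_measure space_restrict_space)

lemma measurable_id_V: "(\<lambda>p. p) \<in> measurable V borel"
proof -
  have "(\<lambda>p. fst p) \<in> measurable V borel"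
    unfolding vol_measure_def by (rule measurable_compose[OF measurable_fst]) (simp add: measurable_restrict_space1)
  moreover have "(\<lambda>p. snd p) \<in> measurable V borel"
    unfolding vol_measure_def by (rule measurable_compose[OF measurable_snd measurable_sphere_id])
  ultimately have "(\<lambda>p. (fst p, snd p)) \<in> measurable V (borel \<Otimes>\<^sub>M borel)" by (rule measurable_Pair)
  then show ?thesis by (simp add: borel_prod)
qed

lemma measurable_id_B: "(\<lambda>p. p) \<in> measurable B borel"
proof -
  have "(\<lambda>p. fst p) \<in> measurable B borel"
    unfolding bdry_measure_def surface_frontier
    by (rule measurable_compose[OF measurable_fst]) (simp add: measurable_restrict_space1)
  moreover have "(\<lambda>p. snd p) \<in> measurable B borel"
    unfolding bdry_measure_def by (rule measurable_compose[OF measurable_snd measurable_sphere_id])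
  ultimately have "(\<lambda>p. (fst p, snd p)) \<in> measurable B (borel \<Otimes>\<^sub>M borel)" by (rule measurable_Pair)
  then show ?thesis by (simp add: borel_prod)
qed

lemma measurable_VI [measurable (raw)]: "f \<in> measurable borel N \<Longrightarrow> f \<in> measurable V N"
  using measurable_compose[OF measurable_id_V] by blast

lemma measurable_BI [measurable (raw)]: "f \<in> measurable borel N \<Longrightarrow> f \<in> measurable B N"
  using measurable_compose[OF measurable_id_B] by blast

text \<open>Composition with a measurable retraction onto the phase space over the domain. From here
  on the argument can work with Borel functions on all of \<open>phase\<close>, for which
  measurability along chords is automatic.\<close>

lemma extend_V:
  assumes f: "f \<in> borel_measurable V"
  shows "\<exists>f'. f' \<in> borel_measurable borel \<and> (\<forall>p\<in>space V. f' p = f p)"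
proof -
  obtain x0 where x0: "x0 \<in> \<Omega>" using nonempty_dom by blast
  define T where "T p = (if fst p \<in> \<Omega> then fst p else x0, if norm (snd p) = 1 then snd p else axis 1 1)"
    for p :: "phase"
  have "T \<in> measurable borel V"
    unfolding vol_measure_def T_def[abs_def] sphere_measure_eq
  proof (rule measurable_Pair)
    show "(\<lambda>p::phase. if fst p \<in> \<Omega> then fst p else x0) \<in> measurable borel (restrict_space lborel \<Omega>)"
    proof (rule measurable_restrict_space2)
      have "(\<lambda>p::phase. if fst p \<in> \<Omega> then fst p else x0) \<in> borel_measurable borel" by measurable
      then show "(\<lambda>p::phase. if fst p \<in> \<Omega> then fst p else x0) \<in> measurable borel lborel" by simp
    qed (use x0 in auto)
    show "(\<lambda>p::phase. if norm (snd p) = 1 then snd p else axis 1 1)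
      \<in> measurable borel (restrict_space hausdorff_measure (sphere 0 1))"
    proof (rule measurable_restrict_space2)
      have "(\<lambda>p::phase. if norm (snd p) = 1 then snd p else axis 1 1) \<in> borel_measurable borel"
        by measurable
      then show "(\<lambda>p::phase. if norm (snd p) = 1 then snd p else axis 1 1) \<in> measurable borel hausdorff_measure"
        by (simp cong: measurable_cong_sets)
    qed auto
  qed
  then have "(\<lambda>p. f (T p)) \<in> borel_measurable borel" using f by (rule measurable_compose)
  moreover have "f (T p) = f p" if "p \<in> space V" for p
    using that by (cases p) (auto simp: T_def space_V)
  ultimately show ?thesis by blast
qed

lemma frontier_nonempty: "frontier \<Omega> \<noteq> {}"
proof -
  obtain x where x: "x \<in> \<Omega>" using nonempty_dom by blast
  have w: "norm (axis 1 1 :: real^3) = 1" by simp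
  have "x \<in> closure \<Omega>" using x closure_subset by blast
  from exit_point(1)[OF w this exit_time_pos_dom[OF w x]] show ?thesis by blast
qed

lemma extend_B:
  assumes f: "f \<in> borel_measurable B"
  shows "\<exists>f'. f' \<in> borel_measurable borel \<and> (\<forall>p\<in>space B. f' p = f p)"
proof -
  obtain x0 where x0: "x0 \<in> frontier \<Omega>" using frontier_nonempty by blast
  define T where "T p = (if fst p \<in> frontier \<Omega> then fst p else x0, if norm (snd p) = 1 then snd p else axis 1 1)"
    for p :: "phase"
  have [measurable]: "frontier \<Omega> \<in> sets borel" by (rule frontier_borel)
  have "T \<in> measurable borel B"
    unfolding bdry_measure_def T_def[abs_def] sphere_measure_eq surface_frontier
  proof (rule measurable_Pair)
    show "(\<lambda>p::phase. if fst p \<in> frontier \<Omega> then fst p else x0) \<in> measurable borel (restrict_space hausdorff_measure (frontier \<Omega>))"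
    proof (rule measurable_restrict_space2)
      have "(\<lambda>p::phase. if fst p \<in> frontier \<Omega> then fst p else x0) \<in> borel_measurable borel" by measurable
      then show "(\<lambda>p::phase. if fst p \<in> frontier \<Omega> then fst p else x0) \<in> measurable borel hausdorff_measure"
        by (simp cong: measurable_cong_sets)
    qed (use x0 in auto)
    show "(\<lambda>p::phase. if norm (snd p) = 1 then snd p else axis 1 1)
      \<in> measurable borel (restrict_space hausdorff_measure (sphere 0 1))"
    proof (rule measurable_restrict_space2)
      have "(\<lambda>p::phase. if norm (snd p) = 1 then snd p else axis 1 1) \<in> borel_measurable borel"
        by measurable
      then show "(\<lambda>p::phase. if norm (snd p) = 1 then snd p else axis 1 1) \<in> measurable borel hausdorff_measure"
        by (simp cong: measurable_cong_sets)
    qed auto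
  qed
  then have "(\<lambda>p. f (T p)) \<in> borel_measurable borel" using f by (rule measurable_compose)
  moreover have "f (T p) = f p" if "p \<in> space B" for p
    using that by (cases p) (auto simp: T_def space_B)
  ultimately show ?thesis by blast
qed

lemma finite_sphere: "finite_measure sphere_measure"
  by standard (simp add: sphere_measure_mass)

lemma finite_dom: "finite_measure (restrict_space lborel \<Omega>)"
proof
  have "emeasure lborel \<Omega> \<le> emeasure lborel (cball (0::real^3) rad)"
    using rad_dom by (intro emeasure_mono) auto
  also have "\<dots> < top" using rad(1) by (simp add: emeasure_cball)
  finally show "emeasure (restrict_space lborel \<Omega>) (space (restrict_space lborel \<Omega>)) \<noteq> \<infinity>"
    by (subst emeasure_restrict_space) (auto simp: space_restrict_space)
qed

lemma finite_bdry: "finite_measure (restrict_space hausdorff_measure (frontier \<Omega>))"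
  using frontier_finite by (intro finite_measureI) (auto simp: space_restrict_space emeasure_restrict_space)

lemma finite_V: "finite_measure V"
  unfolding vol_measure_def by (rule finite_measure_pair_measure[OF finite_sphere finite_dom])

lemma finite_B: "finite_measure B"
  unfolding bdry_measure_def surface_frontier by (rule finite_measure_pair_measure[OF finite_sphere finite_bdry])

lemma nn_integral_V:
  fixes F :: "phase \<Rightarrow> ennreal"
  assumes F: "F \<in> borel_measurable borel"
  shows "(\<integral>\<^sup>+p. F p \<partial>V) = (\<integral>\<^sup>+x. indicator \<Omega> x * (\<integral>\<^sup>+w. F (x, w) \<partial>sphere_measure) \<partial>lborel)"
    "(\<integral>\<^sup>+p. F p \<partial>V) = (\<integral>\<^sup>+w. (\<integral>\<^sup>+x. indicator \<Omega> x * F (x, w) \<partial>lborel) \<partial>sphere_measure)"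
proof -
  interpret D: finite_measure "restrict_space lborel \<Omega>" by (rule finite_dom)
  interpret PP: pair_sigma_finite "restrict_space lborel \<Omega>" sphere_measure ..
  have FV: "F \<in> borel_measurable (restrict_space lborel \<Omega> \<Otimes>\<^sub>M sphere_measure)"
    using measurable_VI[OF F] by (simp add: vol_measure_def)
  have "(\<integral>\<^sup>+p. F p \<partial>V) = (\<integral>\<^sup>+x. (\<integral>\<^sup>+w. F (x, w) \<partial>sphere_measure) \<partial>restrict_space lborel \<Omega>)"
    unfolding vol_measure_def by (rule sphere.nn_integral_fst[OF FV, symmetric])
  also have "\<dots> = (\<integral>\<^sup>+x. indicator \<Omega> x * (\<integral>\<^sup>+w. F (x, w) \<partial>sphere_measure) \<partial>lborel)"
    by (subst nn_integral_restrict_space) (auto simp: mult.commute)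
  finally show "(\<integral>\<^sup>+p. F p \<partial>V) = (\<integral>\<^sup>+x. indicator \<Omega> x * (\<integral>\<^sup>+w. F (x, w) \<partial>sphere_measure) \<partial>lborel)" .
  have "(\<integral>\<^sup>+p. F p \<partial>V) = (\<integral>\<^sup>+w. (\<integral>\<^sup>+x. F (x, w) \<partial>restrict_space lborel \<Omega>) \<partial>sphere_measure)"
    unfolding vol_measure_def by (rule PP.nn_integral_snd[OF FV, symmetric])
  also have "\<dots> = (\<integral>\<^sup>+w. (\<integral>\<^sup>+x. indicator \<Omega> x * F (x, w) \<partial>lborel) \<partial>sphere_measure)"
    by (subst nn_integral_restrict_space) (auto simp: mult.commute)
  finally show "(\<integral>\<^sup>+p. F p \<partial>V) = (\<integral>\<^sup>+w. (\<integral>\<^sup>+x. indicator \<Omega> x * F (x, w) \<partial>lborel) \<partial>sphere_measure)" .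
qed

lemma nn_integral_B:
  fixes F :: "phase \<Rightarrow> ennreal"
  assumes F: "F \<in> borel_measurable borel"
  shows "(\<integral>\<^sup>+p. F p \<partial>B) = (\<integral>\<^sup>+w. (\<integral>\<^sup>+x. indicator (frontier \<Omega>) x * F (x, w) \<partial>hausdorff_measure) \<partial>sphere_measure)"
proof -
  interpret D: finite_measure "restrict_space hausdorff_measure (frontier \<Omega>)" by (rule finite_bdry)
  interpret PP: pair_sigma_finite "restrict_space hausdorff_measure (frontier \<Omega>)" sphere_measure ..
  have FV: "F \<in> borel_measurable (restrict_space hausdorff_measure (frontier \<Omega>) \<Otimes>\<^sub>M sphere_measure)"
    using measurable_BI[OF F] by (simp add: bdry_measure_def surface_frontier)
  have "(\<integral>\<^sup>+p. F p \<partial>B) = (\<integral>\<^sup>+w. (\<integral>\<^sup>+x. F (x, w) \<partial>restrict_space hausdorff_measure (frontier \<Omega>)) \<partial>sphere_measure)"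
    unfolding bdry_measure_def surface_frontier by (rule PP.nn_integral_snd[OF FV, symmetric])
  also have "\<dots> = (\<integral>\<^sup>+w. (\<integral>\<^sup>+x. indicator (frontier \<Omega>) x * F (x, w) \<partial>hausdorff_measure) \<partial>sphere_measure)"
    by (subst nn_integral_restrict_space) (auto simp: mult.commute)
  finally show ?thesis .
qed

text \<open>The flux measures \<open>\<bar>w \<bullet> \<nu>\<bar> dw dx\<close> on \<open>\<Gamma>\<^sup>-\<close> and \<open>\<Gamma>\<^sup>+\<close>: \<open>ennreal\<close> cuts off the
  wrong sign.\<close>
definition Kin :: "phase measure" where
  "Kin = density B (\<lambda>p. ennreal (- (snd p \<bullet> nub (fst p))))"

definition Kout :: "phase measure" where
  "Kout = density B (\<lambda>p. ennreal (snd p \<bullet> nub (fst p)))"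

abbreviation T :: "phase \<Rightarrow> real" where "T p \<equiv> \<tau> (fst p) (snd p)"

definition pt :: "phase \<Rightarrow> real \<Rightarrow> phase" where
  "pt p s = (fst p + s *\<^sub>R snd p, snd p)"

abbreviation ext :: "phase \<Rightarrow> phase" where "ext p \<equiv> pt p (T p)"

lemma pt_simps [simp]: "fst (pt p s) = fst p + s *\<^sub>R snd p" "snd (pt p s) = snd p"
  by (auto simp: pt_def)

lemma measurable_pt [measurable (raw)]:
  assumes f: "f \<in> borel_measurable M" and g: "g \<in> borel_measurable M"
  shows "(\<lambda>x. pt (f x) (g x)) \<in> borel_measurable M"
  unfolding pt_def
  by (intro borel_measurable_Pair borel_measurable_add borel_measurable_scaleR measurable_fst_snd_borel f g)

lemma sets_Kin: "sets Kin = sets B" "sets Kout = sets B"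
  by (auto simp: Kin_def Kout_def)

lemma measurable_KinI [measurable (raw)]: "f \<in> measurable borel N \<Longrightarrow> f \<in> measurable Kin N"
  using measurable_BI measurable_cong_sets[OF sets_Kin(1) refl] by blast

lemma measurable_KoutI [measurable (raw)]: "f \<in> measurable borel N \<Longrightarrow> f \<in> measurable Kout N"
  using measurable_BI measurable_cong_sets[OF sets_Kin(2) refl] by blast

lemma nn_integral_Kin:
  assumes [measurable]: "F \<in> borel_measurable borel"
  shows "(\<integral>\<^sup>+p. F p \<partial>Kin) = (\<integral>\<^sup>+w. (\<integral>\<^sup>+y. indicator (inflow w) y * ennreal (- (w \<bullet> nub y)) * F (y, w) \<partial>hausdorff_measure) \<partial>sphere_measure)"
proof -
  have "(\<integral>\<^sup>+p. F p \<partial>Kin) = (\<integral>\<^sup>+p. ennreal (- (snd p \<bullet> nub (fst p))) * F p \<partial>B)"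
    unfolding Kin_def by (rule nn_integral_density) (auto intro!: measurable_BI)
  also have "\<dots> = (\<integral>\<^sup>+w. (\<integral>\<^sup>+y. indicator (frontier \<Omega>) y * (ennreal (- (w \<bullet> nub y)) * F (y, w)) \<partial>hausdorff_measure) \<partial>sphere_measure)"
    by (subst nn_integral_B) auto
  also have "\<dots> = (\<integral>\<^sup>+w. (\<integral>\<^sup>+y. indicator (inflow w) y * ennreal (- (w \<bullet> nub y)) * F (y, w) \<partial>hausdorff_measure) \<partial>sphere_measure)"
    by (intro nn_integral_cong) (auto simp: indicator_def inflow_def ennreal_neg)
  finally show ?thesis .
qed

lemma nn_integral_Kout:
  assumes [measurable]: "F \<in> borel_measurable borel"
  shows "(\<integral>\<^sup>+p. F p \<partial>Kout) = (\<integral>\<^sup>+w. (\<integral>\<^sup>+y. indicator (inflow (- w)) y * ennreal (w \<bullet> nub y) * F (y, w) \<partial>hausdorff_measure) \<partial>sphere_measure)"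
proof -
  have "(\<integral>\<^sup>+p. F p \<partial>Kout) = (\<integral>\<^sup>+p. ennreal (snd p \<bullet> nub (fst p)) * F p \<partial>B)"
    unfolding Kout_def by (rule nn_integral_density) (auto intro!: measurable_BI)
  also have "\<dots> = (\<integral>\<^sup>+w. (\<integral>\<^sup>+y. indicator (frontier \<Omega>) y * (ennreal (w \<bullet> nub y) * F (y, w)) \<partial>hausdorff_measure) \<partial>sphere_measure)"
    by (subst nn_integral_B) auto
  also have "\<dots> = (\<integral>\<^sup>+w. (\<integral>\<^sup>+y. indicator (inflow (- w)) y * ennreal (w \<bullet> nub y) * F (y, w) \<partial>hausdorff_measure) \<partial>sphere_measure)"
    by (intro nn_integral_cong) (auto simp: indicator_def inflow_def ennreal_neg)
  finally show ?thesis .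
qed

lemma interval_indicator_measurable [measurable]:
  "(\<lambda>(p, s). indicator {0<..<T p} s :: ennreal) \<in> borel_measurable (borel \<Otimes>\<^sub>M borel)"
  "(\<lambda>(p, s). indicator {0<..<T p} s :: real) \<in> borel_measurable (borel \<Otimes>\<^sub>M borel)"
  unfolding indicator_def greaterThanLessThan_iff by measurable

text \<open>The disintegration of the volume for each direction, integrated over the sphere. Volume
  is measured by Lebesgue measure and \<open>Kin\<close> by \<open>hausdorff2\<close>, which is why
  \<open>planar_const\<close> enters.\<close>

lemma lines_V:
  assumes [measurable]: "F \<in> borel_measurable borel"
  shows "ennreal planar_const * (\<integral>\<^sup>+p. F p \<partial>V) = (\<integral>\<^sup>+p. (\<integral>\<^sup>+s. indicator {0<..<T p} s * F (pt p s) \<partial>lborel) \<partial>Kin)"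
proof -
  define H where "H p = (\<integral>\<^sup>+s. indicator {0<..<T p} s * F (pt p s) \<partial>lborel)" for p
  have [measurable]: "H \<in> borel_measurable borel" unfolding H_def[abs_def] by measurable
  have Fw: "(\<lambda>x. F (x, w)) \<in> borel_measurable borel" for w by measurable
  have sm: "(\<lambda>w. \<integral>\<^sup>+x. indicator \<Omega> x * F (x, w) \<partial>lborel) \<in> borel_measurable sphere_measure"
    by (intro measurable_sphereI) measurable
  have "ennreal planar_const * (\<integral>\<^sup>+p. F p \<partial>V)
     = (\<integral>\<^sup>+w. ennreal planar_const * (\<integral>\<^sup>+x. indicator \<Omega> x * F (x, w) \<partial>lborel) \<partial>sphere_measure)"
    unfolding nn_integral_V(2)[OF assms] by (rule nn_integral_cmult[OF sm, symmetric])
  also have "\<dots> = (\<integral>\<^sup>+w. (\<integral>\<^sup>+y. indicator (inflow w) y * ennreal (- (w \<bullet> nub y)) * H (y, w) \<partial>hausdorff_measure) \<partial>sphere_measure)"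
    by (intro nn_integral_cong) (simp add: lines_integral[OF _ Fw] H_def pt_def)
  also have "\<dots> = (\<integral>\<^sup>+p. H p \<partial>Kin)" by (rule nn_integral_Kin[symmetric]) measurable
  finally show ?thesis unfolding H_def .
qed

text \<open>The map to the exit point carries the inflow flux to the outflow flux, by
  \<open>exit_integral\<close> for each direction.\<close>

lemma Kout_Kin:
  assumes [measurable]: "G \<in> borel_measurable borel"
  shows "(\<integral>\<^sup>+p. G p \<partial>Kout) = (\<integral>\<^sup>+p. G (ext p) \<partial>Kin)"
proof -
  have [measurable]: "(\<lambda>p. G (ext p)) \<in> borel_measurable borel" by measurable
  have Gw: "(\<lambda>x. G (x, w)) \<in> borel_measurable borel" for w by measurable
  show ?thesis
    unfolding nn_integral_Kout[OF assms]
    by (subst nn_integral_Kin, measurable, rule nn_integral_cong)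
      (simp add: exit_integral[OF _ Gw] pt_def)
qed

lemma AE_Kin: "AE p in Kin. norm (snd p) = 1 \<and> fst p \<in> inflow (snd p)"
proof -
  have "AE p in B. 0 < ennreal (- (snd p \<bullet> nub (fst p))) \<longrightarrow> norm (snd p) = 1 \<and> fst p \<in> inflow (snd p)"
    by (rule AE_I2) (auto simp: space_B inflow_def)
  then show ?thesis unfolding Kin_def by (subst AE_density) (auto intro!: measurable_BI)
qed

end

section \<open>Fubini along chords and absolute continuity\<close>

context c3_dom
begin

lemma pos_c: "0 < planar_const" by (rule planar_const(1))

lemma finite_Kin: "finite_measure Kin"
proof (rule finite_measureI)
  interpret B: finite_measure B by (rule finite_B)
  have "emeasure Kin (space Kin) = (\<integral>\<^sup>+p. 1 \<partial>Kin)" by simp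
  also have "\<dots> = (\<integral>\<^sup>+p. ennreal (- (snd p \<bullet> nub (fst p))) * 1 \<partial>B)"
    unfolding Kin_def by (rule nn_integral_density) (auto intro!: measurable_BI)
  also have "\<dots> \<le> (\<integral>\<^sup>+p. 1 \<partial>B)"
  proof (rule nn_integral_mono)
    fix p assume "p \<in> space B"
    then have "norm (snd p) = 1" "norm (nub (fst p)) = 1" using nu_norm by (auto simp: space_B)
    then have "- (snd p \<bullet> nub (fst p)) \<le> 1"
      using Cauchy_Schwarz_ineq2[of "snd p" "nub (fst p)"] by simp
    then have "ennreal (- (snd p \<bullet> nub (fst p))) \<le> ennreal 1" by (rule ennreal_leI)
    then show "ennreal (- (snd p \<bullet> nub (fst p))) * 1 \<le> 1" by simp
  qed
  also have "\<dots> = emeasure B (space B)" by simp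
  also have "\<dots> < top" by (simp add: less_top[symmetric])
  finally show "emeasure Kin (space Kin) \<noteq> \<infinity>" by simp
qed

lemma pair_Kin: "pair_sigma_finite Kin (lborel :: real measure)"
proof -
  interpret K: finite_measure Kin by (rule finite_Kin)
  show ?thesis ..
qed

lemma measurable_Kin_pairI: "f \<in> measurable (borel \<Otimes>\<^sub>M borel) N \<Longrightarrow> f \<in> measurable (Kin \<Otimes>\<^sub>M lborel) N"
proof -
  assume f: "f \<in> measurable (borel \<Otimes>\<^sub>M borel) N"
  have "(\<lambda>q. fst q) \<in> measurable (Kin \<Otimes>\<^sub>M lborel) borel"
    by (rule measurable_compose[OF measurable_fst]) (auto intro: measurable_KinI)
  moreover have "(\<lambda>q. snd q) \<in> measurable (Kin \<Otimes>\<^sub>M lborel) borel"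
    by (rule measurable_compose[OF measurable_snd]) simp
  ultimately have "(\<lambda>q. (fst q, snd q)) \<in> measurable (Kin \<Otimes>\<^sub>M lborel) (borel \<Otimes>\<^sub>M borel)" by (rule measurable_Pair)
  then have "(\<lambda>q. f (fst q, snd q)) \<in> measurable (Kin \<Otimes>\<^sub>M lborel) N" using f by (rule measurable_compose)
  then show ?thesis by simp
qed

text \<open>The signed form of \<open>lines_V\<close>. The measure of length along chords times
  \<open>Kin\<close> has image \<open>planar_const\<close> times \<open>V\<close>; once these
  measures are identified, Fubini's theorem for integrable functions gives all three
  statements.\<close>

lemma lines_integrable:
  fixes f :: "phase \<Rightarrow> real"
  assumes fm [measurable]: "f \<in> borel_measurable borel" and fi: "integrable V f"
  shows "AE p in Kin. set_integrable lborel {0<..<T p} (\<lambda>s. f (pt p s))"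
    "integrable Kin (\<lambda>p. LINT s:{0<..<T p}|lborel. f (pt p s))"
    "planar_const * (\<integral>p. f p \<partial>V) = (\<integral>p. (LINT s:{0<..<T p}|lborel. f (pt p s)) \<partial>Kin)"
proof -
  interpret PP: pair_sigma_finite Kin "lborel :: real measure" by (rule pair_Kin)
  define I where "I q = (indicator {0<..<T (fst q)} (snd q) :: real)" for q :: "phase \<times> real"
  define \<Phi> where "\<Phi> q = pt (fst q) (snd q)" for q :: "phase \<times> real"
  have Im: "I \<in> borel_measurable (borel \<Otimes>\<^sub>M borel)"
    using interval_indicator_measurable(2) by (simp add: I_def[abs_def] split_beta')
  have \<Phi>m: "\<Phi> \<in> borel_measurable (borel \<Otimes>\<^sub>M borel)" unfolding \<Phi>_def[abs_def] by measurable
  have IK: "I \<in> borel_measurable (Kin \<Otimes>\<^sub>M lborel)" by (rule measurable_Kin_pairI[OF Im])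
  have \<Phi>K: "\<Phi> \<in> borel_measurable (Kin \<Otimes>\<^sub>M lborel)" by (rule measurable_Kin_pairI[OF \<Phi>m])
  define L where "L = density (Kin \<Otimes>\<^sub>M lborel) (\<lambda>q. ennreal (I q))"
  have LI: "\<Phi> \<in> measurable L borel" using \<Phi>K by (simp add: L_def)
  have eq: "distr L borel \<Phi> = density (distr V borel (\<lambda>p. p)) (\<lambda>_. ennreal planar_const)"
  proof (rule measure_eqI)
    fix A assume "A \<in> sets (distr L borel \<Phi>)"
    then have A [measurable]: "A \<in> sets borel" by simp
    have iA: "(\<lambda>q. indicator A (\<Phi> q) :: ennreal) \<in> borel_measurable (Kin \<Otimes>\<^sub>M lborel)"
      using \<Phi>K by measurable
    have "emeasure (distr L borel \<Phi>) A = (\<integral>\<^sup>+p. indicator A p \<partial>distr L borel \<Phi>)" by simp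
    also have "\<dots> = (\<integral>\<^sup>+q. indicator A (\<Phi> q) \<partial>L)"
      using A by (intro nn_integral_distr[OF LI]) simp
    also have "\<dots> = (\<integral>\<^sup>+q. ennreal (I q) * indicator A (\<Phi> q) \<partial>(Kin \<Otimes>\<^sub>M lborel))"
      unfolding L_def using IK iA by (subst nn_integral_density) auto
    also have "\<dots> = (\<integral>\<^sup>+p. (\<integral>\<^sup>+s. ennreal (I (p, s)) * indicator A (\<Phi> (p, s)) \<partial>lborel) \<partial>Kin)"
      using IK iA by (subst lborel.nn_integral_fst) auto
    also have "\<dots> = (\<integral>\<^sup>+p. (\<integral>\<^sup>+s. indicator {0<..<T p} s * indicator A (pt p s) \<partial>lborel) \<partial>Kin)"
      by (simp add: I_def \<Phi>_def ennreal_indicator)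
    also have "\<dots> = ennreal planar_const * (\<integral>\<^sup>+p. indicator A p \<partial>V)"
      by (rule lines_V[symmetric]) measurable
    also have "\<dots> = emeasure (density (distr V borel (\<lambda>p. p)) (\<lambda>_. ennreal planar_const)) A"
    proof -
      have "emeasure (density (distr V borel (\<lambda>p. p)) (\<lambda>_. ennreal planar_const)) A
        = (\<integral>\<^sup>+p. ennreal planar_const * indicator A p \<partial>distr V borel (\<lambda>p. p))"
        by (rule emeasure_density) auto
      also have "\<dots> = (\<integral>\<^sup>+p. ennreal planar_const * indicator A p \<partial>V)"
        by (rule nn_integral_distr) (auto intro: measurable_VI)
      also have "\<dots> = ennreal planar_const * (\<integral>\<^sup>+p. indicator A p \<partial>V)"
        by (rule nn_integral_cmult) (auto intro: measurable_VI)
      finally show ?thesis ..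
    qed
    finally show "emeasure (distr L borel \<Phi>) A = emeasure (density (distr V borel (\<lambda>p. p)) (\<lambda>_. ennreal planar_const)) A" .
  qed simp
  have idV: "(\<lambda>p. p) \<in> measurable V borel" by (rule measurable_id_V)
  have f\<Phi>: "(\<lambda>q. f (\<Phi> q)) \<in> borel_measurable (Kin \<Otimes>\<^sub>M lborel)" using \<Phi>K by measurable
  have I0: "AE q in Kin \<Otimes>\<^sub>M lborel. 0 \<le> I q" by (simp add: I_def)
  have int: "integrable (Kin \<Otimes>\<^sub>M lborel) (\<lambda>q. I q *\<^sub>R f (\<Phi> q))"
  proof -
    have "integrable (distr V borel (\<lambda>p. p)) f" using fi by (subst integrable_distr_eq[OF idV]) auto
    then have "integrable (density (distr V borel (\<lambda>p. p)) (\<lambda>_. ennreal planar_const)) f"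
      using pos_c by (subst integrable_density) auto
    then have "integrable L (\<lambda>q. f (\<Phi> q))" using integrable_distr_eq[OF LI fm] by (simp add: eq)
    then show ?thesis unfolding L_def using integrable_density[OF f\<Phi> IK I0] by simp
  qed
  have val: "(\<integral>q. I q *\<^sub>R f (\<Phi> q) \<partial>(Kin \<Otimes>\<^sub>M lborel)) = planar_const * (\<integral>p. f p \<partial>V)"
  proof -
    have "(\<integral>q. I q *\<^sub>R f (\<Phi> q) \<partial>(Kin \<Otimes>\<^sub>M lborel)) = (\<integral>q. f (\<Phi> q) \<partial>L)"
      unfolding L_def using integral_density[OF f\<Phi> IK I0] by simp
    also have "\<dots> = (\<integral>p. f p \<partial>distr L borel \<Phi>)" by (rule integral_distr[OF LI fm, symmetric])
    also have "\<dots> = (\<integral>p. planar_const *\<^sub>R f p \<partial>distr V borel (\<lambda>p. p))"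
      unfolding eq using pos_c by (intro integral_density) auto
    also have "\<dots> = (\<integral>p. planar_const *\<^sub>R f p \<partial>V)" by (rule integral_distr[OF idV]) auto
    finally show ?thesis by simp
  qed
  have F: "AE p in Kin. integrable lborel (\<lambda>s. I (p, s) *\<^sub>R f (\<Phi> (p, s)))"
    by (rule PP.AE_integrable_fst'[OF int])
  then show "AE p in Kin. set_integrable lborel {0<..<T p} (\<lambda>s. f (pt p s))"
    by (simp add: set_integrable_def I_def \<Phi>_def)
  have "integrable Kin (\<lambda>p. \<integral>s. I (p, s) *\<^sub>R f (\<Phi> (p, s)) \<partial>lborel)" by (rule PP.integrable_fst'[OF int])
  then show "integrable Kin (\<lambda>p. LINT s:{0<..<T p}|lborel. f (pt p s))"
    by (simp add: set_lebesgue_integral_def I_def \<Phi>_def)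
  have "(\<integral>p. (\<integral>s. I (p, s) *\<^sub>R f (\<Phi> (p, s)) \<partial>lborel) \<partial>Kin) = (\<integral>q. I q *\<^sub>R f (\<Phi> q) \<partial>(Kin \<Otimes>\<^sub>M lborel))"
    by (rule PP.integral_fst'[OF int])
  then show "planar_const * (\<integral>p. f p \<partial>V) = (\<integral>p. (LINT s:{0<..<T p}|lborel. f (pt p s)) \<partial>Kin)"
    unfolding val by (simp add: set_lebesgue_integral_def I_def \<Phi>_def)
qed

text \<open>The exceptional set has volume 0, so almost every chord meets it in length 0.\<close>

lemma AE_V_lines:
  assumes Pm: "Measurable.pred borel P" and ae: "AE p in V. P p"
  shows "AE p in Kin. AE s in lborel. s \<in> {0<..<T p} \<longrightarrow> P (pt p s)"
proof -
  have [measurable]: "{p. \<not> P p} \<in> sets borel" using Pm by measurable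
  have "(\<integral>\<^sup>+p. indicator {p. \<not> P p} p \<partial>V) = (\<integral>\<^sup>+p. 0 \<partial>V)"
    using ae by (intro nn_integral_cong_AE) (auto simp: indicator_def)
  then have "(\<integral>\<^sup>+p. (\<integral>\<^sup>+s. indicator {0<..<T p} s * indicator {p. \<not> P p} (pt p s) \<partial>lborel) \<partial>Kin) = 0"
    by (subst lines_V[symmetric]) auto
  then have "AE p in Kin. (\<integral>\<^sup>+s. indicator {0<..<T p} s * indicator {p. \<not> P p} (pt p s) \<partial>lborel) = 0"
    by (subst (asm) nn_integral_0_iff_AE) (auto intro!: measurable_KinI)
  then show ?thesis
  proof (rule eventually_mono)
    fix p assume "(\<integral>\<^sup>+s. indicator {0<..<T p} s * indicator {p. \<not> P p} (pt p s) \<partial>lborel) = 0"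
    then have "AE s in lborel. (indicator {0<..<T p} s * indicator {p. \<not> P p} (pt p s) :: ennreal) = 0"
      by (subst (asm) nn_integral_0_iff_AE) auto
    then show "AE s in lborel. s \<in> {0<..<T p} \<longrightarrow> P (pt p s)"
      by (rule eventually_mono) (auto simp: indicator_def split: if_splits)
  qed
qed

text \<open>The condition includes \<open>s = T p\<close>, so that \<open>A (ext p)\<close> is the
  outgoing trace. At the start the value \<open>A0 p\<close> is kept apart from \<open>A p\<close>,
  since the solution formula is read off for positive \<open>s\<close> only.\<close>

definition on_line :: "(phase \<Rightarrow> real) \<Rightarrow> (phase \<Rightarrow> real) \<Rightarrow> (phase \<Rightarrow> real)
   \<Rightarrow> phase \<Rightarrow> bool" where
  "on_line A0 A a p \<longleftrightarrow> set_integrable lborel {0<..<T p} (\<lambda>s. a (pt p s)) \<and>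
     (\<forall>s. 0 < s \<longrightarrow> s \<le> T p \<longrightarrow> A (pt p s) = A0 p + (LINT t:{0<..<s}|lborel. a (pt p t)))"

text \<open>\<open>A\<close> is absolutely continuous along almost every characteristic, with initial value \<open>A0\<close> on
  \<open>\<Gamma>\<^sup>-\<close> and derivative \<open>a\<close>.\<close>
definition line_ac :: "(phase \<Rightarrow> real) \<Rightarrow> (phase \<Rightarrow> real) \<Rightarrow> (phase \<Rightarrow> real) \<Rightarrow> bool" where
  "line_ac A0 A a \<longleftrightarrow> A0 \<in> borel_measurable borel \<and> A \<in> borel_measurable borel \<and> a \<in> borel_measurable borel \<and>
     (AE p in Kin. on_line A0 A a p)"

lemma line_ac_measurable:
  assumes "line_ac A0 A a"
  shows "A0 \<in> borel_measurable borel" "A \<in> borel_measurable borel" "a \<in> borel_measurable borel"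
  using assms by (auto simp: line_ac_def)

lemma AE_Kin_pos: "AE p in Kin. 0 < T p \<and> norm (snd p) = 1 \<and> fst p \<in> inflow (snd p)"
  using AE_Kin by eventually_elim (auto intro: exit_time_pos_inflow)

text \<open>Green's formula: the fundamental theorem on each chord up to the exit point, integrated
  against the inflow flux.\<close>

lemma line_ac_green:
  assumes ac: "line_ac A0 A a" and a: "integrable V a" and A0: "integrable Kin A0"
  shows "integrable Kin (\<lambda>p. A (ext p))"
    "planar_const * (\<integral>p. a p \<partial>V) = (\<integral>p. A (ext p) \<partial>Kin) - (\<integral>p. A0 p \<partial>Kin)"
proof -
  note [measurable] = line_ac_measurable[OF ac]
  note L = lines_integrable[OF line_ac_measurable(3)[OF ac] a]
  have ae: "AE p in Kin. A (ext p) = A0 p + (LINT s:{0<..<T p}|lborel. a (pt p s))"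
  proof -
    have "AE p in Kin. on_line A0 A a p \<and> 0 < T p"
      using ac AE_Kin_pos unfolding line_ac_def by auto
    then show ?thesis by (rule eventually_mono) (auto simp: on_line_def)
  qed
  have i: "integrable Kin (\<lambda>p. A0 p + (LINT s:{0<..<T p}|lborel. a (pt p s)))"
    using A0 L(2) by (rule Bochner_Integration.integrable_add)
  have m1: "(\<lambda>p. A (ext p)) \<in> borel_measurable Kin" by (rule measurable_KinI) measurable
  have m2: "(\<lambda>p. A0 p + (LINT s:{0<..<T p}|lborel. a (pt p s))) \<in> borel_measurable Kin"
    using i by (rule borel_measurable_integrable)
  show "integrable Kin (\<lambda>p. A (ext p))"
    using i integrable_cong_AE[OF m1 m2 ae] by simp
  have "(\<integral>p. A (ext p) \<partial>Kin) = (\<integral>p. A0 p + (LINT s:{0<..<T p}|lborel. a (pt p s)) \<partial>Kin)"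
    by (rule integral_cong_AE[OF m1 m2 ae])
  also have "\<dots> = (\<integral>p. A0 p \<partial>Kin) + planar_const * (\<integral>p. a p \<partial>V)"
    unfolding L(3) using A0 L(2) by (rule Bochner_Integration.integral_add)
  finally show "planar_const * (\<integral>p. a p \<partial>V) = (\<integral>p. A (ext p) \<partial>Kin) - (\<integral>p. A0 p \<partial>Kin)" by simp
qed

lemma line_ac_mult:
  assumes A: "line_ac A0 A a" and E: "line_ac E0 E e"
  shows "line_ac (\<lambda>p. A0 p * E0 p) (\<lambda>p. A p * E p) (\<lambda>p. a p * E p + A p * e p)"
proof -
  note [measurable] = line_ac_measurable[OF A] line_ac_measurable[OF E]
  have "AE p in Kin. on_line (\<lambda>p. A0 p * E0 p) (\<lambda>p. A p * E p) (\<lambda>p. a p * E p + A p * e p) p"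
    using A[unfolded line_ac_def, THEN conjunct2, THEN conjunct2, THEN conjunct2]
      E[unfolded line_ac_def, THEN conjunct2, THEN conjunct2, THEN conjunct2]
  proof eventually_elim
    fix p assume 1: "on_line A0 A a p" and 2: "on_line E0 E e p"
    have m: "(\<lambda>s. A (pt p s)) \<in> borel_measurable borel" "(\<lambda>s. E (pt p s)) \<in> borel_measurable borel" by measurable
    note pp = product_primitive[where T="T p" and f="\<lambda>s. a (pt p s)" and g="\<lambda>s. e (pt p s)"
        and F="\<lambda>s. A (pt p s)" and G="\<lambda>s. E (pt p s)" and ?F0.0="A0 p" and ?G0.0="E0 p"]
    show "on_line (\<lambda>p. A0 p * E0 p) (\<lambda>p. A p * E p) (\<lambda>p. a p * E p + A p * e p) p"
      using 1 2 m unfolding on_line_def by (intro conjI allI impI pp) auto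
  qed
  then show ?thesis unfolding line_ac_def by auto
qed

lemma line_ac_diff:
  assumes A: "line_ac A0 A a" and E: "line_ac E0 E e"
  shows "line_ac (\<lambda>p. A0 p - E0 p) (\<lambda>p. A p - E p) (\<lambda>p. a p - e p)"
proof -
  note [measurable] = line_ac_measurable[OF A] line_ac_measurable[OF E]
  have "AE p in Kin. on_line (\<lambda>p. A0 p - E0 p) (\<lambda>p. A p - E p) (\<lambda>p. a p - e p) p"
    using A[unfolded line_ac_def, THEN conjunct2, THEN conjunct2, THEN conjunct2]
      E[unfolded line_ac_def, THEN conjunct2, THEN conjunct2, THEN conjunct2]
  proof eventually_elim
    fix p assume 1: "on_line A0 A a p" and 2: "on_line E0 E e p"
    show "on_line (\<lambda>p. A0 p - E0 p) (\<lambda>p. A p - E p) (\<lambda>p. a p - e p) p"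
      unfolding on_line_def
    proof (intro conjI allI impI)
      show "set_integrable lborel {0<..<T p} (\<lambda>s. a (pt p s) - e (pt p s))"
        using 1 2 by (auto simp: on_line_def intro: set_integral_diff(1))
      fix s assume s: "0 < s" "s \<le> T p"
      then have sub: "{0<..<s} \<subseteq> {0<..<T p}" by auto
      have "set_integrable lborel {0<..<s} (\<lambda>s. a (pt p s))" "set_integrable lborel {0<..<s} (\<lambda>s. e (pt p s))"
        using 1 2 sub by (auto simp: on_line_def intro: set_integrable_subset)
      then have "(LINT t:{0<..<s}|lborel. a (pt p t) - e (pt p t))
         = (LINT t:{0<..<s}|lborel. a (pt p t)) - (LINT t:{0<..<s}|lborel. e (pt p t))"
        by (rule set_integral_diff(2))
      then show "A (pt p s) - E (pt p s) = A0 p - E0 p + (LINT t:{0<..<s}|lborel. a (pt p t) - e (pt p t))"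
        using 1 2 s by (simp add: on_line_def)
    qed
  qed
  then show ?thesis unfolding line_ac_def by auto
qed

text \<open>A change of the derivative on a null set of the volume is invisible to the integrals
  over almost every chord.\<close>

lemma line_ac_cong:
  assumes A: "line_ac A0 A a" and am: "a' \<in> borel_measurable borel" and ae: "AE p in V. a p = a' p"
  shows "line_ac A0 A a'"
proof -
  note [measurable] = line_ac_measurable[OF A] am
  have "AE p in Kin. AE s in lborel. s \<in> {0<..<T p} \<longrightarrow> a (pt p s) = a' (pt p s)"
    by (rule AE_V_lines[OF _ ae]) measurable
  then have "AE p in Kin. on_line A0 A a' p"
    using A[unfolded line_ac_def, THEN conjunct2, THEN conjunct2, THEN conjunct2]
  proof eventually_elim
    fix p assume e: "AE s in lborel. s \<in> {0<..<T p} \<longrightarrow> a (pt p s) = a' (pt p s)" and 1: "on_line A0 A a p"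
    have m [measurable]: "(\<lambda>s. a (pt p s)) \<in> borel_measurable borel" "(\<lambda>s. a' (pt p s)) \<in> borel_measurable borel" by measurable
    show "on_line A0 A a' p"
      unfolding on_line_def
    proof (intro conjI allI impI)
      have "integrable lborel (\<lambda>s. indicator {0<..<T p} s *\<^sub>R a (pt p s))
        \<longleftrightarrow> integrable lborel (\<lambda>s. indicator {0<..<T p} s *\<^sub>R a' (pt p s))"
        by (rule integrable_cong_AE) (auto intro!: eventually_mono[OF e] simp: indicator_def)
      then show "set_integrable lborel {0<..<T p} (\<lambda>s. a' (pt p s))"
        using 1 by (simp add: on_line_def set_integrable_def)
      fix s assume s: "0 < s" "s \<le> T p"
      have "(LINT t:{0<..<s}|lborel. a (pt p t)) = (LINT t:{0<..<s}|lborel. a' (pt p t))"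
        unfolding set_lebesgue_integral_def
        by (rule integral_cong_AE) (use s in \<open>auto intro!: eventually_mono[OF e] simp: indicator_def\<close>)
      then show "A (pt p s) = A0 p + (LINT t:{0<..<s}|lborel. a' (pt p t))"
        using 1 s by (simp add: on_line_def)
    qed
  qed
  then show ?thesis unfolding line_ac_def by auto
qed

lemma line_ac_C1:
  assumes cont: "continuous_on UNIV (\<lambda>p. \<phi> (fst p) (snd p))"
    and der: "\<And>x w. ((\<lambda>y. \<phi> y w) has_derivative D\<phi> x w) (at x)"
    and contD: "continuous_on UNIV (\<lambda>p. D\<phi> (fst p) (snd p) (snd p))"
  shows "line_ac (\<lambda>p. \<phi> (fst p) (snd p)) (\<lambda>p. \<phi> (fst p) (snd p)) (\<lambda>p. D\<phi> (fst p) (snd p) (snd p))"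
proof -
  have "on_line (\<lambda>p. \<phi> (fst p) (snd p)) (\<lambda>p. \<phi> (fst p) (snd p)) (\<lambda>p. D\<phi> (fst p) (snd p) (snd p)) p"
    if T: "0 < T p" for p
  proof -
    obtain x w where p: "p = (x, w)" by (cases p)
    have d: "((\<lambda>s. \<phi> (x + s *\<^sub>R w) w) has_real_derivative D\<phi> (x + s *\<^sub>R w) w w) (at s)" for s
    proof -
      have 1: "((\<lambda>s. x + s *\<^sub>R w) has_derivative (\<lambda>h. h *\<^sub>R w)) (at s)"
        by (auto intro!: derivative_eq_intros)
      have "((\<lambda>s. \<phi> (x + s *\<^sub>R w) w) has_derivative (\<lambda>h. D\<phi> (x + s *\<^sub>R w) w (h *\<^sub>R w))) (at s)"
        using has_derivative_compose[OF 1 der] .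
      moreover have "(\<lambda>h. D\<phi> (x + s *\<^sub>R w) w (h *\<^sub>R w)) = (\<lambda>h. h * D\<phi> (x + s *\<^sub>R w) w w)"
        using linear_cmul[OF has_derivative_linear[OF der[of w "x + s *\<^sub>R w"]]] by auto
      ultimately show ?thesis by (simp add: has_field_derivative_def mult_commute_abs)
    qed
    have c: "continuous_on UNIV (\<lambda>s. D\<phi> (x + s *\<^sub>R w) w w)"
    proof -
      have "continuous_on UNIV (\<lambda>s. (\<lambda>p. D\<phi> (fst p) (snd p) (snd p)) (x + s *\<^sub>R w, w))"
        by (rule continuous_on_compose2[OF contD]) (auto intro!: continuous_intros)
      then show ?thesis by simp
    qed
    show ?thesis
      unfolding on_line_def p
      using primitive_of_C1[OF d c] T p by auto
  qed
  then have "AE p in Kin. on_line (\<lambda>p. \<phi> (fst p) (snd p)) (\<lambda>p. \<phi> (fst p) (snd p)) (\<lambda>p. D\<phi> (fst p) (snd p) (snd p)) p"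
    by (intro eventually_mono[OF AE_Kin_pos]) blast
  then show ?thesis
    unfolding line_ac_def using cont contD by (auto intro: borel_measurable_continuous_onI)
qed

end

subsection \<open>The solution operator of the transport equation\<close>

lemma ennreal_square_add_le: "(x + y)\<^sup>2 \<le> 2 * x\<^sup>2 + 2 * y\<^sup>2" for x y :: ennreal
proof (cases "x = top \<or> y = top")
  case True
  then show ?thesis by (auto simp: power2_eq_square ennreal_mult_eq_top_iff)
next
  case False
  then obtain a b where ab: "x = ennreal a" "0 \<le> a" "y = ennreal b" "0 \<le> b"
    by (cases x; cases y) auto
  have "(a + b)\<^sup>2 \<le> 2 * a\<^sup>2 + 2 * b\<^sup>2"
    using zero_le_power2[of "a - b"] unfolding power2_eq_square by (simp add: algebra_simps)
  then have "ennreal ((a + b)\<^sup>2) \<le> ennreal (2 * a\<^sup>2 + 2 * b\<^sup>2)" by (rule ennreal_leI)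
  moreover have "ennreal (2 * a\<^sup>2 + 2 * b\<^sup>2) = 2 * ennreal (a\<^sup>2) + 2 * ennreal (b\<^sup>2)"
    by (subst ennreal_plus) (auto simp: ennreal_mult')
  moreover have "(ennreal a + ennreal b)\<^sup>2 = ennreal ((a + b)\<^sup>2)"
    using ab by (simp add: ennreal_power ennreal_plus[symmetric] del: ennreal_plus)
  ultimately show ?thesis using ab by (simp add: ennreal_power)
qed

lemma nn_integral_square_interval:
  fixes f :: "real \<Rightarrow> ennreal"
  assumes [measurable]: "f \<in> borel_measurable borel" and L: "0 \<le> L"
  shows "(\<integral>\<^sup>+t. indicator {0<..<L} t * f t \<partial>lborel)\<^sup>2 \<le> ennreal L * (\<integral>\<^sup>+t. indicator {0<..<L} t * (f t)\<^sup>2 \<partial>lborel)"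
proof -
  have "(\<integral>\<^sup>+t. indicator {0<..<L} t * f t \<partial>lborel)\<^sup>2
    = (\<integral>\<^sup>+t. indicator {0<..<L} t * (indicator {0<..<L} t * f t) \<partial>lborel)\<^sup>2"
    by (intro arg_cong[where f="\<lambda>x. x\<^sup>2"] nn_integral_cong) (auto simp: indicator_def)
  also have "\<dots> \<le> (\<integral>\<^sup>+t. (indicator {0<..<L} t)\<^sup>2 \<partial>lborel) * (\<integral>\<^sup>+t. (indicator {0<..<L} t * f t)\<^sup>2 \<partial>lborel)"
    by (rule Cauchy_Schwarz_nn_integral) auto
  also have "(\<integral>\<^sup>+t. (indicator {0<..<L} t :: ennreal)\<^sup>2 \<partial>lborel) = (\<integral>\<^sup>+t. indicator {0<..<L} t \<partial>lborel)"
    by (intro nn_integral_cong) (auto simp: indicator_def)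
  also have "\<dots> = ennreal L" using L by simp
  also have "(\<integral>\<^sup>+t. (indicator {0<..<L} t * f t)\<^sup>2 \<partial>lborel) = (\<integral>\<^sup>+t. indicator {0<..<L} t * (f t)\<^sup>2 \<partial>lborel)"
    by (intro nn_integral_cong) (auto simp: indicator_def)
  finally show ?thesis .
qed

context c3_dom
begin

text \<open>The time elapsed since entry. Together with \<open>orig\<close> it depends measurably on
  the phase point, which makes the solution along chords a function on phase space.\<close>

definition btime :: "phase \<Rightarrow> real" where
  "btime p = \<tau> (fst p) (- snd p)"

definition orig :: "phase \<Rightarrow> phase" where
  "orig p = pt p (- btime p)"

lemma back_measurable [measurable]: "btime \<in> borel_measurable borel"
  unfolding btime_def[abs_def] by measurable

lemma orig_measurable [measurable]: "orig \<in> borel_measurable borel"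
  unfolding orig_def[abs_def] by measurable

lemma btime_pt:
  assumes "norm (snd p) = 1" "fst p \<in> inflow (snd p)" "0 < s" "s \<le> T p"
  shows "btime (pt p s) = s" "orig (pt p s) = p"
proof -
  show b: "btime (pt p s) = s"
    using assms by (auto simp: btime_def inflow_def intro!: back_time)
  show "orig (pt p s) = p" unfolding orig_def b by (simp add: pt_def)
qed

lemma T_le: "norm (snd p) = 1 \<Longrightarrow> fst p \<in> inflow (snd p) \<Longrightarrow> T p \<le> 2 * rad"
  using exit_time_le[of "fst p" "snd p"] rad(2)[OF inflow_frontier(2)] by fastforce

context
  fixes \<epsilon> :: real
  assumes eps: "0 < \<epsilon>" "\<epsilon> < 1"
begin

text \<open>Solution operator of \<open>\<epsilon> w \<bullet> \<nabla>u + u = F\<close>, \<open>u = c g\<close> on \<open>\<Gamma>\<^sup>-\<close>; here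
  \<open>c\<close> is the constant relating Hausdorff and Lebesgue measure of planar sets.\<close>
definition TR :: "(phase \<Rightarrow> ennreal) \<Rightarrow> (phase \<Rightarrow> ennreal) \<Rightarrow> phase \<Rightarrow> ennreal" where
  "TR F g p = ennreal (exp (- btime p / \<epsilon>)) * (ennreal planar_const * g (orig p) +
     ennreal (1 / \<epsilon>) * (\<integral>\<^sup>+t. indicator {0<..<btime p} t * (ennreal (exp (t / \<epsilon>)) * F (pt (orig p) t)) \<partial>lborel))"

lemma back_indicator_measurable [measurable]:
  "(\<lambda>(p, s). indicator {0<..<btime p} s :: ennreal) \<in> borel_measurable (borel \<Otimes>\<^sub>M borel)"
  unfolding indicator_def greaterThanLessThan_iff by measurable

lemma TR_measurable [measurable]:
  assumes [measurable]: "F \<in> borel_measurable borel" "g \<in> borel_measurable borel"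
  shows "TR F g \<in> borel_measurable borel"
proof -
  have "(\<lambda>(p, t). indicator {0<..<btime p} t * (ennreal (exp (t / \<epsilon>)) * F (pt (orig p) t))) \<in> borel_measurable (borel \<Otimes>\<^sub>M lborel)"
    by measurable
  from lborel.borel_measurable_nn_integral[OF this]
  have [measurable]: "(\<lambda>p. \<integral>\<^sup>+t. indicator {0<..<btime p} t * (ennreal (exp (t / \<epsilon>)) * F (pt (orig p) t)) \<partial>lborel) \<in> borel_measurable borel"
    by simp
  show ?thesis unfolding TR_def[abs_def] by measurable
qed

lemma TR_mono: "(\<And>p. F p \<le> F' p) \<Longrightarrow> TR F g p \<le> TR F' g p"
  unfolding TR_def by (intro mult_left_mono add_left_mono nn_integral_mono) auto

text \<open>Monotone convergence, valid without integrability because the operator takes extended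
  nonnegative values. It makes the limit of the iteration a fixed point.\<close>

lemma TR_SUP:
  assumes F: "\<And>n. F n \<in> borel_measurable borel" and inc: "\<And>p. incseq (\<lambda>n. F n p)"
  shows "TR (\<lambda>p. SUP n. F n p) g p = (SUP n. TR (F n) g p)"
proof -
  have m: "(\<lambda>t. indicator {0<..<btime p} t * (ennreal (exp (t / \<epsilon>)) * F n (pt (orig p) t))) \<in> borel_measurable lborel" for n
    using F by measurable
  have i: "incseq (\<lambda>n t. indicator {0<..<btime p} t * (ennreal (exp (t / \<epsilon>)) * F n (pt (orig p) t)))"
  proof -
    have "F m q \<le> F n q" if "m \<le> n" for m n q using inc[of q] that by (rule incseqD)
    then show ?thesis
      unfolding incseq_def le_fun_def by (intro allI impI mult_left_mono) auto
  qed
  have "(\<integral>\<^sup>+t. indicator {0<..<btime p} t * (ennreal (exp (t / \<epsilon>)) * (SUP n. F n (pt (orig p) t))) \<partial>lborel)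
    = (SUP n. \<integral>\<^sup>+t. indicator {0<..<btime p} t * (ennreal (exp (t / \<epsilon>)) * F n (pt (orig p) t)) \<partial>lborel)"
    using nn_integral_monotone_convergence_SUP[OF i m] by (simp add: SUP_mult_left_ennreal image_comp)
  then show ?thesis
    unfolding TR_def by (simp add: SUP_mult_left_ennreal ennreal_SUP_add_right)
qed

lemma TR_line:
  assumes "norm (snd p) = 1" "fst p \<in> inflow (snd p)" "0 < s" "s \<le> T p"
  shows "TR F g (pt p s) = ennreal (exp (- s / \<epsilon>)) * (ennreal planar_const * g p +
     ennreal (1 / \<epsilon>) * (\<integral>\<^sup>+t. indicator {0<..<s} t * (ennreal (exp (t / \<epsilon>)) * F (pt p t)) \<partial>lborel))"
  unfolding TR_def btime_pt[OF assms] ..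

text \<open>On a chord the product of the two exponentials is at most 1, and the Cauchy-Schwarz
  inequality costs the chord length, at most \<open>2 * rad\<close>. The constants depend on
  \<open>\<epsilon>\<close>: this lemma supplies finiteness, the quantitative bound comes from the
  energy inequality.\<close>

lemma TR_L2:
  assumes F [measurable]: "F \<in> borel_measurable borel" and g [measurable]: "g \<in> borel_measurable borel"
    and F2: "(\<integral>\<^sup>+p. (F p)\<^sup>2 \<partial>V) < top" and g2: "(\<integral>\<^sup>+p. (g p)\<^sup>2 \<partial>Kin) < top"
  shows "(\<integral>\<^sup>+p. (TR F g p)\<^sup>2 \<partial>V) < top"
proof -
  define I where "I p = (\<integral>\<^sup>+s. indicator {0<..<T p} s * (F (pt p s))\<^sup>2 \<partial>lborel)" for p
  have Im: "I \<in> borel_measurable borel" unfolding I_def[abs_def] by measurable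
  define k1 k2 where "k1 = ennreal (2 * rad) * (2 * ennreal (planar_const\<^sup>2))"
    and "k2 = ennreal (2 * rad) * (2 * ennreal (1 / \<epsilon>\<^sup>2) * ennreal (2 * rad))"
  have "ennreal planar_const * (\<integral>\<^sup>+p. (TR F g p)\<^sup>2 \<partial>V)
    = (\<integral>\<^sup>+p. (\<integral>\<^sup>+s. indicator {0<..<T p} s * (TR F g (pt p s))\<^sup>2 \<partial>lborel) \<partial>Kin)"
    by (rule lines_V) measurable
  also have "\<dots> \<le> (\<integral>\<^sup>+p. k1 * (g p)\<^sup>2 + k2 * I p \<partial>Kin)"
  proof (rule nn_integral_mono_AE, rule eventually_mono[OF AE_Kin_pos])
    fix p assume p: "0 < T p \<and> norm (snd p) = 1 \<and> fst p \<in> inflow (snd p)"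
    have Fp [measurable]: "(\<lambda>s. F (pt p s)) \<in> borel_measurable borel" by measurable
    define J where "J = (\<integral>\<^sup>+s. indicator {0<..<T p} s * F (pt p s) \<partial>lborel)"
    have J2: "J\<^sup>2 \<le> ennreal (2 * rad) * I p"
    proof -
      have "J\<^sup>2 \<le> ennreal (T p) * I p"
        unfolding J_def I_def using p by (intro nn_integral_square_interval) auto
      also have "\<dots> \<le> ennreal (2 * rad) * I p"
        using p T_le[of p] by (intro mult_right_mono ennreal_leI) auto
      finally show ?thesis .
    qed
    define b where "b = 2 * (ennreal (planar_const\<^sup>2) * (g p)\<^sup>2) + 2 * (ennreal (1 / \<epsilon>\<^sup>2) * (ennreal (2 * rad) * I p))"
    have bound: "(TR F g (pt p s))\<^sup>2 \<le> b" if s: "0 < s" "s < T p" for s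
    proof -
      have "TR F g (pt p s) = ennreal (exp (- s / \<epsilon>)) * (ennreal planar_const * g p) +
         ennreal (1 / \<epsilon>) * (\<integral>\<^sup>+t. ennreal (exp (- s / \<epsilon>)) * (indicator {0<..<s} t * (ennreal (exp (t / \<epsilon>)) * F (pt p t))) \<partial>lborel)"
      proof -
        define X where "X = (\<integral>\<^sup>+t. indicator {0<..<s} t * (ennreal (exp (t / \<epsilon>)) * F (pt p t)) \<partial>lborel)"
        have "(\<integral>\<^sup>+t. ennreal (exp (- s / \<epsilon>)) * (indicator {0<..<s} t * (ennreal (exp (t / \<epsilon>)) * F (pt p t))) \<partial>lborel)
          = ennreal (exp (- s / \<epsilon>)) * X"
          unfolding X_def by (rule nn_integral_cmult) measurable
        moreover have "TR F g (pt p s) = ennreal (exp (- s / \<epsilon>)) * (ennreal planar_const * g p + ennreal (1 / \<epsilon>) * X)"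
          unfolding X_def using p s by (intro TR_line) auto
        ultimately show ?thesis by (simp only: distrib_left mult.left_commute)
      qed
      also have "\<dots> \<le> 1 * (ennreal planar_const * g p) + ennreal (1 / \<epsilon>) * J"
        unfolding J_def
      proof (intro add_mono mult_right_mono mult_left_mono nn_integral_mono)
        show "ennreal (exp (- s / \<epsilon>)) \<le> 1" using s eps by simp
        fix t
        show "ennreal (exp (- s / \<epsilon>)) * (indicator {0<..<s} t * (ennreal (exp (t / \<epsilon>)) * F (pt p t))) \<le> indicator {0<..<T p} t * F (pt p t)"
        proof (cases "t \<in> {0<..<s}")
          case True
          have "ennreal (exp (- s / \<epsilon>)) * ennreal (exp (t / \<epsilon>)) = ennreal (exp ((t - s) / \<epsilon>))"
            by (simp add: ennreal_mult'[symmetric] exp_add[symmetric] diff_divide_distrib)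
          also have "\<dots> \<le> 1" using True eps by (simp add: divide_le_0_iff)
          finally have "ennreal (exp (- s / \<epsilon>)) * ennreal (exp (t / \<epsilon>)) * F (pt p t) \<le> 1 * F (pt p t)"
            by (rule mult_right_mono) simp
          then show ?thesis using True s by (simp add: mult.assoc)
        qed simp
      qed auto
      finally have "(TR F g (pt p s))\<^sup>2 \<le> (ennreal planar_const * g p + ennreal (1 / \<epsilon>) * J)\<^sup>2"
        by (intro power_mono) auto
      also have "\<dots> \<le> 2 * (ennreal planar_const * g p)\<^sup>2 + 2 * (ennreal (1 / \<epsilon>) * J)\<^sup>2"
        by (rule ennreal_square_add_le)
      also have "\<dots> = 2 * (ennreal (planar_const\<^sup>2) * (g p)\<^sup>2) + 2 * (ennreal (1 / \<epsilon>\<^sup>2) * J\<^sup>2)"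
        using eps pos_c by (simp add: power_mult_distrib ennreal_power power_one_over)
      also have "\<dots> \<le> b" unfolding b_def by (intro add_left_mono mult_left_mono J2) auto
      finally show ?thesis .
    qed
    have "(\<integral>\<^sup>+s. indicator {0<..<T p} s * (TR F g (pt p s))\<^sup>2 \<partial>lborel) \<le> (\<integral>\<^sup>+s. indicator {0<..<T p} s * b \<partial>lborel)"
      by (intro nn_integral_mono) (auto simp: indicator_def bound)
    also have "\<dots> = ennreal (T p) * b" using p by (subst nn_integral_multc) auto
    also have "\<dots> \<le> ennreal (2 * rad) * b"
      using p T_le[of p] by (intro mult_right_mono ennreal_leI) auto
    also have "\<dots> = k1 * (g p)\<^sup>2 + k2 * I p"
      by (simp add: k1_def k2_def b_def distrib_left mult.assoc)
    finally show "(\<integral>\<^sup>+s. indicator {0<..<T p} s * (TR F g (pt p s))\<^sup>2 \<partial>lborel) \<le> k1 * (g p)\<^sup>2 + k2 * I p" .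
  qed
  also have "\<dots> = k1 * (\<integral>\<^sup>+p. (g p)\<^sup>2 \<partial>Kin) + k2 * (\<integral>\<^sup>+p. I p \<partial>Kin)"
    using Im g by (subst nn_integral_add) (auto intro!: measurable_KinI simp: nn_integral_cmult)
  also have "(\<integral>\<^sup>+p. I p \<partial>Kin) = ennreal planar_const * (\<integral>\<^sup>+p. (F p)\<^sup>2 \<partial>V)"
    unfolding I_def by (rule lines_V[symmetric]) measurable
  also have "k1 * (\<integral>\<^sup>+p. (g p)\<^sup>2 \<partial>Kin) + k2 * (ennreal planar_const * (\<integral>\<^sup>+p. (F p)\<^sup>2 \<partial>V)) < top"
    using F2 g2 by (simp add: k1_def k2_def ennreal_mult_less_top)
  finally show ?thesis using pos_c by (auto simp: ennreal_mult_less_top)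
qed

text \<open>After multiplication by the integrating factor \<open>exp (s / \<epsilon>)\<close> the
  formula is a primitive by definition. The product rule with the decaying exponential undoes this
  and produces the derivative.\<close>

lemma TR_ac:
  assumes F [measurable]: "F \<in> borel_measurable borel" and g [measurable]: "g \<in> borel_measurable borel"
    and F2: "(\<integral>\<^sup>+p. (F p)\<^sup>2 \<partial>V) < top" and g2: "(\<integral>\<^sup>+p. (g p)\<^sup>2 \<partial>Kin) < top"
  shows "line_ac (\<lambda>p. planar_const * enn2real (g p)) (\<lambda>p. enn2real (TR F g p))
     (\<lambda>p. (enn2real (F p) - enn2real (TR F g p)) / \<epsilon>)"
proof -
  define I where "I p = (\<integral>\<^sup>+s. indicator {0<..<T p} s * (F (pt p s))\<^sup>2 \<partial>lborel)" for p
  have Im: "I \<in> borel_measurable borel" unfolding I_def[abs_def] by measurable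
  have "(\<integral>\<^sup>+p. I p \<partial>Kin) = ennreal planar_const * (\<integral>\<^sup>+p. (F p)\<^sup>2 \<partial>V)"
    unfolding I_def by (rule lines_V[symmetric]) measurable
  also have "\<dots> < top" using F2 by (simp add: ennreal_mult_less_top)
  finally have "(\<integral>\<^sup>+p. I p \<partial>Kin) \<noteq> \<infinity>" by simp
  then have Ifin: "AE p in Kin. I p \<noteq> \<infinity>"
    by (intro nn_integral_PInf_AE) (auto intro!: measurable_KinI Im)
  have gfin: "AE p in Kin. (g p)\<^sup>2 \<noteq> \<infinity>"
    using g2 by (intro nn_integral_PInf_AE) (auto intro!: measurable_KinI)
  let ?u = "\<lambda>p. enn2real (TR F g p)"
  have "AE p in Kin. on_line (\<lambda>p. planar_const * enn2real (g p)) ?u (\<lambda>p. (enn2real (F p) - ?u p) / \<epsilon>) p"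
    using AE_Kin_pos Ifin gfin
  proof eventually_elim
    fix p assume p: "0 < T p \<and> norm (snd p) = 1 \<and> fst p \<in> inflow (snd p)"
      and I: "I p \<noteq> \<infinity>" and gp: "(g p)\<^sup>2 \<noteq> \<infinity>"
    have gp': "g p = ennreal (enn2real (g p))" using gp by (cases "g p") (auto simp: power2_eq_square ennreal_top_mult)
    have Fp [measurable]: "(\<lambda>s. F (pt p s)) \<in> borel_measurable borel" by measurable
    define f where "f t = enn2real (F (pt p t))" for t
    have fm [measurable]: "f \<in> borel_measurable borel" unfolding f_def[abs_def] by measurable
    \<comment> \<open>Almost every chord carries a square integrable source, and it is bounded, so
      the source is integrable on it and finite almost everywhere.\<close>
    have "(\<integral>\<^sup>+s. indicator {0<..<T p} s * F (pt p s) \<partial>lborel)\<^sup>2 \<le> ennreal (T p) * I p"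
      unfolding I_def using p by (intro nn_integral_square_interval) auto
    also have "\<dots> < top" using I by (simp add: ennreal_mult_less_top less_top)
    finally have J: "(\<integral>\<^sup>+s. indicator {0<..<T p} s * F (pt p s) \<partial>lborel) < top"
      by (auto simp: power2_eq_square less_top[symmetric] ennreal_mult_eq_top_iff)
    then have "AE s in lborel. indicator {0<..<T p} s * F (pt p s) \<noteq> \<infinity>"
      by (intro nn_integral_PInf_AE) auto
    then have Ff: "AE s in lborel. s \<in> {0<..<T p} \<longrightarrow> F (pt p s) = ennreal (f s)"
      by (rule eventually_mono) (auto simp: f_def less_top)
    \<comment> \<open>The derivative of \<open>J\<close>, the solution times the integrating
      factor.\<close>
    define h where "h t = exp (t / \<epsilon>) * f t / \<epsilon>" for t
    have h0: "0 \<le> h t" for t using eps by (simp add: h_def f_def)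
    have hm [measurable]: "h \<in> borel_measurable borel" unfolding h_def[abs_def] by measurable
    have hF: "(\<integral>\<^sup>+t. ennreal (indicator {0<..<s} t *\<^sub>R h t) \<partial>lborel)
       = ennreal (1 / \<epsilon>) * (\<integral>\<^sup>+t. indicator {0<..<s} t * (ennreal (exp (t / \<epsilon>)) * F (pt p t)) \<partial>lborel)"
      if s: "s \<le> T p" for s
    proof -
      have "ennreal (1 / \<epsilon>) * (\<integral>\<^sup>+t. indicator {0<..<s} t * (ennreal (exp (t / \<epsilon>)) * F (pt p t)) \<partial>lborel)
        = (\<integral>\<^sup>+t. ennreal (1 / \<epsilon>) * (indicator {0<..<s} t * (ennreal (exp (t / \<epsilon>)) * F (pt p t))) \<partial>lborel)"
        by (rule nn_integral_cmult[symmetric]) measurable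
      also have "\<dots> = (\<integral>\<^sup>+t. ennreal (indicator {0<..<s} t *\<^sub>R h t) \<partial>lborel)"
      proof (rule nn_integral_cong_AE, rule eventually_mono[OF Ff])
        fix t assume t: "t \<in> {0<..<T p} \<longrightarrow> F (pt p t) = ennreal (f t)"
        show "ennreal (1 / \<epsilon>) * (indicator {0<..<s} t * (ennreal (exp (t / \<epsilon>)) * F (pt p t))) = ennreal (indicator {0<..<s} t *\<^sub>R h t)"
        proof (cases "t \<in> {0<..<s}")
          case True
          have "0 \<le> f t" by (simp add: f_def)
          then have "ennreal (1 / \<epsilon>) * (ennreal (exp (t / \<epsilon>)) * ennreal (f t)) = ennreal (1 / \<epsilon> * (exp (t / \<epsilon>) * f t))"
            using eps ennreal_mult'[of "exp (t / \<epsilon>)" "f t"] ennreal_mult'[of "1 / \<epsilon>" "exp (t / \<epsilon>) * f t"] by simp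
          then show ?thesis using True t s by (simp add: h_def)
        qed simp
      qed
      finally show ?thesis ..
    qed
    have hi: "set_integrable lborel {0<..<T p} h"
      unfolding set_integrable_def
    proof (rule integrableI_nonneg)
      show "AE t in lborel. 0 \<le> indicator {0<..<T p} t *\<^sub>R h t" using h0 by (simp add: indicator_def)
      have "(\<integral>\<^sup>+t. indicator {0<..<T p} t * (ennreal (exp (t / \<epsilon>)) * F (pt p t)) \<partial>lborel)
        \<le> (\<integral>\<^sup>+t. ennreal (exp (T p / \<epsilon>)) * (indicator {0<..<T p} t * F (pt p t)) \<partial>lborel)"
        using eps by (intro nn_integral_mono) (auto simp: indicator_def divide_right_mono intro!: mult_right_mono ennreal_leI)
      also have "\<dots> = ennreal (exp (T p / \<epsilon>)) * (\<integral>\<^sup>+t. indicator {0<..<T p} t * F (pt p t) \<partial>lborel)"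
        by (rule nn_integral_cmult) measurable
      also have "\<dots> < top" using J by (simp add: ennreal_mult_less_top)
      finally show "(\<integral>\<^sup>+t. ennreal (indicator {0<..<T p} t *\<^sub>R h t) \<partial>lborel) < \<infinity>"
        unfolding hF[OF order_refl] by (simp add: ennreal_mult_less_top)
    qed measurable
    define J where "J s = exp (s / \<epsilon>) * ?u (pt p s)" for s
    have um [measurable]: "(\<lambda>s. ?u (pt p s)) \<in> borel_measurable borel" by measurable
    have Jm: "J \<in> borel_measurable borel" unfolding J_def[abs_def] by measurable
    have Jval: "J s = planar_const * enn2real (g p) + (LINT t:{0<..<s}|lborel. h t)" if s: "0 < s" "s \<le> T p" for s
    proof -
      have hs: "set_integrable lborel {0<..<s} h"
        by (rule set_integrable_subset[OF hi]) (use s in auto)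
      have "(\<integral>\<^sup>+t. ennreal (indicator {0<..<s} t *\<^sub>R h t) \<partial>lborel) = ennreal (LINT t:{0<..<s}|lborel. h t)"
        unfolding set_lebesgue_integral_def using hs h0 unfolding set_integrable_def
        by (intro nn_integral_eq_integral) (auto simp: indicator_def)
      moreover have "0 \<le> (LINT t:{0<..<s}|lborel. h t)"
        unfolding set_lebesgue_integral_def using h0 by (intro integral_nonneg_AE) (auto simp: indicator_def)
      ultimately have "TR F g (pt p s) = ennreal (exp (- s / \<epsilon>)) * (ennreal planar_const * ennreal (enn2real (g p)) + ennreal (LINT t:{0<..<s}|lborel. h t))"
        using p s hF[OF s(2)] gp' by (subst TR_line) auto
      also have "\<dots> = ennreal (exp (- s / \<epsilon>) * (planar_const * enn2real (g p) + (LINT t:{0<..<s}|lborel. h t)))"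
        using \<open>0 \<le> (LINT t:{0<..<s}|lborel. h t)\<close> pos_c by (simp add: ennreal_mult ennreal_plus)
      finally have "?u (pt p s) = exp (- s / \<epsilon>) * (planar_const * enn2real (g p) + (LINT t:{0<..<s}|lborel. h t))"
        using \<open>0 \<le> (LINT t:{0<..<s}|lborel. h t)\<close> pos_c by simp
      moreover have "exp (s / \<epsilon>) * exp (- s / \<epsilon>) = 1" by (simp add: exp_add[symmetric])
      ultimately show ?thesis by (simp add: J_def mult.assoc[symmetric])
    qed
    define E where "E s = exp (- s / \<epsilon>)" for s
    have Ed: "(E has_real_derivative - E s / \<epsilon>) (at s)" for s
      unfolding E_def[abs_def] using eps by (auto intro!: derivative_eq_intros)
    have Ec: "continuous_on UNIV (\<lambda>s. - E s / \<epsilon>)"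
      unfolding E_def using eps by (intro continuous_intros) auto
    have Em: "E \<in> borel_measurable borel" unfolding E_def[abs_def] by measurable
    have Eval: "E s = 1 + (LINT t:{0<..<s}|lborel. - E t / \<epsilon>)" if "0 < s" "s \<le> T p" for s
      using primitive_of_C1(2)[OF Ed Ec that(1)] by (simp add: E_def)
    have Eint: "set_integrable lborel {0<..<T p} (\<lambda>s. - E s / \<epsilon>)"
      using primitive_of_C1(1)[OF Ed Ec] p by blast
    have EJ: "E s * J s = ?u (pt p s)" for s
      by (simp add: E_def J_def mult.assoc[symmetric] exp_add[symmetric])
    \<comment> \<open>The product rule for \<open>E * J\<close> reproduces the transport equation,
      because the two exponentials cancel.\<close>
    have der: "- E t / \<epsilon> * J t + E t * h t = (f t - ?u (pt p t)) / \<epsilon>" for t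
    proof -
      have "E t * h t = f t / \<epsilon>" by (simp add: E_def h_def mult.assoc[symmetric] exp_add[symmetric])
      moreover have "- E t / \<epsilon> * J t = - ?u (pt p t) / \<epsilon>" using EJ[of t] by simp
      ultimately show ?thesis by (simp add: diff_divide_distrib)
    qed
    note pp = product_primitive[OF Eint hi Eval Jval Em Jm, unfolded EJ der]
    show "on_line (\<lambda>p. planar_const * enn2real (g p)) ?u (\<lambda>p. (enn2real (F p) - ?u p) / \<epsilon>) p"
      unfolding on_line_def using pp unfolding f_def by simp
  qed
  then show ?thesis unfolding line_ac_def by auto
qed

end

end

subsection \<open>The energy inequality\<close>

lemma integrable_mult_L2:
  fixes f g :: "'a \<Rightarrow> real"
  assumes [measurable]: "f \<in> borel_measurable M" "g \<in> borel_measurable M"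
    and f: "integrable M (\<lambda>x. (f x)\<^sup>2)" and g: "integrable M (\<lambda>x. (g x)\<^sup>2)"
  shows "integrable M (\<lambda>x. f x * g x)"
proof (rule Bochner_Integration.integrable_bound[OF Bochner_Integration.integrable_add[OF f g]])
  have "\<bar>a * b\<bar> \<le> a\<^sup>2 + b\<^sup>2" for a b :: real
  proof -
    have "2 * (\<bar>a\<bar> * \<bar>b\<bar>) \<le> a\<^sup>2 + b\<^sup>2"
      using zero_le_power2[of "\<bar>a\<bar> - \<bar>b\<bar>"] by (simp add: power2_diff)
    moreover have "0 \<le> \<bar>a\<bar> * \<bar>b\<bar>" by simp
    ultimately show ?thesis unfolding abs_mult by linarith
  qed
  then show "AE x in M. norm (f x * g x) \<le> norm ((f x)\<^sup>2 + (g x)\<^sup>2)" by simp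
qed measurable

lemma integrable_add_square:
  fixes f g :: "'a \<Rightarrow> real"
  assumes [measurable]: "f \<in> borel_measurable M" "g \<in> borel_measurable M"
    and f: "integrable M (\<lambda>x. (f x)\<^sup>2)" and g: "integrable M (\<lambda>x. (g x)\<^sup>2)"
  shows "integrable M (\<lambda>x. (f x + g x)\<^sup>2)" "integrable M (\<lambda>x. (f x - g x)\<^sup>2)"
proof -
  have i: "integrable M (\<lambda>x. 2 * (f x * g x))"
    by (intro integrable_mult_right integrable_mult_L2 f g) measurable
  have "integrable M (\<lambda>x. (f x)\<^sup>2 + (g x)\<^sup>2 + 2 * (f x * g x))" by (intro Bochner_Integration.integrable_add f g i)
  then show "integrable M (\<lambda>x. (f x + g x)\<^sup>2)" by (simp add: power2_sum mult.assoc)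
  have "integrable M (\<lambda>x. (f x)\<^sup>2 + (g x)\<^sup>2 - 2 * (f x * g x))"
    by (intro Bochner_Integration.integrable_add Bochner_Integration.integrable_diff f g i)
  then show "integrable M (\<lambda>x. (f x - g x)\<^sup>2)" by (simp add: power2_diff mult.assoc)
qed

lemma integrable_square_iff:
  fixes f :: "'a \<Rightarrow> real"
  assumes [measurable]: "f \<in> borel_measurable M"
  shows "integrable M (\<lambda>x. (f x)\<^sup>2) \<longleftrightarrow> (\<integral>\<^sup>+x. ennreal ((f x)\<^sup>2) \<partial>M) < top"
  by (subst integrable_iff_bounded) simp

lemma integrable_bounded_mult:
  fixes f g :: "'a \<Rightarrow> real"
  assumes f: "integrable M f" and g: "g \<in> borel_measurable M" "\<And>x. x \<in> space M \<Longrightarrow> \<bar>g x\<bar> \<le> K"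
  shows "integrable M (\<lambda>x. g x * f x)"
proof (rule Bochner_Integration.integrable_bound[OF integrable_mult_right[OF f, of K]])
  show "(\<lambda>x. g x * f x) \<in> borel_measurable M" using g f by measurable
  show "AE x in M. norm (g x * f x) \<le> norm (K * f x)"
  proof (rule AE_I2)
    fix x assume "x \<in> space M"
    then have "\<bar>g x\<bar> \<le> \<bar>K\<bar>" using g(2) by fastforce
    then show "norm (g x * f x) \<le> norm (K * f x)" by (simp add: abs_mult mult_right_mono)
  qed
qed

context c3_dom
begin

text \<open>The constant keeps \<open>psi\<close> at least 1: on the closure of the domain
  \<open>aw\<close> is at least \<open>rad\<^sup>2 / 2 + 2\<close>, and the correction is at most
  \<open>rad\<close>, which is at most \<open>(rad\<^sup>2 + 1) / 2\<close>.\<close>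

definition aw :: "real^3 \<Rightarrow> real" where
  "aw x = rad\<^sup>2 + 2 - (x \<bullet> x) / 2"

definition Mb :: real where
  "Mb = rad\<^sup>2 + 2 + rad"

lemma aw_measurable [measurable]: "aw \<in> borel_measurable borel"
  unfolding aw_def[abs_def] by measurable

lemma aw_bounds: "x \<in> closure \<Omega> \<Longrightarrow> 1 \<le> aw x" "aw x \<le> rad\<^sup>2 + 2"
proof -
  assume "x \<in> closure \<Omega>"
  then have "(norm x)\<^sup>2 \<le> rad\<^sup>2" using rad(2)[of x] by (intro power_mono) auto
  moreover have "0 \<le> rad\<^sup>2" by simp
  ultimately show "1 \<le> aw x" unfolding aw_def power2_norm_eq_inner by linarith
qed (simp add: aw_def)

lemma AE_V_fst:
  assumes "AE x in restrict_space lborel \<Omega>. P x"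
  shows "AE p in V. P (fst p)"
proof -
  obtain N where N: "{x \<in> space (restrict_space lborel \<Omega>). \<not> P x} \<subseteq> N" "emeasure (restrict_space lborel \<Omega>) N = 0"
    "N \<in> sets (restrict_space lborel \<Omega>)" using AE_E[OF assms] by blast
  have S: "sphere 0 1 \<in> sets sphere_measure"
    using sets.top[of sphere_measure] unfolding space_sphere_measure .
  show ?thesis
  proof (rule AE_I)
    show "{p \<in> space V. \<not> P (fst p)} \<subseteq> N \<times> space sphere_measure"
      using N(1) by (auto simp: space_V space_restrict_space)
    show "emeasure V (N \<times> space sphere_measure) = 0"
      unfolding vol_measure_def using N S
      by (subst sphere.emeasure_pair_measure_Times) auto
    show "N \<times> space sphere_measure \<in> sets V"
      unfolding vol_measure_def using N(3) S by (intro pair_measureI) auto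
  qed
qed

lemma pair_V: "pair_sigma_finite (restrict_space lborel \<Omega>) sphere_measure"
proof -
  interpret D: finite_measure "restrict_space lborel \<Omega>" by (rule finite_dom)
  show ?thesis ..
qed

lemma integrable_L2_V:
  fixes f :: "phase \<Rightarrow> real"
  assumes [measurable]: "f \<in> borel_measurable borel" and "integrable V (\<lambda>p. (f p)\<^sup>2)"
  shows "integrable V f"
proof -
  interpret finite_measure V by (rule finite_V)
  have "integrable V (\<lambda>p. f p * 1)"
    by (rule integrable_mult_L2) (auto intro: measurable_VI assms)
  then show ?thesis by simp
qed

definition avg :: "(phase \<Rightarrow> real) \<Rightarrow> real^3 \<Rightarrow> real" where
  "avg u = ang_avg (\<lambda>x w. u (x, w))"

lemma measurable_pair_sphere:
  fixes u :: "phase \<Rightarrow> 'b"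
  shows "u \<in> measurable borel N \<Longrightarrow> (\<lambda>(x, w). u (x, w)) \<in> measurable (borel \<Otimes>\<^sub>M sphere_measure) N"
proof -
  assume u: "u \<in> measurable borel N"
  have 1: "(fst :: phase \<Rightarrow> _) \<in> measurable (borel \<Otimes>\<^sub>M sphere_measure) borel" by simp
  have 2: "(snd :: phase \<Rightarrow> _) \<in> measurable (borel \<Otimes>\<^sub>M sphere_measure) borel"
    by (rule measurable_compose[OF measurable_snd measurable_sphere_id])
  have "(\<lambda>q::phase. (fst q, snd q)) \<in> measurable (borel \<Otimes>\<^sub>M sphere_measure) (borel \<Otimes>\<^sub>M borel)"
    using measurable_Pair[OF 1 2] .
  then have "(\<lambda>q::phase. (fst q, snd q)) \<in> measurable (borel \<Otimes>\<^sub>M sphere_measure) borel" by (simp add: borel_prod)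
  then have "(\<lambda>q. u (fst q, snd q)) \<in> measurable (borel \<Otimes>\<^sub>M sphere_measure) N" using u by (rule measurable_compose)
  then show ?thesis by (simp add: split_beta')
qed

lemma avg_measurable [measurable]: "u \<in> borel_measurable borel \<Longrightarrow> avg u \<in> borel_measurable borel"
proof -
  assume "u \<in> borel_measurable borel"
  then have "(\<lambda>(x, w). u (x, w)) \<in> borel_measurable (borel \<Otimes>\<^sub>M sphere_measure)" by (rule measurable_pair_sphere)
  then have "(\<lambda>x. \<integral>w. u (x, w) \<partial>sphere_measure) \<in> borel_measurable borel"
    by (rule sphere.borel_measurable_lebesgue_integral)
  then show ?thesis unfolding avg_def ang_avg_def[abs_def] by measurable
qed

lemma AE_sphere_integrable:
  fixes u :: "phase \<Rightarrow> real"
  assumes [measurable]: "u \<in> borel_measurable borel" and u: "integrable V (\<lambda>p. (u p)\<^sup>2)"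
  shows "AE p in V. integrable sphere_measure (\<lambda>w. u (fst p, w))"
proof -
  interpret PP: pair_sigma_finite "restrict_space lborel \<Omega>" sphere_measure by (rule pair_V)
  have "integrable (restrict_space lborel \<Omega> \<Otimes>\<^sub>M sphere_measure) u"
    using integrable_L2_V[OF assms] by (simp add: vol_measure_def)
  from PP.AE_integrable_fst'[OF this] show ?thesis by (rule AE_V_fst)
qed

text \<open>The Bochner integral is additive on slices that are integrable, and these are almost all
  of them; hence the restriction to almost every \<open>p\<close>.\<close>

lemma avg_diff:
  assumes "u \<in> borel_measurable borel" "integrable V (\<lambda>p. (u p)\<^sup>2)"
    "v \<in> borel_measurable borel" "integrable V (\<lambda>p. (v p)\<^sup>2)"
  shows "AE p in V. avg (\<lambda>p. u p - v p) (fst p) = avg u (fst p) - avg v (fst p)"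
  using AE_sphere_integrable[OF assms(1,2)] AE_sphere_integrable[OF assms(3,4)]
  by eventually_elim (simp add: avg_def ang_avg_def right_diff_distrib)

text \<open>This is where the mass of the sphere measure being at most \<open>4 pi\<close> enters.\<close>
lemma avg_jensen:
  assumes um [measurable]: "u \<in> borel_measurable borel" and u: "integrable V (\<lambda>p. (u p)\<^sup>2)"
    and bm [measurable]: "b \<in> borel_measurable borel" and b: "\<And>x. x \<in> \<Omega> \<Longrightarrow> 0 \<le> b x \<and> b x \<le> K"
  shows "integrable V (\<lambda>p. b (fst p) * (avg u (fst p))\<^sup>2)" "integrable V (\<lambda>p. b (fst p) * (u p)\<^sup>2)"
    "(\<integral>p. b (fst p) * (avg u (fst p))\<^sup>2 \<partial>V) \<le> (\<integral>p. b (fst p) * (u p)\<^sup>2 \<partial>V)"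
proof -
  have pt: "ennreal ((avg u x)\<^sup>2) * ennreal (4 * pi * planar_const) \<le> (\<integral>\<^sup>+w. ennreal ((u (x, w))\<^sup>2) \<partial>sphere_measure)" for x
  proof -
    have ux: "(\<lambda>w. u (x, w)) \<in> borel_measurable sphere_measure" by (rule measurable_sphereI) measurable
    define m where "m = 4 * pi * planar_const"
    have m: "0 \<le> m" "m \<le> 4 * pi" using planar_const by (auto simp: m_def)
    define N where "N = (\<integral>\<^sup>+w. ennreal \<bar>u (x, w)\<bar> \<partial>sphere_measure)"
    \<comment> \<open>A slice that is not integrable has Bochner integral 0, so the bound holds for
      every \<open>x\<close>.\<close>
    have "ennreal \<bar>\<integral>w. u (x, w) \<partial>sphere_measure\<bar> \<le> N"
    proof (cases "integrable sphere_measure (\<lambda>w. u (x, w))")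
      case True
      from integral_norm_bound_ennreal[OF True] show ?thesis by (simp add: N_def)
    next
      case False
      then show ?thesis by (simp add: not_integrable_integral_eq)
    qed
    then have "(ennreal \<bar>\<integral>w. u (x, w) \<partial>sphere_measure\<bar>)\<^sup>2 \<le> N\<^sup>2" by (intro power_mono) auto
    also have "N\<^sup>2 = (\<integral>\<^sup>+w. 1 * ennreal \<bar>u (x, w)\<bar> \<partial>sphere_measure)\<^sup>2" by (simp add: N_def)
    also have "\<dots> \<le> (\<integral>\<^sup>+w. 1\<^sup>2 \<partial>sphere_measure) * (\<integral>\<^sup>+w. (ennreal \<bar>u (x, w)\<bar>)\<^sup>2 \<partial>sphere_measure)"
      using ux by (intro Cauchy_Schwarz_nn_integral) auto
    also have "(\<integral>\<^sup>+w. 1\<^sup>2 \<partial>sphere_measure) = ennreal m" by (simp add: sphere_measure_mass m_def)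
    also have "(\<integral>\<^sup>+w. (ennreal \<bar>u (x, w)\<bar>)\<^sup>2 \<partial>sphere_measure) = (\<integral>\<^sup>+w. ennreal ((u (x, w))\<^sup>2) \<partial>sphere_measure)"
      by (simp add: ennreal_power)
    finally have *: "ennreal ((\<integral>w. u (x, w) \<partial>sphere_measure)\<^sup>2) \<le> ennreal m * (\<integral>\<^sup>+w. ennreal ((u (x, w))\<^sup>2) \<partial>sphere_measure)"
      by (simp add: ennreal_power)
    have "ennreal ((avg u x)\<^sup>2) * ennreal m = ennreal (m / (4 * pi)\<^sup>2) * ennreal ((\<integral>w. u (x, w) \<partial>sphere_measure)\<^sup>2)"
    proof -
      have "(avg u x)\<^sup>2 * m = m / (4 * pi)\<^sup>2 * (\<integral>w. u (x, w) \<partial>sphere_measure)\<^sup>2"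
        by (simp add: avg_def ang_avg_def power_mult_distrib power_divide)
      then show ?thesis using m by (simp add: ennreal_mult[symmetric])
    qed
    also have "\<dots> \<le> ennreal (m / (4 * pi)\<^sup>2) * (ennreal m * (\<integral>\<^sup>+w. ennreal ((u (x, w))\<^sup>2) \<partial>sphere_measure))"
      by (intro mult_left_mono *) simp
    also have "\<dots> = ennreal (m / (4 * pi)\<^sup>2 * m) * (\<integral>\<^sup>+w. ennreal ((u (x, w))\<^sup>2) \<partial>sphere_measure)"
    proof -
      have "ennreal (m / (4 * pi)\<^sup>2 * m) = ennreal (m / (4 * pi)\<^sup>2) * ennreal m"
        using m by (intro ennreal_mult) auto
      then show ?thesis by (simp only: mult.assoc)
    qed
    also have "\<dots> \<le> 1 * (\<integral>\<^sup>+w. ennreal ((u (x, w))\<^sup>2) \<partial>sphere_measure)"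
    proof (intro mult_right_mono)
      have "m * m \<le> (4 * pi) * (4 * pi)" using m by (intro mult_mono) auto
      then have "m / (4 * pi)\<^sup>2 * m \<le> 1" by (simp add: power2_eq_square divide_le_eq)
      then show "ennreal (m / (4 * pi)\<^sup>2 * m) \<le> 1" by simp
    qed simp
    finally show ?thesis by (simp add: m_def)
  qed
  have spV: "p \<in> space V \<Longrightarrow> fst p \<in> \<Omega>" for p by (auto simp: space_V)
  show iu: "integrable V (\<lambda>p. b (fst p) * (u p)\<^sup>2)"
    using b spV by (intro integrable_bounded_mult[OF u, where K=K]) (auto intro!: measurable_VI)
  have le: "(\<integral>\<^sup>+p. ennreal (b (fst p) * (avg u (fst p))\<^sup>2) \<partial>V) \<le> (\<integral>\<^sup>+p. ennreal (b (fst p) * (u p)\<^sup>2) \<partial>V)"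
  proof -
    have "(\<integral>\<^sup>+p. ennreal (b (fst p) * (avg u (fst p))\<^sup>2) \<partial>V)
      = (\<integral>\<^sup>+x. indicator \<Omega> x * (\<integral>\<^sup>+w. ennreal (b x * (avg u x)\<^sup>2) \<partial>sphere_measure) \<partial>lborel)"
      by (subst nn_integral_V(1)) auto
    also have "\<dots> \<le> (\<integral>\<^sup>+x. indicator \<Omega> x * (\<integral>\<^sup>+w. ennreal (b x * (u (x, w))\<^sup>2) \<partial>sphere_measure) \<partial>lborel)"
    proof (rule nn_integral_mono)
      fix x
      show "indicator \<Omega> x * (\<integral>\<^sup>+w. ennreal (b x * (avg u x)\<^sup>2) \<partial>sphere_measure)
         \<le> indicator \<Omega> x * (\<integral>\<^sup>+w. ennreal (b x * (u (x, w))\<^sup>2) \<partial>sphere_measure)"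
      proof (cases "x \<in> \<Omega>")
        case True
        have bx: "0 \<le> b x" using b[OF True] by simp
        have "(\<integral>\<^sup>+w. ennreal (b x * (avg u x)\<^sup>2) \<partial>sphere_measure) = ennreal (b x) * (ennreal ((avg u x)\<^sup>2) * ennreal (4 * pi * planar_const))"
          using bx by (simp add: sphere_measure_mass ennreal_mult mult.assoc)
        also have "\<dots> \<le> ennreal (b x) * (\<integral>\<^sup>+w. ennreal ((u (x, w))\<^sup>2) \<partial>sphere_measure)"
          by (intro mult_left_mono pt) simp
        also have "\<dots> = (\<integral>\<^sup>+w. ennreal (b x) * ennreal ((u (x, w))\<^sup>2) \<partial>sphere_measure)"
        proof (rule nn_integral_cmult[symmetric])
          show "(\<lambda>w. ennreal ((u (x, w))\<^sup>2)) \<in> borel_measurable sphere_measure" by (rule measurable_sphereI) measurable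
        qed
        also have "\<dots> = (\<integral>\<^sup>+w. ennreal (b x * (u (x, w))\<^sup>2) \<partial>sphere_measure)"
          using bx by (simp add: ennreal_mult)
        finally show ?thesis using True by simp
      qed simp
    qed
    also have "\<dots> = (\<integral>\<^sup>+p. ennreal (b (fst p) * (u p)\<^sup>2) \<partial>V)"
      by (subst nn_integral_V(1)) auto
    finally show ?thesis .
  qed
  have nn: "AE p in V. 0 \<le> b (fst p) * (avg u (fst p))\<^sup>2" "AE p in V. 0 \<le> b (fst p) * (u p)\<^sup>2"
    using b spV by (auto intro!: AE_I2)
  have eq: "(\<integral>\<^sup>+p. ennreal (b (fst p) * (u p)\<^sup>2) \<partial>V) = ennreal (\<integral>p. b (fst p) * (u p)\<^sup>2 \<partial>V)"
    by (rule nn_integral_eq_integral[OF iu nn(2)])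
  show ia: "integrable V (\<lambda>p. b (fst p) * (avg u (fst p))\<^sup>2)"
  proof (rule integrableI_nonneg[OF _ nn(1)])
    show "(\<lambda>p. b (fst p) * (avg u (fst p))\<^sup>2) \<in> borel_measurable V" by (rule measurable_VI) measurable
    show "(\<integral>\<^sup>+p. ennreal (b (fst p) * (avg u (fst p))\<^sup>2) \<partial>V) < \<infinity>"
      using le eq by (auto intro: le_less_trans)
  qed
  have "ennreal (\<integral>p. b (fst p) * (avg u (fst p))\<^sup>2 \<partial>V) \<le> ennreal (\<integral>p. b (fst p) * (u p)\<^sup>2 \<partial>V)"
    using le eq nn_integral_eq_integral[OF ia nn(1)] by simp
  moreover have "0 \<le> (\<integral>p. b (fst p) * (u p)\<^sup>2 \<partial>V)" using nn(2) by (rule integral_nonneg_AE)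
  ultimately show "(\<integral>p. b (fst p) * (avg u (fst p))\<^sup>2 \<partial>V) \<le> (\<integral>p. b (fst p) * (u p)\<^sup>2 \<partial>V)"
    by (simp add: ennreal_le_iff)
qed

lemma avg_L2:
  assumes "u \<in> borel_measurable borel" "integrable V (\<lambda>p. (u p)\<^sup>2)"
  shows "integrable V (\<lambda>p. (avg u (fst p))\<^sup>2)"
  using avg_jensen(1)[OF assms, of "\<lambda>_. 1" 1] by simp

text \<open>For fixed \<open>x\<close> the integrand is linear in \<open>w\<close>, and the sphere
  measure has mean 0. With \<open>h\<close> an angular average this removes the first order part of
  \<open>psi\<close> from the collision term.\<close>

lemma odd_moment_zero:
  assumes [measurable]: "h \<in> borel_measurable borel" and h: "integrable V (\<lambda>p. (h (fst p))\<^sup>2)"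
  shows "integrable V (\<lambda>p. (fst p \<bullet> snd p) * (h (fst p))\<^sup>2)" "(\<integral>p. (fst p \<bullet> snd p) * (h (fst p))\<^sup>2 \<partial>V) = 0"
proof -
  interpret PP: pair_sigma_finite "restrict_space lborel \<Omega>" sphere_measure by (rule pair_V)
  show i: "integrable V (\<lambda>p. (fst p \<bullet> snd p) * (h (fst p))\<^sup>2)"
  proof (rule integrable_bounded_mult[OF h, where K=rad])
    show "(\<lambda>p. fst p \<bullet> snd p) \<in> borel_measurable V" by (rule measurable_VI) measurable
    fix p assume "p \<in> space V"
    then have "norm (snd p) = 1" "norm (fst p) \<le> rad" using rad_dom by (auto simp: space_V)
    then show "\<bar>fst p \<bullet> snd p\<bar> \<le> rad" using Cauchy_Schwarz_ineq2[of "fst p" "snd p"] by simp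
  qed
  have "(\<integral>p. (fst p \<bullet> snd p) * (h (fst p))\<^sup>2 \<partial>V)
     = (\<integral>x. (\<integral>w. (x \<bullet> w) * (h x)\<^sup>2 \<partial>sphere_measure) \<partial>restrict_space lborel \<Omega>)"
    using PP.integral_fst'[OF i[unfolded vol_measure_def]] by (simp add: vol_measure_def)
  then show "(\<integral>p. (fst p \<bullet> snd p) * (h (fst p))\<^sup>2 \<partial>V) = 0" by (simp add: sphere_mean_zero)
qed

context
  fixes \<epsilon> :: real
  assumes eps: "0 < \<epsilon>" "\<epsilon> < 1"
begin

text \<open>The multiplier \<open>a + \<epsilon> w \<bullet> \<nabla>a\<close> with \<open>a = const - \<bar>x\<bar>\<^sup>2/2\<close>: the first order correction cancels
  the cross terms between \<open>u - avg u\<close> and \<open>avg u\<close>, and \<open>div \<nabla>a < 0\<close> gives the coercive term \<open>\<epsilon>\<^sup>2 u\<^sup>2\<close>.\<close>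
definition psi :: "phase \<Rightarrow> real" where
  "psi p = aw (fst p) - \<epsilon> * (fst p \<bullet> snd p)"

lemma psi_measurable [measurable]: "psi \<in> borel_measurable borel"
  unfolding psi_def[abs_def] by measurable

lemma psi_bounds:
  assumes "fst p \<in> closure \<Omega>" "norm (snd p) = 1"
  shows "1 \<le> psi p" "psi p \<le> Mb"
proof -
  have n: "norm (fst p) \<le> rad" using rad(2)[OF assms(1)] .
  have "\<bar>fst p \<bullet> snd p\<bar> \<le> rad" using Cauchy_Schwarz_ineq2[of "fst p" "snd p"] assms(2) n by simp
  then have "\<bar>\<epsilon> * (fst p \<bullet> snd p)\<bar> \<le> 1 * rad"
    unfolding abs_mult using eps by (intro mult_mono) auto
  then have e: "\<epsilon> * (fst p \<bullet> snd p) \<le> rad" "- rad \<le> \<epsilon> * (fst p \<bullet> snd p)" by linarith+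
  have q: "(norm (fst p))\<^sup>2 \<le> rad\<^sup>2" using n by (intro power_mono) auto
  have "2 * rad \<le> rad\<^sup>2 + 1" using zero_le_power2[of "rad - 1"] by (simp add: power2_diff)
  then show "1 \<le> psi p" using e q unfolding psi_def aw_def power2_norm_eq_inner by linarith
  show "psi p \<le> Mb" using e aw_bounds(2)[of "fst p"] unfolding psi_def Mb_def by linarith
qed

lemma psi_ac: "line_ac psi psi (\<lambda>p. - (fst p \<bullet> snd p) - \<epsilon> * (snd p \<bullet> snd p))"
proof -
  have d: "((\<lambda>y. rad\<^sup>2 + 2 - y \<bullet> y / 2 - \<epsilon> * (y \<bullet> w)) has_derivative (\<lambda>h. - (x \<bullet> h) - \<epsilon> * (h \<bullet> w))) (at x)"
    for x w :: "real^3"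
    by (auto intro!: derivative_eq_intros simp: inner_commute)
  have "line_ac (\<lambda>p. rad\<^sup>2 + 2 - (fst p \<bullet> fst p) / 2 - \<epsilon> * (fst p \<bullet> snd p))
     (\<lambda>p. rad\<^sup>2 + 2 - (fst p \<bullet> fst p) / 2 - \<epsilon> * (fst p \<bullet> snd p))
     (\<lambda>p. - (fst p \<bullet> snd p) - \<epsilon> * (snd p \<bullet> snd p))"
    by (rule line_ac_C1[where \<phi>="\<lambda>x w. rad\<^sup>2 + 2 - (x \<bullet> x) / 2 - \<epsilon> * (x \<bullet> w)"
          and D\<phi>="\<lambda>x w h. - (x \<bullet> h) - \<epsilon> * (h \<bullet> w)", OF _ d]) (auto intro!: continuous_intros)
  then show ?thesis by (simp add: psi_def[abs_def] aw_def)
qed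

text \<open>Green's formula for \<open>u * u * psi\<close>, multiplied by \<open>\<epsilon>\<close>.
  The source is kept as a sum because its two parts are estimated differently: \<open>F\<close> must
  return with weight exactly \<open>psi\<close>, so that an average can be absorbed, whereas
  \<open>S\<close> may cost a large constant.\<close>

lemma energy:
  assumes ac: "line_ac (\<lambda>p. planar_const * g p) u (\<lambda>p. (S p + F p - u p) / \<epsilon>)"
    and [measurable]: "S \<in> borel_measurable borel" "F \<in> borel_measurable borel" "g \<in> borel_measurable borel"
    and u2: "integrable V (\<lambda>p. (u p)\<^sup>2)" and S2: "integrable V (\<lambda>p. (S p)\<^sup>2)"
    and F2: "integrable V (\<lambda>p. (F p)\<^sup>2)" and g2: "integrable Kin (\<lambda>p. (g p)\<^sup>2)"
  shows "integrable Kin (\<lambda>p. (u (ext p))\<^sup>2)"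
    "\<epsilon> * (\<integral>p. (u (ext p))\<^sup>2 \<partial>Kin) + planar_const * (\<integral>p. (aw (fst p) + \<epsilon>\<^sup>2 / 2) * (u p)\<^sup>2 \<partial>V)
      \<le> planar_const * (\<integral>p. psi p * (F p)\<^sup>2 \<partial>V) + planar_const * (2 * Mb\<^sup>2 / \<epsilon>\<^sup>2) * (\<integral>p. (S p)\<^sup>2 \<partial>V)
        + \<epsilon> * planar_const\<^sup>2 * Mb * (\<integral>p. (g p)\<^sup>2 \<partial>Kin)"
proof -
  note um [measurable] = line_ac_measurable(2)[OF ac]
  have spV: "fst p \<in> \<Omega>" "fst p \<in> closure \<Omega>" "norm (snd p) = 1" if "p \<in> space V" for p
    using that closure_subset[of \<Omega>] by (auto simp: space_V)
  have psiV: "\<bar>psi p\<bar> \<le> Mb" if "p \<in> space V" for p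
    using psi_bounds[OF spV(2,3)[OF that]] by simp
  have psim: "psi \<in> borel_measurable V" by (rule measurable_VI) measurable
  define f where "f p = (S p + F p - u p) / \<epsilon>" for p
  have fm [measurable]: "f \<in> borel_measurable borel" unfolding f_def[abs_def] by measurable
  define D where "D p = - (fst p \<bullet> snd p) - \<epsilon> * (snd p \<bullet> snd p)" for p :: "phase"
  have Dm [measurable]: "D \<in> borel_measurable borel" unfolding D_def[abs_def] by measurable
  have ac3: "line_ac (\<lambda>p. planar_const * g p * (planar_const * g p) * psi p) (\<lambda>p. u p * u p * psi p)
      (\<lambda>p. (f p * u p + u p * f p) * psi p + u p * u p * D p)"
    using line_ac_mult[OF line_ac_mult[OF ac ac] psi_ac] by (simp add: f_def D_def)
  have mV: "h \<in> borel_measurable V" if "h \<in> borel_measurable borel" for h :: "_ \<Rightarrow> real"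
    using that by (rule measurable_VI)
  have fu: "integrable V (\<lambda>p. f p * u p)"
  proof -
    have "integrable V (\<lambda>p. (S p + F p - u p)\<^sup>2)"
      by (intro integrable_add_square S2 F2 u2 mV) measurable
    then have "integrable V (\<lambda>p. (S p + F p - u p) * u p)"
      by (intro integrable_mult_L2 u2 mV) measurable
    then have "integrable V (\<lambda>p. 1 / \<epsilon> * ((S p + F p - u p) * u p))" by (rule integrable_mult_right)
    then show ?thesis by (simp add: f_def)
  qed
  have DV: "\<bar>D p\<bar> \<le> rad + 1" if "p \<in> space V" for p
  proof -
    have "\<bar>fst p \<bullet> snd p\<bar> \<le> rad"
      using Cauchy_Schwarz_ineq2[of "fst p" "snd p"] spV[OF that] rad_dom[of "fst p"] by simp
    moreover have "snd p \<bullet> snd p = 1" using spV(3)[OF that] by (simp add: norm_eq_1)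
    ultimately show ?thesis using eps by (simp add: D_def)
  qed
  have ai: "integrable V (\<lambda>p. (f p * u p + u p * f p) * psi p + u p * u p * D p)"
  proof -
    have "integrable V (\<lambda>p. psi p * (2 * (f p * u p)) + D p * (u p)\<^sup>2)"
      using psiV DV
      by (intro Bochner_Integration.integrable_add integrable_bounded_mult[where K=Mb] integrable_bounded_mult[where K="rad+1"]
          integrable_mult_right fu u2 mV) auto
    moreover have "(\<lambda>p. psi p * (2 * (f p * u p)) + D p * (u p)\<^sup>2) = (\<lambda>p. (f p * u p + u p * f p) * psi p + u p * u p * D p)"
      by (rule ext) (simp add: power2_eq_square algebra_simps)
    ultimately show ?thesis by simp
  qed
  have gK: "AE p in Kin. (g p)\<^sup>2 * psi p \<le> Mb * (g p)\<^sup>2 \<and> norm ((planar_const * g p * (planar_const * g p)) * psi p) \<le> norm (planar_const\<^sup>2 * Mb * (g p)\<^sup>2)"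
  proof (rule eventually_mono[OF AE_Kin_pos])
    fix p assume p: "0 < T p \<and> norm (snd p) = 1 \<and> fst p \<in> inflow (snd p)"
    then have b: "1 \<le> psi p" "psi p \<le> Mb" using psi_bounds[of p] inflow_frontier(2)[of "fst p" "snd p"] by auto
    have 1: "(g p)\<^sup>2 * psi p \<le> Mb * (g p)\<^sup>2" using mult_right_mono[OF b(2), of "(g p)\<^sup>2"] by (simp add: mult.commute)
    have "norm ((planar_const * g p * (planar_const * g p)) * psi p) = planar_const\<^sup>2 * ((g p)\<^sup>2 * psi p)"
    proof -
      have "planar_const * g p * (planar_const * g p) * psi p = planar_const\<^sup>2 * ((g p)\<^sup>2 * psi p)"
        by (simp add: power2_eq_square mult_ac)
      moreover have "0 \<le> planar_const\<^sup>2 * ((g p)\<^sup>2 * psi p)" using b by simp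
      ultimately show ?thesis by (metis abs_of_nonneg real_norm_def)
    qed
    also have "\<dots> \<le> planar_const\<^sup>2 * (Mb * (g p)\<^sup>2)" using 1 by (intro mult_left_mono) auto
    also have "\<dots> = norm (planar_const\<^sup>2 * Mb * (g p)\<^sup>2)" using b by (simp add: abs_mult)
    finally show "(g p)\<^sup>2 * psi p \<le> Mb * (g p)\<^sup>2 \<and> norm ((planar_const * g p * (planar_const * g p)) * psi p) \<le> norm (planar_const\<^sup>2 * Mb * (g p)\<^sup>2)"
      using 1 by simp
  qed
  have A0i: "integrable Kin (\<lambda>p. planar_const * g p * (planar_const * g p) * psi p)"
  proof (rule Bochner_Integration.integrable_bound[OF integrable_mult_right[OF g2, of "planar_const\<^sup>2 * Mb"]])
    show "(\<lambda>p. planar_const * g p * (planar_const * g p) * psi p) \<in> borel_measurable Kin" by (rule measurable_KinI) measurable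
    show "AE p in Kin. norm (planar_const * g p * (planar_const * g p) * psi p) \<le> norm (planar_const\<^sup>2 * Mb * (g p)\<^sup>2)"
      using gK by (rule eventually_mono) blast
  qed
  note green = line_ac_green[OF ac3 ai A0i]
  \<comment> \<open>Exit points lie in the closure of the domain, where \<open>psi\<close> is at
    least 1; the trace inherits its integrability from the weighted one given by Green's
    formula.\<close>
  have extb: "AE p in Kin. (u (ext p))\<^sup>2 \<le> u (ext p) * u (ext p) * psi (ext p)"
  proof (rule eventually_mono[OF AE_Kin_pos])
    fix p assume p: "0 < T p \<and> norm (snd p) = 1 \<and> fst p \<in> inflow (snd p)"
    then have "fst (ext p) \<in> frontier \<Omega>" using exit_point(1)[of "snd p" "fst p"] inflow_frontier(2)[of "fst p" "snd p"] by auto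
    then have "1 \<le> psi (ext p)" using p by (intro psi_bounds) (auto simp: frontier_eq)
    then have "(u (ext p))\<^sup>2 * 1 \<le> (u (ext p))\<^sup>2 * psi (ext p)" by (intro mult_left_mono) auto
    then show "(u (ext p))\<^sup>2 \<le> u (ext p) * u (ext p) * psi (ext p)" by (simp add: power2_eq_square)
  qed
  show ui: "integrable Kin (\<lambda>p. (u (ext p))\<^sup>2)"
  proof (rule Bochner_Integration.integrable_bound[OF green(1)])
    show "(\<lambda>p. (u (ext p))\<^sup>2) \<in> borel_measurable Kin" by (rule measurable_KinI) measurable
    show "AE p in Kin. norm ((u (ext p))\<^sup>2) \<le> norm (u (ext p) * u (ext p) * psi (ext p))"
    proof (rule eventually_mono[OF extb])
      fix p assume *: "(u (ext p))\<^sup>2 \<le> u (ext p) * u (ext p) * psi (ext p)"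
      have "0 \<le> (u (ext p))\<^sup>2" by simp
      with * have "0 \<le> u (ext p) * u (ext p) * psi (ext p)" by linarith
      with * \<open>0 \<le> (u (ext p))\<^sup>2\<close> show "norm ((u (ext p))\<^sup>2) \<le> norm (u (ext p) * u (ext p) * psi (ext p))"
        by (simp only: real_norm_def abs_of_nonneg)
    qed
  qed
  have ue: "(\<integral>p. (u (ext p))\<^sup>2 \<partial>Kin) \<le> (\<integral>p. u (ext p) * u (ext p) * psi (ext p) \<partial>Kin)"
    by (rule integral_mono_AE[OF ui green(1) extb])
  have ge: "(\<integral>p. planar_const * g p * (planar_const * g p) * psi p \<partial>Kin) \<le> planar_const\<^sup>2 * Mb * (\<integral>p. (g p)\<^sup>2 \<partial>Kin)"
  proof -
    have "(\<integral>p. planar_const * g p * (planar_const * g p) * psi p \<partial>Kin) \<le> (\<integral>p. planar_const\<^sup>2 * Mb * (g p)\<^sup>2 \<partial>Kin)"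
    proof (rule integral_mono_AE[OF A0i])
      show "integrable Kin (\<lambda>p. planar_const\<^sup>2 * Mb * (g p)\<^sup>2)" by (rule integrable_mult_right[OF g2])
      show "AE p in Kin. planar_const * g p * (planar_const * g p) * psi p \<le> planar_const\<^sup>2 * Mb * (g p)\<^sup>2"
      proof (rule eventually_mono[OF gK], elim conjE)
        fix p assume "(g p)\<^sup>2 * psi p \<le> Mb * (g p)\<^sup>2"
        then have "planar_const\<^sup>2 * ((g p)\<^sup>2 * psi p) \<le> planar_const\<^sup>2 * (Mb * (g p)\<^sup>2)" by (intro mult_left_mono) auto
        then show "planar_const * g p * (planar_const * g p) * psi p \<le> planar_const\<^sup>2 * Mb * (g p)\<^sup>2"
          by (simp add: power2_eq_square mult_ac)
      qed
    qed
    then show ?thesis by simp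
  qed
  have Fi: "integrable V (\<lambda>p. psi p * (F p)\<^sup>2)"
    using psiV by (intro integrable_bounded_mult[OF F2, where K=Mb] psim) auto
  have awi: "integrable V (\<lambda>p. (aw (fst p) + \<epsilon>\<^sup>2 / 2) * (u p)\<^sup>2)"
  proof (rule integrable_bounded_mult[OF u2, where K="rad\<^sup>2 + 2 + \<epsilon>\<^sup>2 / 2"])
    show "(\<lambda>p. aw (fst p) + \<epsilon>\<^sup>2 / 2) \<in> borel_measurable V" by (rule mV) measurable
    fix p assume "p \<in> space V"
    from aw_bounds(1)[OF spV(2)[OF this]] aw_bounds(2)[of "fst p"]
    show "\<bar>aw (fst p) + \<epsilon>\<^sup>2 / 2\<bar> \<le> rad\<^sup>2 + 2 + \<epsilon>\<^sup>2 / 2" by (simp add: abs_of_nonneg)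
  qed
  have Si: "integrable V (\<lambda>p. 2 * Mb\<^sup>2 / \<epsilon>\<^sup>2 * (S p)\<^sup>2)" by (rule integrable_mult_right[OF S2])
  \<comment> \<open>The integrands are compared pointwise. With \<open>P = psi p\<close> and
    \<open>X\<close> the inner product of position and direction, the coefficients of
    \<open>u\<^sup>2\<close> add up to
    \<open>- (P + \<epsilon> * X + \<epsilon>\<^sup>2 / 2)\<close>, and
    \<open>P + \<epsilon> * X\<close> is \<open>aw\<close>.\<close>
  have key: "\<epsilon> * (\<integral>p. (f p * u p + u p * f p) * psi p + u p * u p * D p \<partial>V)
     \<le> (\<integral>p. psi p * (F p)\<^sup>2 + 2 * Mb\<^sup>2 / \<epsilon>\<^sup>2 * (S p)\<^sup>2 - (aw (fst p) + \<epsilon>\<^sup>2 / 2) * (u p)\<^sup>2 \<partial>V)"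
  proof -
    have "(\<integral>p. \<epsilon> * ((f p * u p + u p * f p) * psi p + u p * u p * D p) \<partial>V)
     \<le> (\<integral>p. psi p * (F p)\<^sup>2 + 2 * Mb\<^sup>2 / \<epsilon>\<^sup>2 * (S p)\<^sup>2 - (aw (fst p) + \<epsilon>\<^sup>2 / 2) * (u p)\<^sup>2 \<partial>V)"
    proof (rule integral_mono)
      show "integrable V (\<lambda>p. \<epsilon> * ((f p * u p + u p * f p) * psi p + u p * u p * D p))"
        by (rule integrable_mult_right[OF ai])
      show "integrable V (\<lambda>p. psi p * (F p)\<^sup>2 + 2 * Mb\<^sup>2 / \<epsilon>\<^sup>2 * (S p)\<^sup>2 - (aw (fst p) + \<epsilon>\<^sup>2 / 2) * (u p)\<^sup>2)"
        by (intro Bochner_Integration.integrable_add Bochner_Integration.integrable_diff Fi Si awi)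
      fix p assume p: "p \<in> space V"
      define P X where "P = psi p" and "X = fst p \<bullet> snd p"
      have P: "1 \<le> P" "P \<le> Mb" using psi_bounds[OF spV(2,3)[OF p]] by (auto simp: P_def)
      have aw: "aw (fst p) = P + \<epsilon> * X" by (simp add: P_def X_def psi_def)
      have D: "D p = - X - \<epsilon>" using spV(3)[OF p] by (simp add: D_def X_def norm_eq_1)
      have ef: "\<epsilon> * f p = S p + F p - u p" using eps by (simp add: f_def)
      have "\<epsilon> * ((f p * u p + u p * f p) * psi p + u p * u p * D p)
         = 2 * P * u p * (\<epsilon> * f p) - \<epsilon> * X * (u p)\<^sup>2 - \<epsilon>\<^sup>2 * (u p)\<^sup>2"
        unfolding D P_def[symmetric] by (simp add: power2_eq_square algebra_simps)
      also have "\<dots> = 2 * P * u p * F p + 2 * (P * u p) * S p - 2 * P * (u p)\<^sup>2 - \<epsilon> * X * (u p)\<^sup>2 - \<epsilon>\<^sup>2 * (u p)\<^sup>2"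
        unfolding ef by (simp add: power2_eq_square algebra_simps)
      also have "\<dots> \<le> (P * (F p)\<^sup>2 + P * (u p)\<^sup>2) + (2 * Mb\<^sup>2 / \<epsilon>\<^sup>2 * (S p)\<^sup>2 + \<epsilon>\<^sup>2 / 2 * (u p)\<^sup>2)
          - 2 * P * (u p)\<^sup>2 - \<epsilon> * X * (u p)\<^sup>2 - \<epsilon>\<^sup>2 * (u p)\<^sup>2"
      proof -
        have "0 \<le> P * (F p - u p)\<^sup>2" using P by simp
        then have 1: "2 * P * u p * F p \<le> P * (F p)\<^sup>2 + P * (u p)\<^sup>2"
          by (simp add: power2_eq_square algebra_simps)
        \<comment> \<open>Young's inequality, weighted so that \<open>S\<close> uses up half of the
          available \<open>\<epsilon>\<^sup>2 * u\<^sup>2\<close>. This is the origin of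
          \<open>1 / \<epsilon>\<^sup>2\<close> in front of \<open>S\<^sup>2\<close>.\<close>
        have "0 \<le> (\<epsilon> * u p - 2 * P / \<epsilon> * S p)\<^sup>2" by simp
        also have "\<dots> = \<epsilon>\<^sup>2 * (u p)\<^sup>2 + 4 * P\<^sup>2 / \<epsilon>\<^sup>2 * (S p)\<^sup>2 - 4 * (P * u p) * S p"
          using eps by (simp add: power2_diff power_mult_distrib power_divide)
        finally have 2: "2 * (P * u p) * S p \<le> 2 * P\<^sup>2 / \<epsilon>\<^sup>2 * (S p)\<^sup>2 + \<epsilon>\<^sup>2 / 2 * (u p)\<^sup>2" by simp
        have "P\<^sup>2 \<le> Mb\<^sup>2" using P by (intro power_mono) auto
        then have "2 * P\<^sup>2 / \<epsilon>\<^sup>2 * (S p)\<^sup>2 \<le> 2 * Mb\<^sup>2 / \<epsilon>\<^sup>2 * (S p)\<^sup>2"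
          by (intro mult_right_mono divide_right_mono) auto
        then show ?thesis using 1 2 by linarith
      qed
      also have "\<dots> = psi p * (F p)\<^sup>2 + 2 * Mb\<^sup>2 / \<epsilon>\<^sup>2 * (S p)\<^sup>2 - (aw (fst p) + \<epsilon>\<^sup>2 / 2) * (u p)\<^sup>2"
        unfolding aw P_def[symmetric] by (simp add: algebra_simps)
      finally show "\<epsilon> * ((f p * u p + u p * f p) * psi p + u p * u p * D p)
        \<le> psi p * (F p)\<^sup>2 + 2 * Mb\<^sup>2 / \<epsilon>\<^sup>2 * (S p)\<^sup>2 - (aw (fst p) + \<epsilon>\<^sup>2 / 2) * (u p)\<^sup>2" .
    qed
    then show ?thesis by simp
  qed
  have split: "(\<integral>p. psi p * (F p)\<^sup>2 + 2 * Mb\<^sup>2 / \<epsilon>\<^sup>2 * (S p)\<^sup>2 - (aw (fst p) + \<epsilon>\<^sup>2 / 2) * (u p)\<^sup>2 \<partial>V)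
    = (\<integral>p. psi p * (F p)\<^sup>2 \<partial>V) + 2 * Mb\<^sup>2 / \<epsilon>\<^sup>2 * (\<integral>p. (S p)\<^sup>2 \<partial>V) - (\<integral>p. (aw (fst p) + \<epsilon>\<^sup>2 / 2) * (u p)\<^sup>2 \<partial>V)"
    using Fi Si awi by (subst Bochner_Integration.integral_diff) (auto simp: Bochner_Integration.integral_add)
  define Ia where "Ia = (\<integral>p. (f p * u p + u p * f p) * psi p + u p * u p * D p \<partial>V)"
  have gI: "(\<integral>p. u (ext p) * u (ext p) * psi (ext p) \<partial>Kin)
     = (\<integral>p. planar_const * g p * (planar_const * g p) * psi p \<partial>Kin) + planar_const * Ia"
    using green(2) unfolding Ia_def by linarith
  have "\<epsilon> * (\<integral>p. (u (ext p))\<^sup>2 \<partial>Kin) \<le> \<epsilon> * (\<integral>p. u (ext p) * u (ext p) * psi (ext p) \<partial>Kin)"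
    using eps ue by (intro mult_left_mono) auto
  also have "\<dots> = \<epsilon> * (\<integral>p. planar_const * g p * (planar_const * g p) * psi p \<partial>Kin) + planar_const * (\<epsilon> * Ia)"
    unfolding gI by (simp only: distrib_left mult.left_commute)
  also have "\<dots> \<le> \<epsilon> * (planar_const\<^sup>2 * Mb * (\<integral>p. (g p)\<^sup>2 \<partial>Kin)) + planar_const *
      ((\<integral>p. psi p * (F p)\<^sup>2 \<partial>V) + 2 * Mb\<^sup>2 / \<epsilon>\<^sup>2 * (\<integral>p. (S p)\<^sup>2 \<partial>V) - (\<integral>p. (aw (fst p) + \<epsilon>\<^sup>2 / 2) * (u p)\<^sup>2 \<partial>V))"
    using eps pos_c ge key[unfolded split Ia_def[symmetric]] by (intro add_mono mult_left_mono) auto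
  finally show "\<epsilon> * (\<integral>p. (u (ext p))\<^sup>2 \<partial>Kin) + planar_const * (\<integral>p. (aw (fst p) + \<epsilon>\<^sup>2 / 2) * (u p)\<^sup>2 \<partial>V)
      \<le> planar_const * (\<integral>p. psi p * (F p)\<^sup>2 \<partial>V) + planar_const * (2 * Mb\<^sup>2 / \<epsilon>\<^sup>2) * (\<integral>p. (S p)\<^sup>2 \<partial>V)
        + \<epsilon> * planar_const\<^sup>2 * Mb * (\<integral>p. (g p)\<^sup>2 \<partial>Kin)"
    by (simp add: algebra_simps)
qed

text \<open>For an average as source, \<open>psi\<close> reduces to \<open>aw\<close> because the
  odd moment vanishes, and Jensen's inequality replaces the average by the function. The averaged
  \<open>v\<close> is kept distinct from \<open>u\<close> so that the inequality applies to one step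
  of the iteration; with \<open>v = u\<close> the terms with \<open>aw\<close> cancel.\<close>

lemma energy_avg:
  assumes ac: "line_ac (\<lambda>p. planar_const * g p) u (\<lambda>p. (S p + avg v (fst p) - u p) / \<epsilon>)"
    and m [measurable]: "S \<in> borel_measurable borel" "v \<in> borel_measurable borel" "g \<in> borel_measurable borel"
    and u2: "integrable V (\<lambda>p. (u p)\<^sup>2)" and S2: "integrable V (\<lambda>p. (S p)\<^sup>2)"
    and v2: "integrable V (\<lambda>p. (v p)\<^sup>2)" and g2: "integrable Kin (\<lambda>p. (g p)\<^sup>2)"
  shows "integrable Kin (\<lambda>p. (u (ext p))\<^sup>2)"
    "\<epsilon> * (\<integral>p. (u (ext p))\<^sup>2 \<partial>Kin) + planar_const * (\<integral>p. (aw (fst p) + \<epsilon>\<^sup>2 / 2) * (u p)\<^sup>2 \<partial>V)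
      \<le> planar_const * (\<integral>p. aw (fst p) * (v p)\<^sup>2 \<partial>V) + planar_const * (2 * Mb\<^sup>2 / \<epsilon>\<^sup>2) * (\<integral>p. (S p)\<^sup>2 \<partial>V)
        + \<epsilon> * planar_const\<^sup>2 * Mb * (\<integral>p. (g p)\<^sup>2 \<partial>Kin)"
proof -
  have am: "(\<lambda>p::phase. avg v (fst p)) \<in> borel_measurable borel" by measurable
  note E = energy[OF ac m(1) am m(3) u2 S2 avg_L2[OF m(2) v2] g2]
  show "integrable Kin (\<lambda>p. (u (ext p))\<^sup>2)" by (rule E(1))
  have ab: "0 \<le> aw x \<and> aw x \<le> rad\<^sup>2 + 2" if "x \<in> \<Omega>" for x
    using aw_bounds(1)[of x] aw_bounds(2)[of x] that closure_subset[of \<Omega>] by force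
  note J = avg_jensen[OF m(2) v2 aw_measurable ab]
  note O = odd_moment_zero[OF avg_measurable[OF m(2)] avg_L2[OF m(2) v2]]
  have "(\<integral>p. psi p * (avg v (fst p))\<^sup>2 \<partial>V)
     = (\<integral>p. aw (fst p) * (avg v (fst p))\<^sup>2 - \<epsilon> * ((fst p \<bullet> snd p) * (avg v (fst p))\<^sup>2) \<partial>V)"
    by (simp add: psi_def left_diff_distrib mult.assoc)
  also have "\<dots> = (\<integral>p. aw (fst p) * (avg v (fst p))\<^sup>2 \<partial>V)"
    using J(1) O by (subst Bochner_Integration.integral_diff) auto
  also have "\<dots> \<le> (\<integral>p. aw (fst p) * (v p)\<^sup>2 \<partial>V)" by (rule J(3))
  finally have "planar_const * (\<integral>p. psi p * (avg v (fst p))\<^sup>2 \<partial>V) \<le> planar_const * (\<integral>p. aw (fst p) * (v p)\<^sup>2 \<partial>V)"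
    using pos_c by (intro mult_left_mono) auto
  then show "\<epsilon> * (\<integral>p. (u (ext p))\<^sup>2 \<partial>Kin) + planar_const * (\<integral>p. (aw (fst p) + \<epsilon>\<^sup>2 / 2) * (u p)\<^sup>2 \<partial>V)
      \<le> planar_const * (\<integral>p. aw (fst p) * (v p)\<^sup>2 \<partial>V) + planar_const * (2 * Mb\<^sup>2 / \<epsilon>\<^sup>2) * (\<integral>p. (S p)\<^sup>2 \<partial>V)
        + \<epsilon> * planar_const\<^sup>2 * Mb * (\<integral>p. (g p)\<^sup>2 \<partial>Kin)"
    using E(2) by linarith
qed

end

end

subsection \<open>Existence by monotone iteration\<close>

text \<open>For an increasing sequence a product of two members is dominated by the square of the
  later one.\<close>

lemma SUP_square_le:
  fixes f :: "nat \<Rightarrow> ennreal"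
  assumes "incseq f"
  shows "(SUP n. f n)\<^sup>2 \<le> (SUP n. (f n)\<^sup>2)"
proof -
  have "(SUP n. f n)\<^sup>2 = (SUP n. (SUP m. f n * f m))"
    by (simp add: power2_eq_square SUP_mult_right_ennreal SUP_mult_left_ennreal) (rule SUP_commute)
  also have "\<dots> \<le> (SUP n. (f n)\<^sup>2)"
  proof (intro SUP_least)
    fix n m
    have "f n * f m \<le> f (max n m) * f (max n m)"
      using assms by (intro mult_mono) (auto simp: incseq_def)
    also have "\<dots> \<le> (SUP n. (f n)\<^sup>2)"
      unfolding power2_eq_square by (rule SUP_upper2[of "max n m"]) auto
    finally show "f n * f m \<le> (SUP n. (f n)\<^sup>2)" .
  qed
  finally show ?thesis .
qed

context c3_dom
begin

lemma enn2real_L2: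
  assumes [measurable]: "W \<in> borel_measurable borel" and W2: "(\<integral>\<^sup>+p. (W p)\<^sup>2 \<partial>V) < top"
  shows "AE p in V. W p = ennreal (enn2real (W p))" "integrable V (\<lambda>p. (enn2real (W p))\<^sup>2)"
    "(\<integral>\<^sup>+p. (W p)\<^sup>2 \<partial>V) = ennreal (\<integral>p. (enn2real (W p))\<^sup>2 \<partial>V)"
proof -
  have "AE p in V. (W p)\<^sup>2 \<noteq> \<infinity>"
    using W2 by (intro nn_integral_PInf_AE) (auto intro!: measurable_VI)
  then show ae: "AE p in V. W p = ennreal (enn2real (W p))"
    by (rule eventually_mono) (auto simp: power2_eq_square ennreal_mult_eq_top_iff less_top)
  have eq: "(\<integral>\<^sup>+p. (W p)\<^sup>2 \<partial>V) = (\<integral>\<^sup>+p. ennreal ((enn2real (W p))\<^sup>2) \<partial>V)"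
    by (rule nn_integral_cong_AE, rule eventually_mono[OF ae]) (metis ennreal_power enn2real_nonneg)
  show i: "integrable V (\<lambda>p. (enn2real (W p))\<^sup>2)"
    using W2 eq by (subst integrable_square_iff) (auto intro!: measurable_VI)
  show "(\<integral>\<^sup>+p. (W p)\<^sup>2 \<partial>V) = ennreal (\<integral>p. (enn2real (W p))\<^sup>2 \<partial>V)"
    unfolding eq by (rule nn_integral_eq_integral[OF i]) simp
qed

lemma AE_V_slices:
  assumes "AE p in V. P p"
  shows "AE p in V. AE w in sphere_measure. P (fst p, w)"
proof -
  interpret PP: pair_sigma_finite "restrict_space lborel \<Omega>" sphere_measure by (rule pair_V)
  have "AE x in restrict_space lborel \<Omega>. AE w in sphere_measure. P (x, w)"
    using PP.AE_pair[OF assms[unfolded vol_measure_def]] .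
  then show ?thesis by (rule AE_V_fst)
qed

text \<open>The average with extended values is monotone in \<open>W\<close> without any
  integrability; \<open>avg\<close>, which is 0 on slices that are not integrable, would not
  be.\<close>

definition avgE :: "(phase \<Rightarrow> ennreal) \<Rightarrow> real^3 \<Rightarrow> ennreal" where
  "avgE W x = ennreal (1 / (4 * pi)) * (\<integral>\<^sup>+w. W (x, w) \<partial>sphere_measure)"

lemma avgE_measurable [measurable]: "W \<in> borel_measurable borel \<Longrightarrow> avgE W \<in> borel_measurable borel"
proof -
  assume "W \<in> borel_measurable borel"
  then have "(\<lambda>(x, w). W (x, w)) \<in> borel_measurable (borel \<Otimes>\<^sub>M sphere_measure)" by (rule measurable_pair_sphere)
  then have "(\<lambda>x. \<integral>\<^sup>+w. W (x, w) \<partial>sphere_measure) \<in> borel_measurable borel"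
    by (rule sphere.borel_measurable_nn_integral)
  then show ?thesis unfolding avgE_def[abs_def] by measurable
qed

lemma avg_nonneg: "(\<And>p. 0 \<le> u p) \<Longrightarrow> 0 \<le> avg u x"
  unfolding avg_def ang_avg_def by (intro mult_nonneg_nonneg integral_nonneg_AE) auto

lemma avgE_avg:
  assumes W [measurable]: "W \<in> borel_measurable borel" and W2: "(\<integral>\<^sup>+p. (W p)\<^sup>2 \<partial>V) < top"
  shows "AE p in V. avgE W (fst p) = ennreal (avg (\<lambda>p. enn2real (W p)) (fst p))"
proof -
  let ?u = "\<lambda>p. enn2real (W p)"
  have um: "?u \<in> borel_measurable borel" by measurable
  show ?thesis
    using AE_V_slices[OF enn2real_L2(1)[OF assms]] AE_sphere_integrable[OF um enn2real_L2(2)[OF assms]]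
  proof eventually_elim
    fix p assume ae: "AE w in sphere_measure. W (fst p, w) = ennreal (?u (fst p, w))"
      and i: "integrable sphere_measure (\<lambda>w. ?u (fst p, w))"
    have "(\<integral>\<^sup>+w. W (fst p, w) \<partial>sphere_measure) = (\<integral>\<^sup>+w. ennreal (?u (fst p, w)) \<partial>sphere_measure)"
      by (rule nn_integral_cong_AE[OF ae])
    also have "\<dots> = ennreal (\<integral>w. ?u (fst p, w) \<partial>sphere_measure)"
      by (rule nn_integral_eq_integral[OF i]) simp
    finally show "avgE W (fst p) = ennreal (avg ?u (fst p))"
      by (simp add: avgE_def avg_def ang_avg_def ennreal_mult'[symmetric])
  qed
qed

context
  fixes \<epsilon> :: real
  assumes eps: "0 < \<epsilon>" "\<epsilon> < 1"
begin

text \<open>The passage from extended values to real functions: for a square integrable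
  \<open>W\<close> the two averages agree almost everywhere, and \<open>line_ac_cong\<close> allows
  the exchange inside the derivative.\<close>

lemma TR_avg_step:
  fixes S g :: "phase \<Rightarrow> real"
  assumes Sm [measurable]: "S \<in> borel_measurable borel" and gm [measurable]: "g \<in> borel_measurable borel"
    and S0: "\<And>p. 0 \<le> S p" and g0: "\<And>p. 0 \<le> g p"
    and S2: "integrable V (\<lambda>p. (S p)\<^sup>2)" and g2: "integrable Kin (\<lambda>p. (g p)\<^sup>2)"
    and Wm [measurable]: "W \<in> borel_measurable borel" and W2: "(\<integral>\<^sup>+p. (W p)\<^sup>2 \<partial>V) < top"
    and W': "W' = TR \<epsilon> (\<lambda>p. ennreal (S p) + avgE W (fst p)) (\<lambda>p. ennreal (g p))"
  shows "W' \<in> borel_measurable borel" "(\<integral>\<^sup>+p. (W' p)\<^sup>2 \<partial>V) < top"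
    "line_ac (\<lambda>p. planar_const * g p) (\<lambda>p. enn2real (W' p))
       (\<lambda>p. (S p + avg (\<lambda>p. enn2real (W p)) (fst p) - enn2real (W' p)) / \<epsilon>)"
proof -
  let ?u = "\<lambda>p. enn2real (W p)"
  have um: "?u \<in> borel_measurable borel" by measurable
  note u2 = enn2real_L2(2)[OF Wm W2]
  define F where "F p = ennreal (S p) + avgE W (fst p)" for p
  have Fm [measurable]: "F \<in> borel_measurable borel" unfolding F_def[abs_def] by measurable
  have Gm [measurable]: "(\<lambda>p. ennreal (g p)) \<in> borel_measurable borel" by measurable
  have am: "(\<lambda>p::phase. avg ?u (fst p)) \<in> borel_measurable borel" by measurable
  have a0: "0 \<le> avg ?u x" for x by (rule avg_nonneg) simp
  have Fae: "AE p in V. F p = ennreal (S p + avg ?u (fst p))"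
    by (rule eventually_mono[OF avgE_avg[OF Wm W2]]) (simp add: F_def S0 a0 ennreal_plus)
  have "integrable V (\<lambda>p. (S p + avg ?u (fst p))\<^sup>2)"
    by (rule integrable_add_square(1)[OF measurable_VI[OF Sm] measurable_VI[OF am] S2 avg_L2[OF um u2]])
  then have "(\<integral>\<^sup>+p. ennreal ((S p + avg ?u (fst p))\<^sup>2) \<partial>V) < top"
    by (subst (asm) integrable_square_iff) (auto intro!: measurable_VI)
  moreover have "(\<integral>\<^sup>+p. (F p)\<^sup>2 \<partial>V) = (\<integral>\<^sup>+p. ennreal ((S p + avg ?u (fst p))\<^sup>2) \<partial>V)"
    by (rule nn_integral_cong_AE, rule eventually_mono[OF Fae]) (simp add: ennreal_power S0 a0 del: ennreal_plus)
  ultimately have F2: "(\<integral>\<^sup>+p. (F p)\<^sup>2 \<partial>V) < top" by simp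
  have "(\<integral>\<^sup>+p. ennreal ((g p)\<^sup>2) \<partial>Kin) < top"
    using g2 by (subst (asm) integrable_square_iff) (auto intro!: measurable_KinI)
  then have G2: "(\<integral>\<^sup>+p. (ennreal (g p))\<^sup>2 \<partial>Kin) < top" by (simp add: ennreal_power g0)
  have W'F: "W' = TR \<epsilon> F (\<lambda>p. ennreal (g p))" by (simp add: W' F_def[abs_def])
  show W'm [measurable]: "W' \<in> borel_measurable borel" unfolding W'F using TR_measurable[OF eps Fm Gm] .
  show "(\<integral>\<^sup>+p. (W' p)\<^sup>2 \<partial>V) < top" unfolding W'F by (rule TR_L2[OF eps Fm Gm F2 G2])
  have ac: "line_ac (\<lambda>p. planar_const * enn2real (ennreal (g p))) (\<lambda>p. enn2real (W' p))
       (\<lambda>p. (enn2real (F p) - enn2real (W' p)) / \<epsilon>)"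
    unfolding W'F by (rule TR_ac[OF eps Fm Gm F2 G2])
  have "line_ac (\<lambda>p. planar_const * enn2real (ennreal (g p))) (\<lambda>p. enn2real (W' p))
       (\<lambda>p. (S p + avg ?u (fst p) - enn2real (W' p)) / \<epsilon>)"
  proof (rule line_ac_cong[OF ac])
    show "(\<lambda>p. (S p + avg ?u (fst p) - enn2real (W' p)) / \<epsilon>) \<in> borel_measurable borel" by measurable
    show "AE p in V. (enn2real (F p) - enn2real (W' p)) / \<epsilon> = (S p + avg ?u (fst p) - enn2real (W' p)) / \<epsilon>"
      by (rule eventually_mono[OF Fae]) (simp add: S0 a0 del: ennreal_plus)
  qed
  then show "line_ac (\<lambda>p. planar_const * g p) (\<lambda>p. enn2real (W' p))
       (\<lambda>p. (S p + avg ?u (fst p) - enn2real (W' p)) / \<epsilon>)"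
    by (simp add: g0)
qed

definition Xn :: "(phase \<Rightarrow> real) \<Rightarrow> real" where
  "Xn u = (\<integral>p. (aw (fst p) + \<epsilon>\<^sup>2 / 2) * (u p)\<^sup>2 \<partial>V)"

lemma Xn_integrable:
  assumes u2: "integrable V (\<lambda>p. (u p)\<^sup>2)"
  shows "integrable V (\<lambda>p. (aw (fst p) + \<epsilon>\<^sup>2 / 2) * (u p)\<^sup>2)" "integrable V (\<lambda>p. aw (fst p) * (u p)\<^sup>2)"
    "(\<integral>p. aw (fst p) * (u p)\<^sup>2 \<partial>V) + \<epsilon>\<^sup>2 / 2 * (\<integral>p. (u p)\<^sup>2 \<partial>V) = Xn u"
proof -
  have awm: "(\<lambda>p::phase. aw (fst p)) \<in> borel_measurable borel" by measurable
  show ai: "integrable V (\<lambda>p. aw (fst p) * (u p)\<^sup>2)"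
  proof (rule integrable_bounded_mult[OF u2 measurable_VI[OF awm], where K="rad\<^sup>2 + 2"])
    fix p assume "p \<in> space V"
    then have "fst p \<in> closure \<Omega>" using closure_subset[of \<Omega>] by (auto simp: space_V)
    then show "\<bar>aw (fst p)\<bar> \<le> rad\<^sup>2 + 2" using aw_bounds(1)[of "fst p"] aw_bounds(2)[of "fst p"] by simp
  qed
  have bi: "integrable V (\<lambda>p. \<epsilon>\<^sup>2 / 2 * (u p)\<^sup>2)" by (rule integrable_mult_right[OF u2])
  show "integrable V (\<lambda>p. (aw (fst p) + \<epsilon>\<^sup>2 / 2) * (u p)\<^sup>2)"
    using Bochner_Integration.integrable_add[OF ai bi] by (simp add: distrib_right)
  show "(\<integral>p. aw (fst p) * (u p)\<^sup>2 \<partial>V) + \<epsilon>\<^sup>2 / 2 * (\<integral>p. (u p)\<^sup>2 \<partial>V) = Xn u"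
    unfolding Xn_def using Bochner_Integration.integral_add[OF ai bi] by (simp add: distrib_right)
qed

lemma Xn_ge:
  assumes u2: "integrable V (\<lambda>p. (u p)\<^sup>2)"
  shows "(\<integral>p. (u p)\<^sup>2 \<partial>V) \<le> Xn u"
  unfolding Xn_def
proof (rule integral_mono[OF u2 Xn_integrable(1)[OF u2]])
  fix p assume "p \<in> space V"
  then have "fst p \<in> closure \<Omega>" using closure_subset[of \<Omega>] by (auto simp: space_V)
  then have "1 \<le> aw (fst p) + \<epsilon>\<^sup>2 / 2" using aw_bounds(1)[of "fst p"] by (simp add: add_increasing2)
  then have "1 * (u p)\<^sup>2 \<le> (aw (fst p) + \<epsilon>\<^sup>2 / 2) * (u p)\<^sup>2" by (intro mult_right_mono) auto
  then show "(u p)\<^sup>2 \<le> (aw (fst p) + \<epsilon>\<^sup>2 / 2) * (u p)\<^sup>2" by simp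
qed

text \<open>The largest possible ratio of \<open>aw\<close> to
  \<open>aw + \<epsilon>\<^sup>2 / 2\<close>: the function \<open>a / (a + e)\<close> increases in
  \<open>a\<close>, and \<open>aw\<close> is at most \<open>rad\<^sup>2 + 2\<close>.\<close>

definition cr :: real where "cr = (rad\<^sup>2 + 2) / (rad\<^sup>2 + 2 + \<epsilon>\<^sup>2 / 2)"

lemma cr: "0 \<le> cr" "cr < 1"
  using eps by (auto simp: cr_def add_nonneg_pos divide_less_eq intro!: divide_nonneg_nonneg add_nonneg_nonneg)

lemma aw_contract:
  assumes u2: "integrable V (\<lambda>p. (u p)\<^sup>2)"
  shows "(\<integral>p. aw (fst p) * (u p)\<^sup>2 \<partial>V) \<le> cr * Xn u"
proof -
  have "(\<integral>p. aw (fst p) * (u p)\<^sup>2 \<partial>V) \<le> (\<integral>p. cr * ((aw (fst p) + \<epsilon>\<^sup>2 / 2) * (u p)\<^sup>2) \<partial>V)"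
  proof (rule integral_mono[OF Xn_integrable(2)[OF u2] integrable_mult_right[OF Xn_integrable(1)[OF u2]]])
    fix p assume p: "p \<in> space V"
    define A e a where "A = rad\<^sup>2 + 2" and "e = \<epsilon>\<^sup>2 / 2" and "a = aw (fst p)"
    have e: "0 < e" "0 < A" using eps by (auto simp: e_def A_def add_nonneg_pos)
    have aA: "a \<le> A" using aw_bounds(2)[of "fst p"] by (simp add: a_def A_def)
    have "a * (A + e) \<le> A * (a + e)" using mult_right_mono[OF aA, of e] e by (simp add: algebra_simps)
    then have "a \<le> A / (A + e) * (a + e)" using e by (simp add: pos_le_divide_eq)
    then have "a * (u p)\<^sup>2 \<le> (A / (A + e) * (a + e)) * (u p)\<^sup>2" by (intro mult_right_mono) auto
    then show "aw (fst p) * (u p)\<^sup>2 \<le> cr * ((aw (fst p) + \<epsilon>\<^sup>2 / 2) * (u p)\<^sup>2)"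
      by (simp add: cr_def A_def e_def a_def mult.assoc)
  qed
  then show ?thesis by (simp add: Xn_def)
qed

text \<open>An increasing sequence of extended functions has a limit; what needs proof is that it is
  square integrable. By the energy inequality \<open>Xn\<close> of the next iterate is at most
  \<open>cr\<close> times \<open>Xn\<close> of the present one plus \<open>D\<close>, and
  \<open>cr < 1\<close> makes this bound self-reproducing.\<close>

lemma existence_nonneg:
  fixes S g :: "phase \<Rightarrow> real"
  assumes Sm [measurable]: "S \<in> borel_measurable borel" and gm [measurable]: "g \<in> borel_measurable borel"
    and S0: "\<And>p. 0 \<le> S p" and g0: "\<And>p. 0 \<le> g p"
    and S2: "integrable V (\<lambda>p. (S p)\<^sup>2)" and g2: "integrable Kin (\<lambda>p. (g p)\<^sup>2)"
  shows "\<exists>u. u \<in> borel_measurable borel \<and> integrable V (\<lambda>p. (u p)\<^sup>2) \<and>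
    line_ac (\<lambda>p. planar_const * g p) u (\<lambda>p. (S p + avg u (fst p) - u p) / \<epsilon>)"
proof -
  define G where "G W = TR \<epsilon> (\<lambda>p. ennreal (S p) + avgE W (fst p)) (\<lambda>p. ennreal (g p))" for W
  define W where "W n = (G ^^ n) (\<lambda>_. 0)" for n
  have W0: "W 0 = (\<lambda>_. 0)" and WS: "W (Suc n) = G (W n)" for n by (auto simp: W_def)
  define D where "D = 2 * Mb\<^sup>2 / \<epsilon>\<^sup>2 * (\<integral>p. (S p)\<^sup>2 \<partial>V) + \<epsilon> * planar_const * Mb * (\<integral>p. (g p)\<^sup>2 \<partial>Kin)"
  have Mb0: "0 \<le> Mb" using rad(1) by (simp add: Mb_def)
  have D0: "0 \<le> D" using eps pos_c Mb0 by (simp add: D_def)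
  \<comment> \<open>The fixed point of \<open>r \<mapsto> cr * r + D\<close>, so a bound by
    \<open>R\<close> is inherited by the next iterate.\<close>
  define R where "R = D / (1 - cr)"
  have R: "0 \<le> R" "cr * R + D = R" using cr D0 by (auto simp: R_def field_simps)
  have inv: "W n \<in> borel_measurable borel \<and> (\<integral>\<^sup>+p. (W n p)\<^sup>2 \<partial>V) < top \<and> Xn (\<lambda>p. enn2real (W n p)) \<le> R" for n
  proof (induction n)
    case 0
    then show ?case using R by (simp add: W0 Xn_def)
  next
    case (Suc n)
    let ?u = "\<lambda>p. enn2real (W n p)" and ?v = "\<lambda>p. enn2real (W (Suc n) p)"
    have [measurable]: "W n \<in> borel_measurable borel" using Suc by blast
    have um: "?u \<in> borel_measurable borel" by measurable
    have u2: "integrable V (\<lambda>p. (?u p)\<^sup>2)" using enn2real_L2(2) Suc by blast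
    note st = TR_avg_step[OF Sm gm S0 g0 S2 g2 conjunct1[OF Suc] conjunct1[OF conjunct2[OF Suc]], of "W (Suc n)", unfolded WS G_def, OF refl, folded G_def, folded WS]
    have v2: "integrable V (\<lambda>p. (?v p)\<^sup>2)" by (rule enn2real_L2(2)[OF st(1,2)])
    note en = energy_avg(2)[OF eps st(3) Sm um gm v2 S2 u2 g2]
    \<comment> \<open>The outgoing trace has the favourable sign and is dropped.\<close>
    have "0 \<le> \<epsilon> * (\<integral>p. (?v (ext p))\<^sup>2 \<partial>Kin)" using eps by simp
    then have "planar_const * Xn ?v \<le> planar_const * (\<integral>p. aw (fst p) * (?u p)\<^sup>2 \<partial>V) + planar_const * D"
      using en unfolding Xn_def[symmetric] D_def by (simp add: algebra_simps power2_eq_square)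
    then have "Xn ?v \<le> (\<integral>p. aw (fst p) * (?u p)\<^sup>2 \<partial>V) + D"
      using pos_c unfolding distrib_left[symmetric] by (rule mult_left_le_imp_le)
    also have "\<dots> \<le> cr * Xn ?u + D" using aw_contract[OF u2] by simp
    also have "\<dots> \<le> cr * R + D" using Suc cr by (intro add_right_mono mult_left_mono) auto
    also have "\<dots> = R" by (rule R)
    finally show ?case using st(1,2) by blast
  qed
  have Wm [measurable]: "W n \<in> borel_measurable borel" for n using inv by blast
  have Wm2 [measurable]: "(\<lambda>w. W n (x, w)) \<in> borel_measurable sphere_measure" for n x
    by (rule measurable_sphereI) measurable
  have avgE_mono: "avgE U x \<le> avgE U' x" if "\<And>p. U p \<le> U' p" for U U' x
    unfolding avgE_def using that by (intro mult_left_mono nn_integral_mono) auto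
  have G_mono: "G U p \<le> G U' p" if "\<And>p. U p \<le> U' p" for U U' p
    unfolding G_def by (rule TR_mono[OF eps]) (intro add_left_mono avgE_mono that)
  have "W n p \<le> W (Suc n) p" for n p
  proof (induction n arbitrary: p)
    case 0 then show ?case by (simp add: W0)
  next
    case (Suc n)
    show ?case unfolding WS[of "Suc n"] by (subst WS) (rule G_mono[OF Suc])
  qed
  then have inc: "incseq (\<lambda>n. W n p)" for p by (rule incseq_SucI)
  define Wi where "Wi p = (SUP n. W n p)" for p
  have Wim [measurable]: "Wi \<in> borel_measurable borel" unfolding Wi_def[abs_def] by measurable
  have fin: "(\<integral>\<^sup>+p. (Wi p)\<^sup>2 \<partial>V) < top"
  proof -
    have "(\<integral>\<^sup>+p. (Wi p)\<^sup>2 \<partial>V) \<le> (\<integral>\<^sup>+p. (SUP n. (W n p)\<^sup>2) \<partial>V)"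
      unfolding Wi_def by (intro nn_integral_mono SUP_square_le inc)
    also have "\<dots> = (SUP n. \<integral>\<^sup>+p. (W n p)\<^sup>2 \<partial>V)"
    proof (rule nn_integral_monotone_convergence_SUP)
      have "(W m p)\<^sup>2 \<le> (W n p)\<^sup>2" if "m \<le> n" for m n p
        using incseqD[OF inc that] by (intro power_mono) auto
      then show "incseq (\<lambda>n p. (W n p)\<^sup>2)" by (simp add: incseq_def le_fun_def)
      show "(\<lambda>p. (W n p)\<^sup>2) \<in> borel_measurable V" for n by (rule measurable_VI) measurable
    qed
    also have "\<dots> \<le> ennreal R"
    proof (rule SUP_least)
      fix n
      have n: "W n \<in> borel_measurable borel" "(\<integral>\<^sup>+p. (W n p)\<^sup>2 \<partial>V) < top" "Xn (\<lambda>p. enn2real (W n p)) \<le> R"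
        using inv by auto
      show "(\<integral>\<^sup>+p. (W n p)\<^sup>2 \<partial>V) \<le> ennreal R"
        unfolding enn2real_L2(3)[OF n(1,2)]
        using Xn_ge[OF enn2real_L2(2)[OF n(1,2)]] n(3) by (intro ennreal_leI) linarith
    qed
    finally show ?thesis by (auto intro: le_less_trans)
  qed
  have fixp: "Wi = G Wi"
  proof
    fix p
    \<comment> \<open>Dropping the first member does not change the supremum of an increasing
      sequence, and every remaining member is an image under \<open>G\<close>.\<close>
    have "Wi p = (SUP n. W (Suc n) p)"
      unfolding Wi_def by (rule antisym) (auto intro!: SUP_least intro: SUP_upper2 incseq_SucD[OF inc])
    also have "\<dots> = (SUP n. TR \<epsilon> (\<lambda>p. ennreal (S p) + avgE (W n) (fst p)) (\<lambda>p. ennreal (g p)) p)"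
      by (simp add: WS G_def)
    also have "\<dots> = TR \<epsilon> (\<lambda>p. SUP n. ennreal (S p) + avgE (W n) (fst p)) (\<lambda>p. ennreal (g p)) p"
    proof (rule TR_SUP[OF eps, symmetric])
      show "(\<lambda>p. ennreal (S p) + avgE (W n) (fst p)) \<in> borel_measurable borel" for n by measurable
      show "incseq (\<lambda>n. ennreal (S p) + avgE (W n) (fst p))" for p
      proof (rule incseq_SucI)
        fix n
        have "W n q \<le> W (Suc n) q" for q using incseq_SucD[OF inc] .
        then show "ennreal (S p) + avgE (W n) (fst p) \<le> ennreal (S p) + avgE (W (Suc n)) (fst p)"
          by (intro add_left_mono avgE_mono)
      qed
    qed
    also have "(\<lambda>p. SUP n. ennreal (S p) + avgE (W n) (fst p)) = (\<lambda>p. ennreal (S p) + avgE Wi (fst p))"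
    proof
      fix p :: "phase"
      have "(\<integral>\<^sup>+w. (SUP n. W n (fst p, w)) \<partial>sphere_measure) = (SUP n. \<integral>\<^sup>+w. W n (fst p, w) \<partial>sphere_measure)"
      proof (rule nn_integral_monotone_convergence_SUP)
        show "incseq (\<lambda>n w. W n (fst p, w))" using incseqD[OF inc] by (simp add: incseq_def le_fun_def)
      qed measurable
      then show "(SUP n. ennreal (S p) + avgE (W n) (fst p)) = ennreal (S p) + avgE Wi (fst p)"
        by (simp add: avgE_def Wi_def SUP_mult_left_ennreal ennreal_SUP_add_right)
    qed
    finally show "Wi p = G Wi p" by (simp add: G_def)
  qed
  note st = TR_avg_step[OF Sm gm S0 g0 S2 g2 Wim fin fixp[unfolded G_def]]
  have "(\<lambda>p. enn2real (Wi p)) \<in> borel_measurable borel" by measurable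
  then show ?thesis using st(3) enn2real_L2(2)[OF Wim fin] by blast
qed

lemma pos_neg_parts:
  fixes S :: "'a \<Rightarrow> real"
  assumes [measurable]: "S \<in> borel_measurable M" and S2: "integrable M (\<lambda>p. (S p)\<^sup>2)"
  shows "integrable M (\<lambda>p. (max 0 (S p))\<^sup>2)" "integrable M (\<lambda>p. (max 0 (- S p))\<^sup>2)"
proof -
  have le: "(max 0 a)\<^sup>2 \<le> a\<^sup>2" "(max 0 (- a))\<^sup>2 \<le> a\<^sup>2" for a :: real by (auto simp: max_def)
  show "integrable M (\<lambda>p. (max 0 (S p))\<^sup>2)"
    by (rule Bochner_Integration.integrable_bound[OF S2]) (auto simp: le)
  show "integrable M (\<lambda>p. (max 0 (- S p))\<^sup>2)"
    by (rule Bochner_Integration.integrable_bound[OF S2]) (auto simp: le)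
qed

text \<open>By linearity: the solutions for the positive and the negative parts of the data are
  subtracted. The averages subtract almost everywhere, which suffices for the derivative.\<close>

lemma existence_char:
  fixes S g :: "phase \<Rightarrow> real"
  assumes Sm [measurable]: "S \<in> borel_measurable borel" and gm [measurable]: "g \<in> borel_measurable borel"
    and S2: "integrable V (\<lambda>p. (S p)\<^sup>2)" and g2: "integrable Kin (\<lambda>p. (g p)\<^sup>2)"
  shows "\<exists>u. u \<in> borel_measurable borel \<and> integrable V (\<lambda>p. (u p)\<^sup>2) \<and>
    line_ac (\<lambda>p. planar_const * g p) u (\<lambda>p. (S p + avg u (fst p) - u p) / \<epsilon>)"
proof -
  have m: "(\<lambda>p. max 0 (S p)) \<in> borel_measurable borel" "(\<lambda>p. max 0 (- S p)) \<in> borel_measurable borel"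
    "(\<lambda>p. max 0 (g p)) \<in> borel_measurable borel" "(\<lambda>p. max 0 (- g p)) \<in> borel_measurable borel" by measurable
  note SV = pos_neg_parts[OF measurable_VI[OF Sm] S2] and gK = pos_neg_parts[OF measurable_KinI[OF gm] g2]
  obtain u where u: "u \<in> borel_measurable borel" "integrable V (\<lambda>p. (u p)\<^sup>2)"
    "line_ac (\<lambda>p. planar_const * max 0 (g p)) u (\<lambda>p. (max 0 (S p) + avg u (fst p) - u p) / \<epsilon>)"
    using existence_nonneg[OF m(1,3) _ _ SV(1) gK(1)] by auto
  obtain v where v: "v \<in> borel_measurable borel" "integrable V (\<lambda>p. (v p)\<^sup>2)"
    "line_ac (\<lambda>p. planar_const * max 0 (- g p)) v (\<lambda>p. (max 0 (- S p) + avg v (fst p) - v p) / \<epsilon>)"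
    using existence_nonneg[OF m(2,4) _ _ SV(2) gK(2)] by auto
  note [measurable] = u(1) v(1)
  define z where "z p = u p - v p" for p
  have zm [measurable]: "z \<in> borel_measurable borel" unfolding z_def[abs_def] by measurable
  have z2: "integrable V (\<lambda>p. (z p)\<^sup>2)"
    unfolding z_def by (rule integrable_add_square(2)[OF measurable_VI[OF u(1)] measurable_VI[OF v(1)] u(2) v(2)])
  have pm: "max 0 a - max 0 (- a) = a" for a :: real by (simp add: max_def)
  have "line_ac (\<lambda>p. planar_const * g p) z
     (\<lambda>p. (max 0 (S p) + avg u (fst p) - u p) / \<epsilon> - (max 0 (- S p) + avg v (fst p) - v p) / \<epsilon>)"
    using line_ac_diff[OF u(3) v(3)] by (simp add: z_def[abs_def] right_diff_distrib[symmetric] pm)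
  then have "line_ac (\<lambda>p. planar_const * g p) z (\<lambda>p. (S p + avg z (fst p) - z p) / \<epsilon>)"
  proof (rule line_ac_cong)
    show "(\<lambda>p. (S p + avg z (fst p) - z p) / \<epsilon>) \<in> borel_measurable borel" by measurable
    show "AE p in V. (max 0 (S p) + avg u (fst p) - u p) / \<epsilon> - (max 0 (- S p) + avg v (fst p) - v p) / \<epsilon>
       = (S p + avg z (fst p) - z p) / \<epsilon>"
    proof (rule eventually_mono[OF avg_diff[OF u(1,2) v(1,2)]])
      fix p :: "phase"
      assume a: "avg (\<lambda>p. u p - v p) (fst p) = avg u (fst p) - avg v (fst p)"
      show "(max 0 (S p) + avg u (fst p) - u p) / \<epsilon> - (max 0 (- S p) + avg v (fst p) - v p) / \<epsilon>
       = (S p + avg z (fst p) - z p) / \<epsilon>"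
        using a pm[of "S p"] by (simp add: z_def[abs_def] diff_divide_distrib[symmetric] algebra_simps)
    qed
  qed
  then show ?thesis using zm z2 by blast
qed

text \<open>The problem with a prescribed source. It serves to compare a weak solution, whose
  average is frozen into the source, with a solution along characteristics.\<close>

lemma transport_exists:
  fixes F g :: "phase \<Rightarrow> real"
  assumes Fm [measurable]: "F \<in> borel_measurable borel" and gm [measurable]: "g \<in> borel_measurable borel"
    and F2: "integrable V (\<lambda>p. (F p)\<^sup>2)" and g2: "integrable Kin (\<lambda>p. (g p)\<^sup>2)"
  shows "\<exists>u. u \<in> borel_measurable borel \<and> integrable V (\<lambda>p. (u p)\<^sup>2) \<and>
    line_ac (\<lambda>p. planar_const * g p) u (\<lambda>p. (F p - u p) / \<epsilon>)"
proof -
  have pos: "\<exists>u. u \<in> borel_measurable borel \<and> integrable V (\<lambda>p. (u p)\<^sup>2) \<and>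
      line_ac (\<lambda>p. planar_const * G p) u (\<lambda>p. (H p - u p) / \<epsilon>)"
    if [measurable]: "H \<in> borel_measurable borel" "G \<in> borel_measurable borel"
      and nn: "\<And>p. 0 \<le> H p" "\<And>p. 0 \<le> G p"
      and i: "integrable V (\<lambda>p. (H p)\<^sup>2)" "integrable Kin (\<lambda>p. (G p)\<^sup>2)" for H G
  proof -
    have m: "(\<lambda>p. ennreal (H p)) \<in> borel_measurable borel" "(\<lambda>p. ennreal (G p)) \<in> borel_measurable borel" by measurable
    have "(\<integral>\<^sup>+p. ennreal ((H p)\<^sup>2) \<partial>V) < top"
      using i(1) by (subst (asm) integrable_square_iff) (auto intro!: measurable_VI)
    then have f1: "(\<integral>\<^sup>+p. (ennreal (H p))\<^sup>2 \<partial>V) < top" by (simp add: ennreal_power nn)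
    have "(\<integral>\<^sup>+p. ennreal ((G p)\<^sup>2) \<partial>Kin) < top"
      using i(2) by (subst (asm) integrable_square_iff) (auto intro!: measurable_KinI)
    then have f2: "(\<integral>\<^sup>+p. (ennreal (G p))\<^sup>2 \<partial>Kin) < top" by (simp add: ennreal_power nn)
    have tm [measurable]: "TR \<epsilon> (\<lambda>p. ennreal (H p)) (\<lambda>p. ennreal (G p)) \<in> borel_measurable borel"
      by (rule TR_measurable[OF eps m])
    have "(\<lambda>p. enn2real (TR \<epsilon> (\<lambda>p. ennreal (H p)) (\<lambda>p. ennreal (G p)) p)) \<in> borel_measurable borel" by measurable
    moreover have "line_ac (\<lambda>p. planar_const * G p) (\<lambda>p. enn2real (TR \<epsilon> (\<lambda>p. ennreal (H p)) (\<lambda>p. ennreal (G p)) p))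
       (\<lambda>p. (H p - enn2real (TR \<epsilon> (\<lambda>p. ennreal (H p)) (\<lambda>p. ennreal (G p)) p)) / \<epsilon>)"
      using TR_ac[OF eps m f1 f2] by (simp add: nn)
    ultimately show ?thesis using enn2real_L2(2)[OF tm TR_L2[OF eps m f1 f2]] by blast
  qed
  have m: "(\<lambda>p. max 0 (F p)) \<in> borel_measurable borel" "(\<lambda>p. max 0 (- F p)) \<in> borel_measurable borel"
    "(\<lambda>p. max 0 (g p)) \<in> borel_measurable borel" "(\<lambda>p. max 0 (- g p)) \<in> borel_measurable borel" by measurable
  note FV = pos_neg_parts[OF measurable_VI[OF Fm] F2] and gK = pos_neg_parts[OF measurable_KinI[OF gm] g2]
  obtain u where u: "u \<in> borel_measurable borel" "integrable V (\<lambda>p. (u p)\<^sup>2)"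
    "line_ac (\<lambda>p. planar_const * max 0 (g p)) u (\<lambda>p. (max 0 (F p) - u p) / \<epsilon>)"
    using pos[OF m(1,3) _ _ FV(1) gK(1)] by auto
  obtain v where v: "v \<in> borel_measurable borel" "integrable V (\<lambda>p. (v p)\<^sup>2)"
    "line_ac (\<lambda>p. planar_const * max 0 (- g p)) v (\<lambda>p. (max 0 (- F p) - v p) / \<epsilon>)"
    using pos[OF m(2,4) _ _ FV(2) gK(2)] by auto
  note [measurable] = u(1) v(1)
  have pm: "max 0 a - max 0 (- a) = a" for a :: real by (simp add: max_def)
  have d: "(max 0 (F p) - u p) / \<epsilon> - (max 0 (- F p) - v p) / \<epsilon> = (F p - (u p - v p)) / \<epsilon>" for p
    using pm[of "F p"] by (simp add: diff_divide_distrib[symmetric] algebra_simps)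
  have "line_ac (\<lambda>p. planar_const * g p) (\<lambda>p. u p - v p) (\<lambda>p. (F p - (u p - v p)) / \<epsilon>)"
    using line_ac_diff[OF u(3) v(3)] by (simp add: right_diff_distrib[symmetric] pm d)
  moreover have "(\<lambda>p. u p - v p) \<in> borel_measurable borel" by measurable
  moreover have "integrable V (\<lambda>p. (u p - v p)\<^sup>2)"
    by (rule integrable_add_square(2)[OF measurable_VI[OF u(1)] measurable_VI[OF v(1)] u(2) v(2)])
  ultimately show ?thesis by blast
qed

end

end

subsection \<open>Test functions for the adjoint equation\<close>

definition C1grad :: "('a::euclidean_space \<Rightarrow> real) \<Rightarrow> ('a \<Rightarrow> 'a) \<Rightarrow> bool" where
  "C1grad k G \<longleftrightarrow> (\<forall>x. (k has_derivative (\<lambda>h. G x \<bullet> h)) (at x)) \<and> continuous_on UNIV G"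

lemma C1grad_continuous: "C1grad k G \<Longrightarrow> continuous_on UNIV k"
  unfolding C1grad_def by (meson continuous_at_imp_continuous_on has_derivative_continuous)

lemma C1grad_mult:
  assumes "C1grad k G" "C1grad l H"
  shows "C1grad (\<lambda>x. k x * l x) (\<lambda>x. k x *\<^sub>R H x + l x *\<^sub>R G x)"
  using assms C1grad_continuous[OF assms(1)] C1grad_continuous[OF assms(2)]
  unfolding C1grad_def
  by (auto intro!: derivative_eq_intros continuous_intros simp: inner_add_left)

lemma C1grad_prod:
  fixes k :: "'b \<Rightarrow> 'a::euclidean_space \<Rightarrow> real"
  assumes "finite I" "\<And>i. i \<in> I \<Longrightarrow> \<exists>G. C1grad (k i) G"
  shows "\<exists>G. C1grad (\<lambda>x. \<Prod>i\<in>I. k i x) G"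
  using assms
proof (induction I)
  case empty
  have "C1grad (\<lambda>x. 1) (\<lambda>x::'a. 0)" by (auto simp: C1grad_def)
  then show ?case by auto
next
  case (insert i I)
  then obtain G H where "C1grad (k i) G" "C1grad (\<lambda>x. \<Prod>i\<in>I. k i x) H" by blast
  from C1grad_mult[OF this] show ?case using insert by auto
qed

lemma square_pos_part_deriv: "((\<lambda>t::real. (max 0 t)\<^sup>2) has_real_derivative 2 * max 0 t) (at t)"
proof (cases "t = 0")
  case False
  show ?thesis
  proof (cases "0 < t")
    case True
    have "((\<lambda>t. t\<^sup>2) has_real_derivative 2 * max 0 t) (at t)" using True by (auto intro!: derivative_eq_intros)
    then show ?thesis
      by (rule has_field_derivative_transform_within_open[where S="{0<..}"]) (use True in auto)
  next
    case False2: False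
    have "((\<lambda>t. 0) has_real_derivative 2 * max 0 t) (at t)" using False2 by auto
    then show ?thesis
      by (rule has_field_derivative_transform_within_open[where S="{..<0}"]) (use False False2 in auto)
  qed
next
  case True
  have "((\<lambda>h. ((max 0 (0 + h))\<^sup>2 - (max 0 0)\<^sup>2) / h) \<longlongrightarrow> 0) (at (0::real))"
  proof (rule Lim_null_comparison)
    show "\<forall>\<^sub>F h in at 0. norm (((max 0 (0 + h))\<^sup>2 - (max 0 0)\<^sup>2) / h) \<le> \<bar>h\<bar>"
      by (rule always_eventually) (auto simp: max_def power2_eq_square)
    show "((\<lambda>h. \<bar>h\<bar>) \<longlongrightarrow> 0) (at (0::real))" by (auto intro!: tendsto_eq_intros)
  qed
  then show ?thesis using True by (simp add: DERIV_def)
qed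

text \<open>A rational substitute for a smooth cut-off: with \<open>q\<close> the square of the
  positive part of \<open>t\<close>, this is \<open>n * q / (1 + n * q)\<close>. It is continuously
  differentiable because \<open>q\<close> is, and it tends to the indicator of
  \<open>t > 0\<close>.\<close>

definition bump1 :: "nat \<Rightarrow> real \<Rightarrow> real" where
  "bump1 n t = 1 - 1 / (1 + real n * (max 0 t)\<^sup>2)"

lemma bump1_pos: "0 < 1 + real n * (max 0 t)\<^sup>2"
  by (intro add_pos_nonneg) auto

lemma bump1_bounds: "0 \<le> bump1 n t" "bump1 n t \<le> 1"
  using bump1_pos[of n t] by (auto simp: bump1_def)

lemma bump1_zero: "t \<le> 0 \<Longrightarrow> bump1 n t = 0"
  by (simp add: bump1_def max_def)

lemma bump1_lim: "(\<lambda>n. bump1 n t) \<longlonglongrightarrow> (if 0 < t then 1 else 0)"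
proof (cases "0 < t")
  case True
  have "filterlim (\<lambda>n. 1 + real n * t\<^sup>2) at_top sequentially"
    using True by (intro filterlim_tendsto_add_at_top[OF tendsto_const] filterlim_at_top_mult_tendsto_pos[OF tendsto_const])
      (auto intro: filterlim_real_sequentially)
  then have "(\<lambda>n. 1 / (1 + real n * t\<^sup>2)) \<longlonglongrightarrow> 0"
    by (intro tendsto_divide_0[OF tendsto_const] filterlim_at_top_imp_at_infinity)
  then have "(\<lambda>n. 1 - 1 / (1 + real n * t\<^sup>2)) \<longlonglongrightarrow> 1 - 0" by (intro tendsto_intros)
  then show ?thesis using True by (simp add: bump1_def max_def)
qed (simp add: bump1_zero)

lemma bump1_deriv:
  "(bump1 n has_real_derivative (real n * (2 * max 0 t) / (1 + real n * (max 0 t)\<^sup>2)\<^sup>2)) (at t)"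
proof -
  define q where "q = (\<lambda>t::real. (max 0 t)\<^sup>2)"
  have q: "(q has_real_derivative 2 * max 0 t) (at t)" unfolding q_def by (rule square_pos_part_deriv)
  have pos: "1 + real n * q t \<noteq> 0" using bump1_pos[of n t] by (simp add: q_def)
  have "((\<lambda>t. 1 - 1 / (1 + real n * q t)) has_real_derivative
      (real n * (2 * max 0 t) / (1 + real n * q t)\<^sup>2)) (at t)"
    by (rule derivative_eq_intros q refl pos | simp add: power2_eq_square)+
  then show ?thesis by (simp add: q_def bump1_def[abs_def])
qed

lemma bump1_C1:
  fixes v :: "'a::euclidean_space"
  shows "\<exists>G. C1grad (\<lambda>x. bump1 n (x \<bullet> v + r)) G"
proof -
  define d where "d t = real n * (2 * max 0 t) / (1 + real n * (max 0 t)\<^sup>2)\<^sup>2" for t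
  have dc: "continuous_on UNIV d"
    unfolding d_def using bump1_pos[of n] by (intro continuous_intros) (auto simp: less_imp_neq[symmetric])
  have "C1grad (\<lambda>x. bump1 n (x \<bullet> v + r)) (\<lambda>x. d (x \<bullet> v + r) *\<^sub>R v)"
    unfolding C1grad_def
  proof (intro conjI allI)
    fix x
    have 1: "((\<lambda>x. x \<bullet> v + r) has_derivative (\<lambda>h. h \<bullet> v)) (at x)" by (auto intro!: derivative_eq_intros)
    have 2: "(bump1 n has_derivative (*) (d (x \<bullet> v + r))) (at (x \<bullet> v + r))"
      using bump1_deriv[of n "x \<bullet> v + r"] by (simp add: has_field_derivative_def d_def)
    show "((\<lambda>x. bump1 n (x \<bullet> v + r)) has_derivative (\<lambda>h. d (x \<bullet> v + r) *\<^sub>R v \<bullet> h)) (at x)"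
      using has_derivative_compose[OF 1 2] by (simp add: inner_commute)
    show "continuous_on UNIV (\<lambda>x. d (x \<bullet> v + r) *\<^sub>R v)"
      by (intro continuous_intros continuous_on_compose2[OF dc]) auto
  qed
  then show ?thesis by blast
qed

text \<open>Each face of the open box contributes one factor. The result vanishes outside the box
  for every \<open>n\<close> and tends to its indicator.\<close>

definition bump :: "nat \<Rightarrow> 'a::euclidean_space \<Rightarrow> 'a \<Rightarrow> 'a \<Rightarrow> real" where
  "bump n a b x = (\<Prod>i\<in>Basis. bump1 n (x \<bullet> i + - (a \<bullet> i)) * bump1 n (x \<bullet> (- i) + b \<bullet> i))"

lemma bump_C1: "\<exists>G. C1grad (bump n a b) G"
proof -
  have "\<exists>G. C1grad (\<lambda>x. bump1 n (x \<bullet> i + - (a \<bullet> i)) * bump1 n (x \<bullet> (- i) + b \<bullet> i)) G" for i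
    using bump1_C1[of n i "- (a \<bullet> i)"] bump1_C1[of n "- i" "b \<bullet> i"] C1grad_mult by blast
  then show ?thesis unfolding bump_def[abs_def] by (intro C1grad_prod) auto
qed

lemma bump_continuous: "continuous_on UNIV (bump n a b)"
  using bump_C1 C1grad_continuous by blast

lemma bump_bounds: "0 \<le> bump n a b x" "bump n a b x \<le> 1"
  unfolding bump_def by (auto intro!: prod_nonneg prod_le_1 mult_nonneg_nonneg mult_le_one bump1_bounds)

lemma bump_zero: "x \<notin> box a b \<Longrightarrow> bump n a b x = 0"
proof -
  assume "x \<notin> box a b"
  then obtain i where i: "i \<in> Basis" "x \<bullet> i \<le> a \<bullet> i \<or> b \<bullet> i \<le> x \<bullet> i" by (auto simp: mem_box not_less)
  then have "bump1 n (x \<bullet> i + - (a \<bullet> i)) * bump1 n (x \<bullet> (- i) + b \<bullet> i) = 0" by (auto simp: bump1_zero)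
  then show ?thesis unfolding bump_def using i(1) by (intro prod_zero) auto
qed

lemma bump_lim: "(\<lambda>n. bump n a b x) \<longlonglongrightarrow> indicator (box a b) x"
proof (cases "x \<in> box a b")
  case True
  then have "0 < x \<bullet> i + - (a \<bullet> i)" "0 < x \<bullet> (- i) + b \<bullet> i" if "i \<in> Basis" for i
    using that by (auto simp: mem_box)
  then have "(\<lambda>n. bump n a b x) \<longlonglongrightarrow> (\<Prod>i\<in>(Basis::'a set). 1 * 1)"
    unfolding bump_def by (intro tendsto_prod tendsto_mult) (use bump1_lim in \<open>metis (full_types)\<close>)+
  then show ?thesis using True by simp
qed (simp add: bump_zero)

text \<open>Boxes are stable under intersection and generate the Borel sets, so the integral of
  \<open>f\<close> vanishes over every Borel subset of the large box. Taking the sets where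
  \<open>f\<close> and \<open>- f\<close> are positive gives the claim.\<close>

lemma AE_zero_of_boxes:
  fixes f :: "'a::euclidean_space \<Rightarrow> real"
  assumes id: "(\<lambda>x. x) \<in> measurable M borel" and fm [measurable]: "f \<in> borel_measurable borel"
    and fi: "integrable M f" and z: "\<And>a b. box a b \<subseteq> box a0 b0 \<Longrightarrow> (\<integral>x. indicator (box a b) x * f x \<partial>M) = 0"
  shows "AE x in M. x \<in> box a0 b0 \<longrightarrow> f x = 0"
proof -
  let ?X = "box a0 b0"
  have setsM: "A \<inter> space M \<in> sets M" if "A \<in> sets borel" for A using measurable_sets[OF id that] by simp
  have mM: "h \<in> borel_measurable M" if "h \<in> borel_measurable borel" for h :: "'a \<Rightarrow> real"
    using measurable_compose[OF id that] .
  have int: "integrable M (\<lambda>x. indicator A x * f x)" if [measurable]: "A \<in> sets borel" for A :: "'a set"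
  proof (rule Bochner_Integration.integrable_bound[OF fi])
    show "(\<lambda>x. indicator A x * f x) \<in> borel_measurable M" by (rule mM) measurable
  qed (auto simp: indicator_def)
  have box_int: "\<exists>c d. box a b \<inter> box c' d' = box c d" for a b c' d' :: 'a
    by (auto simp: box_Int_box)
  have all: "(\<integral>x. indicator (A \<inter> ?X) x * f x \<partial>M) = 0" if A: "A \<in> sets borel" for A
  proof -
    let ?G = "range (\<lambda>(a, b). box a b :: 'a set)"
    have st: "Int_stable ?G"
      unfolding Int_stable_def using box_int by (force simp: image_iff)
    have sA: "A \<in> sigma_sets UNIV ?G" using A unfolding borel_eq_box by simp
    have cl: "?G \<subseteq> Pow UNIV" by simp
    from sA show ?thesis
    proof (induction rule: sigma_sets_induct_disjoint[OF st cl, consumes 1, case_names basic empty compl union])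
      case (basic A)
      then obtain a b where "A = box a b" by auto
      then obtain c d where cd: "A \<inter> ?X = box c d" using box_int by metis
      then have "box c d \<subseteq> ?X" by blast
      then show ?case unfolding cd by (rule z)
    next
      case (compl A)
      have Ab [measurable]: "A \<in> sets borel" using compl(1) unfolding borel_eq_box by simp
      have "(\<integral>x. indicator ((UNIV - A) \<inter> ?X) x * f x \<partial>M) = (\<integral>x. indicator ?X x * f x - indicator (A \<inter> ?X) x * f x \<partial>M)"
        by (intro Bochner_Integration.integral_cong) (auto simp: indicator_def)
      also have "\<dots> = (\<integral>x. indicator ?X x * f x \<partial>M) - (\<integral>x. indicator (A \<inter> ?X) x * f x \<partial>M)"
        by (intro Bochner_Integration.integral_diff int) measurable
      also have "\<dots> = 0" using compl(2) z[of a0 b0] by simp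
      finally show ?case .
    next
      case (union A)
      have Ab: "A i \<in> sets borel" for i using union(2) unfolding borel_eq_box by auto
      define C where "C i = (A i \<inter> ?X) \<inter> space M" for i
      have Cs: "C i \<in> sets M" for i unfolding C_def using Ab by (intro setsM) auto
      have disj: "C i \<inter> C j = {}" if "i \<noteq> j" for i j
        using union(1) that by (auto simp: C_def disjoint_family_on_def)
      have UC: "(\<Union>i. C i) = ((\<Union>i. A i) \<inter> ?X) \<inter> space M" by (auto simp: C_def)
      have si: "set_integrable M (\<Union>i. C i) f"
        using fi Cs unfolding set_integrable_def by (intro integrable_mult_indicator) auto
      have c: "(LINT x:C i|M. f x) = (\<integral>x. indicator (A i \<inter> ?X) x * f x \<partial>M)" for i
        unfolding set_lebesgue_integral_def by (intro Bochner_Integration.integral_cong) (auto simp: C_def indicator_def)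
      have "(\<integral>x. indicator ((\<Union>i. A i) \<inter> ?X) x * f x \<partial>M) = (LINT x:(\<Union>i. C i)|M. f x)"
        unfolding set_lebesgue_integral_def by (intro Bochner_Integration.integral_cong) (auto simp: UC indicator_def)
      also have "\<dots> = (\<Sum>i. (LINT x:C i|M. f x))"
        by (rule lebesgue_integral_countable_add[OF Cs disj si])
      also have "\<dots> = 0" unfolding c union(3) by simp
      finally show ?case .
    qed auto
  qed
  have half: "AE x in M. x \<in> ?X \<longrightarrow> h x \<le> 0"
    if hm [measurable]: "h \<in> borel_measurable borel" and hi: "\<And>A. A \<in> sets borel \<Longrightarrow> integrable M (\<lambda>x. indicator A x * h x)"
      and h0: "\<And>A. A \<in> sets borel \<Longrightarrow> (\<integral>x. indicator (A \<inter> ?X) x * h x \<partial>M) = 0" for h :: "'a \<Rightarrow> real"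
  proof -
    have P: "{x. 0 < h x} \<in> sets borel" by measurable
    then have PX: "{x. 0 < h x} \<inter> ?X \<in> sets borel" by auto
    have "AE x in M. indicator ({x. 0 < h x} \<inter> ?X) x * h x = 0"
      using h0[OF P] integral_nonneg_eq_0_iff_AE[OF hi[OF PX]] by (auto simp: indicator_def)
    then show ?thesis by (rule eventually_mono) (auto simp: indicator_def split: if_splits)
  qed
  have 1: "AE x in M. x \<in> ?X \<longrightarrow> f x \<le> 0" by (rule half[OF fm int all])
  have 2: "AE x in M. x \<in> ?X \<longrightarrow> - f x \<le> 0"
  proof (rule half)
    show "(\<lambda>x. - f x) \<in> borel_measurable borel" by measurable
    show "integrable M (\<lambda>x. indicator A x * - f x)" if "A \<in> sets borel" for A using int[OF that] by simp
    show "(\<integral>x. indicator (A \<inter> ?X) x * - f x \<partial>M) = 0" if "A \<in> sets borel" for A using all[OF that] by simp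
  qed
  show ?thesis using 1 2 by eventually_elim auto
qed

text \<open>Dominated convergence, since the bumps are between 0 and 1. The box in phase space is a
  product, which matches test functions that are products of a function of \<open>x\<close> and one
  of \<open>w\<close>.\<close>

lemma box_integral_zero_of_bumps:
  fixes f :: "phase \<Rightarrow> real"
  assumes id: "(\<lambda>x. x) \<in> measurable M borel" and fm [measurable]: "f \<in> borel_measurable borel"
    and fi: "integrable M f"
    and z: "\<And>n. (\<integral>p. bump n (fst a) (fst b) (fst p) * bump n (snd a) (snd b) (snd p) * f p \<partial>M) = 0"
  shows "(\<integral>p. indicator (box a b) p * f p \<partial>M) = 0"
proof -
  let ?h = "\<lambda>n p. bump n (fst a) (fst b) (fst p) * bump n (snd a) (snd b) (snd p) * f p"
  have mM: "h \<in> borel_measurable M" if "h \<in> borel_measurable borel" for h :: "_ \<Rightarrow> real"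
    using measurable_compose[OF id that] .
  have bm: "(\<lambda>p::phase. bump n (fst a) (fst b) (fst p) * bump n (snd a) (snd b) (snd p)) \<in> borel_measurable borel" for n
    by (intro borel_measurable_continuous_onI continuous_intros continuous_on_compose2[OF bump_continuous]) auto
  have "(\<lambda>n. \<integral>p. ?h n p \<partial>M) \<longlonglongrightarrow> (\<integral>p. indicator (box a b) p * f p \<partial>M)"
  proof (rule integral_dominated_convergence)
    show "(\<lambda>p. indicator (box a b) p * f p) \<in> borel_measurable M" by (rule mM) measurable
    show "?h n \<in> borel_measurable M" for n
      by (rule mM) (intro borel_measurable_times[OF bm fm])
    show "integrable M (\<lambda>p. \<bar>f p\<bar>)" using fi by simp
    show "AE p in M. (\<lambda>n. ?h n p) \<longlonglongrightarrow> indicator (box a b) p * f p"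
    proof (rule AE_I2)
      fix p :: "phase"
      have "indicator (box a b) p = indicator (box (fst a) (fst b)) (fst p) * (indicator (box (snd a) (snd b)) (snd p) :: real)"
        by (auto simp: box_prod[of a b] indicator_def mem_Times_iff)
      then show "(\<lambda>n. ?h n p) \<longlonglongrightarrow> indicator (box a b) p * f p"
        by (simp only:) (intro tendsto_mult bump_lim tendsto_const)
    qed
    show "AE p in M. norm (?h n p) \<le> \<bar>f p\<bar>" for n
    proof (rule AE_I2)
      fix p :: "phase"
      have "\<bar>bump n (fst a) (fst b) (fst p) * bump n (snd a) (snd b) (snd p)\<bar> \<le> 1"
        using bump_bounds[of n "fst a" "fst b" "fst p"] bump_bounds[of n "snd a" "snd b" "snd p"]
        by (simp add: abs_mult mult_le_one)
      then have "\<bar>bump n (fst a) (fst b) (fst p) * bump n (snd a) (snd b) (snd p)\<bar> * \<bar>f p\<bar> \<le> 1 * \<bar>f p\<bar>"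
        by (rule mult_right_mono) simp
      then show "norm (?h n p) \<le> \<bar>f p\<bar>" by (simp add: abs_mult)
    qed
  qed
  then show ?thesis by (simp add: z LIMSEQ_const_iff)
qed

definition is_test :: "(real^3 \<Rightarrow> real^3 \<Rightarrow> real) \<Rightarrow> (real^3 \<Rightarrow> real^3 \<Rightarrow> real^3 \<Rightarrow> real) \<Rightarrow> bool" where
  "is_test \<phi> D\<phi> \<longleftrightarrow> continuous_on UNIV (\<lambda>p. \<phi> (fst p) (snd p)) \<and>
     (\<forall>x w. ((\<lambda>y. \<phi> y w) has_derivative D\<phi> x w) (at x)) \<and>
     continuous_on UNIV (\<lambda>p. D\<phi> (fst p) (snd p) (snd p))"

text \<open>A test function solving the adjoint equation \<open>\<phi> - \<epsilon> w \<bullet> \<nabla>\<phi> = k \<otimes> \<eta>\<close> up to a term far away.\<close>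
lemma adjoint_test:
  fixes k :: "real^3 \<Rightarrow> real" and \<eta> :: "real^3 \<Rightarrow> real"
  assumes k: "C1grad k G" and \<eta>: "continuous_on UNIV \<eta>" and e: "0 < \<epsilon>" and R: "0 \<le> R"
  shows "\<exists>\<phi> D\<phi>. is_test \<phi> D\<phi> \<and>
    (\<forall>x w. \<phi> x w - \<epsilon> * D\<phi> x w w = (k x - exp (- R / \<epsilon>) * k (x + R *\<^sub>R w)) * \<eta> w) \<and>
    (\<forall>x w. (\<forall>t\<in>{0..R}. k (x + t *\<^sub>R w) = 0) \<longrightarrow> \<phi> x w = 0)"
proof -
  have kc: "continuous_on UNIV k" by (rule C1grad_continuous[OF k])
  have Gc: "continuous_on UNIV G" and kd: "\<And>x. (k has_derivative (\<lambda>h. G x \<bullet> h)) (at x)"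
    using k by (auto simp: C1grad_def)
  define E where "E t = exp (- t / \<epsilon>)" for t
  have Ec: "continuous_on S E" for S unfolding E_def[abs_def] using e by (intro continuous_intros) auto
  \<comment> \<open>Up to the factor \<open>\<eta> w / \<epsilon>\<close>, the solution of the
    adjoint equation obtained by integrating along the forward ray. Truncation at \<open>R\<close>
    keeps the interval compact, so that Leibniz' rule applies.\<close>
  define I where "I x w = integral (cbox 0 R) (\<lambda>t. E t * k (x + t *\<^sub>R w))" for x w
  define fx where "fx w x t = E t *\<^sub>R blinfun_inner_right (G (x + t *\<^sub>R w))" for w x t
  define J where "J x w = integral (cbox 0 R) (\<lambda>t. E t * (G (x + t *\<^sub>R w) \<bullet> w))" for x w
  define \<phi> where "\<phi> x w = (1 / \<epsilon>) * I x w * \<eta> w" for x w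
  define D where "D x w h = (1 / \<epsilon>) * blinfun_apply (integral (cbox 0 R) (fx w x)) h * \<eta> w" for x w h
  have gc: "continuous_on S (\<lambda>t. fx w x t)" for S w x
    unfolding fx_def by (intro continuous_intros Ec bounded_linear.continuous_on[OF bounded_linear_blinfun_inner_right]
        continuous_on_compose2[OF Gc]) auto
  have Dw: "D x w w = (1 / \<epsilon>) * J x w * \<eta> w" for x w
  proof -
    have "fx w x integrable_on cbox 0 R" by (rule integrable_continuous[OF gc])
    from integral_linear[OF this, of "\<lambda>L. blinfun_apply L w"]
    have "integral (cbox 0 R) ((\<lambda>L. blinfun_apply L w) \<circ> fx w x) = blinfun_apply (integral (cbox 0 R) (fx w x)) w"
      by (simp add: bounded_linear_intros)
    then show ?thesis by (simp add: D_def J_def comp_def fx_def blinfun.scaleR_left)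
  qed
  have Id: "((\<lambda>x. I x w) has_derivative blinfun_apply (integral (cbox 0 R) (fx w x))) (at x)" for x w
    unfolding I_def
  proof (rule leibniz_rule[where U=UNIV])
    fix x t
    have 1: "((\<lambda>x. x + t *\<^sub>R w) has_derivative (\<lambda>h. h)) (at x)" by (auto intro!: derivative_eq_intros)
    have "((\<lambda>x. E t * k (x + t *\<^sub>R w)) has_derivative (\<lambda>h. E t * (G (x + t *\<^sub>R w) \<bullet> h))) (at x)"
      by (rule has_derivative_mult_right[OF has_derivative_compose[OF 1 kd]])
    moreover have "blinfun_apply (fx w x t) = (\<lambda>h. E t * (G (x + t *\<^sub>R w) \<bullet> h))"
      by (rule ext) (simp add: fx_def blinfun.scaleR_left)
    ultimately show "((\<lambda>x. E t * k (x + t *\<^sub>R w)) has_derivative blinfun_apply (fx w x t)) (at x)" by simp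
  next
    fix x
    show "(\<lambda>t. E t * k (x + t *\<^sub>R w)) integrable_on cbox 0 R"
      by (intro integrable_continuous continuous_intros Ec continuous_on_compose2[OF kc]) auto
  next
    show "continuous_on (UNIV \<times> cbox 0 R) (\<lambda>(x, t). fx w x t)"
      unfolding fx_def split_beta
      by (intro continuous_intros continuous_on_compose2[OF Ec[of UNIV]] bounded_linear.continuous_on[OF bounded_linear_blinfun_inner_right]
        continuous_on_compose2[OF Gc]) auto
  qed auto
  have \<phi>d: "((\<lambda>y. \<phi> y w) has_derivative D x w) (at x)" for x w
    unfolding \<phi>_def D_def[abs_def]
    by (rule has_derivative_mult_left[OF has_derivative_mult_right[OF Id]])
  have Ic: "continuous_on UNIV (\<lambda>p. I (fst p) (snd p))"
    unfolding I_def
    by (rule integral_continuous_on_param, unfold split_beta)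
      (intro continuous_intros continuous_on_compose2[OF Ec[of UNIV]] continuous_on_compose2[OF kc], auto)
  have Jc: "continuous_on UNIV (\<lambda>p. J (fst p) (snd p))"
    unfolding J_def
    by (rule integral_continuous_on_param, unfold split_beta)
      (intro continuous_intros continuous_on_compose2[OF Ec[of UNIV]] continuous_on_compose2[OF Gc], auto)
  have \<eta>c: "continuous_on UNIV (\<lambda>p. \<eta> (snd p))" by (rule continuous_on_compose2[OF \<eta>]) (auto intro: continuous_intros)
  have test: "is_test \<phi> D"
    unfolding is_test_def
  proof (intro conjI allI \<phi>d)
    show "continuous_on UNIV (\<lambda>p. \<phi> (fst p) (snd p))" unfolding \<phi>_def by (intro continuous_intros Ic \<eta>c)
    show "continuous_on UNIV (\<lambda>p. D (fst p) (snd p) (snd p))" unfolding Dw by (intro continuous_intros Jc \<eta>c)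
  qed
  \<comment> \<open>The fundamental theorem for \<open>t \<mapsto> E t * k (x + t w)\<close>; the
    value at the truncation point \<open>R\<close> is the remaining term.\<close>
  have adj: "I x w / \<epsilon> - J x w = k x - E R * k (x + R *\<^sub>R w)" for x w
  proof -
    have der: "((\<lambda>t. E t * k (x + t *\<^sub>R w)) has_vector_derivative (E t * (G (x + t *\<^sub>R w) \<bullet> w) - 1 / \<epsilon> * (E t * k (x + t *\<^sub>R w)))) (at t within {0..R})" for t
    proof -
      have 1: "((\<lambda>t. x + t *\<^sub>R w) has_derivative (\<lambda>h. h *\<^sub>R w)) (at t)" by (auto intro!: derivative_eq_intros)
      have "((\<lambda>t. k (x + t *\<^sub>R w)) has_derivative (\<lambda>h. G (x + t *\<^sub>R w) \<bullet> (h *\<^sub>R w))) (at t)"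
        by (rule has_derivative_compose[OF 1 kd])
      then have 2: "((\<lambda>t. k (x + t *\<^sub>R w)) has_real_derivative (G (x + t *\<^sub>R w) \<bullet> w)) (at t)"
        by (simp add: has_field_derivative_def mult_commute_abs)
      have 3: "(E has_real_derivative (- (1 / \<epsilon>) * E t)) (at t)"
        unfolding E_def[abs_def] using e by (auto intro!: derivative_eq_intros)
      have "((\<lambda>t. E t * k (x + t *\<^sub>R w)) has_real_derivative (E t * (G (x + t *\<^sub>R w) \<bullet> w) - 1 / \<epsilon> * (E t * k (x + t *\<^sub>R w)))) (at t)"
        by (rule DERIV_cong[OF DERIV_mult[OF 3 2]]) (simp add: algebra_simps)
      then show ?thesis
        by (simp add: has_real_derivative_iff_has_vector_derivative has_vector_derivative_at_within)
    qed
    have "((\<lambda>t. E t * (G (x + t *\<^sub>R w) \<bullet> w) - 1 / \<epsilon> * (E t * k (x + t *\<^sub>R w))) has_integral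
       (E R * k (x + R *\<^sub>R w) - E 0 * k (x + 0 *\<^sub>R w))) {0..R}"
      by (rule fundamental_theorem_of_calculus[OF R der])
    then have v: "integral (cbox 0 R) (\<lambda>t. E t * (G (x + t *\<^sub>R w) \<bullet> w) - 1 / \<epsilon> * (E t * k (x + t *\<^sub>R w))) = E R * k (x + R *\<^sub>R w) - k x"
      by (simp add: integral_unique E_def)
    have "integral (cbox 0 R) (\<lambda>t. E t * (G (x + t *\<^sub>R w) \<bullet> w) - 1 / \<epsilon> * (E t * k (x + t *\<^sub>R w))) = J x w - 1 / \<epsilon> * I x w"
    proof -
      have i1: "(\<lambda>t. E t * (G (x + t *\<^sub>R w) \<bullet> w)) integrable_on cbox 0 R"
        by (intro integrable_continuous continuous_intros Ec continuous_on_compose2[OF Gc]) auto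
      have i2: "(\<lambda>t. E t * k (x + t *\<^sub>R w)) integrable_on cbox 0 R"
        by (intro integrable_continuous continuous_intros Ec continuous_on_compose2[OF kc]) auto
      show ?thesis
        using integral_diff[OF i1 integrable_on_cmult_left[OF i2, of "1 / \<epsilon>"]]
        by (simp only: I_def J_def integral_mult_right of_real_eq_id id_apply)
    qed
    then show ?thesis using v by simp
  qed
  have fin: "\<phi> x w - \<epsilon> * D x w w = (k x - exp (- R / \<epsilon>) * k (x + R *\<^sub>R w)) * \<eta> w" for x w
  proof -
    have "\<phi> x w - \<epsilon> * D x w w = (I x w / \<epsilon> - J x w) * \<eta> w"
      using e by (simp add: \<phi>_def Dw algebra_simps)
    then show ?thesis unfolding adj by (simp add: E_def)
  qed
  have zero: "\<phi> x w = 0" if "\<forall>t\<in>{0..R}. k (x + t *\<^sub>R w) = 0" for x w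
  proof -
    have "I x w = integral (cbox 0 R) (\<lambda>t. 0)"
      unfolding I_def using that by (intro integral_cong) auto
    then show ?thesis by (simp add: \<phi>_def)
  qed
  show ?thesis using test fin zero by blast
qed

subsection \<open>Weak solutions and characteristics\<close>

text \<open>An open set is a countable union of boxes with rational corners, and countably many null
  sets are harmless.\<close>

lemma AE_zero_of_boxes_open:
  fixes f :: "'a::euclidean_space \<Rightarrow> real"
  assumes id: "(\<lambda>x. x) \<in> measurable M borel" and fm: "f \<in> borel_measurable borel"
    and fi: "integrable M f" and U: "open U"
    and z: "\<And>a b. box a b \<noteq> {} \<Longrightarrow> box a b \<subseteq> U \<Longrightarrow> (\<integral>x. indicator (box a b) x * f x \<partial>M) = 0"
  shows "AE x in M. x \<in> U \<longrightarrow> f x = 0"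
proof -
  define l where "l h = (\<Sum>(i::'a)\<in>Basis. fst (h i) *\<^sub>R i)" for h :: "'a \<Rightarrow> real \<times> real"
  define r where "r h = (\<Sum>(i::'a)\<in>Basis. snd (h i) *\<^sub>R i)" for h :: "'a \<Rightarrow> real \<times> real"
  define I where "I = {h\<in>Basis \<rightarrow>\<^sub>E \<rat> \<times> \<rat>. box (l h) (r h) \<subseteq> U}"
  have Un: "U = (\<Union>h\<in>I. box (l h) (r h))"
    unfolding I_def l_def r_def by (rule open_UNION_box[OF U])
  have "countable (Basis \<rightarrow>\<^sub>E \<rat> \<times> \<rat> :: ('a \<Rightarrow> real \<times> real) set)"
    by (intro countable_PiE) (auto simp: countable_rat)
  then have cI: "countable I" unfolding I_def by (rule countable_subset[rotated]) auto
  have "AE x in M. x \<in> box (l h) (r h) \<longrightarrow> f x = 0" if h: "h \<in> I" for h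
  proof (rule AE_zero_of_boxes[OF id fm fi])
    fix a b assume s: "box a b \<subseteq> box (l h) (r h)"
    show "(\<integral>x. indicator (box a b) x * f x \<partial>M) = 0"
    proof (cases "box a b = {}")
      case False
      then show ?thesis using z[OF False] s h unfolding I_def by blast
    qed simp
  qed
  then have "AE x in M. \<forall>h\<in>I. x \<in> box (l h) (r h) \<longrightarrow> f x = 0"
    unfolding AE_ball_countable[OF cI] by blast
  then show ?thesis by (rule eventually_mono) (use Un in blast)
qed

lemma is_test_prod:
  assumes k: "C1grad k G" and \<eta>: "continuous_on UNIV \<eta>"
  shows "is_test (\<lambda>x w. k x * \<eta> w) (\<lambda>x w h. (G x \<bullet> h) * \<eta> w)"
  unfolding is_test_def
proof (intro conjI allI)
  have \<eta>c: "continuous_on UNIV (\<lambda>p. \<eta> (snd p))" by (rule continuous_on_compose2[OF \<eta>]) (auto intro: continuous_intros)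
  have kc: "continuous_on UNIV (\<lambda>p. k (fst p))"
    by (rule continuous_on_compose2[OF C1grad_continuous[OF k]]) (auto intro: continuous_intros)
  have Gc: "continuous_on UNIV (\<lambda>p. G (fst p))"
    by (rule continuous_on_compose2[of UNIV G]) (use k in \<open>auto simp: C1grad_def intro: continuous_intros\<close>)
  show "continuous_on UNIV (\<lambda>p. k (fst p) * \<eta> (snd p))" by (intro continuous_intros kc \<eta>c)
  show "continuous_on UNIV (\<lambda>p. (G (fst p) \<bullet> snd p) * \<eta> (snd p))" by (intro continuous_intros Gc \<eta>c)
  fix x w
  have "(k has_derivative (\<lambda>h. G x \<bullet> h)) (at x)" using k by (simp add: C1grad_def)
  then show "((\<lambda>y. k y * \<eta> w) has_derivative (\<lambda>h. (G x \<bullet> h) * \<eta> w)) (at x)"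
    by (rule has_derivative_mult_left)
qed

section \<open>Flux integrals and the weak transport equation\<close>

context c3_dom
begin

lemma Kout_distr: "distr Kin borel ext = distr Kout borel (\<lambda>p. p)"
proof (rule measure_eqI)
  have e [measurable]: "ext \<in> borel_measurable borel" by measurable
  fix A assume "A \<in> sets (distr Kin borel ext)"
  then have A [measurable]: "A \<in> sets borel" by simp
  have "emeasure (distr Kin borel ext) A = (\<integral>\<^sup>+p. indicator A p \<partial>distr Kin borel ext)" by simp
  also have "\<dots> = (\<integral>\<^sup>+p. indicator A (ext p) \<partial>Kin)"
    by (rule nn_integral_distr) measurable
  also have "\<dots> = (\<integral>\<^sup>+p. indicator A p \<partial>Kout)" by (rule Kout_Kin[symmetric]) measurable
  also have "\<dots> = (\<integral>\<^sup>+p. indicator A p \<partial>distr Kout borel (\<lambda>p. p))"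
    by (rule nn_integral_distr[symmetric]) measurable
  finally show "emeasure (distr Kin borel ext) A = emeasure (distr Kout borel (\<lambda>p. p)) A" by simp
qed simp

lemma Kout_integral:
  fixes h :: "phase \<Rightarrow> real"
  assumes [measurable]: "h \<in> borel_measurable borel"
  shows "(\<integral>p. h p \<partial>Kout) = (\<integral>p. h (ext p) \<partial>Kin)" "integrable Kout h \<longleftrightarrow> integrable Kin (\<lambda>p. h (ext p))"
proof -
  have e [measurable]: "ext \<in> measurable Kin borel" by (rule measurable_KinI) measurable
  have i [measurable]: "(\<lambda>p. p) \<in> measurable Kout borel" by (rule measurable_KoutI) simp
  show "(\<integral>p. h p \<partial>Kout) = (\<integral>p. h (ext p) \<partial>Kin)"
    using integral_distr[OF e assms] integral_distr[OF i assms] unfolding Kout_distr by simp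
  show "integrable Kout h \<longleftrightarrow> integrable Kin (\<lambda>p. h (ext p))"
    using integrable_distr_eq[OF e assms] integrable_distr_eq[OF i assms] unfolding Kout_distr by simp
qed

lemma finite_Kout: "finite_measure Kout"
proof (rule finite_measureI)
  interpret K: finite_measure Kin by (rule finite_Kin)
  have "emeasure Kout (space Kout) = (\<integral>\<^sup>+p. 1 \<partial>Kout)" by simp
  also have "\<dots> = (\<integral>\<^sup>+p. 1 \<partial>Kin)" by (rule Kout_Kin) measurable
  also have "\<dots> = emeasure Kin (space Kin)" by simp
  finally show "emeasure Kout (space Kout) \<noteq> \<infinity>" by simp
qed

text \<open>In \<open>Kout\<close> the cut-off at 0 does the work of both the indicator of
  \<open>Gamma_plus\<close> and the absolute value. The function \<open>h\<close> is a Borel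
  representative of \<open>f\<close> on the boundary part of phase space.\<close>

lemma flux_out:
  assumes h [measurable]: "h \<in> borel_measurable borel" and eq: "\<And>p. p \<in> space B \<Longrightarrow> f p = h p"
  shows "\<phi> \<in> borel_measurable borel \<Longrightarrow> (\<integral>p. indicator (Gamma_plus \<Omega>) p * f p * \<phi> p * \<bar>snd p \<bullet> outward_normal \<Omega> (fst p)\<bar> \<partial>B)
      = (\<integral>p. h p * \<phi> p \<partial>Kout)"
    "(\<integral>\<^sup>+p. indicator (Gamma_plus \<Omega>) p * ennreal ((f p)\<^sup>2 * \<bar>snd p \<bullet> outward_normal \<Omega> (fst p)\<bar>) \<partial>B)
      = (\<integral>\<^sup>+p. ennreal ((h p)\<^sup>2) \<partial>Kout)"
proof -
  have K: "Kout = density B (\<lambda>p. ennreal (max 0 (snd p \<bullet> nub (fst p))))"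
    unfolding Kout_def by (rule arg_cong[where f="density B"]) (auto simp: max_def ennreal_neg)
  have m: "(\<lambda>p. max 0 (snd p \<bullet> nub (fst p))) \<in> borel_measurable B" by (rule measurable_BI) measurable
  show "(\<integral>p. indicator (Gamma_plus \<Omega>) p * f p * \<phi> p * \<bar>snd p \<bullet> outward_normal \<Omega> (fst p)\<bar> \<partial>B)
      = (\<integral>p. h p * \<phi> p \<partial>Kout)" if [measurable]: "\<phi> \<in> borel_measurable borel"
  proof -
    have hm: "(\<lambda>p. h p * \<phi> p) \<in> borel_measurable B" by (rule measurable_BI) measurable
    show ?thesis
      unfolding K
      by (subst integral_density[OF hm m]) (auto intro!: Bochner_Integration.integral_cong simp: eq space_B Gamma_plus_def indicator_def max_def)
  qed
  have hm: "(\<lambda>p. ennreal ((h p)\<^sup>2)) \<in> borel_measurable B" by (rule measurable_BI) measurable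
  have m': "(\<lambda>p. ennreal (snd p \<bullet> nub (fst p))) \<in> borel_measurable B" by (rule measurable_BI) measurable
  show "(\<integral>\<^sup>+p. indicator (Gamma_plus \<Omega>) p * ennreal ((f p)\<^sup>2 * \<bar>snd p \<bullet> outward_normal \<Omega> (fst p)\<bar>) \<partial>B)
      = (\<integral>\<^sup>+p. ennreal ((h p)\<^sup>2) \<partial>Kout)"
    unfolding Kout_def nn_integral_density[OF m' hm]
  proof (rule nn_integral_cong)
    fix p assume p: "p \<in> space B"
    then have n: "nub (fst p) = outward_normal \<Omega> (fst p)" by (auto simp: space_B)
    show "indicator (Gamma_plus \<Omega>) p * ennreal ((f p)\<^sup>2 * \<bar>snd p \<bullet> outward_normal \<Omega> (fst p)\<bar>)
        = ennreal (snd p \<bullet> nub (fst p)) * ennreal ((h p)\<^sup>2)"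
      using p unfolding n eq[OF p]
      by (auto simp: Gamma_plus_def indicator_def space_B ennreal_neg ennreal_mult mult.commute split: prod.splits)
  qed
qed

lemma flux_in:
  assumes h [measurable]: "h \<in> borel_measurable borel" and eq: "\<And>p. p \<in> space B \<Longrightarrow> f p = h p"
  shows "\<phi> \<in> borel_measurable borel \<Longrightarrow> (\<integral>p. indicator (Gamma_minus \<Omega>) p * f p * \<phi> p * \<bar>snd p \<bullet> outward_normal \<Omega> (fst p)\<bar> \<partial>B)
      = (\<integral>p. h p * \<phi> p \<partial>Kin)"
    "(\<integral>\<^sup>+p. indicator (Gamma_minus \<Omega>) p * ennreal ((f p)\<^sup>2 * \<bar>snd p \<bullet> outward_normal \<Omega> (fst p)\<bar>) \<partial>B)
      = (\<integral>\<^sup>+p. ennreal ((h p)\<^sup>2) \<partial>Kin)"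
proof -
  have K: "Kin = density B (\<lambda>p. ennreal (max 0 (- (snd p \<bullet> nub (fst p)))))"
    unfolding Kin_def by (rule arg_cong[where f="density B"]) (auto simp: max_def ennreal_neg)
  have m: "(\<lambda>p. max 0 (- (snd p \<bullet> nub (fst p)))) \<in> borel_measurable B" by (rule measurable_BI) measurable
  show "(\<integral>p. indicator (Gamma_minus \<Omega>) p * f p * \<phi> p * \<bar>snd p \<bullet> outward_normal \<Omega> (fst p)\<bar> \<partial>B)
      = (\<integral>p. h p * \<phi> p \<partial>Kin)" if [measurable]: "\<phi> \<in> borel_measurable borel"
  proof -
    have hm: "(\<lambda>p. h p * \<phi> p) \<in> borel_measurable B" by (rule measurable_BI) measurable
    show ?thesis
      unfolding K
      by (subst integral_density[OF hm m]) (auto intro!: Bochner_Integration.integral_cong simp: eq space_B Gamma_minus_def indicator_def max_def)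
  qed
  have hm: "(\<lambda>p. ennreal ((h p)\<^sup>2)) \<in> borel_measurable B" by (rule measurable_BI) measurable
  have m': "(\<lambda>p. ennreal (- (snd p \<bullet> nub (fst p)))) \<in> borel_measurable B" by (rule measurable_BI) measurable
  show "(\<integral>\<^sup>+p. indicator (Gamma_minus \<Omega>) p * ennreal ((f p)\<^sup>2 * \<bar>snd p \<bullet> outward_normal \<Omega> (fst p)\<bar>) \<partial>B)
      = (\<integral>\<^sup>+p. ennreal ((h p)\<^sup>2) \<partial>Kin)"
    unfolding Kin_def nn_integral_density[OF m' hm]
  proof (rule nn_integral_cong)
    fix p assume p: "p \<in> space B"
    then have n: "nub (fst p) = outward_normal \<Omega> (fst p)" by (auto simp: space_B)
    show "indicator (Gamma_minus \<Omega>) p * ennreal ((f p)\<^sup>2 * \<bar>snd p \<bullet> outward_normal \<Omega> (fst p)\<bar>)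
        = ennreal (- (snd p \<bullet> nub (fst p))) * ennreal ((h p)\<^sup>2)"
      using p unfolding n eq[OF p]
      by (auto simp: Gamma_minus_def indicator_def space_B ennreal_neg ennreal_mult[symmetric] mult.commute split: prod.splits)
  qed
qed

lemma AE_Kout_iff: "(AE p in Kout. P p) \<longleftrightarrow> (AE p in B. p \<in> Gamma_plus \<Omega> \<longrightarrow> P p)"
proof -
  have m': "(\<lambda>p. ennreal (snd p \<bullet> nub (fst p))) \<in> borel_measurable B" by (rule measurable_BI) measurable
  show ?thesis
    unfolding Kout_def AE_density[OF m']
    by (rule AE_cong) (auto simp: Gamma_plus_def space_B)
qed

lemma continuous_bounded_dom:
  fixes h :: "phase \<Rightarrow> real"
  assumes "continuous_on UNIV h"
  shows "\<exists>K. \<forall>p. p \<in> space V \<or> p \<in> space B \<longrightarrow> \<bar>h p\<bar> \<le> K"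
proof -
  have "compact (closure \<Omega> \<times> sphere (0::real^3) 1)" using bounded_dom by (intro compact_Times) auto
  then have "bounded (h ` (closure \<Omega> \<times> sphere 0 1))"
    by (intro compact_imp_bounded compact_continuous_image continuous_on_subset[OF assms]) auto
  then obtain K where K: "\<forall>x\<in>closure \<Omega> \<times> sphere 0 1. norm (h x) \<le> K"
    unfolding bounded_iff by auto
  have "\<bar>h p\<bar> \<le> K" if "p \<in> space V \<or> p \<in> space B" for p
  proof -
    have "p \<in> closure \<Omega> \<times> sphere 0 1"
      using that closure_subset[of \<Omega>] by (auto simp: space_V space_B frontier_def)
    then show ?thesis using K by force
  qed
  then show ?thesis by blast
qed

lemma space_Kin: "space Kin = space B" "space Kout = space B"
  by (auto simp: Kin_def Kout_def)

lemma continuous_mult_integrable: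
  fixes h f :: "phase \<Rightarrow> real"
  assumes h: "continuous_on UNIV h"
  shows "integrable V f \<Longrightarrow> integrable V (\<lambda>p. f p * h p)"
    "integrable Kin f \<Longrightarrow> integrable Kin (\<lambda>p. f p * h p)"
    "integrable Kout f \<Longrightarrow> integrable Kout (\<lambda>p. f p * h p)"
proof -
  have hm: "h \<in> borel_measurable borel" using h by (rule borel_measurable_continuous_onI)
  obtain K where K: "\<And>p. p \<in> space V \<or> p \<in> space B \<Longrightarrow> \<bar>h p\<bar> \<le> K"
    using continuous_bounded_dom[OF h] by blast
  have "integrable V f \<Longrightarrow> integrable V (\<lambda>p. h p * f p)"
    by (erule integrable_bounded_mult[where K=K]) (auto intro: measurable_VI hm K)
  then show "integrable V f \<Longrightarrow> integrable V (\<lambda>p. f p * h p)" by (simp add: mult.commute)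
  have "integrable Kin f \<Longrightarrow> integrable Kin (\<lambda>p. h p * f p)"
    by (erule integrable_bounded_mult[where K=K]) (auto intro: measurable_KinI hm K simp: space_Kin)
  then show "integrable Kin f \<Longrightarrow> integrable Kin (\<lambda>p. f p * h p)" by (simp add: mult.commute)
  have "integrable Kout f \<Longrightarrow> integrable Kout (\<lambda>p. h p * f p)"
    by (erule integrable_bounded_mult[where K=K]) (auto intro: measurable_KoutI hm K simp: space_Kin)
  then show "integrable Kout f \<Longrightarrow> integrable Kout (\<lambda>p. f p * h p)" by (simp add: mult.commute)
qed

lemma integrable_of_square:
  fixes f :: "phase \<Rightarrow> real"
  assumes f: "f \<in> borel_measurable borel"
  shows "integrable Kin (\<lambda>p. (f p)\<^sup>2) \<Longrightarrow> integrable Kin f"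
    "integrable Kout (\<lambda>p. (f p)\<^sup>2) \<Longrightarrow> integrable Kout f"
proof -
  interpret K: finite_measure Kin by (rule finite_Kin)
  interpret L: finite_measure Kout by (rule finite_Kout)
  have "integrable Kin (\<lambda>p. (f p)\<^sup>2) \<Longrightarrow> integrable Kin (\<lambda>p. f p * 1)"
    by (rule integrable_mult_L2) (auto intro: measurable_KinI f)
  then show "integrable Kin (\<lambda>p. (f p)\<^sup>2) \<Longrightarrow> integrable Kin f" by simp
  have "integrable Kout (\<lambda>p. (f p)\<^sup>2) \<Longrightarrow> integrable Kout (\<lambda>p. f p * 1)"
    by (rule integrable_mult_L2) (auto intro: measurable_KoutI f)
  then show "integrable Kout (\<lambda>p. (f p)\<^sup>2) \<Longrightarrow> integrable Kout f" by simp
qed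

lemma testD:
  assumes "is_test \<phi> D\<phi>"
  shows "continuous_on UNIV (\<lambda>p. \<phi> (fst p) (snd p))" "continuous_on UNIV (\<lambda>p. D\<phi> (fst p) (snd p) (snd p))"
    "(\<lambda>p. \<phi> (fst p) (snd p)) \<in> borel_measurable borel" "(\<lambda>p. D\<phi> (fst p) (snd p) (snd p)) \<in> borel_measurable borel"
    "line_ac (\<lambda>p. \<phi> (fst p) (snd p)) (\<lambda>p. \<phi> (fst p) (snd p)) (\<lambda>p. D\<phi> (fst p) (snd p) (snd p))"
  using assms line_ac_C1[of \<phi> D\<phi>] by (auto simp: is_test_def intro: borel_measurable_continuous_onI)

context
  fixes \<epsilon> :: real
  assumes eps: "0 < \<epsilon>" "\<epsilon> < 1"
begin

text \<open>The average is decoupled from the unknown and placed in the source \<open>F\<close>. The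
  trace \<open>up\<close> is a function of its own, since the weak formulation relates it to
  \<open>u\<close> through the test functions only.\<close>

definition weak_transport where
  "weak_transport F g u up \<longleftrightarrow> (\<forall>\<phi> D\<phi>. is_test \<phi> D\<phi> \<longrightarrow>
     (\<integral>p. u p * (\<phi> (fst p) (snd p) - \<epsilon> * D\<phi> (fst p) (snd p) (snd p)) \<partial>V) + \<epsilon> * (\<integral>p. up p * \<phi> (fst p) (snd p) \<partial>Kout)
     = (\<integral>p. F p * \<phi> (fst p) (snd p) \<partial>V) + \<epsilon> * (\<integral>p. g p * \<phi> (fst p) (snd p) \<partial>Kin))"

text \<open>Green's formula for the product of \<open>u\<close> with a test function. Dividing it by
  \<open>planar_const\<close> turns the initial value into \<open>g\<close> and the end value into
  \<open>u / planar_const\<close>.\<close>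

lemma weak_of_line_ac:
  fixes F g u :: "phase \<Rightarrow> real"
  assumes ac: "line_ac (\<lambda>p. planar_const * g p) u (\<lambda>p. (F p - u p) / \<epsilon>)"
    and F [measurable]: "F \<in> borel_measurable borel" and g [measurable]: "g \<in> borel_measurable borel"
    and u2: "integrable V (\<lambda>p. (u p)\<^sup>2)" and F2: "integrable V (\<lambda>p. (F p)\<^sup>2)" and g2: "integrable Kin (\<lambda>p. (g p)\<^sup>2)"
  shows "integrable Kout (\<lambda>p. (u p)\<^sup>2)" "weak_transport F g u (\<lambda>p. u p / planar_const)"
proof -
  note um [measurable] = line_ac_measurable(2)[OF ac]
  have zm: "(\<lambda>p. 0::real) \<in> borel_measurable borel" by simp
  \<comment> \<open>The energy inequality is used with \<open>F\<close> in the place of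
    \<open>S\<close> and no average; it supplies the square integrability of the trace.\<close>
  have "line_ac (\<lambda>p. planar_const * g p) u (\<lambda>p. (F p + 0 - u p) / \<epsilon>)" using ac by simp
  from energy(1)[OF eps this F zm g u2 F2 _ g2]
  have ue: "integrable Kin (\<lambda>p. (u (ext p))\<^sup>2)" by simp
  show "integrable Kout (\<lambda>p. (u p)\<^sup>2)" using ue by (subst Kout_integral(2)) measurable
  note ui = integrable_L2_V[OF um u2] and Fi = integrable_L2_V[OF F F2] and gi = integrable_of_square(1)[OF g g2]
  show "weak_transport F g u (\<lambda>p. u p / planar_const)"
    unfolding weak_transport_def
  proof (intro allI impI)
    fix \<phi> D\<phi> assume t: "is_test \<phi> D\<phi>"
    define f d where "f p = \<phi> (fst p) (snd p)" and "d p = D\<phi> (fst p) (snd p) (snd p)" for p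
    note td = testD[OF t, folded f_def d_def]
    note [measurable] = td(3,4)
    note i1 = continuous_mult_integrable(1)[OF td(1) Fi] and i2 = continuous_mult_integrable(1)[OF td(1) ui]
      and i3 = continuous_mult_integrable(1)[OF td(2) ui] and i4 = continuous_mult_integrable(2)[OF td(1) gi]
    have e: "(F p - u p) / \<epsilon> * f p + u p * d p = (1 / \<epsilon>) * (F p * f p - (u p * f p - \<epsilon> * (u p * d p)))" for p
      using eps by (simp add: field_simps)
    have ia: "integrable V (\<lambda>p. (F p - u p) / \<epsilon> * f p + u p * d p)"
      unfolding e by (intro integrable_mult_right Bochner_Integration.integrable_diff i1 i2 i3)
    have ib: "integrable Kin (\<lambda>p. planar_const * g p * f p)" using integrable_mult_right[OF i4, of planar_const] by (simp add: mult.assoc)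
    from line_ac_green(2)[OF line_ac_mult[OF ac td(5)] ia ib]
    have G: "planar_const * (\<integral>p. (1 / \<epsilon>) * (F p * f p - (u p * f p - \<epsilon> * (u p * d p))) \<partial>V)
      = (\<integral>p. u (ext p) * f (ext p) \<partial>Kin) - planar_const * (\<integral>p. g p * f p \<partial>Kin)"
      unfolding e by (simp add: mult.assoc)
    have "(\<integral>p. (1 / \<epsilon>) * (F p * f p - (u p * f p - \<epsilon> * (u p * d p))) \<partial>V)
      = (1 / \<epsilon>) * ((\<integral>p. F p * f p \<partial>V) - (\<integral>p. u p * f p - \<epsilon> * (u p * d p) \<partial>V))"
      by (subst integral_mult_right_zero, subst Bochner_Integration.integral_diff)
        (intro integrable_mult_right Bochner_Integration.integrable_diff i1 i2 i3 refl)+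
    also have "(\<integral>p. u p * f p - \<epsilon> * (u p * d p) \<partial>V) = (\<integral>p. u p * (f p - \<epsilon> * d p) \<partial>V)"
      by (intro Bochner_Integration.integral_cong refl) (simp add: algebra_simps)
    finally have X: "(\<integral>p. (1 / \<epsilon>) * (F p * f p - (u p * f p - \<epsilon> * (u p * d p))) \<partial>V)
      = (1 / \<epsilon>) * ((\<integral>p. F p * f p \<partial>V) - (\<integral>p. u p * (f p - \<epsilon> * d p) \<partial>V))" .
    have G1: "planar_const * ((1 / \<epsilon>) * ((\<integral>p. F p * f p \<partial>V) - (\<integral>p. u p * (f p - \<epsilon> * d p) \<partial>V)))
      = (\<integral>p. u (ext p) * f (ext p) \<partial>Kin) - planar_const * (\<integral>p. g p * f p \<partial>Kin)" using G unfolding X .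
    have "(\<integral>p. u p / planar_const * f p \<partial>Kout) = (\<integral>p. (1 / planar_const) * (u p * f p) \<partial>Kout)" by simp
    also have "\<dots> = (1 / planar_const) * (\<integral>p. u p * f p \<partial>Kout)" by (rule integral_mult_right_zero)
    also have "(\<integral>p. u p * f p \<partial>Kout) = (\<integral>p. u (ext p) * f (ext p) \<partial>Kin)" by (rule Kout_integral(1)) measurable
    finally have G2: "(\<integral>p. u (ext p) * f (ext p) \<partial>Kin) = planar_const * (\<integral>p. u p / planar_const * f p \<partial>Kout)"
      using planar_const by simp
    have "planar_const * ((1 / \<epsilon>) * ((\<integral>p. F p * f p \<partial>V) - (\<integral>p. u p * (f p - \<epsilon> * d p) \<partial>V)))
      = planar_const * ((\<integral>p. u p / planar_const * f p \<partial>Kout) - (\<integral>p. g p * f p \<partial>Kin))"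
      unfolding G1 G2 by (simp add: right_diff_distrib)
    then have "(1 / \<epsilon>) * ((\<integral>p. F p * f p \<partial>V) - (\<integral>p. u p * (f p - \<epsilon> * d p) \<partial>V))
      = (\<integral>p. u p / planar_const * f p \<partial>Kout) - (\<integral>p. g p * f p \<partial>Kin)"
      using planar_const by (simp only: mult_cancel_left) auto
    then have "(\<integral>p. u p * (f p - \<epsilon> * d p) \<partial>V) + \<epsilon> * (\<integral>p. u p / planar_const * f p \<partial>Kout)
      = (\<integral>p. F p * f p \<partial>V) + \<epsilon> * (\<integral>p. g p * f p \<partial>Kin)"
      using eps by (simp add: field_simps)
    then show "(\<integral>p. u p * (\<phi> (fst p) (snd p) - \<epsilon> * D\<phi> (fst p) (snd p) (snd p)) \<partial>V) + \<epsilon> * (\<integral>p. u p / planar_const * \<phi> (fst p) (snd p) \<partial>Kout)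
     = (\<integral>p. F p * \<phi> (fst p) (snd p) \<partial>V) + \<epsilon> * (\<integral>p. g p * \<phi> (fst p) (snd p) \<partial>Kin)"
      by (simp add: f_def d_def)
  qed
qed

text \<open>The difference has zero data. Test functions solving the adjoint equation with a right
  side supported inside the domain vanish on \<open>Gamma_plus\<close>, so they test the interior
  part alone and force it to be 0. What is left is the trace, which can then be tested by arbitrary
  products.\<close>

lemma weak_transport_unique:
  fixes F g u u' v v' :: "phase \<Rightarrow> real"
  assumes wu: "weak_transport F g u u'" and wv: "weak_transport F g v v'"
    and [measurable]: "u \<in> borel_measurable borel" "v \<in> borel_measurable borel"
      "u' \<in> borel_measurable borel" "v' \<in> borel_measurable borel"
    and ui: "integrable V u" and vi: "integrable V v" and u'i: "integrable Kout u'" and v'i: "integrable Kout v'"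
  shows "AE p in V. u p = v p" "AE p in Kout. u' p = v' p"
proof -
  define d where "d p = u p - v p" for p
  define e where "e p = u' p - v' p" for p
  have dm [measurable]: "d \<in> borel_measurable borel" unfolding d_def[abs_def] by measurable
  have em [measurable]: "e \<in> borel_measurable borel" unfolding e_def[abs_def] by measurable
  have di: "integrable V d" unfolding d_def using ui vi by (rule Bochner_Integration.integrable_diff)
  have ei: "integrable Kout e" unfolding e_def using u'i v'i by (rule Bochner_Integration.integrable_diff)
  have W: "(\<integral>p. d p * (\<phi> (fst p) (snd p) - \<epsilon> * D\<phi> (fst p) (snd p) (snd p)) \<partial>V) + \<epsilon> * (\<integral>p. e p * \<phi> (fst p) (snd p) \<partial>Kout) = 0"
    if t: "is_test \<phi> D\<phi>" for \<phi> D\<phi>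
  proof -
    define f h where "f p = \<phi> (fst p) (snd p)" and "h p = \<phi> (fst p) (snd p) - \<epsilon> * D\<phi> (fst p) (snd p) (snd p)" for p
    have hc: "continuous_on UNIV h" "continuous_on UNIV f"
      unfolding h_def f_def by (intro continuous_intros testD(1,2)[OF t])+
    have "(\<integral>p. d p * h p \<partial>V) = (\<integral>p. u p * h p - v p * h p \<partial>V)" by (simp add: d_def left_diff_distrib)
    also have "\<dots> = (\<integral>p. u p * h p \<partial>V) - (\<integral>p. v p * h p \<partial>V)"
      by (intro Bochner_Integration.integral_diff continuous_mult_integrable(1)[OF hc(1)] ui vi)
    finally have 1: "(\<integral>p. d p * h p \<partial>V) = (\<integral>p. u p * h p \<partial>V) - (\<integral>p. v p * h p \<partial>V)" .
    have "(\<integral>p. e p * f p \<partial>Kout) = (\<integral>p. u' p * f p - v' p * f p \<partial>Kout)" by (simp add: e_def left_diff_distrib)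
    also have "\<dots> = (\<integral>p. u' p * f p \<partial>Kout) - (\<integral>p. v' p * f p \<partial>Kout)"
      by (intro Bochner_Integration.integral_diff continuous_mult_integrable(3)[OF hc(2)] u'i v'i)
    finally have 2: "(\<integral>p. e p * f p \<partial>Kout) = (\<integral>p. u' p * f p \<partial>Kout) - (\<integral>p. v' p * f p \<partial>Kout)" .
    have "(\<integral>p. u p * h p \<partial>V) + \<epsilon> * (\<integral>p. u' p * f p \<partial>Kout) = (\<integral>p. v p * h p \<partial>V) + \<epsilon> * (\<integral>p. v' p * f p \<partial>Kout)"
      using wu wv t unfolding weak_transport_def f_def h_def by simp
    then show ?thesis unfolding h_def[symmetric] unfolding f_def[symmetric] 1 2 by (simp add: right_diff_distrib)
  qed
  have "AE p in V. p \<in> \<Omega> \<times> (UNIV :: (real^3) set) \<longrightarrow> d p = 0"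
  proof (rule AE_zero_of_boxes_open[OF measurable_id_V dm di])
    show "open (\<Omega> \<times> (UNIV :: (real^3) set))" using open_dom by (intro open_Times) auto
    fix a b :: "phase"
    assume ne: "box a b \<noteq> {}" and sub: "box a b \<subseteq> \<Omega> \<times> UNIV"
    have bx: "box a b = box (fst a) (fst b) \<times> box (snd a) (snd b)" by (rule box_prod)
    have bO: "box (fst a) (fst b) \<subseteq> \<Omega>" using ne sub unfolding bx by blast
    show "(\<integral>p. indicator (box a b) p * d p \<partial>V) = 0"
    proof (rule box_integral_zero_of_bumps[OF measurable_id_V dm di])
      fix n
      define k where "k = bump n (fst a) (fst b)"
      define \<eta> where "\<eta> = bump n (snd a) (snd b)"
      have k0: "k x = 0" if "x \<notin> \<Omega>" for x unfolding k_def using that bO by (intro bump_zero) blast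
      \<comment> \<open>After time \<open>R\<close> a ray that starts in the domain is at distance
        at least \<open>rad + 1\<close> from 0, outside the support of \<open>k\<close>.\<close>
      define R where "R = 2 * rad + 1"
      have R: "0 \<le> R" using rad(1) by (simp add: R_def)
      obtain G where G: "C1grad k G" unfolding k_def using bump_C1 by blast
      have \<eta>c: "continuous_on UNIV \<eta>" unfolding \<eta>_def by (rule bump_continuous)
      obtain \<phi> D\<phi> where t: "is_test \<phi> D\<phi>"
        and t1: "\<And>x w. \<phi> x w - \<epsilon> * D\<phi> x w w = (k x - exp (- R / \<epsilon>) * k (x + R *\<^sub>R w)) * \<eta> w"
        and t2: "\<And>x w. (\<forall>t\<in>{0..R}. k (x + t *\<^sub>R w) = 0) \<Longrightarrow> \<phi> x w = 0"
        using adjoint_test[OF G \<eta>c eps(1) R] by blast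
      have far: "k (x + R *\<^sub>R w) = 0" if x: "x \<in> \<Omega>" and w: "norm w = 1" for x w
      proof (rule k0)
        have "norm (R *\<^sub>R w) \<le> norm (x + R *\<^sub>R w) + norm x" using norm_triangle_ineq4[of "x + R *\<^sub>R w" x] by simp
        then have "R \<le> norm (x + R *\<^sub>R w) + rad" using w R rad_dom[OF x] by simp
        then have "rad < norm (x + R *\<^sub>R w)" using rad(1) by (simp add: R_def)
        then show "x + R *\<^sub>R w \<notin> \<Omega>" using rad_dom by fastforce
      qed
      \<comment> \<open>A ray leaving through \<open>Gamma_plus\<close> never returns to the domain,
        by the support inequality, so it misses the support of \<open>k\<close>.\<close>
      have out: "AE p in Kout. e p * \<phi> (fst p) (snd p) = 0"
        unfolding AE_Kout_iff
      proof (rule AE_I2, rule impI)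
        fix p assume "p \<in> Gamma_plus \<Omega>"
        then have p: "fst p \<in> frontier \<Omega>" "0 < snd p \<bullet> outward_normal \<Omega> (fst p)" by (auto simp: Gamma_plus_def)
        have "fst p + t *\<^sub>R snd p \<notin> \<Omega>" if "0 \<le> t" for t
        proof
          assume "fst p + t *\<^sub>R snd p \<in> \<Omega>"
          from nu_supp[OF p(1) this] have "t * (snd p \<bullet> outward_normal \<Omega> (fst p)) < 0" by simp
          then show False using p(2) that by (simp add: mult_less_0_iff)
        qed
        then have "\<phi> (fst p) (snd p) = 0" by (intro t2) (auto intro: k0)
        then show "e p * \<phi> (fst p) (snd p) = 0" by simp
      qed
      have z1: "(\<integral>p. e p * \<phi> (fst p) (snd p) \<partial>Kout) = 0"
        by (rule integral_eq_zero_AE[OF out])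
      have "(\<integral>p. k (fst p) * \<eta> (snd p) * d p \<partial>V) = (\<integral>p. d p * (\<phi> (fst p) (snd p) - \<epsilon> * D\<phi> (fst p) (snd p) (snd p)) \<partial>V)"
        by (rule Bochner_Integration.integral_cong) (auto simp: t1 space_V far)
      also have "\<dots> = 0" using W[OF t] z1 by simp
      finally show "(\<integral>p. bump n (fst a) (fst b) (fst p) * bump n (snd a) (snd b) (snd p) * d p \<partial>V) = 0"
        by (simp add: k_def \<eta>_def)
    qed
  qed
  then have d0: "AE p in V. d p = 0"
    using AE_space by eventually_elim (auto simp: space_V)
  then show "AE p in V. u p = v p" by (rule eventually_mono) (simp add: d_def)
  \<comment> \<open>The interior difference is now known to be 0, so every test function gives a
    statement about the trace alone.\<close>
  have W2: "(\<integral>p. e p * \<phi> (fst p) (snd p) \<partial>Kout) = 0" if t: "is_test \<phi> D\<phi>" for \<phi> D\<phi>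
  proof -
    have "(\<integral>p. d p * (\<phi> (fst p) (snd p) - \<epsilon> * D\<phi> (fst p) (snd p) (snd p)) \<partial>V) = 0"
      by (rule integral_eq_zero_AE, rule eventually_mono[OF d0]) simp
    then show ?thesis using W[OF t] eps by simp
  qed
  have idK: "(\<lambda>p. p) \<in> measurable Kout borel" by (rule measurable_KoutI) simp
  have "AE p in Kout. p \<in> UNIV \<longrightarrow> e p = 0"
  proof (rule AE_zero_of_boxes_open[OF idK em ei open_UNIV])
    fix a b :: "phase"
    show "(\<integral>p. indicator (box a b) p * e p \<partial>Kout) = 0"
    proof (rule box_integral_zero_of_bumps[OF idK em ei])
      fix n
      obtain G where G: "C1grad (bump n (fst a) (fst b)) G" using bump_C1 by blast
      from W2[OF is_test_prod[OF G bump_continuous[of n "snd a" "snd b"]]]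
      show "(\<integral>p. bump n (fst a) (fst b) (fst p) * bump n (snd a) (snd b) (snd p) * e p \<partial>Kout) = 0"
        by (simp add: mult.commute)
    qed
  qed
  then show "AE p in Kout. u' p = v' p" by (rule eventually_mono) (simp add: e_def)
qed

end

end

section \<open>Well-posedness and the estimate\<close>

context c3_dom
begin

lemma vol_norm_ext:
  assumes u' [measurable]: "u' \<in> borel_measurable borel" and eq: "\<And>p. p \<in> space V \<Longrightarrow> u (fst p) (snd p) = u' p"
  shows "in_L2_vol \<Omega> u \<longleftrightarrow> integrable V (\<lambda>p. (u' p)\<^sup>2)"
    "integrable V (\<lambda>p. (u' p)\<^sup>2) \<Longrightarrow> L2_vol \<Omega> u = sqrt (\<integral>p. (u' p)\<^sup>2 \<partial>V)"
proof -
  have m: "(\<lambda>p. u (fst p) (snd p)) \<in> borel_measurable V"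
    using measurable_VI[OF u'] measurable_cong[of V "\<lambda>p. u (fst p) (snd p)" u'] eq by blast
  have q: "L2sq_vol \<Omega> u = (\<integral>\<^sup>+p. ennreal ((u' p)\<^sup>2) \<partial>V)"
    unfolding L2sq_vol_def by (rule nn_integral_cong) (simp add: eq)
  show "in_L2_vol \<Omega> u \<longleftrightarrow> integrable V (\<lambda>p. (u' p)\<^sup>2)"
    using m unfolding in_L2_vol_def q integrable_square_iff[OF measurable_VI[OF u']] by simp
  assume "integrable V (\<lambda>p. (u' p)\<^sup>2)"
  from nn_integral_eq_integral[OF this] show "L2_vol \<Omega> u = sqrt (\<integral>p. (u' p)\<^sup>2 \<partial>V)"
    unfolding L2_vol_def q by simp
qed

lemma bdry_norm_ext:
  assumes u' [measurable]: "u' \<in> borel_measurable borel" and eq: "\<And>p. p \<in> space B \<Longrightarrow> u (fst p) (snd p) = u' p"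
  shows "in_L2_bdry \<Omega> (Gamma_plus \<Omega>) u \<longleftrightarrow> integrable Kout (\<lambda>p. (u' p)\<^sup>2)"
    "integrable Kout (\<lambda>p. (u' p)\<^sup>2) \<Longrightarrow> L2_bdry \<Omega> (Gamma_plus \<Omega>) u = sqrt (\<integral>p. (u' p)\<^sup>2 \<partial>Kout)"
    "in_L2_bdry \<Omega> (Gamma_minus \<Omega>) u \<longleftrightarrow> integrable Kin (\<lambda>p. (u' p)\<^sup>2)"
    "integrable Kin (\<lambda>p. (u' p)\<^sup>2) \<Longrightarrow> L2_bdry \<Omega> (Gamma_minus \<Omega>) u = sqrt (\<integral>p. (u' p)\<^sup>2 \<partial>Kin)"
proof -
  have m: "(\<lambda>p. u (fst p) (snd p)) \<in> borel_measurable B"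
    using measurable_BI[OF u'] measurable_cong[of B "\<lambda>p. u (fst p) (snd p)" u'] eq by blast
  have q: "L2sq_bdry \<Omega> (Gamma_plus \<Omega>) u = (\<integral>\<^sup>+p. ennreal ((u' p)\<^sup>2) \<partial>Kout)"
    "L2sq_bdry \<Omega> (Gamma_minus \<Omega>) u = (\<integral>\<^sup>+p. ennreal ((u' p)\<^sup>2) \<partial>Kin)"
    unfolding L2sq_bdry_def by (rule flux_out(2)[OF u' eq] flux_in(2)[OF u' eq], simp)+
  show "in_L2_bdry \<Omega> (Gamma_plus \<Omega>) u \<longleftrightarrow> integrable Kout (\<lambda>p. (u' p)\<^sup>2)"
    using m unfolding in_L2_bdry_def q integrable_square_iff[OF measurable_KoutI[OF u']] by simp
  show "in_L2_bdry \<Omega> (Gamma_minus \<Omega>) u \<longleftrightarrow> integrable Kin (\<lambda>p. (u' p)\<^sup>2)"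
    using m unfolding in_L2_bdry_def q integrable_square_iff[OF measurable_KinI[OF u']] by simp
  show "L2_bdry \<Omega> (Gamma_plus \<Omega>) u = sqrt (\<integral>p. (u' p)\<^sup>2 \<partial>Kout)" if i: "integrable Kout (\<lambda>p. (u' p)\<^sup>2)"
    using nn_integral_eq_integral[OF i] unfolding L2_bdry_def q by simp
  show "L2_bdry \<Omega> (Gamma_minus \<Omega>) u = sqrt (\<integral>p. (u' p)\<^sup>2 \<partial>Kin)" if i: "integrable Kin (\<lambda>p. (u' p)\<^sup>2)"
    using nn_integral_eq_integral[OF i] unfolding L2_bdry_def q by simp
qed

context
  fixes \<epsilon> :: real
  assumes eps: "0 < \<epsilon>" "\<epsilon> < 1"
begin

text \<open>The values of \<open>u\<close> in the interior and on the boundary are independent of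
  each other, so they get separate Borel representatives \<open>u'\<close> and \<open>t'\<close>.
  Square integrability makes the single integrals finite, which allows the average to be moved to
  the source side.\<close>

lemma weak_solution_iff:
  assumes m [measurable]: "S' \<in> borel_measurable borel" "g' \<in> borel_measurable borel"
      "u' \<in> borel_measurable borel" "t' \<in> borel_measurable borel"
    and S: "\<And>p. p \<in> space V \<Longrightarrow> S (fst p) (snd p) = S' p" and g: "\<And>p. p \<in> space B \<Longrightarrow> g (fst p) (snd p) = g' p"
    and u: "\<And>p. p \<in> space V \<Longrightarrow> u (fst p) (snd p) = u' p" and t: "\<And>p. p \<in> space B \<Longrightarrow> u (fst p) (snd p) = t' p"
    and S2: "integrable V (\<lambda>p. (S' p)\<^sup>2)"
  shows "weak_solution \<Omega> \<epsilon> S g u \<longleftrightarrow> integrable V (\<lambda>p. (u' p)\<^sup>2) \<and> integrable Kout (\<lambda>p. (t' p)\<^sup>2) \<and>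
    weak_transport \<epsilon> (\<lambda>p. S' p + avg u' (fst p)) g' u' t'"
proof -
  have av: "ang_avg u (fst p) = avg u' (fst p)" if p: "p \<in> space V" for p
  proof -
    have "(\<integral>w. u (fst p) w \<partial>sphere_measure) = (\<integral>w. u' (fst p, w) \<partial>sphere_measure)"
    proof (rule Bochner_Integration.integral_cong[OF refl])
      fix w assume "w \<in> space sphere_measure"
      then have "(fst p, w) \<in> space V" using p by (auto simp: space_V space_sphere_measure)
      from u[OF this] show "u (fst p) w = u' (fst p, w)" by simp
    qed
    then show ?thesis by (simp add: ang_avg_def avg_def)
  qed
  have key: "((\<integral>p. u (fst p) (snd p) * (\<phi> (fst p) (snd p) - \<epsilon> * D\<phi> (fst p) (snd p) (snd p))
              - ang_avg u (fst p) * \<phi> (fst p) (snd p) \<partial>V)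
        + \<epsilon> * (\<integral>p. indicator (Gamma_plus \<Omega>) p * u (fst p) (snd p) * \<phi> (fst p) (snd p)
                    * \<bar>snd p \<bullet> outward_normal \<Omega> (fst p)\<bar> \<partial>B)
        - \<epsilon> * (\<integral>p. indicator (Gamma_minus \<Omega>) p * g (fst p) (snd p) * \<phi> (fst p) (snd p)
                    * \<bar>snd p \<bullet> outward_normal \<Omega> (fst p)\<bar> \<partial>B)
        = (\<integral>p. S (fst p) (snd p) * \<phi> (fst p) (snd p) \<partial>V)) \<longleftrightarrow>
     ((\<integral>p. u' p * (\<phi> (fst p) (snd p) - \<epsilon> * D\<phi> (fst p) (snd p) (snd p)) \<partial>V) + \<epsilon> * (\<integral>p. t' p * \<phi> (fst p) (snd p) \<partial>Kout)
     = (\<integral>p. (S' p + avg u' (fst p)) * \<phi> (fst p) (snd p) \<partial>V) + \<epsilon> * (\<integral>p. g' p * \<phi> (fst p) (snd p) \<partial>Kin))"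
    if ts: "is_test \<phi> D\<phi>" and u2: "integrable V (\<lambda>p. (u' p)\<^sup>2)" for \<phi> D\<phi>
  proof -
    define f h where "f p = \<phi> (fst p) (snd p)" and "h p = \<phi> (fst p) (snd p) - \<epsilon> * D\<phi> (fst p) (snd p) (snd p)" for p
    have hc: "continuous_on UNIV h" "continuous_on UNIV f"
      unfolding h_def f_def by (intro continuous_intros testD(1,2)[OF ts])+
    have fm: "f \<in> borel_measurable borel" using hc(2) by (rule borel_measurable_continuous_onI)
    have am: "(\<lambda>p::phase. avg u' (fst p)) \<in> borel_measurable borel" by measurable
    note i1 = continuous_mult_integrable(1)[OF hc(1) integrable_L2_V[OF m(3) u2]]
      and i2 = continuous_mult_integrable(1)[OF hc(2) integrable_L2_V[OF am avg_L2[OF m(3) u2]]]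
      and i3 = continuous_mult_integrable(1)[OF hc(2) integrable_L2_V[OF m(1) S2]]
    have "(\<integral>p. u (fst p) (snd p) * h p - ang_avg u (fst p) * f p \<partial>V) = (\<integral>p. u' p * h p - avg u' (fst p) * f p \<partial>V)"
      by (rule Bochner_Integration.integral_cong[OF refl]) (simp add: u av)
    also have "\<dots> = (\<integral>p. u' p * h p \<partial>V) - (\<integral>p. avg u' (fst p) * f p \<partial>V)"
      using i1 i2 by (rule Bochner_Integration.integral_diff)
    finally have 1: "(\<integral>p. u (fst p) (snd p) * h p - ang_avg u (fst p) * f p \<partial>V) = (\<integral>p. u' p * h p \<partial>V) - (\<integral>p. avg u' (fst p) * f p \<partial>V)" .
    have 2: "(\<integral>p. S (fst p) (snd p) * f p \<partial>V) = (\<integral>p. S' p * f p \<partial>V)"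
      by (rule Bochner_Integration.integral_cong[OF refl]) (simp add: S)
    have "(\<integral>p. (S' p + avg u' (fst p)) * f p \<partial>V) = (\<integral>p. S' p * f p + avg u' (fst p) * f p \<partial>V)"
      by (simp add: distrib_right)
    also have "\<dots> = (\<integral>p. S' p * f p \<partial>V) + (\<integral>p. avg u' (fst p) * f p \<partial>V)"
      using i3 i2 by (rule Bochner_Integration.integral_add)
    finally have 3: "(\<integral>p. (S' p + avg u' (fst p)) * f p \<partial>V) = (\<integral>p. S' p * f p \<partial>V) + (\<integral>p. avg u' (fst p) * f p \<partial>V)" .
    have 4: "(\<integral>p. indicator (Gamma_plus \<Omega>) p * u (fst p) (snd p) * f p * \<bar>snd p \<bullet> outward_normal \<Omega> (fst p)\<bar> \<partial>B)
        = (\<integral>p. t' p * f p \<partial>Kout)" by (rule flux_out(1)[OF m(4) t fm])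
    have 5: "(\<integral>p. indicator (Gamma_minus \<Omega>) p * g (fst p) (snd p) * f p * \<bar>snd p \<bullet> outward_normal \<Omega> (fst p)\<bar> \<partial>B)
        = (\<integral>p. g' p * f p \<partial>Kin)" by (rule flux_in(1)[OF m(2) g fm])
    show ?thesis unfolding h_def[symmetric] unfolding f_def[symmetric] 1 2 3 4 5 by linarith
  qed
  show ?thesis
  proof (cases "integrable V (\<lambda>p. (u' p)\<^sup>2)")
    case True
    then show ?thesis
      using key
      by (simp only: weak_solution_def vol_norm_ext(1)[OF m(3) u] bdry_norm_ext(1)[OF m(4) t] weak_transport_def[OF eps] is_test_def[symmetric]
          simp_thms cong: imp_cong)
  qed (simp add: weak_solution_def vol_norm_ext(1)[OF m(3) u])
qed

text \<open>The energy inequality for the difference, with all data 0 and \<open>v = u\<close>: the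
  coercive term and the trace are both bounded by 0.\<close>

lemma characteristic_unique:
  fixes S g u v :: "phase \<Rightarrow> real"
  assumes u: "line_ac (\<lambda>p. planar_const * g p) u (\<lambda>p. (S p + avg u (fst p) - u p) / \<epsilon>)"
    and v: "line_ac (\<lambda>p. planar_const * g p) v (\<lambda>p. (S p + avg v (fst p) - v p) / \<epsilon>)"
    and u2: "integrable V (\<lambda>p. (u p)\<^sup>2)" and v2: "integrable V (\<lambda>p. (v p)\<^sup>2)"
  shows "AE p in V. u p = v p" "AE p in Kout. u p = v p"
proof -
  note um [measurable] = line_ac_measurable(2)[OF u] and vm [measurable] = line_ac_measurable(2)[OF v]
  define z where "z p = u p - v p" for p
  have zm [measurable]: "z \<in> borel_measurable borel" unfolding z_def[abs_def] by measurable
  have z2: "integrable V (\<lambda>p. (z p)\<^sup>2)"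
    unfolding z_def by (rule integrable_add_square(2)[OF measurable_VI[OF um] measurable_VI[OF vm] u2 v2])
  have "line_ac (\<lambda>p. planar_const * 0) z (\<lambda>p. (S p + avg u (fst p) - u p) / \<epsilon> - (S p + avg v (fst p) - v p) / \<epsilon>)"
    using line_ac_diff[OF u v] by (simp add: z_def[abs_def])
  then have ac: "line_ac (\<lambda>p. planar_const * 0) z (\<lambda>p. (0 + avg z (fst p) - z p) / \<epsilon>)"
  proof (rule line_ac_cong)
    show "(\<lambda>p. (0 + avg z (fst p) - z p) / \<epsilon>) \<in> borel_measurable borel" by measurable
    show "AE p in V. (S p + avg u (fst p) - u p) / \<epsilon> - (S p + avg v (fst p) - v p) / \<epsilon> = (0 + avg z (fst p) - z p) / \<epsilon>"
      using avg_diff[OF um u2 vm v2]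
      by (rule eventually_mono) (simp add: z_def[abs_def] diff_divide_distrib[symmetric])
  qed
  have zero: "(\<lambda>p. 0::real) \<in> borel_measurable borel" by simp
  have i0: "integrable V (\<lambda>p. 0\<^sup>2 :: real)" "integrable Kin (\<lambda>p. 0\<^sup>2 :: real)" by simp_all
  note en = energy_avg[OF eps ac zero zm zero z2 i0(1) z2 i0(2)]
  define P where "P = (\<integral>p. (z (ext p))\<^sup>2 \<partial>Kin)"
  define Q where "Q = (\<integral>p. (z p)\<^sup>2 \<partial>V)"
  \<comment> \<open>The integrals with weight \<open>aw\<close> occur on both sides and
    cancel.\<close>
  have "\<epsilon> * P + planar_const * (\<epsilon>\<^sup>2 / 2 * Q) \<le> 0"
    using en(2) unfolding Xn_def[OF eps, symmetric] Xn_integrable(3)[OF eps z2, symmetric] P_def[symmetric] Q_def[symmetric]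
    by (simp add: distrib_left)
  moreover have "0 \<le> P" "0 \<le> Q" by (auto simp: P_def Q_def)
  then have "0 \<le> \<epsilon> * P" "0 \<le> planar_const * (\<epsilon>\<^sup>2 / 2 * Q)" using eps planar_const by auto
  ultimately have "\<epsilon> * P = 0" "planar_const * (\<epsilon>\<^sup>2 / 2 * Q) = 0" by linarith+
  then have PQ: "P = 0" "Q = 0" using eps planar_const by auto
  have "AE p in V. (z p)\<^sup>2 = 0" using PQ(2) integral_nonneg_eq_0_iff_AE[OF z2] by (simp add: Q_def)
  then show "AE p in V. u p = v p" by (rule eventually_mono) (simp add: z_def)
  have z2m: "(\<lambda>p. (z p)\<^sup>2) \<in> borel_measurable borel" by measurable
  have iK: "integrable Kout (\<lambda>p. (z p)\<^sup>2)" using en(1) by (simp add: Kout_integral(2)[OF z2m])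
  have "AE p in Kout. (z p)\<^sup>2 = 0"
    using PQ(1) integral_nonneg_eq_0_iff_AE[OF iK] by (simp add: P_def Kout_integral(1)[OF z2m])
  then show "AE p in Kout. u p = v p" by (rule eventually_mono) (simp add: z_def)
qed

text \<open>The average of the weak solution \<open>v\<close> is frozen as a source, and the
  transport problem is solved along characteristics. Uniqueness for the weak transport equation
  identifies the result \<open>u\<close> with \<open>v\<close>, hence also their averages, and the
  equation for \<open>u\<close> closes.\<close>

lemma weak_characteristic:
  fixes S g v t :: "phase \<Rightarrow> real"
  assumes m [measurable]: "S \<in> borel_measurable borel" "g \<in> borel_measurable borel"
      "v \<in> borel_measurable borel" "t \<in> borel_measurable borel"
    and S2: "integrable V (\<lambda>p. (S p)\<^sup>2)" and g2: "integrable Kin (\<lambda>p. (g p)\<^sup>2)"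
    and v2: "integrable V (\<lambda>p. (v p)\<^sup>2)" and t2: "integrable Kout (\<lambda>p. (t p)\<^sup>2)"
    and wk: "weak_transport \<epsilon> (\<lambda>p. S p + avg v (fst p)) g v t"
  shows "\<exists>u. line_ac (\<lambda>p. planar_const * g p) u (\<lambda>p. (S p + avg u (fst p) - u p) / \<epsilon>) \<and>
    integrable V (\<lambda>p. (u p)\<^sup>2) \<and> (AE p in V. v p = u p) \<and> (AE p in Kout. t p = u p / planar_const)"
proof -
  have am: "(\<lambda>p::phase. avg v (fst p)) \<in> borel_measurable borel" by measurable
  have Fm: "(\<lambda>p. S p + avg v (fst p)) \<in> borel_measurable borel" by measurable
  have F2: "integrable V (\<lambda>p. (S p + avg v (fst p))\<^sup>2)"
    by (rule integrable_add_square(1)[OF measurable_VI[OF m(1)] measurable_VI[OF am] S2 avg_L2[OF m(3) v2]])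
  obtain u where um [measurable]: "u \<in> borel_measurable borel" and u2: "integrable V (\<lambda>p. (u p)\<^sup>2)"
    and ac: "line_ac (\<lambda>p. planar_const * g p) u (\<lambda>p. (S p + avg v (fst p) - u p) / \<epsilon>)"
    using transport_exists[OF eps Fm m(2) F2 g2] by blast
  note wu = weak_of_line_ac[OF eps ac Fm m(2) u2 F2 g2]
  have cm: "(\<lambda>p. u p / planar_const) \<in> borel_measurable borel" by measurable
  have ci: "integrable Kout (\<lambda>p. u p / planar_const)"
    using integrable_of_square(2)[OF um wu(1)] by simp
  note un = weak_transport_unique[OF eps wk wu(2) m(3) um m(4) cm integrable_L2_V[OF m(3) v2] integrable_L2_V[OF um u2]
      integrable_of_square(2)[OF m(4) t2] ci]
  have "line_ac (\<lambda>p. planar_const * g p) u (\<lambda>p. (S p + avg u (fst p) - u p) / \<epsilon>)"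
  proof (rule line_ac_cong[OF ac])
    show "(\<lambda>p. (S p + avg u (fst p) - u p) / \<epsilon>) \<in> borel_measurable borel" by measurable
    show "AE p in V. (S p + avg v (fst p) - u p) / \<epsilon> = (S p + avg u (fst p) - u p) / \<epsilon>"
    proof (rule eventually_mono[OF AE_V_slices[OF un(1)]])
      fix p :: "phase" assume a: "AE w in sphere_measure. v (fst p, w) = u (fst p, w)"
      have "(\<integral>w. v (fst p, w) \<partial>sphere_measure) = (\<integral>w. u (fst p, w) \<partial>sphere_measure)"
        by (rule integral_cong_AE[OF _ _ a]) (rule measurable_sphereI, measurable)+
      then show "(S p + avg v (fst p) - u p) / \<epsilon> = (S p + avg u (fst p) - u p) / \<epsilon>"
        by (simp add: avg_def ang_avg_def)
    qed
  qed
  then show ?thesis using u2 un by blast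
qed

text \<open>The energy inequality is divided by \<open>c\<^sup>2 * \<epsilon>\<^sup>2\<close> for
  the trace and by \<open>c * \<epsilon>\<^sup>2 / 2\<close> for the interior norm. Both right sides
  become combinations of the squares of the two terms of the claim; the factor 2 comes from adding
  two square roots.\<close>

lemma characteristic_estimate:
  fixes S g u :: "phase \<Rightarrow> real"
  assumes ac: "line_ac (\<lambda>p. planar_const * g p) u (\<lambda>p. (S p + avg u (fst p) - u p) / \<epsilon>)"
    and m: "S \<in> borel_measurable borel" "g \<in> borel_measurable borel"
    and u2: "integrable V (\<lambda>p. (u p)\<^sup>2)" and S2: "integrable V (\<lambda>p. (S p)\<^sup>2)" and g2: "integrable Kin (\<lambda>p. (g p)\<^sup>2)"
  shows "\<epsilon> powr (-1/2) * sqrt (\<integral>p. (u p / planar_const)\<^sup>2 \<partial>Kout) + sqrt (\<integral>p. (u p)\<^sup>2 \<partial>V)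
    \<le> 2 * sqrt (4 * Mb\<^sup>2 / planar_const + 2 * Mb)
      * (\<epsilon> powr (-2) * sqrt (\<integral>p. (S p)\<^sup>2 \<partial>V) + \<epsilon> powr (-1/2) * sqrt (\<integral>p. (g p)\<^sup>2 \<partial>Kin))"
proof -
  note um [measurable] = line_ac_measurable(2)[OF ac]
  define P where "P = (\<integral>p. (u (ext p))\<^sup>2 \<partial>Kin)"
  define Q where "Q = (\<integral>p. (u p)\<^sup>2 \<partial>V)"
  define a where "a = (\<integral>p. (S p)\<^sup>2 \<partial>V)"
  define b where "b = (\<integral>p. (g p)\<^sup>2 \<partial>Kin)"
  define c where "c = planar_const"
  have c: "0 < c" "c \<le> 1" using planar_const by (auto simp: c_def)
  define K where "K = 4 * Mb\<^sup>2 / c + 2 * Mb"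
  have M0: "0 \<le> Mb" using rad(1) by (simp add: Mb_def)
  have nn: "0 \<le> P" "0 \<le> Q" "0 \<le> a" "0 \<le> b" by (auto simp: P_def Q_def a_def b_def)
  have K0: "0 \<le> K" using M0 c by (simp add: K_def)
  have "\<epsilon> * P + c * (\<epsilon>\<^sup>2 / 2 * Q) \<le> c * (2 * Mb\<^sup>2 / \<epsilon>\<^sup>2) * a + \<epsilon> * c\<^sup>2 * Mb * b"
    using energy_avg(2)[OF eps ac m(1) um m(2) u2 S2 u2 g2]
    unfolding Xn_def[OF eps, symmetric] Xn_integrable(3)[OF eps u2, symmetric] P_def[symmetric] Q_def[symmetric]
      a_def[symmetric] b_def[symmetric] c_def[symmetric]
    by (simp add: distrib_left)
  moreover have "0 \<le> \<epsilon> * P" "0 \<le> c * (\<epsilon>\<^sup>2 / 2 * Q)" using eps c nn by auto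
  ultimately have e1: "\<epsilon> * P \<le> c * (2 * Mb\<^sup>2 / \<epsilon>\<^sup>2) * a + \<epsilon> * c\<^sup>2 * Mb * b"
    and e2: "c * (\<epsilon>\<^sup>2 / 2 * Q) \<le> c * (2 * Mb\<^sup>2 / \<epsilon>\<^sup>2) * a + \<epsilon> * c\<^sup>2 * Mb * b" by linarith+
  \<comment> \<open>\<open>s\<close> and \<open>t\<close> are the two terms in the parentheses of
    the claim, with the powers of \<open>\<epsilon>\<close> written out.\<close>
  define s where "s = sqrt a / \<epsilon>\<^sup>2"
  define t where "t = sqrt b / sqrt \<epsilon>"
  have st: "0 \<le> s" "0 \<le> t" unfolding s_def t_def using nn eps by (intro divide_nonneg_nonneg real_sqrt_ge_zero; simp)+
  have sq: "s\<^sup>2 = a / \<epsilon>^4" "t\<^sup>2 = b / \<epsilon>"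
    using nn eps by (auto simp: s_def t_def power_divide)
  have q1: "(c * (2 * Mb\<^sup>2 / \<epsilon>\<^sup>2) * a + \<epsilon> * c\<^sup>2 * Mb * b) / (c\<^sup>2 * \<epsilon>\<^sup>2) = 2 * Mb\<^sup>2 / c * (a / \<epsilon>^4) + Mb * (b / \<epsilon>)"
  proof -
    have "c * (2 * Mb\<^sup>2 / \<epsilon>\<^sup>2) * a / (c\<^sup>2 * \<epsilon>\<^sup>2) = 2 * Mb\<^sup>2 / c * (a / \<epsilon>^4)"
      using eps c by (simp add: power2_eq_square power4_eq_xxxx mult_ac)
    moreover have "\<epsilon> * c\<^sup>2 * Mb * b / (c\<^sup>2 * \<epsilon>\<^sup>2) = Mb * (b / \<epsilon>)"
      using eps c by (simp add: power2_eq_square)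
    ultimately show ?thesis by (simp only: add_divide_distrib)
  qed
  have q2: "(c * (2 * Mb\<^sup>2 / \<epsilon>\<^sup>2) * a + \<epsilon> * c\<^sup>2 * Mb * b) / (c * \<epsilon>\<^sup>2 / 2) = 4 * Mb\<^sup>2 * (a / \<epsilon>^4) + 2 * c * Mb * (b / \<epsilon>)"
  proof -
    have "c * (2 * Mb\<^sup>2 / \<epsilon>\<^sup>2) * a / (c * \<epsilon>\<^sup>2 / 2) = 4 * Mb\<^sup>2 * (a / \<epsilon>^4)"
      using eps c by (simp add: power2_eq_square power4_eq_xxxx)
    moreover have "\<epsilon> * c\<^sup>2 * Mb * b / (c * \<epsilon>\<^sup>2 / 2) = 2 * c * Mb * (b / \<epsilon>)"
      using eps c by (simp add: power2_eq_square)
    ultimately show ?thesis by (simp only: add_divide_distrib)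
  qed
  have stle: "s\<^sup>2 + t\<^sup>2 \<le> (s + t)\<^sup>2" using st by (simp add: power2_sum)
  have k1: "2 * Mb\<^sup>2 / c \<le> K" "Mb \<le> K" "4 * Mb\<^sup>2 \<le> K" "2 * c * Mb \<le> K"
  proof -
    have "0 \<le> 2 * Mb\<^sup>2 / c" "0 \<le> 4 * Mb\<^sup>2 / c" using c by auto
    then show "2 * Mb\<^sup>2 / c \<le> K" "Mb \<le> K" using M0 by (auto simp: K_def)
    have "4 * Mb\<^sup>2 * c \<le> 4 * Mb\<^sup>2 * 1" using c by (intro mult_left_mono) auto
    then have "4 * Mb\<^sup>2 \<le> 4 * Mb\<^sup>2 / c" using c by (simp add: pos_le_divide_eq)
    then show "4 * Mb\<^sup>2 \<le> K" using M0 by (simp add: K_def)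
    have "2 * (c * Mb) \<le> 2 * (1 * Mb)" using c M0 by (intro mult_left_mono mult_right_mono) auto
    then show "2 * c * Mb \<le> K" using \<open>0 \<le> 4 * Mb\<^sup>2 / c\<close> by (simp add: K_def)
  qed
  have "P / c\<^sup>2 / \<epsilon> \<le> (c * (2 * Mb\<^sup>2 / \<epsilon>\<^sup>2) * a + \<epsilon> * c\<^sup>2 * Mb * b) / (c\<^sup>2 * \<epsilon>\<^sup>2)"
  proof -
    have "P / c\<^sup>2 / \<epsilon> = (\<epsilon> * P) / (c\<^sup>2 * \<epsilon>\<^sup>2)" using eps c by (simp add: power2_eq_square)
    also have "\<dots> \<le> (c * (2 * Mb\<^sup>2 / \<epsilon>\<^sup>2) * a + \<epsilon> * c\<^sup>2 * Mb * b) / (c\<^sup>2 * \<epsilon>\<^sup>2)"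
      using e1 by (rule divide_right_mono) auto
    finally show ?thesis .
  qed
  also have "\<dots> = 2 * Mb\<^sup>2 / c * s\<^sup>2 + Mb * t\<^sup>2" unfolding sq by (rule q1)
  also have "\<dots> \<le> K * s\<^sup>2 + K * t\<^sup>2" by (intro add_mono mult_right_mono k1) auto
  also have "\<dots> \<le> K * (s + t)\<^sup>2" using mult_left_mono[OF stle K0] by (simp add: distrib_left)
  finally have X: "P / c\<^sup>2 / \<epsilon> \<le> K * (s + t)\<^sup>2" .
  have "Q = c * (\<epsilon>\<^sup>2 / 2 * Q) / (c * \<epsilon>\<^sup>2 / 2)" using eps c by simp
  also have "\<dots> \<le> (c * (2 * Mb\<^sup>2 / \<epsilon>\<^sup>2) * a + \<epsilon> * c\<^sup>2 * Mb * b) / (c * \<epsilon>\<^sup>2 / 2)"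
    using e2 c by (intro divide_right_mono) auto
  also have "\<dots> = 4 * Mb\<^sup>2 * s\<^sup>2 + 2 * c * Mb * t\<^sup>2" unfolding sq by (rule q2)
  also have "\<dots> \<le> K * s\<^sup>2 + K * t\<^sup>2" by (intro add_mono mult_right_mono k1) auto
  also have "\<dots> \<le> K * (s + t)\<^sup>2" using mult_left_mono[OF stle K0] by (simp add: distrib_left)
  finally have Y: "Q \<le> K * (s + t)\<^sup>2" .
  have rt: "sqrt x \<le> sqrt K * (s + t)" if "x \<le> K * (s + t)\<^sup>2" for x
  proof -
    have "sqrt x \<le> sqrt (K * (s + t)\<^sup>2)" using that by (rule real_sqrt_le_mono)
    also have "\<dots> = sqrt K * (s + t)"
      unfolding real_sqrt_mult real_sqrt_abs using st by (simp only: abs_of_nonneg add_nonneg_nonneg)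
    finally show ?thesis .
  qed
  have pw: "\<epsilon> powr (-1/2) = 1 / sqrt \<epsilon>" "\<epsilon> powr (-2) = 1 / \<epsilon>\<^sup>2"
  proof -
    have "\<epsilon> powr (-1/2) = inverse (\<epsilon> powr (1/2))" using powr_minus[of \<epsilon> "1/2"] by (simp only: minus_divide_left)
    then show "\<epsilon> powr (-1/2) = 1 / sqrt \<epsilon>"
      by (simp only: powr_half_sqrt[OF less_imp_le[OF eps(1)]] inverse_eq_divide)
    have "\<epsilon> powr (-2) = inverse (\<epsilon> powr 2)" by (rule powr_minus)
    also have "\<epsilon> powr 2 = \<epsilon>\<^sup>2" using less_imp_le[OF eps(1)] by (rule powr_numeral)
    finally show "\<epsilon> powr (-2) = 1 / \<epsilon>\<^sup>2" by (simp only: inverse_eq_divide)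
  qed
  have um2: "(\<lambda>p. (u p / planar_const)\<^sup>2) \<in> borel_measurable borel" by measurable
  have "(\<integral>p. (u p / planar_const)\<^sup>2 \<partial>Kout) = (\<integral>p. (1 / c\<^sup>2) * (u (ext p))\<^sup>2 \<partial>Kin)"
    unfolding Kout_integral(1)[OF um2] by (simp add: c_def power_divide)
  also have "\<dots> = P / c\<^sup>2" unfolding P_def by (subst integral_mult_right_zero) simp
  finally have tr: "(\<integral>p. (u p / planar_const)\<^sup>2 \<partial>Kout) = P / c\<^sup>2" .
  have "\<epsilon> powr (-1/2) * sqrt (P / c\<^sup>2) + sqrt Q = sqrt (P / c\<^sup>2 / \<epsilon>) + sqrt Q"
    by (simp only: pw real_sqrt_divide[of "P / c\<^sup>2" \<epsilon>] times_divide_eq_left mult_1_left)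
  also have "\<dots> \<le> sqrt K * (s + t) + sqrt K * (s + t)" by (intro add_mono rt X Y)
  also have "\<dots> = 2 * sqrt K * (\<epsilon> powr (-2) * sqrt a + \<epsilon> powr (-1/2) * sqrt b)"
    unfolding pw by (simp add: s_def t_def)
  finally show ?thesis unfolding tr Q_def a_def b_def K_def c_def .
qed

lemma well_posed:
  assumes S: "in_L2_vol \<Omega> S" and g: "in_L2_bdry \<Omega> (Gamma_minus \<Omega>) g"
  shows "\<exists>u. weak_solution \<Omega> \<epsilon> S g u \<and>
    (\<forall>v. weak_solution \<Omega> \<epsilon> S g v \<longrightarrow>
       (AE p in vol_measure \<Omega>. v (fst p) (snd p) = u (fst p) (snd p)) \<and>
       (AE p in bdry_measure \<Omega>. p \<in> Gamma_plus \<Omega> \<longrightarrow> v (fst p) (snd p) = u (fst p) (snd p))) \<and>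
    \<epsilon> powr (-1/2) * L2_bdry \<Omega> (Gamma_plus \<Omega>) u + L2_vol \<Omega> u
      \<le> 2 * sqrt (4 * Mb\<^sup>2 / planar_const + 2 * Mb)
        * (\<epsilon> powr (-2) * L2_vol \<Omega> S + \<epsilon> powr (-1/2) * L2_bdry \<Omega> (Gamma_minus \<Omega>) g)"
proof -
  obtain S' where S' [measurable]: "S' \<in> borel_measurable borel" and Se: "\<And>p. p \<in> space V \<Longrightarrow> S (fst p) (snd p) = S' p"
    using extend_V[of "\<lambda>p. S (fst p) (snd p)"] S unfolding in_L2_vol_def by metis
  obtain g' where g' [measurable]: "g' \<in> borel_measurable borel" and ge: "\<And>p. p \<in> space B \<Longrightarrow> g (fst p) (snd p) = g' p"
    using extend_B[of "\<lambda>p. g (fst p) (snd p)"] g unfolding in_L2_bdry_def by metis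
  have S2: "integrable V (\<lambda>p. (S' p)\<^sup>2)" using S vol_norm_ext(1)[OF S' Se] by simp
  have g2: "integrable Kin (\<lambda>p. (g' p)\<^sup>2)" using g bdry_norm_ext(3)[OF g' ge] by simp
  obtain w where wm [measurable]: "w \<in> borel_measurable borel" and w2: "integrable V (\<lambda>p. (w p)\<^sup>2)"
    and ac: "line_ac (\<lambda>p. planar_const * g' p) w (\<lambda>p. (S' p + avg w (fst p) - w p) / \<epsilon>)"
    using existence_char[OF eps S' g' S2 g2] by blast
  \<comment> \<open>One function has to carry the interior solution and the outgoing trace. An open
    set is disjoint from its frontier, so the division by \<open>planar_const\<close> on the
    boundary does not interfere with the interior.\<close>
  define u where "u x y = (if x \<in> \<Omega> then w (x, y) else w (x, y) / planar_const)" for x y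
  define t where "t p = w p / planar_const" for p
  have tm [measurable]: "t \<in> borel_measurable borel" unfolding t_def[abs_def] by measurable
  have ue: "u (fst p) (snd p) = w p" if "p \<in> space V" for p using that by (auto simp: u_def space_V)
  have te: "u (fst p) (snd p) = t p" if "p \<in> space B" for p
    using that open_dom by (auto simp: u_def t_def space_B frontier_def interior_open)
  have am: "(\<lambda>p::phase. avg w (fst p)) \<in> borel_measurable borel" by measurable
  have Fm: "(\<lambda>p. S' p + avg w (fst p)) \<in> borel_measurable borel" by measurable
  have F2: "integrable V (\<lambda>p. (S' p + avg w (fst p))\<^sup>2)"
    by (rule integrable_add_square(1)[OF measurable_VI[OF S'] measurable_VI[OF am] S2 avg_L2[OF wm w2]])
  note wt = weak_of_line_ac[OF eps ac Fm g' w2 F2 g2, folded t_def]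
  have t2: "integrable Kout (\<lambda>p. (t p)\<^sup>2)"
    unfolding t_def power_divide using wt(1) by simp
  have sol: "weak_solution \<Omega> \<epsilon> S g u"
    using weak_solution_iff[OF S' g' wm tm Se ge ue te S2] w2 t2 wt(2) by simp
  have est: "\<epsilon> powr (-1/2) * L2_bdry \<Omega> (Gamma_plus \<Omega>) u + L2_vol \<Omega> u
      \<le> 2 * sqrt (4 * Mb\<^sup>2 / planar_const + 2 * Mb)
        * (\<epsilon> powr (-2) * L2_vol \<Omega> S + \<epsilon> powr (-1/2) * L2_bdry \<Omega> (Gamma_minus \<Omega>) g)"
  proof -
    have "L2_vol \<Omega> u = sqrt (\<integral>p. (w p)\<^sup>2 \<partial>V)" by (rule vol_norm_ext(2)[OF wm _ w2]) (rule ue)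
    moreover have "L2_vol \<Omega> S = sqrt (\<integral>p. (S' p)\<^sup>2 \<partial>V)" by (rule vol_norm_ext(2)[OF S' _ S2]) (rule Se)
    moreover have "L2_bdry \<Omega> (Gamma_plus \<Omega>) u = sqrt (\<integral>p. (t p)\<^sup>2 \<partial>Kout)" by (rule bdry_norm_ext(2)[OF tm _ t2]) (rule te)
    moreover have "L2_bdry \<Omega> (Gamma_minus \<Omega>) g = sqrt (\<integral>p. (g' p)\<^sup>2 \<partial>Kin)" by (rule bdry_norm_ext(4)[OF g' _ g2]) (rule ge)
    ultimately show ?thesis using characteristic_estimate[OF ac S' g' w2 S2 g2] by (simp only: t_def)
  qed
  have uni: "(AE p in V. v (fst p) (snd p) = u (fst p) (snd p)) \<and>
       (AE p in B. p \<in> Gamma_plus \<Omega> \<longrightarrow> v (fst p) (snd p) = u (fst p) (snd p))"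
    if v: "weak_solution \<Omega> \<epsilon> S g v" for v
  proof -
    obtain v' where v' [measurable]: "v' \<in> borel_measurable borel" and ve: "\<And>p. p \<in> space V \<Longrightarrow> v (fst p) (snd p) = v' p"
      using extend_V[of "\<lambda>p. v (fst p) (snd p)"] v unfolding weak_solution_def in_L2_vol_def by metis
    obtain r where r [measurable]: "r \<in> borel_measurable borel" and re: "\<And>p. p \<in> space B \<Longrightarrow> v (fst p) (snd p) = r p"
      using extend_B[of "\<lambda>p. v (fst p) (snd p)"] v unfolding weak_solution_def in_L2_bdry_def by metis
    have "integrable V (\<lambda>p. (v' p)\<^sup>2) \<and> integrable Kout (\<lambda>p. (r p)\<^sup>2) \<and>
        weak_transport \<epsilon> (\<lambda>p. S' p + avg v' (fst p)) g' v' r"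
      using weak_solution_iff[OF S' g' v' r Se ge ve re S2] v by simp
    then obtain z where z: "line_ac (\<lambda>p. planar_const * g' p) z (\<lambda>p. (S' p + avg z (fst p) - z p) / \<epsilon>)"
      "integrable V (\<lambda>p. (z p)\<^sup>2)" "AE p in V. v' p = z p" "AE p in Kout. r p = z p / planar_const"
      using weak_characteristic[OF S' g' v' r S2 g2] by blast
    note un = characteristic_unique[OF z(1) ac z(2) w2]
    have "AE p in V. v (fst p) (snd p) = u (fst p) (snd p)"
      using z(3) un(1) AE_space by eventually_elim (simp add: ve ue)
    moreover have "AE p in Kout. r p = t p" using z(4) un(2) by eventually_elim (simp add: t_def)
    then have "AE p in B. p \<in> Gamma_plus \<Omega> \<longrightarrow> v (fst p) (snd p) = u (fst p) (snd p)"
      unfolding AE_Kout_iff using AE_space by eventually_elim (simp add: re te)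
    ultimately show ?thesis by blast
  qed
  show ?thesis using sol est uni by blast
qed

end

end

theorem theorem2p2:
  fixes \<Omega> :: "(real^3) set"
  assumes "open \<Omega>" "connected \<Omega>" "\<Omega> \<noteq> {}" "bounded \<Omega>" "convex \<Omega>" "C3_boundary \<Omega>"
  shows "\<exists>C > 0. \<exists>\<epsilon>0 > 0. \<forall>\<epsilon> S g. 0 < \<epsilon> \<and> \<epsilon> < \<epsilon>0 \<and> in_L2_vol \<Omega> S \<and> in_L2_bdry \<Omega> (Gamma_minus \<Omega>) g \<longrightarrow>
     (\<exists>u. weak_solution \<Omega> \<epsilon> S g u \<and>
          (\<forall>v. weak_solution \<Omega> \<epsilon> S g v \<longrightarrow>
               (AE p in vol_measure \<Omega>. v (fst p) (snd p) = u (fst p) (snd p)) \<and>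
               (AE p in bdry_measure \<Omega>. p \<in> Gamma_plus \<Omega> \<longrightarrow> v (fst p) (snd p) = u (fst p) (snd p))) \<and>
          \<epsilon> powr (-1/2) * L2_bdry \<Omega> (Gamma_plus \<Omega>) u + L2_vol \<Omega> u
            \<le> C * (\<epsilon> powr (-2) * L2_vol \<Omega> S + \<epsilon> powr (-1/2) * L2_bdry \<Omega> (Gamma_minus \<Omega>) g))"
proof -
  interpret c3_dom \<Omega> by unfold_locales (use assms in auto)
  have "0 < Mb" using rad(1) by (simp add: Mb_def add_nonneg_pos)
  then have "0 < 2 * sqrt (4 * Mb\<^sup>2 / planar_const + 2 * Mb)"
    using planar_const by (simp add: add_pos_pos)
  \<comment> \<open>The threshold \<open>\<epsilon>0\<close> is 1: below it the correction in
    \<open>psi\<close> is dominated by \<open>rad\<close>, on which the bounds of the multiplier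
    rest.\<close>
  moreover have "(0::real) < 1" by simp
  ultimately show ?thesis using well_posed by blast
qed

end
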